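(* Let $X=\{X(t)\}$ be a supOU process with characteristic quadruple $(a,b,\mu_L,\pi)$, finite variance and zero mean, such that the cumulant function $\kappa_X(\zeta)=\log\mathbb{E}e^{i\zeta X(1)}$ is analytic in a neighborhood of the origin, and let $X^*(t)=\int_0^t X(s)\,ds$, $t\ge 0$. Suppose that $\pi$ has a density $p$ satisfying $p(x)\sim\alpha\,\ell(x^{-1})\,x^{\alpha-1}$ as $x\to0$ for some $\alpha\in(0,1)$ and some function $\ell$ slowly varying at infinity, and that $b>0$. For $q>0$ let $$\tau_{X^*}(q)=\lim_{t\to\infty}\frac{\log\mathbb{E}|X^*(t)|^q}{\log t}.$$ If $\mu_L\not\equiv0$, then the limit exists for every $q>0$ and $$\tau_{X^*}(q)=\begin{cases}\left(1-\frac{\alpha}{2}\right)q,&0<q\le2,\\ q-\alpha,&q\ge2.\end{cases}$$ If $\mu_L\equiv0$, then $X^*$ is Gaussian and $$\tau_{X^*}(q)=\left(1-\frac{\alpha}{2}\right)q\quad\text{for all } q>0.$$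
   Context: SupOU process: let $\pi$ be a probability measure on $\mathbb{R}_+=(0,\infty)$ and let $\kappa_L(\zeta)=\log \mathbb{E}e^{i\zeta L(1)}$ be the cumulant function of an infinitely divisible random variable $L(1)$ with Lévy–Khintchine triplet $(a,b,\mu_L)$: $\kappa_L(\zeta)=i\zeta a-\frac{\zeta^2}{2}b+\int_{\mathbb{R}}(e^{i\zeta x}-1-i\zeta x\mathbf{1}_{[-1,1]}(x))\mu_L(dx)$. Let $\Lambda$ be the homogeneous Lévy basis (independently scattered infinitely divisible random measure) on $\mathbb{R}_+\times\mathbb{R}$ with $\log\mathbb{E}e^{i\zeta\Lambda(A)}=(\pi\times \mathrm{Leb})(A)\,\kappa_L(\zeta)$ for Borel sets $A$ (of finite measure). The supOU process with characteristic quadruple $(a,b,\mu_L,\pi)$ is the strictly stationary process $$X(t)=\int_{\mathbb{R}_+}\int_{\mathbb{R}}e^{-\xi t+s}\mathbf{1}_{[0,\infty)}(\xi t-s)\,\Lambda(d\xi,ds),\quad t\in\mathbb{R},$$ where the stochastic integral is in the sense of Rajput–Rosiński: for $\Lambda$-integrable $f$, $\log\mathbb{E}\exp(i\zeta\int f\,d\Lambda)=\int\int\kappa_L(\zeta f(\xi,s))\,ds\,\pi(d\xi)$. Under zero mean and finite variance of $X$, $\int x^2\mu_L(dx)<\infty$, $\mathbb{E}L(1)=0$ and $\kappa_L(\zeta)=-\frac{\zeta^2}{2}b+\int_{\mathbb{R}}(e^{i\zeta x}-1-i\zeta x)\mu_L(dx)$. Analyticity of $\kappa_X$ near the origin is equivalent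 to exponential decay of the tails of the distribution of $X(1)$; in particular all moments are finite. *)

theory Defs
  imports "HOL-Probability.Probability" "HOL-Library.Landau_Symbols"
begin

section \<open>Infinitely divisible laws and the characteristic quadruple\<close>

definition levy_measure :: "real measure \<Rightarrow> bool" where
  "levy_measure \<mu> \<longleftrightarrow>
     sets \<mu> = sets borel \<and> emeasure \<mu> {0} = 0 \<and>
     (\<integral>\<^sup>+x. ennreal (min 1 (x\<^sup>2)) \<partial>\<mu>) < \<infinity>"

definition levy_khintchine :: "real \<Rightarrow> real \<Rightarrow> real measure \<Rightarrow> real \<Rightarrow> complex" where
  "levy_khintchine a b \<mu> \<zeta> =
     \<i> * of_real (\<zeta> * a) - of_real (\<zeta>\<^sup>2 / 2 * b) +
     (CLINT x|\<mu>. iexp (\<zeta> * x) - 1 - \<i> * of_real (\<zeta> * x * indicator {-1..1} x))"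

definition characteristic_quadruple ::
  "real \<Rightarrow> real \<Rightarrow> real measure \<Rightarrow> real measure \<Rightarrow> bool" where
  "characteristic_quadruple a b \<mu> \<pi> \<longleftrightarrow>
     b \<ge> 0 \<and> levy_measure \<mu> \<and>
     prob_space \<pi> \<and> sets \<pi> = sets (restrict_space borel {0<..})"

section \<open>Levy bases and stochastic integrals\<close>

definition finite_measure_sets :: "'b measure \<Rightarrow> 'b set set" where
  "finite_measure_sets m = {A \<in> sets m. emeasure m A < \<infinity>}"

text \<open>
  Homogeneous Levy basis with control measure \<open>m\<close> and cumulant \<open>\<kappa>\<close>.  Since \<open>\<kappa>\<close> is given by a
  Levy--Khintchine formula, the exponential form of the last clause says that
  \<open>m(A) \<kappa>(\<zeta>)\<close> is the distinguished logarithm of the characteristic function of \<open>\<Lambda> A\<close>.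
\<close>
definition levy_basis ::
  "'w measure \<Rightarrow> 'b measure \<Rightarrow> (real \<Rightarrow> complex) \<Rightarrow> ('b set \<Rightarrow> 'w \<Rightarrow> real) \<Rightarrow> bool" where
  "levy_basis M m \<kappa> \<Lambda> \<longleftrightarrow>
     (\<forall>A \<in> finite_measure_sets m. \<Lambda> A \<in> borel_measurable M) \<and>
     (\<forall>A :: nat \<Rightarrow> 'b set. range A \<subseteq> finite_measure_sets m \<and> disjoint_family A \<longrightarrow>
        prob_space.indep_vars M (\<lambda>_. borel) (\<lambda>n. \<Lambda> (A n)) UNIV) \<and>
     (\<forall>A :: nat \<Rightarrow> 'b set. range A \<subseteq> finite_measure_sets m \<and> disjoint_family A \<and>
        (\<Union>n. A n) \<in> finite_measure_sets m \<longrightarrow>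
        (AE \<omega> in M. (\<lambda>n. \<Lambda> (A n) \<omega>) sums \<Lambda> (\<Union>n. A n) \<omega>)) \<and>
     (\<forall>A \<in> finite_measure_sets m. \<forall>\<zeta>.
        char (distr M borel (\<Lambda> A)) \<zeta> = exp (of_real (measure m A) * \<kappa> \<zeta>))"

definition converges_in_probability ::
  "'w measure \<Rightarrow> (nat \<Rightarrow> 'w \<Rightarrow> real) \<Rightarrow> ('w \<Rightarrow> real) \<Rightarrow> bool" where
  "converges_in_probability M Z Y \<longleftrightarrow>
     (\<forall>\<epsilon>>0. (\<lambda>n. measure M {\<omega> \<in> space M. \<bar>Z n \<omega> - Y \<omega>\<bar> > \<epsilon>}) \<longlonglongrightarrow> 0)"

text \<open>
  The value \<open>y = 0\<close> contributes nothing, so \<open>\<Lambda>\<close> is only used on sets of finite measure.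
\<close>
definition simple_stochastic_integral ::
  "'b measure \<Rightarrow> ('b set \<Rightarrow> 'w \<Rightarrow> real) \<Rightarrow> 'b set \<Rightarrow> ('b \<Rightarrow> real) \<Rightarrow> 'w \<Rightarrow> real" where
  "simple_stochastic_integral m \<Lambda> B g \<omega> =
     (\<Sum>y \<in> g ` space m. y * \<Lambda> {x \<in> space m \<inter> B. g x = y} \<omega>)"

text \<open>
  Rajput--Rosinski: \<open>f\<close> is \<open>\<Lambda>\<close>-integrable and \<open>Y\<close> is a version of its integral.
\<close>
definition has_stochastic_integral ::
  "'w measure \<Rightarrow> 'b measure \<Rightarrow> ('b set \<Rightarrow> 'w \<Rightarrow> real) \<Rightarrow> ('b \<Rightarrow> real) \<Rightarrow> ('w \<Rightarrow> real) \<Rightarrow> bool" where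
  "has_stochastic_integral M m \<Lambda> f Y \<longleftrightarrow>
     f \<in> borel_measurable m \<and> Y \<in> borel_measurable M \<and>
     (\<exists>g :: nat \<Rightarrow> 'b \<Rightarrow> real.
        (\<forall>n. simple_function m (g n) \<and> {x \<in> space m. g n x \<noteq> 0} \<in> finite_measure_sets m) \<and>
        (AE x in m. (\<lambda>n. g n x) \<longlonglongrightarrow> f x) \<and>
        (\<forall>B \<in> sets m. \<exists>Z \<in> borel_measurable M.
           converges_in_probability M (\<lambda>n. simple_stochastic_integral m \<Lambda> B (g n)) Z) \<and>
        converges_in_probability M (\<lambda>n. simple_stochastic_integral m \<Lambda> (space m) (g n)) Y)"

section \<open>SupOU processes and their integrals\<close>

definition supOU_kernel :: "real \<Rightarrow> real \<times> real \<Rightarrow> real" where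
  "supOU_kernel t = (\<lambda>(\<xi>, s). exp (- \<xi> * t + s) * indicator {0..} (\<xi> * t - s))"

definition supOU_process ::
  "'w measure \<Rightarrow> real \<Rightarrow> real \<Rightarrow> real measure \<Rightarrow> real measure \<Rightarrow> (real \<Rightarrow> 'w \<Rightarrow> real) \<Rightarrow> bool" where
  "supOU_process M a b \<mu> \<pi> X \<longleftrightarrow>
     characteristic_quadruple a b \<mu> \<pi> \<and>
     (\<exists>\<Lambda>. levy_basis M (\<pi> \<Otimes>\<^sub>M lborel) (levy_khintchine a b \<mu>) \<Lambda> \<and>
        (\<forall>t. has_stochastic_integral M (\<pi> \<Otimes>\<^sub>M lborel) \<Lambda> (supOU_kernel t) (X t)))"

definition integrated_process :: "(real \<Rightarrow> 'w \<Rightarrow> real) \<Rightarrow> real \<Rightarrow> 'w \<Rightarrow> real" where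
  "integrated_process X t \<omega> = (LINT s:{0..t}|lborel. X s \<omega>)"

section \<open>Cumulant functions, slow variation, Gaussianity, scaling function\<close>

text \<open>
  \<open>log \<circ> char\<close> in the sense of the distinguished logarithm: \<open>\<kappa>\<close> is uniquely determined by \<open>Y\<close>.
\<close>
definition is_cumulant_function :: "'w measure \<Rightarrow> ('w \<Rightarrow> real) \<Rightarrow> (real \<Rightarrow> complex) \<Rightarrow> bool" where
  "is_cumulant_function M Y \<kappa> \<longleftrightarrow>
     continuous_on UNIV \<kappa> \<and> \<kappa> 0 = 0 \<and> (\<forall>\<zeta>. exp (\<kappa> \<zeta>) = char (distr M borel Y) \<zeta>)"

definition analytic_near_origin :: "(real \<Rightarrow> complex) \<Rightarrow> bool" where
  "analytic_near_origin \<kappa> \<longleftrightarrow>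
     (\<exists>K. K analytic_on {0} \<and> (\<forall>\<^sub>F \<zeta> in nhds 0. K (of_real \<zeta>) = \<kappa> \<zeta>))"

definition slowly_varying :: "(real \<Rightarrow> real) \<Rightarrow> bool" where
  "slowly_varying l \<longleftrightarrow>
     l \<in> borel_measurable borel \<and> (\<forall>\<^sub>F x in at_top. l x > 0) \<and>
     (\<forall>c>0. ((\<lambda>x. l (c * x) / l x) \<longlongrightarrow> 1) at_top)"

text \<open>Constants count as (degenerate) Gaussian variables.\<close>
definition gaussian_variable :: "'w measure \<Rightarrow> ('w \<Rightarrow> real) \<Rightarrow> bool" where
  "gaussian_variable M Y \<longleftrightarrow>
     Y \<in> borel_measurable M \<and>
     ((\<exists>m \<sigma>. \<sigma> > 0 \<and> distributed M lborel Y (normal_density m \<sigma>)) \<or>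
      (\<exists>m. AE \<omega> in M. Y \<omega> = m))"

definition gaussian_process_on :: "'w measure \<Rightarrow> 't set \<Rightarrow> ('t \<Rightarrow> 'w \<Rightarrow> real) \<Rightarrow> bool" where
  "gaussian_process_on M T Y \<longleftrightarrow>
     (\<forall>F c. finite F \<and> F \<subseteq> T \<longrightarrow> gaussian_variable M (\<lambda>\<omega>. \<Sum>t\<in>F. c t * Y t \<omega>))"

text \<open>
  The limit defining the scaling function of \<open>Y\<close> at \<open>q\<close> exists and equals \<open>\<tau>\<close>.  Finiteness of the
  moments is explicit, because the Bochner integral of a non-integrable function is \<open>0\<close>.
\<close>
definition has_scaling_exponent ::
  "'w measure \<Rightarrow> (real \<Rightarrow> 'w \<Rightarrow> real) \<Rightarrow> real \<Rightarrow> real \<Rightarrow> bool" where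
  "has_scaling_exponent M Y q \<tau> \<longleftrightarrow>
     (\<forall>\<^sub>F t in at_top. integrable M (\<lambda>\<omega>. \<bar>Y t \<omega>\<bar> powr q)) \<and>
     ((\<lambda>t. ln (LINT \<omega>|M. \<bar>Y t \<omega>\<bar> powr q) / ln t) \<longlongrightarrow> \<tau>) at_top"

end

theory Submission
  imports Defs "HOL-Complex_Analysis.Complex_Analysis"
begin

text \<open>
  Put \<open>\<psi> = - Re \<kappa>\<^sub>L\<close>. The modulus of the characteristic function of \<open>\<integral>f d\<Lambda>\<close> is
  \<open>exp (- \<integral>\<psi> (\<zeta> f))\<close>. Since \<open>\<psi> (u + v) \<le> (1 + \<epsilon>) \<psi> u + (1 + 1/\<epsilon>) \<psi> v\<close>, this formula is stable
  under limits in probability, so it passes through Riemann sums to \<open>X\<^sup>*(t)\<close>, with \<open>f = F\<^sub>t\<close> the time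
  integral of the kernel. No stochastic Fubini theorem and no control of the drift is needed.

  The kernel satisfies \<open>F\<^sub>t \<le> t\<close>, with \<open>F\<^sub>t \<ge> exp (- 2) t\<close> on \<open>{\<xi> < 1/t, -1 \<le> s \<le> 0}\<close>, a set of measure about
  \<open>1 / t powr \<alpha>\<close>, and \<open>\<integral>F\<^sub>t\<^sup>2\<close> is about \<open>t powr (2 - \<alpha>)\<close>, up to factors \<open>t powr \<epsilon>\<close>. The estimates on \<open>\<pi>\<close>
  come from iterating \<open>p (x/2) / p x \<rightarrow> 2 powr (1 - \<alpha>)\<close>, which replaces Potter bounds.

  Analyticity makes \<open>cosh (c x) - 1\<close> integrable for \<open>\<mu>\<^sub>L\<close>, hence \<open>E (cosh (c X\<^sup>*(t) / t) - 1)\<close> is of order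
  \<open>1 / t powr (\<alpha> - \<epsilon>)\<close>; this gives the upper bound for \<open>q \<ge> 2\<close>, and the variance that for \<open>q \<le> 2\<close>. The
  Gaussian component alone gives the lower exponent \<open>(1 - \<alpha>/2) q\<close>. The lower exponent \<open>q - \<alpha>\<close> comes from
  single jumps with \<open>\<xi> < 1/t\<close>, detected by testing against \<open>(1 - cos)\<^sup>2\<close>, in which the Gaussian part cancels.
\<close>

section \<open>Mass and moments of a regularly varying density near the origin\<close>

text \<open>Only moduli of characteristic functions are under control, and a squared modulus is the
  characteristic function of the difference of two independent copies. Upper bounds are proved for
  that difference and carried back because the integrated process is centred. The exponent of the
  modulus is itself a cosine transform over the product of \<pi>, Lebesgue measure and the Levy
  measure, in general an infinite measure; hence every transform is written with 1 - cos and cosh -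
  1. For such transforms, continuation to imaginary arguments and finiteness of cosh moments imply
  each other. This is used in both directions: from the cumulant function of \<open>X 1\<close> down
  to the jumps, and from the jumps up to the law of the integral. The obstacle behind the exponent q
  - \<alpha>: after division by t, the variance and the probability of one large jump have the same
  order up to small powers of t, so a test function that is quadratic at zero cannot separate them.
  The square of 1 - cos vanishes there to fourth order.\<close>

lemma regularly_varying_density_ratio:
  fixes p l :: "real \<Rightarrow> real"
  assumes sv: "slowly_varying l" and "0 < \<alpha>"
    and p: "p \<sim>[at_right 0] (\<lambda>x. \<alpha> * l (inverse x) * x powr (\<alpha> - 1))" and "\<epsilon> > 0"
  obtains \<delta> where "\<delta> > 0"
    and "\<And>x. 0 < x \<Longrightarrow> x < \<delta> \<Longrightarrow> p x > 0"
    and "\<And>x. 0 < x \<Longrightarrow> x < \<delta> \<Longrightarrow> 2 powr (1 - \<alpha> - \<epsilon>) * p x \<le> p (x / 2)"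
    and "\<And>x. 0 < x \<Longrightarrow> x < \<delta> \<Longrightarrow> p (x / 2) \<le> 2 powr (1 - \<alpha> + \<epsilon>) * p x"
proof -
  define r where "r = (\<lambda>x. \<alpha> * l (inverse x) * x powr (\<alpha> - 1))"
  define q where "q = (\<lambda>x. p x / r x)"
  have l_pos: "\<forall>\<^sub>F x in at_right 0. l (inverse x) > 0"
    using sv filterlim_inverse_at_top_right unfolding slowly_varying_def
    by (auto simp: filterlim_iff)
  have x_pos: "\<forall>\<^sub>F x in at_right 0. x > (0::real)"
    by (simp add: eventually_at_right_less)
  have r_pos: "\<forall>\<^sub>F x in at_right 0. r x > 0"
    using l_pos x_pos by eventually_elim (use \<open>0 < \<alpha>\<close> in \<open>auto simp: r_def\<close>)
  have q1: "(q \<longlongrightarrow> 1) (at_right 0)"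
  proof -
    \<comment> \<open>Asymptotic equivalence sets the quotient to 1 where both sides vanish;
      \<open>r\<close> is eventually positive, so the quotient is \<open>q\<close>.\<close>
    have "((\<lambda>x. if p x = 0 \<and> r x = 0 then 1 else p x / r x) \<longlongrightarrow> 1) (at_right 0)"
      using p unfolding asymp_equiv_def r_def by simp
    moreover have "\<forall>\<^sub>F x in at_right 0. (if p x = 0 \<and> r x = 0 then 1 else p x / r x) = q x"
      using r_pos by eventually_elim (auto simp: q_def)
    ultimately show ?thesis by (rule Lim_transform_eventually)
  qed
  have half: "filterlim (\<lambda>x::real. x / 2) (at_right 0) (at_right 0)"
    unfolding filterlim_at
  proof
    show "\<forall>\<^sub>F x in at_right 0. x / 2 \<in> {0<..} \<and> x / 2 \<noteq> (0::real)"
      using x_pos by eventually_elim auto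
    have "((\<lambda>x::real. x / 2) \<longlongrightarrow> 0 / 2) (at_right 0)" by (intro tendsto_intros) auto
    then show "((\<lambda>x::real. x / 2) \<longlongrightarrow> 0) (at_right 0)" by simp
  qed
  have q2: "((\<lambda>x. q (x / 2)) \<longlongrightarrow> 1) (at_right 0)"
    by (rule filterlim_compose[OF q1 half])
  have l2: "((\<lambda>x. l (2 * inverse x) / l (inverse x)) \<longlongrightarrow> 1) (at_right 0)"
    using filterlim_compose[of "\<lambda>x. l (2 * x) / l x" "nhds 1" at_top inverse "at_right 0"]
      sv filterlim_inverse_at_top_right
    unfolding slowly_varying_def by auto
  \<comment> \<open>Halving the argument doubles \<open>inverse x\<close>, so slow variation with
    factor 2 makes the quotient of \<open>l\<close> tend to 1, while the power contributes exactly
    \<open>2 powr (1 - \<alpha>)\<close>. The resulting two-sided bound holds at every scale below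
    \<delta> and can therefore be iterated.\<close>
  have "((\<lambda>x. q (x / 2) / q x * (l (2 * inverse x) / l (inverse x)) * 2 powr (1 - \<alpha>))
      \<longlongrightarrow> 1 / 1 * 1 * 2 powr (1 - \<alpha>)) (at_right 0)"
    by (intro tendsto_intros q1 q2 l2) auto
  then have lim: "((\<lambda>x. q (x / 2) / q x * (l (2 * inverse x) / l (inverse x)) * 2 powr (1 - \<alpha>))
      \<longlongrightarrow> 2 powr (1 - \<alpha>)) (at_right 0)" (is "(?h \<longlongrightarrow> _) _") by simp
  have q_pos: "\<forall>\<^sub>F x in at_right 0. q x > 0"
    using order_tendstoD(1)[OF q1, of 0] by simp
  have r_pos2: "\<forall>\<^sub>F x in at_right 0. r (x / 2) > 0"
    using r_pos half by (auto simp: filterlim_iff)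
  have "\<forall>\<^sub>F x in at_right 0. ?h x > 2 powr (1 - \<alpha> - \<epsilon>)"
    by (rule order_tendstoD(1)[OF lim]) (use \<open>\<epsilon> > 0\<close> in simp)
  moreover have "\<forall>\<^sub>F x in at_right 0. ?h x < 2 powr (1 - \<alpha> + \<epsilon>)"
    by (rule order_tendstoD(2)[OF lim]) (use \<open>\<epsilon> > 0\<close> in simp)
  ultimately have "\<forall>\<^sub>F x in at_right 0. p x > 0 \<and> 2 powr (1 - \<alpha> - \<epsilon>) * p x \<le> p (x / 2)
      \<and> p (x / 2) \<le> 2 powr (1 - \<alpha> + \<epsilon>) * p x"
    using q_pos r_pos r_pos2 x_pos l_pos
  proof eventually_elim
    case (elim x)
    have px: "p x = q x * r x" "p (x / 2) = q (x / 2) * r (x / 2)"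
      using elim by (auto simp: q_def)
    have "p x > 0" using px elim by simp
    moreover have "p (x / 2) / p x = ?h x"
    proof -
      have "(x / 2) powr (\<alpha> - 1) = x powr (\<alpha> - 1) * 2 powr (1 - \<alpha>)"
        using elim by (simp add: powr_divide powr_diff field_simps)
      then have "r (x / 2) / r x = (l (2 * inverse x) / l (inverse x)) * 2 powr (1 - \<alpha>)"
        using elim \<open>0 < \<alpha>\<close> by (simp add: r_def field_simps)
      moreover have "p (x / 2) / p x = q (x / 2) / q x * (r (x / 2) / r x)" by (simp add: px)
      ultimately show ?thesis by simp
    qed
    ultimately have "p x > 0" "2 powr (1 - \<alpha> - \<epsilon>) < p (x / 2) / p x"
      "p (x / 2) / p x < 2 powr (1 - \<alpha> + \<epsilon>)"
      using elim by simp_all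
    then show ?case
      by (auto simp: pos_divide_less_eq pos_less_divide_eq intro: less_imp_le)
  qed
  then obtain d where "d > 0" and d: "\<And>x. 0 < x \<Longrightarrow> x < d \<Longrightarrow> p x > 0 \<and>
      2 powr (1 - \<alpha> - \<epsilon>) * p x \<le> p (x / 2) \<and> p (x / 2) \<le> 2 powr (1 - \<alpha> + \<epsilon>) * p x"
    unfolding eventually_at_right_field by auto
  then show ?thesis using that by blast
qed

lemma nn_integral_halving:
  fixes f :: "real \<Rightarrow> ennreal"
  assumes [measurable]: "f \<in> borel_measurable borel"
  shows "(\<integral>\<^sup>+x. f x \<partial>lborel) = ennreal (1/2) * (\<integral>\<^sup>+x. f (x / 2) \<partial>lborel)"
  using nn_integral_real_affine[of f "1/2" 0] by simp

text \<open>Finiteness of \<open>T\<close> is what permits subtracting \<open>\<theta> * T\<close>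
  from both sides.\<close>

lemma ennreal_le_of_contraction:
  fixes T C :: ennreal
  assumes "T \<le> ennreal \<theta> * T + C" "0 \<le> \<theta>" "\<theta> < 1" "T < \<infinity>" "C < \<infinity>"
  shows "T \<le> ennreal (enn2real C / (1 - \<theta>))"
proof -
  obtain t where t: "T = ennreal t" "t \<ge> 0" using assms(4) by (cases T) auto
  obtain c where c: "C = ennreal c" "c \<ge> 0" using assms(5) by (cases C) auto
  have "t \<le> \<theta> * t + c"
    using assms(1,2) t c by (simp add: ennreal_mult[symmetric] ennreal_plus[symmetric] del: ennreal_plus)
  then have "t \<le> c / (1 - \<theta>)" using assms(3) by (simp add: field_simps)
  then show ?thesis using t c by (simp add: ennreal_leI)
qed

text \<open>The moment over \<open>{r<..<\<delta>}\<close> is compared with itself at half scale: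
  the substitution costs \<open>K\<close> from \<open>f\<close>, \<open>2 powr \<gamma>\<close> from
  the weight and 1/2 from the length, in total a factor below 1. The truncated moments thus satisfy
  a contraction whose bound does not depend on \<open>r\<close>, and monotone convergence lets
  \<open>r\<close> tend to 0.\<close>

lemma doubling_moment_finite:
  fixes f :: "real \<Rightarrow> ennreal"
  assumes f[measurable]: "f \<in> borel_measurable borel" and fin: "(\<integral>\<^sup>+x. f x \<partial>lborel) < \<infinity>"
    and "\<delta> > 0" "\<gamma> \<ge> 0" "K \<ge> 0" and K: "K * 2 powr (\<gamma> - 1) < 1"
    and dbl: "\<And>x. 0 < x \<Longrightarrow> x < \<delta> \<Longrightarrow> f (x / 2) \<le> ennreal K * f x"
  shows "(\<integral>\<^sup>+x. ennreal (x powr - \<gamma>) * f x * indicator {0<..<\<delta>} x \<partial>lborel) < \<infinity>"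
proof -
  define T where "T r = (\<integral>\<^sup>+x. ennreal (x powr - \<gamma>) * f x * indicator {r<..<\<delta>} x \<partial>lborel)" for r
  \<comment> \<open>\<open>C\<close> bounds the part over \<open>x \<ge> \<delta> / 2\<close>, where
    the weight is at most \<open>(\<delta> / 2) powr - \<gamma>\<close>.\<close>
  define C where "C = ennreal ((\<delta> / 2) powr - \<gamma>) * (\<integral>\<^sup>+x. f x \<partial>lborel)"
  define \<theta> where "\<theta> = K * 2 powr (\<gamma> - 1)"
  have C: "C < \<infinity>" unfolding C_def using fin by (simp add: ennreal_mult_less_top)
  have T_fin: "T r < \<infinity>" if "r > 0" for r
  proof -
    have "T r \<le> (\<integral>\<^sup>+x. ennreal (r powr - \<gamma>) * f x \<partial>lborel)"
      unfolding T_def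
      by (intro nn_integral_mono)
        (use that \<open>\<gamma> \<ge> 0\<close> in \<open>auto split: split_indicator intro!: mult_right_mono ennreal_leI powr_mono2'\<close>)
    also have "\<dots> = ennreal (r powr - \<gamma>) * (\<integral>\<^sup>+x. f x \<partial>lborel)" by (simp add: nn_integral_cmult)
    also have "\<dots> < \<infinity>" using fin by (simp add: ennreal_mult_less_top)
    finally show ?thesis .
  qed
  have T_le: "T r \<le> ennreal (enn2real C / (1 - \<theta>))" if r: "r > 0" for r
  proof (rule ennreal_le_of_contraction)
    have "T r \<le> (\<integral>\<^sup>+x. ennreal (x powr - \<gamma>) * f x * indicator {r/2<..<\<delta>/2} x
        + ennreal ((\<delta> / 2) powr - \<gamma>) * f x \<partial>lborel)"
      unfolding T_def
    proof (intro nn_integral_mono)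
      fix x
      show "ennreal (x powr - \<gamma>) * f x * indicator {r<..<\<delta>} x
        \<le> ennreal (x powr - \<gamma>) * f x * indicator {r/2<..<\<delta>/2} x + ennreal ((\<delta> / 2) powr - \<gamma>) * f x"
      proof (cases "x < \<delta> / 2")
        case True
        then show ?thesis using r by (auto split: split_indicator)
      next
        case False
        then have "ennreal (x powr - \<gamma>) \<le> ennreal ((\<delta> / 2) powr - \<gamma>)"
          using \<open>\<delta> > 0\<close> \<open>\<gamma> \<ge> 0\<close> by (intro ennreal_leI powr_mono2') auto
        then show ?thesis using False
          by (auto split: split_indicator intro!: mult_right_mono)
      qed
    qed
    also have "\<dots> = (\<integral>\<^sup>+x. ennreal (x powr - \<gamma>) * f x * indicator {r/2<..<\<delta>/2} x \<partial>lborel) + C"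
      unfolding C_def by (subst nn_integral_add) (auto simp: nn_integral_cmult)
    also have "(\<integral>\<^sup>+x. ennreal (x powr - \<gamma>) * f x * indicator {r/2<..<\<delta>/2} x \<partial>lborel)
        = ennreal (1/2) * (\<integral>\<^sup>+x. ennreal ((x/2) powr - \<gamma>) * f (x/2) * indicator {r/2<..<\<delta>/2} (x/2) \<partial>lborel)"
      by (subst nn_integral_halving) auto
    also have "\<dots> \<le> ennreal (1/2) * (\<integral>\<^sup>+x. ennreal (2 powr \<gamma> * K) *
        (ennreal (x powr - \<gamma>) * f x * indicator {r<..<\<delta>} x) \<partial>lborel)"
    proof (intro mult_left_mono nn_integral_mono)
      fix x
      show "ennreal ((x/2) powr - \<gamma>) * f (x/2) * indicator {r/2<..<\<delta>/2} (x/2)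
        \<le> ennreal (2 powr \<gamma> * K) * (ennreal (x powr - \<gamma>) * f x * indicator {r<..<\<delta>} x)"
      proof (cases "x \<in> {r<..<\<delta>}")
        case True
        then have "x > 0" using r by auto
        then have e: "(x/2) powr - \<gamma> = 2 powr \<gamma> * x powr - \<gamma>"
          by (simp add: powr_divide powr_minus field_simps)
        have "ennreal ((x/2) powr - \<gamma>) * f (x/2) \<le> ennreal ((x/2) powr - \<gamma>) * (ennreal K * f x)"
          using dbl[of x] True \<open>x > 0\<close> by (intro mult_left_mono) auto
        also have "\<dots> = ennreal (2 powr \<gamma> * K) * (ennreal (x powr - \<gamma>) * f x)"
          unfolding e using \<open>K \<ge> 0\<close> by (simp add: ennreal_mult ac_simps)
        finally show ?thesis using True by (auto split: split_indicator)
      qed (auto split: split_indicator)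
    qed auto
    also have "\<dots> = ennreal \<theta> * T r"
    proof -
      have "ennreal (1/2) * ennreal (2 powr \<gamma> * K) = ennreal \<theta>"
        unfolding \<theta>_def using \<open>K \<ge> 0\<close> by (simp add: ennreal_mult[symmetric] powr_diff ac_simps del: ennreal_half)
      then show ?thesis unfolding T_def by (subst nn_integral_cmult) (auto simp: mult.assoc[symmetric])
    qed
    finally show "T r \<le> ennreal \<theta> * T r + C" by (simp add: add_right_mono)
  qed (use C T_fin r \<open>K \<ge> 0\<close> K in \<open>auto simp: \<theta>_def\<close>)
  have "(\<integral>\<^sup>+x. ennreal (x powr - \<gamma>) * f x * indicator {0<..<\<delta>} x \<partial>lborel)
      = (\<integral>\<^sup>+x. (SUP n. ennreal (x powr - \<gamma>) * f x * indicator {1 / real (Suc n)<..<\<delta>} x) \<partial>lborel)"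
  proof (intro nn_integral_cong)
    fix x :: real
    have "(SUP n. ennreal (x powr - \<gamma>) * f x * indicator {1 / real (Suc n)<..<\<delta>} x)
      = ennreal (x powr - \<gamma>) * f x * (SUP n. indicator {1 / real (Suc n)<..<\<delta>} x)"
      by (rule SUP_mult_left_ennreal[symmetric])
    also have "(SUP n. indicator {1 / real (Suc n)<..<\<delta>} x) = (indicator {0<..<\<delta>} x :: ennreal)"
    proof (rule antisym)
      show "(SUP n. indicator {1 / real (Suc n)<..<\<delta>} x) \<le> (indicator {0<..<\<delta>} x :: ennreal)"
        by (intro SUP_least) (auto split: split_indicator intro: less_trans[rotated] simp: order.strict_trans[of 0 "1 / (1 + real _)"])
      show "(indicator {0<..<\<delta>} x :: ennreal) \<le> (SUP n. indicator {1 / real (Suc n)<..<\<delta>} x)"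
      proof (cases "x \<in> {0<..<\<delta>}")
        case True
        then obtain n where "1 / real (Suc n) < x" using nat_approx_posE[of x] by auto
        then show ?thesis using True by (intro SUP_upper2[of n]) (auto split: split_indicator)
      qed auto
    qed
    finally show "ennreal (x powr - \<gamma>) * f x * indicator {0<..<\<delta>} x =
      (SUP n. ennreal (x powr - \<gamma>) * f x * indicator {1 / real (Suc n)<..<\<delta>} x)" by simp
  qed
  also have "\<dots> = (SUP n. T (1 / real (Suc n)))"
    unfolding T_def
  proof (intro nn_integral_monotone_convergence_SUP incseq_SucI le_funI)
    fix n :: nat and x :: real
    have "1 / real (Suc (Suc n)) \<le> 1 / real (Suc n)" by (simp add: frac_le)
    then have "1 / real (Suc n) < x \<Longrightarrow> 1 / real (Suc (Suc n)) < x" by linarith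
    then show "ennreal (x powr - \<gamma>) * f x * indicator {1 / real (Suc n)<..<\<delta>} x
        \<le> ennreal (x powr - \<gamma>) * f x * indicator {1 / real (Suc (Suc n))<..<\<delta>} x"
      by (auto split: split_indicator)
  qed auto
  also have "\<dots> \<le> ennreal (enn2real C / (1 - \<theta>))"
    by (intro SUP_least T_le) auto
  also have "\<dots> < \<infinity>" by simp
  finally show ?thesis .
qed

text \<open>One halving multiplies the mass near 0 by at least \<open>K / 2\<close>, the 1/2 being
  the Jacobian; this is iterated \<open>k\<close> times.\<close>

lemma doubling_mass_lower:
  fixes f :: "real \<Rightarrow> ennreal"
  assumes f[measurable]: "f \<in> borel_measurable borel" and "\<delta> > 0" "K \<ge> 0"
    and dbl: "\<And>x. 0 < x \<Longrightarrow> x < \<delta> \<Longrightarrow> ennreal K * f x \<le> f (x / 2)"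
  shows "ennreal ((K / 2) ^ k) * (\<integral>\<^sup>+x. f x * indicator {0<..<\<delta>} x \<partial>lborel)
    \<le> (\<integral>\<^sup>+x. f x * indicator {0<..<\<delta> / 2 ^ k} x \<partial>lborel)"
proof (induction k)
  case (Suc k)
  let ?\<Phi> = "\<lambda>x. (\<integral>\<^sup>+y. f y * indicator {0<..<x} y \<partial>lborel)"
  have "ennreal ((K / 2) ^ Suc k) * ?\<Phi> \<delta> = ennreal (K / 2) * (ennreal ((K / 2) ^ k) * ?\<Phi> \<delta>)"
    using \<open>K \<ge> 0\<close> by (simp add: ennreal_mult[symmetric] mult.assoc[symmetric])
  also have "\<dots> \<le> ennreal (K / 2) * ?\<Phi> (\<delta> / 2 ^ k)"
    by (intro mult_left_mono Suc) auto
  also have "\<dots> = ennreal (1/2) * (\<integral>\<^sup>+y. ennreal K * (f y * indicator {0<..<\<delta> / 2 ^ k} y) \<partial>lborel)"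
    using \<open>K \<ge> 0\<close> by (subst nn_integral_cmult)
      (auto simp: mult.assoc[symmetric] ennreal_mult[symmetric] simp del: ennreal_half)
  also have "\<dots> \<le> ennreal (1/2) * (\<integral>\<^sup>+y. f (y / 2) * indicator {0<..<\<delta> / 2 ^ Suc k} (y / 2) \<partial>lborel)"
  proof (intro mult_left_mono nn_integral_mono)
    fix y
    have "\<delta> / 2 ^ k \<le> \<delta>" using \<open>\<delta> > 0\<close> by (simp add: field_simps)
    then have "y < \<delta> / 2 ^ k \<Longrightarrow> y < \<delta>" by linarith
    then show "ennreal K * (f y * indicator {0<..<\<delta> / 2 ^ k} y)
        \<le> f (y / 2) * indicator {0<..<\<delta> / 2 ^ Suc k} (y / 2)"
      using dbl[of y] by (auto split: split_indicator)
  qed auto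
  also have "\<dots> = ?\<Phi> (\<delta> / 2 ^ Suc k)"
    by (subst (2) nn_integral_halving) auto
  finally show ?case .
qed simp

section \<open>Negative moments of \<open>\<pi>\<close> and its mass near the origin\<close>

context
  fixes p l :: "real \<Rightarrow> real" and \<pi> :: "real measure" and \<alpha> :: real
  assumes prob: "prob_space \<pi>"
    and p_meas: "p \<in> borel_measurable (restrict_space lborel {0<..})"
    and p_nonneg: "\<And>x. x > 0 \<Longrightarrow> p x \<ge> 0"
    and \<pi>: "\<pi> = density (restrict_space lborel {0<..}) (\<lambda>x. ennreal (p x))"
    and \<alpha>: "0 < \<alpha>"
    and l: "slowly_varying l"
    and p: "p \<sim>[at_right 0] (\<lambda>x. \<alpha> * l (inverse x) * x powr (\<alpha> - 1))"
begin

lemma regvar_nn_integral: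
  assumes [measurable]: "h \<in> borel_measurable borel"
  shows "(\<integral>\<^sup>+x. h x \<partial>\<pi>) = (\<integral>\<^sup>+x. h x * (ennreal (p x) * indicator {0<..} x) \<partial>lborel)"
proof -
  have [measurable]: "h \<in> borel_measurable (restrict_space lborel {0<..})"
    by (intro measurable_restrict_space1) simp
  show ?thesis unfolding \<pi> using p_meas
    by (subst nn_integral_density) (auto simp: nn_integral_restrict_space ac_simps)
qed

lemma regvar_density_measurable: "(\<lambda>x. ennreal (p x) * indicator {0<..} x) \<in> borel_measurable borel"
proof -
  have "(\<lambda>x. ennreal (p x)) \<in> borel_measurable (restrict_space lborel {0<..})"
    using p_meas by measurable
  then show ?thesis
    by (subst (asm) borel_measurable_restrict_space_iff_ennreal) auto
qed

lemma regvar_density_integral: "(\<integral>\<^sup>+x. ennreal (p x) * indicator {0<..} x \<partial>lborel) = 1"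
  using regvar_nn_integral[of "\<lambda>_. 1"] prob_space.emeasure_space_1[OF prob] by simp

lemma regvar_negative_moment:
  assumes "0 \<le> \<gamma>" "\<gamma> < \<alpha>"
  shows "(\<integral>\<^sup>+x. ennreal (x powr - \<gamma>) \<partial>\<pi>) < \<infinity>"
proof -
  note [measurable] = regvar_density_measurable
  let ?f = "\<lambda>x. ennreal (p x) * indicator {0<..} x"
  \<comment> \<open>With this \<epsilon> the contraction factor is \<open>2 powr (\<gamma> -
    \<alpha> + \<epsilon>) = 2 powr - \<epsilon>\<close>.\<close>
  define \<epsilon> where "\<epsilon> = (\<alpha> - \<gamma>) / 2"
  have "\<epsilon> > 0" using assms by (simp add: \<epsilon>_def)
  obtain \<delta> where \<delta>: "\<delta> > 0" "\<And>x. 0 < x \<Longrightarrow> x < \<delta> \<Longrightarrow> p x > 0"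
    "\<And>x. 0 < x \<Longrightarrow> x < \<delta> \<Longrightarrow> p (x / 2) \<le> 2 powr (1 - \<alpha> + \<epsilon>) * p x"
    using regularly_varying_density_ratio[OF l \<alpha> p \<open>\<epsilon> > 0\<close>] by metis
  have fin: "(\<integral>\<^sup>+x. ennreal (x powr - \<gamma>) * ?f x * indicator {0<..<\<delta>} x \<partial>lborel) < \<infinity>"
  proof (rule doubling_moment_finite[where K = "2 powr (1 - \<alpha> + \<epsilon>)"])
    show "2 powr (1 - \<alpha> + \<epsilon>) * 2 powr (\<gamma> - 1) < 1"
      using assms by (simp only: powr_add[symmetric] \<epsilon>_def) (intro powr_less_one, auto simp: field_simps)
    fix x assume "0 < x" "x < \<delta>"
    then show "?f (x / 2) \<le> ennreal (2 powr (1 - \<alpha> + \<epsilon>)) * ?f x"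
      using \<delta>(3)[of x] \<delta>(2)[of x] by (simp add: ennreal_mult[symmetric] ennreal_leI)
  qed (use \<delta> assms regvar_density_integral in auto)
  have "(\<integral>\<^sup>+x. ennreal (x powr - \<gamma>) \<partial>\<pi>) = (\<integral>\<^sup>+x. ennreal (x powr - \<gamma>) * ?f x \<partial>lborel)"
    by (rule regvar_nn_integral) measurable
  also have "\<dots> \<le> (\<integral>\<^sup>+x. ennreal (x powr - \<gamma>) * ?f x * indicator {0<..<\<delta>} x
      + ennreal (\<delta> powr - \<gamma>) * ?f x \<partial>lborel)"
  proof (intro nn_integral_mono)
    fix x
    show "ennreal (x powr - \<gamma>) * ?f x \<le> ennreal (x powr - \<gamma>) * ?f x * indicator {0<..<\<delta>} x
      + ennreal (\<delta> powr - \<gamma>) * ?f x"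
    proof (cases "x < \<delta>")
      case False
      then have "ennreal (x powr - \<gamma>) \<le> ennreal (\<delta> powr - \<gamma>)"
        using \<delta>(1) assms(1) by (intro ennreal_leI powr_mono2') auto
      then show ?thesis using False by (auto intro!: mult_right_mono split: split_indicator)
    qed (auto split: split_indicator)
  qed
  also have "\<dots> = (\<integral>\<^sup>+x. ennreal (x powr - \<gamma>) * ?f x * indicator {0<..<\<delta>} x \<partial>lborel)
      + ennreal (\<delta> powr - \<gamma>)"
    by (subst nn_integral_add) (auto simp: nn_integral_cmult regvar_density_integral)
  also have "\<dots> < \<infinity>" using fin by simp
  finally show ?thesis .
qed

lemma regvar_mass_lower:
  assumes "\<epsilon> > 0"
  obtains c t0 where "c > 0" "t0 > 0"
    "\<And>t. t \<ge> t0 \<Longrightarrow> ennreal (c * t powr - (\<alpha> + \<epsilon>)) \<le> emeasure \<pi> {0<..<1 / t}"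
proof -
  note [measurable] = regvar_density_measurable
  let ?f = "\<lambda>x. ennreal (p x) * indicator {0<..} x"
  let ?\<Phi> = "\<lambda>x. (\<integral>\<^sup>+y. ?f y * indicator {0<..<x} y \<partial>lborel)"
  obtain \<delta> where \<delta>: "\<delta> > 0" "\<And>x. 0 < x \<Longrightarrow> x < \<delta> \<Longrightarrow> p x > 0"
    "\<And>x. 0 < x \<Longrightarrow> x < \<delta> \<Longrightarrow> 2 powr (1 - \<alpha> - \<epsilon>) * p x \<le> p (x / 2)"
    using regularly_varying_density_ratio[OF l \<alpha> p \<open>\<epsilon> > 0\<close>] by metis
  have \<Phi>: "emeasure \<pi> {0<..<x} = ?\<Phi> x" for x
  proof -
    have "{0<..<x} \<in> sets \<pi>" unfolding \<pi> by (auto simp: sets_restrict_space_iff)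
    then have "emeasure \<pi> {0<..<x} = (\<integral>\<^sup>+y. indicator {0<..<x} y \<partial>\<pi>)" by simp
    also have "\<dots> = (\<integral>\<^sup>+y. indicator {0<..<x} y * ?f y \<partial>lborel)"
      by (rule regvar_nn_integral) measurable
    finally show ?thesis by (simp add: ac_simps)
  qed
  have low: "ennreal ((2 powr (1 - \<alpha> - \<epsilon>) / 2) ^ k) * ?\<Phi> \<delta> \<le> ?\<Phi> (\<delta> / 2 ^ k)" for k
  proof (rule doubling_mass_lower)
    fix x assume "0 < x" "x < \<delta>"
    then show "ennreal (2 powr (1 - \<alpha> - \<epsilon>)) * ?f x \<le> ?f (x / 2)"
      using \<delta>(3)[of x] \<delta>(2)[of x] by (simp add: ennreal_mult[symmetric] ennreal_leI)
  qed (use \<delta> in auto)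
  \<comment> \<open>\<open>p\<close> is positive on all of \<open>{0<..<\<delta>}\<close>, a set of
    positive length.\<close>
  have "?\<Phi> \<delta> \<noteq> 0"
  proof
    assume "?\<Phi> \<delta> = 0"
    then have "AE x in lborel. ?f x * indicator {0<..<\<delta>} x = 0"
      by (subst (asm) nn_integral_0_iff_AE) auto
    then have "AE x in lborel. x \<notin> {0<..<\<delta>}"
      proof eventually_elim
      case (elim x)
      show ?case
      proof
        assume "x \<in> {0<..<\<delta>}"
        then show False using elim \<delta>(2)[of x] by (simp add: ennreal_eq_0_iff)
      qed
    qed
    then have "emeasure lborel {x \<in> space lborel. x \<in> {0<..<\<delta>}} = 0"
      by (intro emeasure_eq_0_AE) auto
    moreover have "{x \<in> space lborel. x \<in> {0<..<\<delta>}} = {0<..<\<delta>}" by auto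
    ultimately show False using \<delta>(1) by simp
  qed
  moreover have "?\<Phi> \<delta> < \<infinity>"
    using \<Phi>[of \<delta>] prob by (metis finite_measure.emeasure_finite infinity_ennreal_def less_top prob_space_def)
  ultimately obtain m where m: "?\<Phi> \<delta> = ennreal m" "m > 0"
    by (cases "?\<Phi> \<delta>") (auto simp: zero_less_iff_neq_zero)
  \<comment> \<open>Below, \<open>k\<close> is chosen with
    \<open>\<delta> * t \<le> 2 ^ k \<le> 2 * \<delta> * t\<close>: the left bound puts
    \<open>\<delta> / 2 ^ k\<close> below \<open>1 / t\<close>, the right one costs the 2 in
    \<open>c\<close>. Each halving keeps the fraction
    \<open>2 powr - (\<alpha> + \<epsilon>)\<close> of the mass.\<close>
  define c where "c = (2 * \<delta>) powr - (\<alpha> + \<epsilon>) * m"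
  have "ennreal (c * t powr - (\<alpha> + \<epsilon>)) \<le> emeasure \<pi> {0<..<1 / t}" if t: "t \<ge> 1 / \<delta>" for t
  proof -
    have "t > 0" using t \<delta>(1) by (meson divide_pos_pos less_le_trans zero_less_one)
    then have "\<delta> * t \<ge> 1" using t \<delta>(1) by (simp add: field_simps)
    define k where "k = nat \<lceil>log 2 (\<delta> * t)\<rceil>"
    have "log 2 (\<delta> * t) \<ge> 0" using \<open>\<delta> * t \<ge> 1\<close> by (simp add: zero_le_log_cancel_iff)
    then have k: "log 2 (\<delta> * t) \<le> real k" "real k \<le> log 2 (\<delta> * t) + 1"
      unfolding k_def by linarith+
    have "\<delta> * t > 0" using \<open>\<delta> * t \<ge> 1\<close> by linarith
    have k1: "\<delta> * t \<le> 2 ^ k"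
      using k(1) \<open>\<delta> * t > 0\<close> by (simp add: log_le_iff powr_realpow)
    have k2: "2 ^ k \<le> 2 * \<delta> * t"
    proof -
      have "2 powr real k \<le> 2 powr (log 2 (\<delta> * t) + 1)" using k(2) by simp
      also have "\<dots> = 2 * \<delta> * t" using \<open>\<delta> * t > 0\<close> by (simp add: powr_add)
      finally show ?thesis by (simp add: powr_realpow)
    qed
    have "c * t powr - (\<alpha> + \<epsilon>) = (2 * \<delta> * t) powr - (\<alpha> + \<epsilon>) * m"
      using \<open>t > 0\<close> \<delta>(1) by (simp add: c_def powr_mult)
    also have "\<dots> \<le> (2 ^ k) powr - (\<alpha> + \<epsilon>) * m"
      using k2 \<alpha> \<open>\<epsilon> > 0\<close> m by (intro mult_right_mono powr_mono2') auto
    also have "(2 ^ k) powr - (\<alpha> + \<epsilon>) = (2 powr (1 - \<alpha> - \<epsilon>) / 2) ^ k"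
    proof -
      have "2 powr (1 - \<alpha> - \<epsilon>) / 2 = 2 powr - (\<alpha> + \<epsilon>)" by (simp add: powr_diff powr_minus powr_add field_simps)
      then show ?thesis by (simp add: powr_realpow[symmetric] powr_powr ac_simps)
    qed
    finally have "ennreal (c * t powr - (\<alpha> + \<epsilon>)) \<le> ennreal ((2 powr (1 - \<alpha> - \<epsilon>) / 2) ^ k * m)"
      by (rule ennreal_leI)
    also have "\<dots> \<le> ?\<Phi> (\<delta> / 2 ^ k)"
      using low[of k] m by (simp add: ennreal_mult)
    also have "\<dots> \<le> ?\<Phi> (1 / t)"
    proof (intro nn_integral_mono)
      have "\<delta> / 2 ^ k \<le> 1 / t" using k1 \<open>t > 0\<close> by (simp add: field_simps)
      then show "?f y * indicator {0<..<\<delta> / 2 ^ k} y \<le> ?f y * indicator {0<..<1 / t} y" for y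
        by (auto split: split_indicator)
    qed
    finally show ?thesis by (simp add: \<Phi>)
  qed
  moreover have "c > 0" using m \<delta>(1) by (simp add: c_def)
  ultimately show ?thesis using that[of c "1 / \<delta>"] \<delta>(1) by auto
qed

end

section \<open>Analytic cosine transforms\<close>

lemma borel_measurable_cosh [measurable]:
  fixes f :: "'a \<Rightarrow> real"
  assumes "f \<in> borel_measurable N"
  shows "(\<lambda>x. cosh (f x)) \<in> borel_measurable N"
  by (rule borel_measurable_continuous_on[OF _ assms]) (intro continuous_intros)

text \<open>Adding the Taylor expansions at \<open>z + h\<close> and \<open>z - h\<close> cancels
  the linear terms; each remainder is controlled by the third derivative on a compact disc.\<close>

lemma second_difference_bound:
  assumes hol: "H holomorphic_on ball 0 R" and z: "z \<in> ball 0 R"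
  obtains \<rho> B where "\<rho> > 0" "\<And>h. norm h \<le> \<rho> \<Longrightarrow> z + h \<in> ball 0 R"
    "\<And>h. norm h \<le> \<rho> \<Longrightarrow> norm (H (z + h) + H (z - h) - 2 * H z - deriv (deriv H) z * h\<^sup>2) \<le> B * norm h ^ 3"
proof -
  define f where "f i = (deriv ^^ i) H" for i
  have f_hol: "f i holomorphic_on ball 0 R" for i
    unfolding f_def using hol by (intro holomorphic_higher_deriv) auto
  have f_deriv: "(f i has_field_derivative f (Suc i) x) (at x)" if "x \<in> ball 0 R" for i x
    using holomorphic_derivI[OF f_hol[of i] open_ball that] by (simp add: f_def)
  obtain \<rho> where \<rho>: "\<rho> > 0" "cball z \<rho> \<subseteq> ball 0 R"
    using z open_contains_cball[of "ball 0 R"] by (meson open_ball)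
  have "compact (f 3 ` cball z \<rho>)"
    using \<rho> by (intro compact_continuous_image holomorphic_on_imp_continuous_on holomorphic_on_subset[OF f_hol]) auto
  then have "bounded (f 3 ` cball z \<rho>)" by (rule compact_imp_bounded)
  then obtain B where "\<forall>y \<in> f 3 ` cball z \<rho>. norm y \<le> B"
    unfolding bounded_iff by blast
  then have B: "\<And>x. x \<in> cball z \<rho> \<Longrightarrow> norm (f 3 x) \<le> B" by blast
  have tay: "norm (H (z + h) - (H z + deriv H z * h + deriv (deriv H) z * h\<^sup>2 / 2)) \<le> B * norm h ^ 3 / 2"
    if h: "norm h \<le> \<rho>" for h
  proof -
    have "norm (f 0 (z + h) - (\<Sum>i\<le>2. f i z * (z + h - z) ^ i / fact i)) \<le> B * norm (z + h - z) ^ Suc 2 / fact 2"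
    proof (rule complex_Taylor)
      show "convex (cball z \<rho>)" by simp
      show "(f i has_field_derivative f (Suc i) x) (at x within cball z \<rho>)" if "x \<in> cball z \<rho>" for i x
        using f_deriv \<rho> that by (meson has_field_derivative_at_within subsetD)
      show "cmod (f (Suc 2) x) \<le> B" if "x \<in> cball z \<rho>" for x
        using B[OF that] by (simp add: numeral_eq_Suc)
    qed (use h \<rho> in \<open>auto simp: dist_norm\<close>)
    then show ?thesis by (simp add: f_def numeral_eq_Suc atMost_Suc algebra_simps)
  qed
  have "norm (H (z + h) + H (z - h) - 2 * H z - deriv (deriv H) z * h\<^sup>2) \<le> B * norm h ^ 3"
    if h: "norm h \<le> \<rho>" for h
  proof -
    let ?a = "H (z + h) - (H z + deriv H z * h + deriv (deriv H) z * h\<^sup>2 / 2)"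
    let ?b = "H (z + - h) - (H z + deriv H z * (- h) + deriv (deriv H) z * (- h)\<^sup>2 / 2)"
    have "H (z + h) + H (z - h) - 2 * H z - deriv (deriv H) z * h\<^sup>2 = ?a + ?b"
      by (simp add: algebra_simps)
    also have "norm \<dots> \<le> norm ?a + norm ?b" by (rule norm_triangle_ineq)
    also have "\<dots> \<le> B * norm h ^ 3 / 2 + B * norm h ^ 3 / 2"
      using tay[of h] tay[of "- h"] h by (intro add_mono) auto
    finally show ?thesis by simp
  qed
  moreover have "z + h \<in> ball 0 R" if "norm h \<le> \<rho>" for h
  proof -
    have "z + h \<in> cball z \<rho>" using that by (simp add: dist_norm)
    then show ?thesis using \<rho>(2) by blast
  qed
  ultimately show ?thesis using that \<rho>(1) by blast
qed

lemma one_minus_cos_le: "1 - cos (x::real) \<le> x\<^sup>2 / 2"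
proof -
  have "(sin (x / 2))\<^sup>2 \<le> (x / 2)\<^sup>2"
    using abs_sin_x_le_abs_x[of "x/2"] by (metis abs_le_square_iff)
  moreover have "1 - cos x = 2 * (sin (x / 2))\<^sup>2"
    using cos_double_sin[of "x / 2"] by simp
  ultimately show ?thesis by (simp add: power_divide)
qed

lemma tendsto_second_difference_cos:
  assumes h: "h \<longlonglongrightarrow> (0::real)" "\<And>n. h n \<noteq> 0"
  shows "(\<lambda>n. 2 * (1 - cos (h n * y)) / (h n)\<^sup>2) \<longlonglongrightarrow> y\<^sup>2"
proof (cases "y = 0")
  case False
  have "(\<lambda>n. h n * y / 2) \<longlonglongrightarrow> 0 * y / 2" by (intro tendsto_intros h) auto
  then have "filterlim (\<lambda>n. h n * y / 2) (at 0) sequentially"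
    using h(2) False by (auto simp: filterlim_at)
  then have lim: "(\<lambda>n. sin (h n * y / 2) / (h n * y / 2)) \<longlonglongrightarrow> 1"
    by (rule filterlim_compose[OF sinc_at_0])
  have "(\<lambda>n. y\<^sup>2 * (sin (h n * y / 2) / (h n * y / 2))\<^sup>2) \<longlonglongrightarrow> y\<^sup>2 * 1\<^sup>2"
    by (intro tendsto_intros lim)
  moreover have "y\<^sup>2 * (sin (h n * y / 2) / (h n * y / 2))\<^sup>2 = 2 * (1 - cos (h n * y)) / (h n)\<^sup>2" for n
    using False h(2)[of n] cos_double_sin[of "h n * y / 2"] by (simp add: field_simps power2_eq_square)
  ultimately show ?thesis by simp
qed (use h in auto)

text \<open>
  The function \<open>u\<close> is either \<open>1 - cos (\<zeta> Y)\<close>, with \<open>w = 1\<close> and \<open>s = 1\<close>, or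
  \<open>w cos (\<zeta> Y)\<close> with \<open>s = -1\<close>.
\<close>
lemma cosine_transform_deriv2:
  fixes Y w :: "'a \<Rightarrow> real" and u :: "real \<Rightarrow> 'a \<Rightarrow> real" and s :: real
  assumes [measurable]: "Y \<in> borel_measurable N" "w \<in> borel_measurable N"
    and w: "\<And>x. w x \<ge> 0" and s: "s = 1 \<or> s = -1"
    and hol: "H holomorphic_on ball 0 R" and "R > 0"
    and int: "\<And>\<zeta>. \<bar>\<zeta>\<bar> < R \<Longrightarrow> integrable N (u \<zeta>)"
    and eq: "\<And>\<zeta>. \<bar>\<zeta>\<bar> < R \<Longrightarrow> (\<integral>x. u \<zeta> x \<partial>N) = Re (H (of_real \<zeta>))"
    and diff: "\<And>\<zeta> h x. u (\<zeta> + h) x + u (\<zeta> - h) x - 2 * u \<zeta> x = s * (w x * cos (\<zeta> * Y x) * (2 * (1 - cos (h * Y x))))"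
  shows "integrable N (\<lambda>x. w x * (Y x)\<^sup>2)"
    and "\<bar>\<zeta>\<bar> < R \<Longrightarrow> (\<integral>x. w x * (Y x)\<^sup>2 * cos (\<zeta> * Y x) \<partial>N) = s * Re (deriv (deriv H) (of_real \<zeta>))"
proof -
  \<comment> \<open>By \<open>diff\<close>, the symmetric second difference of \<open>u\<close> is,
    up to the sign \<open>s\<close>, the weighted cosine times a nonnegative factor. After division
    by the square of \<open>h n\<close>, its integral converges to the second derivative of
    \<open>H\<close> up to sign.\<close>
  have seq: "\<exists>h. h \<longlonglongrightarrow> 0 \<and> (\<forall>n. h n \<noteq> 0) \<and>
      (\<forall>n. integrable N (\<lambda>x. w x * cos (\<zeta> * Y x) * (2 * (1 - cos (h n * Y x)) / (h n)\<^sup>2))) \<and>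
      (\<lambda>n. \<integral>x. w x * cos (\<zeta> * Y x) * (2 * (1 - cos (h n * Y x)) / (h n)\<^sup>2) \<partial>N) \<longlonglongrightarrow> s * Re (deriv (deriv H) (of_real \<zeta>))"
    if \<zeta>: "\<bar>\<zeta>\<bar> < R" for \<zeta>
  proof -
    obtain \<rho> B where \<rho>: "\<rho> > 0" "\<And>h. norm h \<le> \<rho> \<Longrightarrow> complex_of_real \<zeta> + h \<in> ball 0 R"
      "\<And>h. norm h \<le> \<rho> \<Longrightarrow> norm (H (of_real \<zeta> + h) + H (of_real \<zeta> - h) - 2 * H (of_real \<zeta>)
        - deriv (deriv H) (of_real \<zeta>) * h\<^sup>2) \<le> B * norm h ^ 3"
      using second_difference_bound[OF hol, of "of_real \<zeta>"] \<zeta> by auto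
    define h where "h n = \<rho> / real (Suc n)" for n
    have h0: "h \<longlonglongrightarrow> 0" unfolding h_def by (rule LIMSEQ_Suc[OF lim_const_over_n])
    have hpos: "h n > 0" "h n \<le> \<rho>" for n
      using \<rho>(1) by (auto simp: h_def field_simps)
    have in_ball: "\<bar>\<zeta> + h n\<bar> < R" "\<bar>\<zeta> - h n\<bar> < R" for n
      using \<rho>(2)[of "of_real (h n)"] \<rho>(2)[of "- of_real (h n)"] hpos[of n]
      by (auto simp: norm_of_real simp flip: of_real_add of_real_diff)
    have D: "w x * cos (\<zeta> * Y x) * (2 * (1 - cos (h n * Y x)) / (h n)\<^sup>2)
       = s * (u (\<zeta> + h n) x + u (\<zeta> - h n) x - 2 * u \<zeta> x) / (h n)\<^sup>2" for n x
      unfolding diff using s by (auto simp: field_simps)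
    have I: "integrable N (\<lambda>x. w x * cos (\<zeta> * Y x) * (2 * (1 - cos (h n * Y x)) / (h n)\<^sup>2))" for n
      unfolding D using int in_ball[of n] \<zeta> by auto
    have E: "(\<integral>x. w x * cos (\<zeta> * Y x) * (2 * (1 - cos (h n * Y x)) / (h n)\<^sup>2) \<partial>N)
      = s * Re (H (of_real \<zeta> + of_real (h n)) + H (of_real \<zeta> - of_real (h n)) - 2 * H (of_real \<zeta>)) / (h n)\<^sup>2" for n
      unfolding D using int in_ball[of n] \<zeta> eq[of "\<zeta> + h n"] eq[of "\<zeta> - h n"] eq[of \<zeta>] by simp
    have "(\<lambda>n. \<integral>x. w x * cos (\<zeta> * Y x) * (2 * (1 - cos (h n * Y x)) / (h n)\<^sup>2) \<partial>N)
       \<longlonglongrightarrow> s * Re (deriv (deriv H) (of_real \<zeta>))"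
    proof (rule LIM_zero_cancel, rule Lim_null_comparison)
      have "(\<lambda>n. B * h n) \<longlonglongrightarrow> B * 0" by (intro tendsto_intros h0)
      then show "(\<lambda>n. B * h n) \<longlonglongrightarrow> 0" by simp
      show "\<forall>\<^sub>F n in sequentially. norm ((\<integral>x. w x * cos (\<zeta> * Y x) * (2 * (1 - cos (h n * Y x)) / (h n)\<^sup>2) \<partial>N)
        - s * Re (deriv (deriv H) (of_real \<zeta>))) \<le> B * h n"
      proof (intro always_eventually allI)
        fix n
        let ?d = "H (of_real \<zeta> + of_real (h n)) + H (of_real \<zeta> - of_real (h n)) - 2 * H (of_real \<zeta>)"
        let ?c = "deriv (deriv H) (of_real \<zeta>)"
        have "\<bar>s * Re ?d / (h n)\<^sup>2 - s * Re ?c\<bar> = \<bar>Re ?d - Re ?c * (h n)\<^sup>2\<bar> / (h n)\<^sup>2"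
          using s hpos(1)[of n] by (auto simp: field_simps abs_mult abs_minus_commute)
        also have "Re ?d - Re ?c * (h n)\<^sup>2 = Re (?d - ?c * (of_real (h n))\<^sup>2)"
          by (simp flip: of_real_power)
        also have "\<bar>\<dots>\<bar> / (h n)\<^sup>2 \<le> (B * norm (complex_of_real (h n)) ^ 3) / (h n)\<^sup>2"
          using hpos[of n] by (intro divide_right_mono order_trans[OF abs_Re_le_cmod] \<rho>(3)) auto
        also have "\<dots> = B * h n" using hpos(1)[of n] by (simp add: power2_eq_square power3_eq_cube)
        finally show "norm ((\<integral>x. w x * cos (\<zeta> * Y x) * (2 * (1 - cos (h n * Y x)) / (h n)\<^sup>2) \<partial>N)
            - s * Re ?c) \<le> B * h n"
          unfolding E by simp
      qed
    qed
    then show ?thesis using h0 hpos I by (intro exI[of _ h]) (auto simp: less_imp_neq[symmetric])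
  qed
  \<comment> \<open>At \<open>\<zeta> = 0\<close> the cosine is 1 and the integrands are
    nonnegative, so Fatou's lemma gives integrability. Only then is \<open>w x * (Y x)^2\<close>
    available as a majorant for dominated convergence at the other \<zeta>.\<close>
  show int2: "integrable N (\<lambda>x. w x * (Y x)\<^sup>2)"
  proof -
    obtain h where h: "h \<longlonglongrightarrow> 0" "\<And>n. h n \<noteq> 0"
      "\<And>n. integrable N (\<lambda>x. w x * (2 * (1 - cos (h n * Y x)) / (h n)\<^sup>2))"
      "(\<lambda>n. \<integral>x. w x * (2 * (1 - cos (h n * Y x)) / (h n)\<^sup>2) \<partial>N) \<longlonglongrightarrow> s * Re (deriv (deriv H) 0)"
      using seq[of 0] \<open>R > 0\<close> by auto
    have "(\<integral>\<^sup>+x. ennreal (w x * (Y x)\<^sup>2) \<partial>N)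
        = (\<integral>\<^sup>+x. liminf (\<lambda>n. ennreal (w x * (2 * (1 - cos (h n * Y x)) / (h n)\<^sup>2))) \<partial>N)"
      by (intro nn_integral_cong lim_imp_Liminf[symmetric] tendsto_ennrealI tendsto_mult_left
          tendsto_second_difference_cos h) auto
    also have "\<dots> \<le> liminf (\<lambda>n. \<integral>\<^sup>+x. ennreal (w x * (2 * (1 - cos (h n * Y x)) / (h n)\<^sup>2)) \<partial>N)"
      by (intro nn_integral_liminf) measurable
    also have "\<dots> = liminf (\<lambda>n. ennreal (\<integral>x. w x * (2 * (1 - cos (h n * Y x)) / (h n)\<^sup>2) \<partial>N))"
      using h(3) w by (subst nn_integral_eq_integral) auto
    also have "\<dots> = ennreal (s * Re (deriv (deriv H) 0))"
      by (intro lim_imp_Liminf tendsto_ennrealI h) auto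
    finally show ?thesis using w by (intro integrableI_nonneg) (auto simp: top_unique less_top[symmetric])
  qed
  show "(\<integral>x. w x * (Y x)\<^sup>2 * cos (\<zeta> * Y x) \<partial>N) = s * Re (deriv (deriv H) (of_real \<zeta>))" if \<zeta>: "\<bar>\<zeta>\<bar> < R"
  proof -
    obtain h where h: "h \<longlonglongrightarrow> 0" "\<And>n. h n \<noteq> 0"
      "(\<lambda>n. \<integral>x. w x * cos (\<zeta> * Y x) * (2 * (1 - cos (h n * Y x)) / (h n)\<^sup>2) \<partial>N) \<longlonglongrightarrow> s * Re (deriv (deriv H) (of_real \<zeta>))"
      using seq[OF \<zeta>] by auto
    have "(\<lambda>n. \<integral>x. w x * cos (\<zeta> * Y x) * (2 * (1 - cos (h n * Y x)) / (h n)\<^sup>2) \<partial>N)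
        \<longlonglongrightarrow> (\<integral>x. w x * cos (\<zeta> * Y x) * (Y x)\<^sup>2 \<partial>N)"
    proof (rule integral_dominated_convergence[where w = "\<lambda>x. w x * (Y x)\<^sup>2"])
      show "AE x in N. (\<lambda>n. w x * cos (\<zeta> * Y x) * (2 * (1 - cos (h n * Y x)) / (h n)\<^sup>2))
          \<longlonglongrightarrow> w x * cos (\<zeta> * Y x) * (Y x)\<^sup>2"
        by (intro AE_I2 tendsto_mult_left tendsto_second_difference_cos h)
      fix n
      show "AE x in N. norm (w x * cos (\<zeta> * Y x) * (2 * (1 - cos (h n * Y x)) / (h n)\<^sup>2)) \<le> w x * (Y x)\<^sup>2"
      proof (intro AE_I2)
        fix x
        have "2 * (1 - cos (h n * Y x)) / (h n)\<^sup>2 \<le> (Y x)\<^sup>2"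
          using one_minus_cos_le[of "h n * Y x"] h(2)[of n] by (simp add: divide_le_eq power_mult_distrib mult.commute)
        then have "\<bar>2 * (1 - cos (h n * Y x)) / (h n)\<^sup>2\<bar> \<le> (Y x)\<^sup>2" by simp
        then have "\<bar>w x\<bar> * \<bar>cos (\<zeta> * Y x)\<bar> * \<bar>2 * (1 - cos (h n * Y x)) / (h n)\<^sup>2\<bar> \<le> w x * 1 * (Y x)\<^sup>2"
          using w[of x] by (intro mult_mono) auto
        then show "norm (w x * cos (\<zeta> * Y x) * (2 * (1 - cos (h n * Y x)) / (h n)\<^sup>2)) \<le> w x * (Y x)\<^sup>2"
          by (simp only: real_norm_def abs_mult mult_1_right)
      qed
    qed (use int2 in measurable)
    then show ?thesis using h(3) LIMSEQ_unique by (fastforce simp: ac_simps)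
  qed
qed

text \<open>Differentiating a cosine transform twice multiplies the integrand by
  \<open>- Y^2\<close>. Each induction step gains integrability of the next even moment, which then
  serves as the weight of the following step. The start uses \<open>1 - cos\<close>, which can be
  integrable for infinite \<open>N\<close>.\<close>

lemma even_moments_of_holomorphic:
  fixes Y :: "'a \<Rightarrow> real"
  assumes [measurable]: "Y \<in> borel_measurable N"
    and hol: "G holomorphic_on ball 0 R" and "R > 0"
    and int: "\<And>\<zeta>. \<bar>\<zeta>\<bar> < R \<Longrightarrow> integrable N (\<lambda>x. 1 - cos (\<zeta> * Y x))"
    and eq: "\<And>\<zeta>. \<bar>\<zeta>\<bar> < R \<Longrightarrow> (\<integral>x. 1 - cos (\<zeta> * Y x) \<partial>N) = Re (G (of_real \<zeta>))"
  shows "integrable N (\<lambda>x. Y x ^ (2 * k + 2)) \<and>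
    (\<forall>\<zeta>. \<bar>\<zeta>\<bar> < R \<longrightarrow> (\<integral>x. Y x ^ (2 * k + 2) * cos (\<zeta> * Y x) \<partial>N)
      = (-1) ^ k * Re ((deriv ^^ (2 * k + 2)) G (of_real \<zeta>)))"
proof (induction k)
  case 0
  have d: "(1 - cos ((\<zeta> + h) * Y x)) + (1 - cos ((\<zeta> - h) * Y x)) - 2 * (1 - cos (\<zeta> * Y x))
      = 1 * (1 * cos (\<zeta> * Y x) * (2 * (1 - cos (h * Y x))))" for \<zeta> h x
    by (simp add: distrib_right left_diff_distrib cos_add cos_diff algebra_simps)
  have "integrable N (\<lambda>x. 1 * (Y x)\<^sup>2)"
    by (rule cosine_transform_deriv2(1)[OF _ _ _ _ hol \<open>R > 0\<close> int eq d]) auto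
  moreover have "\<forall>\<zeta>. \<bar>\<zeta>\<bar> < R \<longrightarrow> (\<integral>x. 1 * (Y x)\<^sup>2 * cos (\<zeta> * Y x) \<partial>N) = 1 * Re (deriv (deriv G) (of_real \<zeta>))"
    by (intro allI impI cosine_transform_deriv2(2)[OF _ _ _ _ hol \<open>R > 0\<close> int eq d]) auto
  ultimately show ?case by (simp add: numeral_2_eq_2 del: power_Suc)
next
  case (Suc k)
  \<comment> \<open>The sign is built into \<open>?H\<close>, so that the transform of the weighted
    cosine is \<open>Re ?H\<close> itself and the case \<open>s = -1\<close> applies.\<close>
  let ?w = "\<lambda>x. Y x ^ (2 * k + 2)" and ?H = "\<lambda>z. (-1) ^ k * (deriv ^^ (2 * k + 2)) G z"
  have d: "?w x * cos ((\<zeta> + h) * Y x) + ?w x * cos ((\<zeta> - h) * Y x) - 2 * (?w x * cos (\<zeta> * Y x))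
      = (-1) * (?w x * cos (\<zeta> * Y x) * (2 * (1 - cos (h * Y x))))" for \<zeta> h x
    by (simp add: distrib_right left_diff_distrib cos_add cos_diff algebra_simps)
  have hD: "(deriv ^^ n) G holomorphic_on ball 0 R" for n
    using hol by (intro holomorphic_higher_deriv) auto
  have hol': "?H holomorphic_on ball 0 R"
    by (intro holomorphic_intros hD)
  have int': "integrable N (\<lambda>x. ?w x * cos (\<zeta> * Y x))" for \<zeta>
    using conjunct1[OF Suc]
    by (rule Bochner_Integration.integrable_bound) (auto simp: abs_mult intro!: AE_I2 mult_left_le)
  have eq': "(\<integral>x. ?w x * cos (\<zeta> * Y x) \<partial>N) = Re (?H (of_real \<zeta>))" if "\<bar>\<zeta>\<bar> < R" for \<zeta>
  proof -
    have "Re ((-1) ^ k * z) = (-1) ^ k * Re z" for z :: complex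
      by (cases "even k") auto
    then show ?thesis using conjunct2[OF Suc] that by simp
  qed
  have w: "?w x \<ge> 0" for x by (rule zero_le_even_power) simp
  have "integrable N (\<lambda>x. ?w x * (Y x)\<^sup>2)"
    by (rule cosine_transform_deriv2(1)[OF _ _ w _ hol' \<open>R > 0\<close> int' eq' d]) auto
  moreover have "(\<integral>x. ?w x * (Y x)\<^sup>2 * cos (\<zeta> * Y x) \<partial>N) = (-1) ^ Suc k * Re ((deriv ^^ (2 * Suc k + 2)) G (of_real \<zeta>))"
    if \<zeta>: "\<bar>\<zeta>\<bar> < R" for \<zeta>
  proof -
    have "(\<integral>x. ?w x * (Y x)\<^sup>2 * cos (\<zeta> * Y x) \<partial>N) = (-1) * Re (deriv (deriv ?H) (of_real \<zeta>))"
      by (rule cosine_transform_deriv2(2)[OF _ _ w _ hol' \<open>R > 0\<close> int' eq' d]) (use \<zeta> in auto)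
    also have "deriv (deriv ?H) (of_real \<zeta>) = (-1) ^ k * (deriv ^^ (2 * Suc k + 2)) G (of_real \<zeta>)"
    proof -
      have fd: "(deriv ^^ n) G field_differentiable at z" if "z \<in> ball 0 R" for n z
        using hD[of n] that by (meson holomorphic_on_imp_differentiable_at open_ball)
      have "deriv ?H z = (-1) ^ k * (deriv ^^ Suc (2 * k + 2)) G z" if "z \<in> ball 0 R" for z
        using deriv_cmult[OF fd[OF that, of "2 * k + 2"], of "(-1) ^ k"] by (simp only: funpow.simps o_apply)
      then have "deriv (deriv ?H) (of_real \<zeta>) = deriv (\<lambda>z. (-1) ^ k * (deriv ^^ Suc (2 * k + 2)) G z) (of_real \<zeta>)"
      proof (intro complex_derivative_transform_within_open[where s = "ball 0 R"])
        show "deriv ?H holomorphic_on ball 0 R" by (intro holomorphic_deriv hol') auto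
        show "(\<lambda>z. (-1) ^ k * (deriv ^^ Suc (2 * k + 2)) G z) holomorphic_on ball 0 R"
          by (intro holomorphic_intros hD)
      qed (use \<zeta> in auto)
      also have "\<dots> = (-1) ^ k * (deriv ^^ Suc (Suc (2 * k + 2))) G (of_real \<zeta>)"
        using deriv_cmult[OF fd[of "of_real \<zeta>" "Suc (2 * k + 2)"], of "(-1) ^ k"] \<zeta>
        by (simp only: funpow.simps o_apply) simp
      finally show ?thesis by (simp add: eval_nat_numeral)
    qed
    also have "(-1) * Re ((-1) ^ k * z) = (-1) ^ Suc k * Re z" for z :: complex
      by (cases "even k") auto
    finally show ?thesis .
  qed
  ultimately show ?case by (simp add: power_add[symmetric] algebra_simps power2_eq_square)
qed

section \<open>Series of cosh and cos without constant term, and cosh moments\<close>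

lemma cosh_even_sums:
  "(\<lambda>k. x ^ (2 * k + 2) / fact (2 * k + 2)) sums (cosh x - 1 :: real)"
proof -
  have "(\<lambda>n. if even n then x ^ n / fact n else 0) sums cosh x"
    using cosh_converges[of x] by (simp add: divide_inverse mult.commute cong: if_cong)
  then have "(\<lambda>k. if even (2 * k) then x ^ (2 * k) / fact (2 * k) else 0) sums cosh x"
    by (subst sums_mono_reindex[where g = "\<lambda>k. 2 * k"]) (auto simp: strict_mono_def elim: evenE)
  then have "(\<lambda>k. x ^ (2 * k) / fact (2 * k)) sums cosh x" by simp
  then have "(\<lambda>k. x ^ (2 * Suc k) / fact (2 * Suc k)) sums (cosh x - 1)"
    by (subst sums_Suc_iff) simp
  then show ?thesis by simp
qed

lemma cosh_partial_sum_le: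
  assumes "finite I"
  shows "(\<Sum>k\<in>I. x ^ (2 * k + 2) / fact (2 * k + 2)) \<le> (cosh x - 1 :: real)"
proof -
  have "x ^ (2 * k + 2) / fact (2 * k + 2) \<ge> 0" for k
    by (intro divide_nonneg_nonneg zero_le_even_power) auto
  then show ?thesis
    unfolding sums_unique[OF cosh_even_sums]
    by (intro sum_le_suminf assms sums_summable[OF cosh_even_sums])
qed

lemma cos_even_sums:
  "(\<lambda>k. (-1) ^ (k + 1) * x ^ (2 * k + 2) / fact (2 * k + 2)) sums (cos x - 1 :: real)"
proof -
  have "(\<lambda>k. (-1) ^ Suc k / fact (2 * Suc k) * x ^ (2 * Suc k)) sums (cos x - 1)"
    using cos_paired[of x] by (subst sums_Suc_iff) simp
  then show ?thesis by simp
qed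

text \<open>The series of cosh - 1 has nonnegative terms and may be integrated termwise. The even
  moments are, up to sign, real parts of derivatives of \<open>G\<close> at 0, and their sum is the
  even part of the Taylor series at an imaginary point. Real parts of the coefficients suffice
  because even powers of an imaginary number are real.\<close>

lemma cosh_moment_of_holomorphic:
  fixes Y :: "'a \<Rightarrow> real"
  assumes [measurable]: "Y \<in> borel_measurable N"
    and hol: "G holomorphic_on ball 0 R" and \<theta>: "0 < \<theta>" "\<theta> < R"
    and int: "\<And>\<zeta>. \<bar>\<zeta>\<bar> < R \<Longrightarrow> integrable N (\<lambda>x. 1 - cos (\<zeta> * Y x))"
    and eq: "\<And>\<zeta>. \<bar>\<zeta>\<bar> < R \<Longrightarrow> (\<integral>x. 1 - cos (\<zeta> * Y x) \<partial>N) = Re (G (of_real \<zeta>))"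
  shows "(\<integral>\<^sup>+x. ennreal (cosh (\<theta> * Y x) - 1) \<partial>N)
    = ennreal (- Re (G (\<i> * of_real \<theta>) + G (- (\<i> * of_real \<theta>))) / 2)"
proof -
  have "R > 0" using \<theta> by simp
  have m_int: "integrable N (\<lambda>x. Y x ^ (2 * k + 2))" for k
    using even_moments_of_holomorphic[OF _ hol \<open>R > 0\<close> int eq, of k] by simp
  define m where "m k = (\<integral>x. Y x ^ (2 * k + 2) \<partial>N)" for k
  have m: "m k = (-1) ^ k * Re ((deriv ^^ (2 * k + 2)) G 0)" for k
    using even_moments_of_holomorphic[OF _ hol \<open>R > 0\<close> int eq, of k] \<open>R > 0\<close>
    unfolding m_def by (auto dest: spec[of _ 0])
  let ?a = "\<lambda>n. (deriv ^^ n) G 0 / fact n" and ?w = "\<i> * complex_of_real \<theta>"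
  have s1: "(\<lambda>n. ?a n * ?w ^ n) sums G ?w"
    using holomorphic_power_series[OF hol, of ?w] \<theta> by (simp add: norm_mult)
  have s2: "(\<lambda>n. ?a n * (- ?w) ^ n) sums G (- ?w)"
    using holomorphic_power_series[OF hol, of "- ?w"] \<theta> by (simp add: norm_mult)
  have odd: "odd n" if "n \<notin> range (\<lambda>k. 2 * k)" for n :: nat
    using that by (auto elim: evenE)
  \<comment> \<open>Averaging over \<open>?w\<close> and \<open>- ?w\<close> removes the odd
    coefficients, about which the moments say nothing. The constant term drops out afterwards
    because \<open>eq\<close> at 0 gives \<open>Re (G 0) = 0\<close>.\<close>
  have "(\<lambda>n. - Re (?a n * ?w ^ n + ?a n * (- ?w) ^ n) / 2) sums (- Re (G ?w + G (- ?w)) / 2)"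
    by (intro sums_minus sums_divide sums_Re sums_add s1 s2)
  then have "(\<lambda>k. - Re (?a (2 * k) * ?w ^ (2 * k) + ?a (2 * k) * (- ?w) ^ (2 * k)) / 2)
      sums (- Re (G ?w + G (- ?w)) / 2)"
    by (subst sums_mono_reindex[where g = "\<lambda>k. 2 * k"]) (auto simp: strict_mono_def dest!: odd)
  then have "(\<lambda>k. - Re (?a (2 * Suc k) * ?w ^ (2 * Suc k) + ?a (2 * Suc k) * (- ?w) ^ (2 * Suc k)) / 2)
      sums (- Re (G ?w + G (- ?w)) / 2)"
    using eq[of 0] \<open>R > 0\<close> by (subst sums_Suc_iff) simp
  moreover have "- Re (?a (2 * Suc k) * ?w ^ (2 * Suc k) + ?a (2 * Suc k) * (- ?w) ^ (2 * Suc k)) / 2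
      = \<theta> ^ (2 * k + 2) / fact (2 * k + 2) * m k" for k
  proof -
    have e: "?w ^ (2 * Suc k) = of_real ((-1) ^ Suc k * \<theta> ^ (2 * k + 2))"
    proof -
      have "?w ^ (2 * Suc k) = (?w\<^sup>2) ^ Suc k" by (rule power_mult)
      also have "?w\<^sup>2 = of_real (- (\<theta>\<^sup>2))" by (simp add: power_mult_distrib)
      also have "\<dots> ^ Suc k = of_real ((- (\<theta>\<^sup>2)) ^ Suc k)" by (rule of_real_power[symmetric])
      also have "(- (\<theta>\<^sup>2)) ^ Suc k = (-1) ^ Suc k * \<theta> ^ (2 * Suc k)"
        by (subst power_minus) (simp only: power_mult)
      finally show ?thesis by simp
    qed
    have "(- ?w) ^ (2 * Suc k) = ?w ^ (2 * Suc k)" by (rule power_minus_even) simp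
    moreover have "- Re (A * W + A * W) / 2 = - Re (A * W)" for A W :: complex by simp
    ultimately have "- Re (?a (2 * Suc k) * ?w ^ (2 * Suc k) + ?a (2 * Suc k) * (- ?w) ^ (2 * Suc k)) / 2
      = - Re (?a (2 * Suc k) * of_real ((-1) ^ Suc k * \<theta> ^ (2 * k + 2)))" by (simp only: e)
    also have "\<dots> = - (Re (?a (2 * Suc k)) * ((-1) ^ Suc k * \<theta> ^ (2 * k + 2)))"
      by (simp only: Re_complex_of_real times_complex.sel Im_complex_of_real)
    also have "Re (?a (2 * Suc k)) = Re ((deriv ^^ (2 * k + 2)) G 0) / fact (2 * k + 2)"
    proof -
      have "Re (z / fact n) = Re z / fact n" for z :: complex and n :: nat
        by (metis Re_divide_of_real of_real_fact)
      moreover have "2 * Suc k = 2 * k + 2" by simp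
      ultimately show ?thesis by (simp only:)
    qed
    moreover have "- (D / f * (((-1) * s) * T)) = T / f * (s * D)" for D f s T :: real by simp
    ultimately show ?thesis unfolding m power_Suc[of "-1 :: real" k] by (simp only:)
  qed
  ultimately have S: "(\<lambda>k. \<theta> ^ (2 * k + 2) / fact (2 * k + 2) * m k) sums (- Re (G ?w + G (- ?w)) / 2)"
    by simp
  have "(\<integral>\<^sup>+x. ennreal (cosh (\<theta> * Y x) - 1) \<partial>N)
      = (\<integral>\<^sup>+x. (\<Sum>k. ennreal ((\<theta> * Y x) ^ (2 * k + 2) / fact (2 * k + 2))) \<partial>N)"
  proof (intro nn_integral_cong)
    fix x
    show "ennreal (cosh (\<theta> * Y x) - 1) = (\<Sum>k. ennreal ((\<theta> * Y x) ^ (2 * k + 2) / fact (2 * k + 2)))"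
      unfolding sums_unique[OF cosh_even_sums]
      by (intro suminf_ennreal2[symmetric] sums_summable[OF cosh_even_sums] divide_nonneg_nonneg zero_le_even_power) auto
  qed
  also have "\<dots> = (\<Sum>k. \<integral>\<^sup>+x. ennreal ((\<theta> * Y x) ^ (2 * k + 2) / fact (2 * k + 2)) \<partial>N)"
    by (intro nn_integral_suminf) measurable
  also have "\<dots> = (\<Sum>k. ennreal (\<theta> ^ (2 * k + 2) / fact (2 * k + 2) * m k))"
  proof (intro suminf_cong)
    fix k
    have "(\<integral>\<^sup>+x. ennreal ((\<theta> * Y x) ^ (2 * k + 2) / fact (2 * k + 2)) \<partial>N)
      = ennreal (\<integral>x. \<theta> ^ (2 * k + 2) / fact (2 * k + 2) * Y x ^ (2 * k + 2) \<partial>N)"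
    proof -
      have e: "(\<theta> * y) ^ (2 * k + 2) / fact (2 * k + 2) = \<theta> ^ (2 * k + 2) / fact (2 * k + 2) * y ^ (2 * k + 2)" for y :: real
        by (simp only: power_mult_distrib times_divide_eq_left)
      show ?thesis unfolding e
        by (intro nn_integral_eq_integral integrable_mult_right m_int AE_I2 mult_nonneg_nonneg
            divide_nonneg_nonneg zero_le_even_power) auto
    qed
    then show "(\<integral>\<^sup>+x. ennreal ((\<theta> * Y x) ^ (2 * k + 2) / fact (2 * k + 2)) \<partial>N)
      = ennreal (\<theta> ^ (2 * k + 2) / fact (2 * k + 2) * m k)" by (simp add: m_def)
  qed
  also have "\<dots> = ennreal (- Re (G ?w + G (- ?w)) / 2)"
    unfolding sums_unique[OF S]
  proof (intro suminf_ennreal2 sums_summable[OF S] mult_nonneg_nonneg)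
    show "m k \<ge> 0" for k
      unfolding m_def by (intro Bochner_Integration.integral_nonneg zero_le_even_power) auto
  qed (use \<theta> in auto)
  finally show ?thesis by simp
qed

text \<open>Converse passage: a finite cosh moment bounds all even moments, so the power series
  \<open>A\<close> built from them converges on the disc of radius \<open>R^2\<close>. The cosine
  and the cosh transform are values of this one series, and \<open>H z = - A (- z^2)\<close>
  continues the former to the imaginary axis.\<close>

lemma holomorphic_of_cosh_moment:
  fixes Y :: "'a \<Rightarrow> real"
  assumes [measurable]: "Y \<in> borel_measurable N" and R: "R > 0"
    and fin: "(\<integral>\<^sup>+x. ennreal (cosh (R * Y x) - 1) \<partial>N) < \<infinity>"
  obtains H where "H holomorphic_on ball 0 R"
    "\<And>\<zeta>. \<bar>\<zeta>\<bar> < R \<Longrightarrow> integrable N (\<lambda>x. 1 - cos (\<zeta> * Y x))"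
    "\<And>\<zeta>. \<bar>\<zeta>\<bar> < R \<Longrightarrow> H (of_real \<zeta>) = of_real (\<integral>x. 1 - cos (\<zeta> * Y x) \<partial>N)"
    "\<And>\<theta>. \<bar>\<theta>\<bar> < R \<Longrightarrow> integrable N (\<lambda>x. cosh (\<theta> * Y x) - 1)"
    "\<And>\<theta>. \<bar>\<theta>\<bar> < R \<Longrightarrow> H (\<i> * of_real \<theta>) = - of_real (\<integral>x. cosh (\<theta> * Y x) - 1 \<partial>N)"
proof -
  have cosh_int: "integrable N (\<lambda>x. cosh (R * Y x) - 1)"
    using fin by (intro integrableI_nonneg) (auto simp: cosh_real_ge_1)
  have term_le: "(R * y) ^ (2 * k + 2) / fact (2 * k + 2) \<le> cosh (R * y) - 1" for k and y :: real
    using cosh_partial_sum_le[of "{k}" "R * y"] by (simp only: sum.insert_if finite.intros sum.empty) simp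
  have mom_int: "integrable N (\<lambda>x. Y x ^ (2 * k + 2))" for k
  proof -
    have "integrable N (\<lambda>x. (R * Y x) ^ (2 * k + 2) / fact (2 * k + 2))"
    proof (rule Bochner_Integration.integrable_bound[OF cosh_int])
      show "AE x in N. norm ((R * Y x) ^ (2 * k + 2) / fact (2 * k + 2)) \<le> norm (cosh (R * Y x) - 1)"
      proof (intro AE_I2)
        fix x
        have "(R * Y x) ^ (2 * k + 2) / fact (2 * k + 2) \<ge> 0"
          by (intro divide_nonneg_nonneg zero_le_even_power) auto
        then show "norm ((R * Y x) ^ (2 * k + 2) / fact (2 * k + 2)) \<le> norm (cosh (R * Y x) - 1)"
          using term_le[of "Y x" k] by (simp only: real_norm_def)
      qed
    qed measurable
    then have "integrable N (\<lambda>x. fact (2 * k + 2) / R ^ (2 * k + 2) * ((R * Y x) ^ (2 * k + 2) / fact (2 * k + 2)))"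
      by (rule integrable_mult_right)
    moreover have "fact (2 * k + 2) / R ^ (2 * k + 2) * ((R * y) ^ (2 * k + 2) / fact (2 * k + 2)) = y ^ (2 * k + 2)" for y :: real
      using R by (simp add: power_mult_distrib del: fact_Suc power_Suc power_add)
    ultimately show ?thesis by simp
  qed
  define m where "m k = (\<integral>x. Y x ^ (2 * k + 2) \<partial>N) / fact (2 * k + 2)" for k
  text \<open>\<open>A v\<close> is the transform with \<open>v\<close> in place of the square of the argument, so that \<open>cos\<close> and
    \<open>cosh\<close> correspond to \<open>v = - \<zeta>\<^sup>2\<close> and \<open>v = \<theta>\<^sup>2\<close>.\<close>
  have series: "(\<lambda>k. m k * v ^ (k + 1)) sums (\<integral>x. (\<Sum>k. v ^ (k + 1) * Y x ^ (2 * k + 2) / fact (2 * k + 2)) \<partial>N)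
      \<and> integrable N (\<lambda>x. \<Sum>k. v ^ (k + 1) * Y x ^ (2 * k + 2) / fact (2 * k + 2))"
    if v: "\<bar>v\<bar> \<le> R\<^sup>2" for v
  proof -
    let ?f = "\<lambda>k x. v ^ (k + 1) * Y x ^ (2 * k + 2) / fact (2 * k + 2)"
    have fi: "integrable N (?f k)" for k using mom_int[of k] by auto
    have le: "norm (?f k x) \<le> (R * Y x) ^ (2 * k + 2) / fact (2 * k + 2)" for k x
    proof -
      have "\<bar>v\<bar> ^ (k + 1) \<le> (R\<^sup>2) ^ (k + 1)" using v by (intro power_mono) auto
      also have "\<dots> = R ^ (2 * k + 2)" by (simp only: power_mult[symmetric]) simp
      finally have "\<bar>v\<bar> ^ (k + 1) * \<bar>Y x ^ (2 * k + 2)\<bar> \<le> R ^ (2 * k + 2) * Y x ^ (2 * k + 2)"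
        using mult_right_mono[OF _ zero_le_even_power[of "2 * k + 2" "Y x"]]
          abs_of_nonneg[OF zero_le_even_power[of "2 * k + 2" "Y x"]] by simp
      then have "\<bar>v\<bar> ^ (k + 1) * \<bar>Y x ^ (2 * k + 2)\<bar> / fact (2 * k + 2) \<le> R ^ (2 * k + 2) * Y x ^ (2 * k + 2) / fact (2 * k + 2)"
        by (rule divide_right_mono) simp
      then show ?thesis by (simp only: real_norm_def abs_divide abs_mult power_abs power_mult_distrib abs_of_nonneg[OF fact_ge_zero])
    qed
    have sm: "summable (\<lambda>k. norm (?f k x))" for x
      by (rule summable_comparison_test'[OF sums_summable[OF cosh_even_sums[of "R * Y x"]], of 0])
        (use le in auto)
    \<comment> \<open>The norms sum pointwise to at most \<open>cosh (R * Y x) - 1\<close>, whose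
      integral bounds every partial sum.\<close>
    have si: "summable (\<lambda>k. \<integral>x. norm (?f k x) \<partial>N)"
    proof (rule summableI_nonneg_bounded)
      fix n
      have "(\<Sum>k<n. \<integral>x. norm (?f k x) \<partial>N) = (\<integral>x. (\<Sum>k<n. norm (?f k x)) \<partial>N)"
        by (rule Bochner_Integration.integral_sum[symmetric]) (rule integrable_norm[OF fi])
      also have "\<dots> \<le> (\<integral>x. cosh (R * Y x) - 1 \<partial>N)"
      proof (rule integral_mono)
        fix x
        have "(\<Sum>k<n. norm (?f k x)) \<le> (\<Sum>k<n. (R * Y x) ^ (2 * k + 2) / fact (2 * k + 2))"
          by (intro sum_mono le)
        also have "\<dots> \<le> cosh (R * Y x) - 1"
          by (rule cosh_partial_sum_le) simp
        finally show "(\<Sum>k<n. norm (?f k x)) \<le> cosh (R * Y x) - 1" .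
      qed (rule cosh_int | intro Bochner_Integration.integrable_sum integrable_norm fi)+
      finally show "(\<Sum>k<n. \<integral>x. norm (?f k x) \<partial>N) \<le> (\<integral>x. cosh (R * Y x) - 1 \<partial>N)" .
    qed auto
    have "(\<integral>x. ?f k x \<partial>N) = m k * v ^ (k + 1)" for k by (simp add: m_def)
    then show ?thesis
      using sums_integral[OF fi AE_I2[OF sm] si] integrable_suminf[OF fi AE_I2[OF sm] si] by simp
  qed
  define A where "A w = (\<Sum>k. of_real (m k) * w ^ (k + 1))" for w :: complex
  have m_nonneg: "m k \<ge> 0" for k unfolding m_def by (intro divide_nonneg_nonneg Bochner_Integration.integral_nonneg zero_le_even_power) auto
  have A_sums: "(\<lambda>k. of_real (m k) * w ^ (k + 1)) sums A w" if "norm w \<le> R\<^sup>2" for w :: complex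
  proof -
    have "summable (\<lambda>k. norm (of_real (m k) * w ^ (k + 1)))"
    proof (rule summable_comparison_test'[of _ 0])
      show "summable (\<lambda>k. m k * (R\<^sup>2) ^ (k + 1))" using series[of "R\<^sup>2"] by (auto simp: sums_iff)
      show "norm (norm (of_real (m k) * w ^ (k + 1))) \<le> m k * (R\<^sup>2) ^ (k + 1)" for k
        unfolding norm_mult norm_power real_norm_def abs_mult norm_of_real abs_abs power_abs abs_norm_cancel
        using m_nonneg that by (intro mult_mono power_mono) auto
    qed
    then show ?thesis unfolding A_def by (intro summable_sums) (rule summable_norm_cancel)
  qed
  have A_hol: "A holomorphic_on ball 0 (R\<^sup>2)"
  proof (rule power_series_holomorphic)
    fix w :: complex assume "w \<in> ball 0 (R\<^sup>2)"
    then have "(\<lambda>k. of_real (m k) * w ^ Suc k) sums A w" using A_sums[of w] by simp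
    \<comment> \<open>The series of \<open>A\<close> starts in degree 1; its coefficient sequence is
      padded by 0 in front.\<close>
    then have "(\<lambda>n. (case n of 0 \<Rightarrow> 0 | Suc k \<Rightarrow> of_real (m k)) * w ^ n) sums A w"
      by (subst sums_Suc_iff[symmetric, where f = "\<lambda>n. (case n of 0 \<Rightarrow> 0 | Suc k \<Rightarrow> of_real (m k)) * w ^ n", simplified]) simp
    then show "(\<lambda>n. (case n of 0 \<Rightarrow> 0 | Suc k \<Rightarrow> of_real (m k)) * (w - 0) ^ n) sums A w" by simp
  qed
  have A_real: "A (of_real v) = of_real (\<integral>x. (\<Sum>k. v ^ (k + 1) * Y x ^ (2 * k + 2) / fact (2 * k + 2)) \<partial>N)"
    if "\<bar>v\<bar> \<le> R\<^sup>2" for v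
  proof -
    have "(\<lambda>k. complex_of_real (m k * v ^ (k + 1))) sums
       of_real (\<integral>x. (\<Sum>k. v ^ (k + 1) * Y x ^ (2 * k + 2) / fact (2 * k + 2)) \<partial>N)"
      using series[OF that] by (subst sums_of_real_iff) simp
    then show ?thesis using A_sums[of "of_real v"] that by (auto dest: sums_unique2)
  qed
  have sq: "\<bar>\<zeta>\<^sup>2\<bar> \<le> R\<^sup>2" if "\<bar>\<zeta>\<bar> < R" for \<zeta> :: real
    using that R by (simp add: abs_le_square_iff[symmetric])
  have pw: "((- (\<zeta>\<^sup>2)) ^ (k + 1) * y ^ (2 * k + 2)) = (-1) ^ (k + 1) * (\<zeta> * y) ^ (2 * k + 2)"
    "((\<zeta>\<^sup>2) ^ (k + 1) * y ^ (2 * k + 2)) = (\<zeta> * y) ^ (2 * k + 2)" for \<zeta> y :: real and k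
  proof -
    have "(\<zeta>\<^sup>2) ^ (k + 1) = \<zeta> ^ (2 * k + 2)" by (simp only: power_mult[symmetric]) simp
    then show "((\<zeta>\<^sup>2) ^ (k + 1) * y ^ (2 * k + 2)) = (\<zeta> * y) ^ (2 * k + 2)"
      "((- (\<zeta>\<^sup>2)) ^ (k + 1) * y ^ (2 * k + 2)) = (-1) ^ (k + 1) * (\<zeta> * y) ^ (2 * k + 2)"
      by (simp_all only: power_mult_distrib power_minus[of "\<zeta>\<^sup>2"] mult.assoc)
  qed
  have cos_eq: "(\<Sum>k. (- (\<zeta>\<^sup>2)) ^ (k + 1) * y ^ (2 * k + 2) / fact (2 * k + 2)) = cos (\<zeta> * y) - 1" for \<zeta> y :: real
    unfolding pw using cos_even_sums[of "\<zeta> * y"] by (simp only: sums_iff)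
  have cosh_eq: "(\<Sum>k. (\<zeta>\<^sup>2) ^ (k + 1) * y ^ (2 * k + 2) / fact (2 * k + 2)) = cosh (\<zeta> * y) - 1" for \<zeta> y :: real
    unfolding pw using cosh_even_sums[of "\<zeta> * y"] by (simp only: sums_iff)
  define H where "H z = - A (- (z\<^sup>2))" for z
  show ?thesis
  proof (rule that[of H])
    have "(\<lambda>z. - (z\<^sup>2)) ` ball 0 R \<subseteq> ball (0::complex) (R\<^sup>2)"
      using R by (auto simp: norm_power intro!: power_strict_mono)
    then show "H holomorphic_on ball 0 R"
      unfolding H_def by (intro holomorphic_on_minus holomorphic_on_compose_gen[OF _ A_hol, unfolded o_def] holomorphic_intros)
    fix \<zeta> :: real assume \<zeta>: "\<bar>\<zeta>\<bar> < R"
    have "integrable N (\<lambda>x. cos (\<zeta> * Y x) - 1)"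
      using series[of "- (\<zeta>\<^sup>2)"] sq[OF \<zeta>] by (simp only: cos_eq)
    then have "integrable N (\<lambda>x. - (cos (\<zeta> * Y x) - 1))" by (rule integrable_minus)
    then show "integrable N (\<lambda>x. 1 - cos (\<zeta> * Y x))" by simp
    have e1: "A (of_real (- (\<zeta>\<^sup>2))) = of_real (\<integral>x. cos (\<zeta> * Y x) - 1 \<partial>N)"
      using A_real[of "- (\<zeta>\<^sup>2)"] sq[OF \<zeta>] by (simp only: cos_eq)
    have e2: "(\<integral>x. 1 - cos (\<zeta> * Y x) \<partial>N) = - (\<integral>x. cos (\<zeta> * Y x) - 1 \<partial>N)"
      by (subst Bochner_Integration.integral_minus[symmetric]) simp
    show "H (of_real \<zeta>) = of_real (\<integral>x. 1 - cos (\<zeta> * Y x) \<partial>N)"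
      unfolding H_def e2 using e1 by simp
    show "integrable N (\<lambda>x. cosh (\<zeta> * Y x) - 1)"
      using series[of "\<zeta>\<^sup>2"] sq[OF \<zeta>] by (simp only: cosh_eq)
    have "A (of_real (\<zeta>\<^sup>2)) = of_real (\<integral>x. cosh (\<zeta> * Y x) - 1 \<partial>N)"
      using A_real[of "\<zeta>\<^sup>2"] sq[OF \<zeta>] by (simp only: cosh_eq)
    then show "H (\<i> * of_real \<zeta>) = - of_real (\<integral>x. cosh (\<zeta> * Y x) - 1 \<partial>N)"
      unfolding H_def by (simp add: power_mult_distrib)
  qed
qed

section \<open>Moduli of Levy-Khintchine characteristic functions\<close>

text \<open>The negative real part of the Levy-Khintchine exponent. For a Levy measure and
  \<open>b \<ge> 0\<close> it is a real continuous negative definite function; its square root is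
  subadditive, which is the source of the inequality for sums below.\<close>

definition lk_decay :: "real \<Rightarrow> real measure \<Rightarrow> real \<Rightarrow> real" where
  "lk_decay b \<mu> u = b * u\<^sup>2 / 2 + (\<integral>x. 1 - cos (u * x) \<partial>\<mu>)"

lemma levy_measure_integrable_min:
  assumes "levy_measure \<mu>"
  shows "integrable \<mu> (\<lambda>x. min 1 (x\<^sup>2))"
proof -
  have [measurable_cong]: "sets \<mu> = sets borel" using assms by (simp add: levy_measure_def)
  show ?thesis using assms by (intro integrableI_nonneg) (auto simp: levy_measure_def)
qed

text \<open>The majorant separates \<open>u\<close> from \<open>x\<close>: one Levy-integrable
  function dominates the integrands for all bounded \<open>u\<close> at once.\<close>

lemma one_minus_cos_le_min: "1 - cos (u * x) \<le> (2 + u\<^sup>2) * min 1 (x\<^sup>2)" for u x :: real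
proof (cases "x\<^sup>2 \<le> 1")
  case True
  have "1 - cos (u * x) \<le> (u * x)\<^sup>2 / 2" by (rule one_minus_cos_le)
  also have "\<dots> \<le> u\<^sup>2 * x\<^sup>2" by (simp add: power_mult_distrib)
  also have "\<dots> \<le> (2 + u\<^sup>2) * x\<^sup>2" by (simp add: distrib_right)
  finally show ?thesis using True by (simp add: min_def)
next
  case False
  have "1 - cos (u * x) \<le> 2" using cos_ge_minus_one[of "u * x"] by linarith
  also have "2 \<le> 2 + u\<^sup>2" by simp
  finally show ?thesis using False by (simp add: min_def)
qed

lemma levy_measure_integrable_cos:
  assumes "levy_measure \<mu>"
  shows "integrable \<mu> (\<lambda>x. 1 - cos (u * x))"
proof -
  have [measurable_cong]: "sets \<mu> = sets borel" using assms by (simp add: levy_measure_def)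
  show ?thesis
    by (rule Bochner_Integration.integrable_bound[OF integrable_mult_right[OF levy_measure_integrable_min[OF assms], of "2 + u\<^sup>2"]])
      (use one_minus_cos_le_min[of u] in \<open>auto intro!: AE_I2\<close>)
qed

lemma lk_decay_ge: "b * u\<^sup>2 / 2 \<le> lk_decay b \<mu> u"
  unfolding lk_decay_def by (simp add: Bochner_Integration.integral_nonneg)

lemma lk_decay_nonneg: "b \<ge> 0 \<Longrightarrow> 0 \<le> lk_decay b \<mu> u"
  using lk_decay_ge[of b u \<mu>] by (meson divide_nonneg_nonneg mult_nonneg_nonneg order_trans zero_le_numeral zero_le_power2)

lemma lk_decay_0 [simp]: "lk_decay b \<mu> 0 = 0"
  by (simp add: lk_decay_def)

text \<open>Young's inequality for the mixed term. The weight \<open>e\<close> stays free because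
  factors arbitrarily close to 1 in front of \<open>a\<close> will be needed.\<close>

lemma square_le_of_abs_le_add:
  fixes a b c e :: real
  assumes "\<bar>c\<bar> \<le> \<bar>a\<bar> + \<bar>b\<bar>" "e > 0"
  shows "c\<^sup>2 \<le> (1 + e) * a\<^sup>2 + (1 + 1 / e) * b\<^sup>2"
proof -
  have "0 \<le> (e * \<bar>a\<bar> - \<bar>b\<bar>)\<^sup>2 / e" using assms(2) by simp
  also have "\<dots> = e * a\<^sup>2 + b\<^sup>2 / e - 2 * \<bar>a\<bar> * \<bar>b\<bar>"
    using assms(2) by (simp add: power2_diff field_simps power2_eq_square)
  finally have "(\<bar>a\<bar> + \<bar>b\<bar>)\<^sup>2 \<le> (1 + e) * a\<^sup>2 + (1 + 1 / e) * b\<^sup>2"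
    by (simp add: power2_sum algebra_simps)
  moreover have "c\<^sup>2 \<le> (\<bar>a\<bar> + \<bar>b\<bar>)\<^sup>2"
    using assms(1) by (metis abs_ge_zero power2_abs power_mono)
  ultimately show ?thesis by linarith
qed

text \<open>\<open>1 - cos x\<close> is twice the square of \<open>sin (x / 2)\<close>, and the
  modulus of the sine is subadditive.\<close>

lemma one_minus_cos_add_le:
  fixes s t e :: real
  assumes "e > 0"
  shows "1 - cos (s + t) \<le> (1 + e) * (1 - cos s) + (1 + 1 / e) * (1 - cos t)"
proof -
  have c: "1 - cos x = 2 * (sin (x / 2))\<^sup>2" for x :: real
    using cos_double_sin[of "x / 2"] by simp
  have "\<bar>sin (s / 2) * cos (t / 2)\<bar> \<le> \<bar>sin (s / 2)\<bar>" "\<bar>cos (s / 2) * sin (t / 2)\<bar> \<le> \<bar>sin (t / 2)\<bar>"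
    by (simp_all add: abs_mult mult_left_le mult_left_le_one_le)
  then have "\<bar>sin ((s + t) / 2)\<bar> \<le> \<bar>sin (s / 2)\<bar> + \<bar>sin (t / 2)\<bar>"
    unfolding add_divide_distrib sin_add by linarith
  from square_le_of_abs_le_add[OF this assms] show ?thesis
    unfolding c by (simp add: algebra_simps)
qed

lemma lk_decay_add_le:
  assumes "levy_measure \<mu>" "b \<ge> 0" "e > 0"
  shows "lk_decay b \<mu> (u + v) \<le> (1 + e) * lk_decay b \<mu> u + (1 + 1 / e) * lk_decay b \<mu> v"
proof -
  note [simp] = levy_measure_integrable_cos[OF assms(1)]
  have "(\<integral>x. 1 - cos ((u + v) * x) \<partial>\<mu>) \<le> (\<integral>x. (1 + e) * (1 - cos (u * x)) + (1 + 1 / e) * (1 - cos (v * x)) \<partial>\<mu>)"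
  proof (rule integral_mono)
    show "1 - cos ((u + v) * x) \<le> (1 + e) * (1 - cos (u * x)) + (1 + 1 / e) * (1 - cos (v * x))" for x
      unfolding distrib_right[of u v x] by (rule one_minus_cos_add_le[OF assms(3)])
  qed (intro Bochner_Integration.integrable_add integrable_mult_right levy_measure_integrable_cos assms)+
  also have "\<dots> = (1 + e) * (\<integral>x. 1 - cos (u * x) \<partial>\<mu>) + (1 + 1 / e) * (\<integral>x. 1 - cos (v * x) \<partial>\<mu>)"
    by simp
  finally have 1: "(\<integral>x. 1 - cos ((u + v) * x) \<partial>\<mu>)
    \<le> (1 + e) * (\<integral>x. 1 - cos (u * x) \<partial>\<mu>) + (1 + 1 / e) * (\<integral>x. 1 - cos (v * x) \<partial>\<mu>)" .
  have "b / 2 * (u + v)\<^sup>2 \<le> b / 2 * ((1 + e) * u\<^sup>2 + (1 + 1 / e) * v\<^sup>2)"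
    using assms by (intro mult_left_mono square_le_of_abs_le_add) auto
  then have "b * (u + v)\<^sup>2 / 2 \<le> (1 + e) * (b * u\<^sup>2 / 2) + (1 + 1 / e) * (b * v\<^sup>2 / 2)"
    by (simp add: algebra_simps add_divide_distrib)
  then show ?thesis using 1 unfolding lk_decay_def distrib_left by linarith
qed

lemma lk_decay_uminus [simp]: "lk_decay b \<mu> (- u) = lk_decay b \<mu> u"
  by (simp add: lk_decay_def)

lemma isCont_lk_decay:
  assumes "levy_measure \<mu>"
  shows "isCont (lk_decay b \<mu>) u"
proof -
  have [measurable_cong]: "sets \<mu> = sets borel" using assms by (simp add: levy_measure_def)
  have "isCont (\<lambda>u. \<integral>x. 1 - cos (u * x) \<partial>\<mu>) u"
    unfolding continuous_at_sequentially
  proof safe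
    fix s assume s: "s \<longlonglongrightarrow> u"
    then have "Bseq s" by (simp add: convergentI convergent_imp_Bseq)
    then obtain K where K: "K > 0" "\<And>n. \<bar>s n\<bar> \<le> K" by (auto simp: Bseq_def)
    show "((\<lambda>u. \<integral>x. 1 - cos (u * x) \<partial>\<mu>) \<circ> s) \<longlonglongrightarrow> (\<integral>x. 1 - cos (u * x) \<partial>\<mu>)"
      unfolding o_def
    proof (rule integral_dominated_convergence[where w = "\<lambda>x. (2 + K\<^sup>2) * min 1 (x\<^sup>2)"])
      show "AE x in \<mu>. norm (1 - cos (s n * x)) \<le> (2 + K\<^sup>2) * min 1 (x\<^sup>2)" for n
      proof (intro AE_I2)
        fix x
        have "(s n)\<^sup>2 \<le> K\<^sup>2" using K(2)[of n] K(1) by (metis abs_ge_zero power2_abs power_mono)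
        then have "(2 + (s n)\<^sup>2) * min 1 (x\<^sup>2) \<le> (2 + K\<^sup>2) * min 1 (x\<^sup>2)"
          by (intro mult_right_mono) auto
        then show "norm (1 - cos (s n * x)) \<le> (2 + K\<^sup>2) * min 1 (x\<^sup>2)"
          using one_minus_cos_le_min[of "s n" x] by simp
      qed
    qed (use s levy_measure_integrable_min[OF assms] in \<open>auto intro!: tendsto_intros\<close>)
  qed
  then have "isCont (\<lambda>u. b * u\<^sup>2 / 2 + (\<integral>x. 1 - cos (u * x) \<partial>\<mu>)) u"
    by (intro continuous_intros) auto
  then show ?thesis by (simp add: lk_decay_def[abs_def])
qed

lemma borel_measurable_lk_decay [measurable (raw)]:
  assumes "levy_measure \<mu>" "f \<in> borel_measurable N"
  shows "(\<lambda>x. lk_decay b \<mu> (f x)) \<in> borel_measurable N"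
  by (rule borel_measurable_continuous_on[OF _ assms(2)])
    (auto intro!: continuous_at_imp_continuous_on isCont_lk_decay assms)

text \<open>The compensated integrand is bounded by a multiple of \<open>min 1 (x^2)\<close>, so the
  real part may be taken under the integral, where the compensator is purely imaginary.\<close>

lemma Re_levy_khintchine:
  assumes "levy_measure \<mu>"
  shows "Re (levy_khintchine a b \<mu> u) = - lk_decay b \<mu> u"
proof -
  have [measurable_cong]: "sets \<mu> = sets borel" using assms by (simp add: levy_measure_def)
  let ?f = "\<lambda>x. iexp (u * x) - 1 - \<i> * of_real (u * x * indicator {-1..1} x)"
  have int: "integrable \<mu> ?f"
  proof (rule Bochner_Integration.integrable_bound[OF integrable_mult_right[OF levy_measure_integrable_min[OF assms], of "2 + u\<^sup>2"]])
    show "AE x in \<mu>. norm (?f x) \<le> norm ((2 + u\<^sup>2) * min 1 (x\<^sup>2))"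
    proof (intro AE_I2)
      fix x
      have "norm (?f x) \<le> (2 + u\<^sup>2) * min 1 (x\<^sup>2)"
      proof (cases "\<bar>x\<bar> \<le> 1")
        case True
        then have x: "x\<^sup>2 \<le> 1" by (simp add: abs_square_le_1)
        have "norm (?f x) \<le> (u * x)\<^sup>2 / 2"
          using iexp_approx1[of "u * x" 1] True by (simp add: abs_le_iff numeral_2_eq_2 algebra_simps indicator_def)
        also have "\<dots> \<le> u\<^sup>2 * x\<^sup>2" by (simp add: power_mult_distrib)
        also have "\<dots> \<le> (2 + u\<^sup>2) * x\<^sup>2" by (simp add: distrib_right)
        finally show ?thesis using x by (simp add: min_def)
      next
        case False
        then have x: "\<not> x\<^sup>2 \<le> 1" by (simp add: abs_square_le_1)
        have "norm (?f x) = norm (iexp (u * x) - 1)" using False by (auto simp: indicator_def)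
        also have "\<dots> \<le> norm (iexp (u * x)) + norm (1::complex)" by (rule norm_triangle_ineq4)
        also have "\<dots> \<le> 2 + u\<^sup>2" by simp
        finally show ?thesis using x by (simp add: min_def)
      qed
      then show "norm (?f x) \<le> norm ((2 + u\<^sup>2) * min 1 (x\<^sup>2))" by simp
    qed
  qed measurable
  have "Re (CLINT x|\<mu>. ?f x) = (\<integral>x. Re (?f x) \<partial>\<mu>)"
    by (rule integral_Re[OF int, symmetric])
  also have "\<dots> = (\<integral>x. - (1 - cos (u * x)) \<partial>\<mu>)"
    by (intro Bochner_Integration.integral_cong) (auto simp: Re_exp)
  also have "\<dots> = - (\<integral>x. 1 - cos (u * x) \<partial>\<mu>)" by (rule Bochner_Integration.integral_minus)
  finally show ?thesis unfolding levy_khintchine_def lk_decay_def by simp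
qed

section \<open>Characteristic functions and convergence in probability\<close>

context prob_space
begin

lemma char_distr:
  assumes "Y \<in> borel_measurable M"
  shows "char (distr M borel Y) t = (\<integral>\<omega>. iexp (t * Y \<omega>) \<partial>M)"
  unfolding char_def using assms by (subst integral_distr) auto

lemma char_distr_cmult:
  assumes [measurable]: "Y \<in> borel_measurable M"
  shows "char (distr M borel (\<lambda>\<omega>. c * Y \<omega>)) t = char (distr M borel Y) (t * c)"
  by (simp add: char_distr mult.assoc)

lemma integrable_iexp_rv:
  assumes [measurable]: "Y \<in> borel_measurable M"
  shows "integrable M (\<lambda>\<omega>. iexp (t * Y \<omega>))"
  by (rule integrable_const_bound[of _ 1]) auto

text \<open>Off the exceptional set the two exponentials differ by at most
  \<open>\<bar>t\<bar> * \<delta>\<close>, on it by at most 2.\<close>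

lemma norm_char_diff_le:
  assumes [measurable]: "U \<in> borel_measurable M" "V \<in> borel_measurable M" and "\<delta> \<ge> 0"
  shows "norm (char (distr M borel U) t - char (distr M borel V) t)
    \<le> \<bar>t\<bar> * \<delta> + 2 * prob {\<omega> \<in> space M. \<bar>U \<omega> - V \<omega>\<bar> > \<delta>}"
proof -
  let ?A = "{\<omega> \<in> space M. \<bar>U \<omega> - V \<omega>\<bar> > \<delta>}"
  have "norm (char (distr M borel U) t - char (distr M borel V) t)
     = norm (\<integral>\<omega>. iexp (t * U \<omega>) - iexp (t * V \<omega>) \<partial>M)"
    unfolding char_distr[OF assms(1)] char_distr[OF assms(2)]
    by (subst Bochner_Integration.integral_diff) (auto intro!: integrable_iexp_rv simp del: of_real_mult)
  also have "\<dots> \<le> (\<integral>\<omega>. norm (iexp (t * U \<omega>) - iexp (t * V \<omega>)) \<partial>M)"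
    by (rule integral_norm_bound)
  also have "\<dots> \<le> (\<integral>\<omega>. \<bar>t\<bar> * \<delta> + 2 * indicator ?A \<omega> \<partial>M)"
  proof (rule integral_mono)
    show "integrable M (\<lambda>\<omega>. norm (iexp (t * U \<omega>) - iexp (t * V \<omega>)))"
      by (intro integrable_norm Bochner_Integration.integrable_diff integrable_iexp_rv) measurable
    show "integrable M (\<lambda>\<omega>. \<bar>t\<bar> * \<delta> + 2 * indicator ?A \<omega>)"
      by (intro Bochner_Integration.integrable_add integrable_mult_right integrable_real_indicator) (auto simp: emeasure_eq_measure)
    fix \<omega> assume \<omega>: "\<omega> \<in> space M"
    show "norm (iexp (t * U \<omega>) - iexp (t * V \<omega>)) \<le> \<bar>t\<bar> * \<delta> + 2 * indicator ?A \<omega>"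
    proof (cases "\<omega> \<in> ?A")
      case True
      have "norm (iexp (t * U \<omega>) - iexp (t * V \<omega>)) \<le> norm (iexp (t * U \<omega>)) + norm (iexp (t * V \<omega>))"
        by (rule norm_triangle_ineq4)
      then show ?thesis using True \<open>\<delta> \<ge> 0\<close> by simp (smt (verit) mult_nonneg_nonneg abs_ge_zero)
    next
      case False
      have "iexp (t * U \<omega>) - iexp (t * V \<omega>) = iexp (t * V \<omega>) * (iexp (t * (U \<omega> - V \<omega>)) - 1)"
        by (simp add: algebra_simps flip: exp_add)
      then have "norm (iexp (t * U \<omega>) - iexp (t * V \<omega>)) = norm (iexp (t * (U \<omega> - V \<omega>)) - 1)"
        by (simp add: norm_mult)
      also have "\<dots> \<le> \<bar>t * (U \<omega> - V \<omega>)\<bar>"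
        using iexp_approx1[of "t * (U \<omega> - V \<omega>)" 0] by simp
      also have "\<dots> \<le> \<bar>t\<bar> * \<delta>" using False \<omega> by (auto simp: abs_mult intro!: mult_left_mono)
      finally show ?thesis using False by simp
    qed
  qed
  also have "\<dots> = \<bar>t\<bar> * \<delta> + 2 * prob ?A"
    by (subst Bochner_Integration.integral_add) (auto simp: prob_space emeasure_eq_measure)
  finally show ?thesis .
qed

lemma converges_in_probability_char:
  assumes [measurable]: "\<And>n. Z n \<in> borel_measurable M" "Y \<in> borel_measurable M"
    and conv: "converges_in_probability M Z Y"
  shows "(\<lambda>n. char (distr M borel (Z n)) t) \<longlonglongrightarrow> char (distr M borel Y) t"
proof (rule LIMSEQ_I)
  fix e :: real assume "e > 0"
  define \<delta> where "\<delta> = e / (2 * (\<bar>t\<bar> + 1))"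
  have \<delta>: "\<delta> > 0" using \<open>e > 0\<close> by (simp add: \<delta>_def add_nonneg_pos)
  have t\<delta>: "\<bar>t\<bar> * \<delta> < e / 2"
    using \<open>e > 0\<close> by (simp add: \<delta>_def field_simps add_nonneg_pos)
  have "(\<lambda>n. prob {\<omega> \<in> space M. \<bar>Z n \<omega> - Y \<omega>\<bar> > \<delta>}) \<longlonglongrightarrow> 0"
    using conv \<delta> by (simp add: converges_in_probability_def)
  then obtain N where N: "\<And>n. n \<ge> N \<Longrightarrow> prob {\<omega> \<in> space M. \<bar>Z n \<omega> - Y \<omega>\<bar> > \<delta>} < e / 4"
    using LIMSEQ_D[of _ 0 "e / 4"] \<open>e > 0\<close> by force
  have "norm (char (distr M borel (Z n)) t - char (distr M borel Y) t) < e" if "n \<ge> N" for n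
    using norm_char_diff_le[of "Z n" Y \<delta> t] N[OF that] t\<delta> \<delta> by simp
  then show "\<exists>no. \<forall>n\<ge>no. norm (char (distr M borel (Z n)) t - char (distr M borel Y) t) < e" by blast
qed

text \<open>Differences of a sequence converging in probability tend to 0 in probability, so their
  characteristic functions approach 1. Through the modulus formula, this becomes an estimate on
  differences of the integrands.\<close>

lemma converges_in_probability_char_Cauchy:
  assumes [measurable]: "\<And>n. Z n \<in> borel_measurable M" "Y \<in> borel_measurable M"
    and conv: "converges_in_probability M Z Y" and "e > 0"
  obtains N where "\<And>n k. n \<ge> N \<Longrightarrow> k \<ge> N \<Longrightarrow>
    norm (char (distr M borel (\<lambda>\<omega>. Z n \<omega> - Z k \<omega>)) t - 1) < e"
proof -
  define \<delta> where "\<delta> = e / (2 * (\<bar>t\<bar> + 1))"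
  have \<delta>: "\<delta> > 0" using \<open>e > 0\<close> by (simp add: \<delta>_def add_nonneg_pos)
  have t\<delta>: "\<bar>t\<bar> * \<delta> < e / 2"
    using \<open>e > 0\<close> by (simp add: \<delta>_def field_simps add_nonneg_pos)
  have "(\<lambda>n. prob {\<omega> \<in> space M. \<bar>Z n \<omega> - Y \<omega>\<bar> > \<delta> / 2}) \<longlonglongrightarrow> 0"
    by (rule conv[unfolded converges_in_probability_def, rule_format]) (use \<delta> in simp)
  then obtain N where N: "\<And>n. n \<ge> N \<Longrightarrow> prob {\<omega> \<in> space M. \<bar>Z n \<omega> - Y \<omega>\<bar> > \<delta> / 2} < e / 8"
    using LIMSEQ_D[of _ 0 "e / 8"] \<open>e > 0\<close> by force
  have "norm (char (distr M borel (\<lambda>\<omega>. Z n \<omega> - Z k \<omega>)) t - 1) < e" if "n \<ge> N" "k \<ge> N" for n k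
  proof -
    have "prob {\<omega> \<in> space M. \<bar>(Z n \<omega> - Z k \<omega>) - 0\<bar> > \<delta>}
      \<le> prob ({\<omega> \<in> space M. \<bar>Z n \<omega> - Y \<omega>\<bar> > \<delta> / 2} \<union> {\<omega> \<in> space M. \<bar>Z k \<omega> - Y \<omega>\<bar> > \<delta> / 2})"
    proof (rule finite_measure_mono)
      have "\<bar>Z n \<omega> - Z k \<omega>\<bar> \<le> \<bar>Z n \<omega> - Y \<omega>\<bar> + \<bar>Z k \<omega> - Y \<omega>\<bar>" for \<omega> by linarith
      then have "\<bar>(Z n \<omega> - Z k \<omega>) - 0\<bar> > \<delta> \<Longrightarrow> \<bar>Z n \<omega> - Y \<omega>\<bar> > \<delta> / 2 \<or> \<bar>Z k \<omega> - Y \<omega>\<bar> > \<delta> / 2" for \<omega>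
        by (smt (verit) field_sum_of_halves)
      then show "{\<omega> \<in> space M. \<bar>(Z n \<omega> - Z k \<omega>) - 0\<bar> > \<delta>}
        \<subseteq> {\<omega> \<in> space M. \<bar>Z n \<omega> - Y \<omega>\<bar> > \<delta> / 2} \<union> {\<omega> \<in> space M. \<bar>Z k \<omega> - Y \<omega>\<bar> > \<delta> / 2}"
        by blast
    qed measurable
    also have "\<dots> \<le> prob {\<omega> \<in> space M. \<bar>Z n \<omega> - Y \<omega>\<bar> > \<delta> / 2} + prob {\<omega> \<in> space M. \<bar>Z k \<omega> - Y \<omega>\<bar> > \<delta> / 2}"
      by (rule measure_Un_le) measurable
    also have "\<dots> < e / 4" using N[OF that(1)] N[OF that(2)] by simp
    finally have P: "prob {\<omega> \<in> space M. \<bar>(Z n \<omega> - Z k \<omega>) - 0\<bar> > \<delta>} < e / 4" .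
    have c0: "char (distr M borel (\<lambda>_. 0)) t = 1"
      by (subst char_distr) (auto simp: prob_space)
    show ?thesis
      using norm_char_diff_le[of "\<lambda>\<omega>. Z n \<omega> - Z k \<omega>" "\<lambda>_. 0" \<delta> t] P t\<delta> \<delta> c0 by simp
  qed
  then show ?thesis using that by blast
qed

text \<open>The combination is required only almost surely, since integrals of simple functions are
  linear only up to null sets.\<close>

lemma converges_in_probability_linear:
  assumes [measurable]: "\<And>n. U n \<in> borel_measurable M" "\<And>n. V n \<in> borel_measurable M"
    "\<And>n. W n \<in> borel_measurable M"
    "u \<in> borel_measurable M" "v \<in> borel_measurable M"
    and U: "converges_in_probability M U u" and V: "converges_in_probability M V v"
    and W: "\<And>n. AE \<omega> in M. W n \<omega> = c * U n \<omega> + d * V n \<omega>"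
  shows "converges_in_probability M W (\<lambda>\<omega>. c * u \<omega> + d * v \<omega>)"
  unfolding converges_in_probability_def
proof (intro allI impI)
  fix e :: real assume "e > 0"
  let ?c = "e / (2 * (\<bar>c\<bar> + 1))" and ?d = "e / (2 * (\<bar>d\<bar> + 1))"
  have pos: "?c > 0" "?d > 0" using \<open>e > 0\<close> by (auto simp: add_nonneg_pos)
  have cd: "\<bar>c\<bar> * ?c \<le> e / 2" "\<bar>d\<bar> * ?d \<le> e / 2" using \<open>e > 0\<close> by (auto simp: field_simps add_nonneg_pos)
  have lim: "(\<lambda>n. prob {\<omega> \<in> space M. \<bar>U n \<omega> - u \<omega>\<bar> > ?c} + prob {\<omega> \<in> space M. \<bar>V n \<omega> - v \<omega>\<bar> > ?d}) \<longlonglongrightarrow> 0 + 0"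
    using U V pos unfolding converges_in_probability_def by (intro tendsto_add) auto
  show "(\<lambda>n. prob {\<omega> \<in> space M. e < \<bar>W n \<omega> - (c * u \<omega> + d * v \<omega>)\<bar>}) \<longlonglongrightarrow> 0"
  proof (rule tendsto_sandwich[OF _ _ tendsto_const lim[unfolded add_0_left]])
    show "\<forall>\<^sub>F n in sequentially. prob {\<omega> \<in> space M. e < \<bar>W n \<omega> - (c * u \<omega> + d * v \<omega>)\<bar>}
      \<le> prob {\<omega> \<in> space M. \<bar>U n \<omega> - u \<omega>\<bar> > ?c} + prob {\<omega> \<in> space M. \<bar>V n \<omega> - v \<omega>\<bar> > ?d}"
    proof (intro always_eventually allI)
      fix n
      have "prob {\<omega> \<in> space M. e < \<bar>W n \<omega> - (c * u \<omega> + d * v \<omega>)\<bar>}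
        \<le> prob ({\<omega> \<in> space M. \<bar>U n \<omega> - u \<omega>\<bar> > ?c} \<union> {\<omega> \<in> space M. \<bar>V n \<omega> - v \<omega>\<bar> > ?d})"
      proof (rule finite_measure_mono_AE)
        show "AE \<omega> in M. \<omega> \<in> {\<omega> \<in> space M. e < \<bar>W n \<omega> - (c * u \<omega> + d * v \<omega>)\<bar>} \<longrightarrow>
          \<omega> \<in> {\<omega> \<in> space M. \<bar>U n \<omega> - u \<omega>\<bar> > ?c} \<union> {\<omega> \<in> space M. \<bar>V n \<omega> - v \<omega>\<bar> > ?d}"
          using W[of n]
        proof eventually_elim
          case (elim \<omega>)
          have "\<bar>W n \<omega> - (c * u \<omega> + d * v \<omega>)\<bar> \<le> e"
            if "\<bar>U n \<omega> - u \<omega>\<bar> \<le> ?c" "\<bar>V n \<omega> - v \<omega>\<bar> \<le> ?d"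
          proof -
            have "W n \<omega> - (c * u \<omega> + d * v \<omega>) = c * (U n \<omega> - u \<omega>) + d * (V n \<omega> - v \<omega>)"
              unfolding elim by (simp add: algebra_simps)
            also have "\<bar>\<dots>\<bar> \<le> \<bar>c * (U n \<omega> - u \<omega>)\<bar> + \<bar>d * (V n \<omega> - v \<omega>)\<bar>" by (rule abs_triangle_ineq)
            also have "\<dots> \<le> \<bar>c\<bar> * ?c + \<bar>d\<bar> * ?d"
              unfolding abs_mult using that by (intro add_mono mult_left_mono) auto
            also have "\<dots> \<le> e" using cd by linarith
            finally show ?thesis .
          qed
          then show ?case by (auto simp: not_less[symmetric])
        qed
      qed measurable
      also have "\<dots> \<le> prob {\<omega> \<in> space M. \<bar>U n \<omega> - u \<omega>\<bar> > ?c} + prob {\<omega> \<in> space M. \<bar>V n \<omega> - v \<omega>\<bar> > ?d}"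
        by (rule measure_Un_le) measurable
      finally show "prob {\<omega> \<in> space M. e < \<bar>W n \<omega> - (c * u \<omega> + d * v \<omega>)\<bar>}
        \<le> prob {\<omega> \<in> space M. \<bar>U n \<omega> - u \<omega>\<bar> > ?c} + prob {\<omega> \<in> space M. \<bar>V n \<omega> - v \<omega>\<bar> > ?d}" .
    qed
  qed auto
qed

end

text \<open>
  The modulus of the characteristic function is that of the stochastic integral of \<open>f\<close>; the drift
  does not enter it.
\<close>
definition decays_like ::
  "real \<Rightarrow> real measure \<Rightarrow> 'b measure \<Rightarrow> 'w measure \<Rightarrow> ('b \<Rightarrow> real) \<Rightarrow> ('w \<Rightarrow> real) \<Rightarrow> bool" where
  "decays_like b \<mu> m M f Y \<longleftrightarrow> f \<in> borel_measurable m \<and> Y \<in> borel_measurable M \<and>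
     (\<forall>\<zeta>. integrable m (\<lambda>x. lk_decay b \<mu> (\<zeta> * f x)) \<and>
       norm (char (distr M borel Y) \<zeta>) = exp (- (\<integral>x. lk_decay b \<mu> (\<zeta> * f x) \<partial>m)))"

text \<open>Pointwise convergence of the integrands alone does not give convergence of the
  exponents, and no majorant is at hand. Characteristic functions of \<open>Ys n - Ys k\<close>
  close to 1 make the exponents of \<open>fs n - fs k\<close> small; Fatou's lemma in
  \<open>k\<close> passes this on to \<open>fs n - f\<close>, and the inequality for sums compares
  the exponents of \<open>fs n\<close> and \<open>f\<close>.\<close>

lemma (in prob_space) decays_like_limit:
  fixes f :: "'b \<Rightarrow> real" and Y :: "'a \<Rightarrow> real"
  assumes \<mu>: "levy_measure \<mu>" and b: "b \<ge> 0"
    and f[measurable]: "f \<in> borel_measurable m" and Y[measurable]: "Y \<in> borel_measurable M"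
    and seq: "\<And>n. decays_like b \<mu> m M (fs n) (Ys n)"
    and diff: "\<And>n k. decays_like b \<mu> m M (\<lambda>x. fs n x - fs k x) (\<lambda>\<omega>. Ys n \<omega> - Ys k \<omega>)"
    and lim: "AE x in m. (\<lambda>n. fs n x) \<longlonglongrightarrow> f x"
    and conv: "converges_in_probability M Ys Y"
  shows "decays_like b \<mu> m M f Y"
proof -
  have [measurable]: "fs n \<in> borel_measurable m" "Ys n \<in> borel_measurable M" for n
    using seq[of n] by (auto simp: decays_like_def)
  note [measurable] = borel_measurable_lk_decay[OF \<mu>]
  let ?\<psi> = "lk_decay b \<mu>"
  note nonneg = lk_decay_nonneg[OF b]
  have "integrable m (\<lambda>x. ?\<psi> (\<zeta> * f x)) \<and>
       norm (char (distr M borel Y) \<zeta>) = exp (- (\<integral>x. ?\<psi> (\<zeta> * f x) \<partial>m))" for \<zeta>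
  proof -
    have tail: "\<exists>N. \<forall>n\<ge>N. (\<integral>\<^sup>+x. ennreal (?\<psi> (\<zeta> * (fs n x - f x))) \<partial>m) \<le> ennreal \<eta>" if "\<eta> > 0" for \<eta>
    proof -
      \<comment> \<open>A characteristic function within \<open>1 - exp (- \<eta>)\<close> of 1 has
        modulus at least \<open>exp (- \<eta>)\<close>, that is, exponent at most \<eta>.\<close>
      obtain N where N: "\<And>n k. n \<ge> N \<Longrightarrow> k \<ge> N \<Longrightarrow>
        norm (char (distr M borel (\<lambda>\<omega>. Ys n \<omega> - Ys k \<omega>)) \<zeta> - 1) < 1 - exp (- \<eta>)"
        using converges_in_probability_char_Cauchy[OF _ _ conv, of "1 - exp (- \<eta>)" \<zeta>] \<open>\<eta> > 0\<close> by auto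
      have le: "(\<integral>\<^sup>+x. ennreal (?\<psi> (\<zeta> * (fs n x - fs k x))) \<partial>m) \<le> ennreal \<eta>" if "n \<ge> N" "k \<ge> N" for n k
      proof -
        let ?c = "char (distr M borel (\<lambda>\<omega>. Ys n \<omega> - Ys k \<omega>)) \<zeta>"
        have "1 \<le> norm ?c + norm (?c - 1)" using norm_triangle_ineq4[of ?c "?c - 1"] by simp
        then have "exp (- \<eta>) \<le> norm ?c" using N[OF that] by linarith
        then have "(\<integral>x. ?\<psi> (\<zeta> * (fs n x - fs k x)) \<partial>m) \<le> \<eta>"
          using diff[of n k] by (simp add: decays_like_def)
        then show ?thesis
          using diff[of n k] nonneg by (subst nn_integral_eq_integral) (auto simp: decays_like_def intro: ennreal_leI)
      qed
      have "(\<integral>\<^sup>+x. ennreal (?\<psi> (\<zeta> * (fs n x - f x))) \<partial>m) \<le> ennreal \<eta>" if "n \<ge> N" for n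
      proof -
        have "(\<integral>\<^sup>+x. ennreal (?\<psi> (\<zeta> * (fs n x - f x))) \<partial>m)
          = (\<integral>\<^sup>+x. liminf (\<lambda>k. ennreal (?\<psi> (\<zeta> * (fs n x - fs k x)))) \<partial>m)"
        proof (rule nn_integral_cong_AE, use lim in eventually_elim)
          case (elim x)
          have "(\<lambda>k. \<zeta> * (fs n x - fs k x)) \<longlonglongrightarrow> \<zeta> * (fs n x - f x)" by (intro tendsto_intros elim)
          then have "(\<lambda>k. ?\<psi> (\<zeta> * (fs n x - fs k x))) \<longlonglongrightarrow> ?\<psi> (\<zeta> * (fs n x - f x))"
            by (rule isCont_tendsto_compose[OF isCont_lk_decay[OF \<mu>]])
          then show ?case by (intro lim_imp_Liminf[symmetric] tendsto_ennrealI) auto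
        qed
        also have "\<dots> \<le> liminf (\<lambda>k. \<integral>\<^sup>+x. ennreal (?\<psi> (\<zeta> * (fs n x - fs k x))) \<partial>m)"
          by (rule nn_integral_liminf) measurable
        also have "\<dots> \<le> ennreal \<eta>"
          using le[OF that] by (intro Liminf_le) (auto simp: eventually_sequentially)
        finally show ?thesis .
      qed
      then show ?thesis by blast
    qed
    define r where "r n = enn2real (\<integral>\<^sup>+x. ennreal (?\<psi> (\<zeta> * (fs n x - f x))) \<partial>m)" for n
    obtain N where N: "\<And>n. n \<ge> N \<Longrightarrow> (\<integral>\<^sup>+x. ennreal (?\<psi> (\<zeta> * (fs n x - f x))) \<partial>m) \<le> ennreal 1"
      using tail[of 1] by auto
    have r_int: "integrable m (\<lambda>x. ?\<psi> (\<zeta> * (fs n x - f x)))" if "n \<ge> N" for n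
      using N[OF that] nonneg by (intro integrableI_nonneg) (auto intro: le_less_trans)
    have r_eq: "(\<integral>x. ?\<psi> (\<zeta> * (fs n x - f x)) \<partial>m) = r n" if "n \<ge> N" for n
      unfolding r_def using r_int[OF that] nonneg by (subst integral_eq_nn_integral) auto
    have r0: "r \<longlonglongrightarrow> 0"
    proof (rule LIMSEQ_I)
      fix e :: real assume "e > 0"
      then obtain K where K: "\<And>n. n \<ge> K \<Longrightarrow> (\<integral>\<^sup>+x. ennreal (?\<psi> (\<zeta> * (fs n x - f x))) \<partial>m) \<le> ennreal (e / 2)"
        using tail[of "e / 2"] by auto
      have "norm (r n - 0) < e" if "n \<ge> K" for n
        using enn2real_mono[OF K[OF that]] \<open>e > 0\<close> by (simp add: r_def)
      then show "\<exists>no. \<forall>n\<ge>no. norm (r n - 0) < e" by blast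
    qed
    have q_int: "integrable m (\<lambda>x. ?\<psi> (\<zeta> * fs n x))" for n
      using seq[of n] by (simp add: decays_like_def)
    define q where "q n = (\<integral>x. ?\<psi> (\<zeta> * fs n x) \<partial>m)" for n
    have f_int: "integrable m (\<lambda>x. ?\<psi> (\<zeta> * f x))"
    proof (rule Bochner_Integration.integrable_bound)
      show "integrable m (\<lambda>x. 2 * ?\<psi> (\<zeta> * fs N x) + 2 * ?\<psi> (\<zeta> * (fs N x - f x)))"
        using q_int r_int by auto
      show "AE x in m. norm (?\<psi> (\<zeta> * f x)) \<le> norm (2 * ?\<psi> (\<zeta> * fs N x) + 2 * ?\<psi> (\<zeta> * (fs N x - f x)))"
      proof (intro AE_I2)
        fix x
        have *: "?\<psi> (\<zeta> * fs N x + - (\<zeta> * (fs N x - f x))) \<le> (1 + 1) * ?\<psi> (\<zeta> * fs N x) + (1 + 1 / 1) * ?\<psi> (- (\<zeta> * (fs N x - f x)))"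
          by (rule lk_decay_add_le[OF \<mu> b]) simp
        then show "norm (?\<psi> (\<zeta> * f x)) \<le> norm (2 * ?\<psi> (\<zeta> * fs N x) + 2 * ?\<psi> (\<zeta> * (fs N x - f x)))"
        proof -
          have "\<zeta> * fs N x + - (\<zeta> * (fs N x - f x)) = \<zeta> * f x" by (simp add: algebra_simps)
          then have "?\<psi> (\<zeta> * f x) \<le> 2 * ?\<psi> (\<zeta> * fs N x) + 2 * ?\<psi> (\<zeta> * (fs N x - f x))"
            using * by (simp only: lk_decay_uminus) simp
          then show ?thesis using nonneg[of \<mu>] by simp
        qed
      qed
    qed measurable
    define q' where "q' = (\<integral>x. ?\<psi> (\<zeta> * f x) \<partial>m)"
    \<comment> \<open>For fixed \<open>e\<close> the term with \<open>1 / e\<close> vanishes as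
      \<open>n\<close> grows, leaving the factor \<open>1 + e\<close>, which can be taken as close
      to 1 as desired.\<close>
    have le1: "q n \<le> (1 + e) * q' + (1 + 1 / e) * r n" and le2: "q' \<le> (1 + e) * q n + (1 + 1 / e) * r n"
      if "n \<ge> N" "e > 0" for n e
    proof -
      have "q n \<le> (\<integral>x. (1 + e) * ?\<psi> (\<zeta> * f x) + (1 + 1 / e) * ?\<psi> (\<zeta> * (fs n x - f x)) \<partial>m)"
        unfolding q_def
      proof (rule integral_mono)
        fix x
        show "?\<psi> (\<zeta> * fs n x) \<le> (1 + e) * ?\<psi> (\<zeta> * f x) + (1 + 1 / e) * ?\<psi> (\<zeta> * (fs n x - f x))"
          using lk_decay_add_le[OF \<mu> b \<open>e > 0\<close>, of "\<zeta> * f x" "\<zeta> * (fs n x - f x)"] by (simp add: algebra_simps)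
      qed (use q_int f_int r_int[OF that(1)] in \<open>auto intro!: Bochner_Integration.integrable_add integrable_mult_right\<close>)
      also have "\<dots> = (1 + e) * q' + (1 + 1 / e) * r n"
        using f_int r_int[OF that(1)] by (simp add: q'_def r_eq[OF that(1)])
      finally show "q n \<le> (1 + e) * q' + (1 + 1 / e) * r n" .
      have "q' \<le> (\<integral>x. (1 + e) * ?\<psi> (\<zeta> * fs n x) + (1 + 1 / e) * ?\<psi> (\<zeta> * (fs n x - f x)) \<partial>m)"
        unfolding q'_def
      proof (rule integral_mono)
        fix x
        have "?\<psi> (\<zeta> * fs n x + - (\<zeta> * (fs n x - f x))) \<le> (1 + e) * ?\<psi> (\<zeta> * fs n x) + (1 + 1 / e) * ?\<psi> (- (\<zeta> * (fs n x - f x)))"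
          by (rule lk_decay_add_le[OF \<mu> b \<open>e > 0\<close>])
        moreover have "\<zeta> * fs n x + - (\<zeta> * (fs n x - f x)) = \<zeta> * f x" by (simp add: algebra_simps)
        ultimately show "?\<psi> (\<zeta> * f x) \<le> (1 + e) * ?\<psi> (\<zeta> * fs n x) + (1 + 1 / e) * ?\<psi> (\<zeta> * (fs n x - f x))"
          by (simp only: lk_decay_uminus)
      qed (use q_int f_int r_int[OF that(1)] in \<open>auto intro!: Bochner_Integration.integrable_add integrable_mult_right\<close>)
      also have "\<dots> = (1 + e) * q n + (1 + 1 / e) * r n"
        using q_int r_int[OF that(1)] by (simp add: q_def r_eq[OF that(1)])
      finally show "q' \<le> (1 + e) * q n + (1 + 1 / e) * r n" .
    qed
    have q'0: "q' \<ge> 0" unfolding q'_def using nonneg by (intro Bochner_Integration.integral_nonneg)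
    have "q \<longlonglongrightarrow> q'"
    proof (rule LIMSEQ_I)
      fix d :: real assume "d > 0"
      \<comment> \<open>This makes \<open>e * (2 * q')\<close> smaller than \<open>d\<close>; the
        summand 1 in the denominator covers \<open>q' = 0\<close>.\<close>
      define e where "e = d / (2 * (2 * q' + 1))"
      have e: "e > 0" using \<open>d > 0\<close> q'0 by (simp add: e_def)
      have "e * (2 * q') < d" using \<open>d > 0\<close> q'0 by (simp add: e_def field_simps) (smt (verit) mult_nonneg_nonneg)
      moreover have "(\<lambda>n. e * (2 * q' + 2 * r n) + (1 + 1 / e) * r n) \<longlonglongrightarrow> e * (2 * q' + 2 * 0) + (1 + 1 / e) * 0"
        by (intro tendsto_intros r0)
      ultimately have "\<forall>\<^sub>F n in sequentially. e * (2 * q' + 2 * r n) + (1 + 1 / e) * r n < d"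
        by (intro order_tendstoD(2)) auto
      then have "\<forall>\<^sub>F n in sequentially. norm (q n - q') < d"
        using eventually_ge_at_top[of N]
      proof eventually_elim
        case (elim n)
        have r: "r n \<ge> 0" by (simp add: r_def)
        have "q n \<le> 2 * q' + 2 * r n" using le1[OF elim(2), of 1] by simp
        then have "e * q n \<le> e * (2 * q' + 2 * r n)" using e by (intro mult_left_mono) auto
        moreover have "e * q' \<le> e * (2 * q' + 2 * r n)" using e q'0 r by (intro mult_left_mono) auto
        ultimately show ?case
          using elim(1) le1[OF elim(2) e] le2[OF elim(2) e] by (simp add: abs_less_iff distrib_right)
      qed
      then show "\<exists>no. \<forall>n\<ge>no. norm (q n - q') < d" by (simp add: eventually_sequentially)
    qed
    then have "(\<lambda>n. exp (- q n)) \<longlonglongrightarrow> exp (- q')" by (intro tendsto_intros)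
    moreover have "(\<lambda>n. norm (char (distr M borel (Ys n)) \<zeta>)) \<longlonglongrightarrow> norm (char (distr M borel Y) \<zeta>)"
      by (intro tendsto_norm converges_in_probability_char conv) auto
    moreover have "norm (char (distr M borel (Ys n)) \<zeta>) = exp (- q n)" for n
      using seq[of n] by (simp add: decays_like_def q_def)
    ultimately have "norm (char (distr M borel Y) \<zeta>) = exp (- q')" by (simp add: LIMSEQ_unique)
    then show ?thesis using f_int by (simp add: q'_def)
  qed
  then show ?thesis by (simp add: decays_like_def)
qed

section \<open>Stochastic integrals with respect to a Levy basis\<close>

text \<open>Unlike in \<^const>\<open>has_stochastic_integral\<close>, no convergence on measurable subsets is required.\<close>
definition stochastic_integral_limit ::
  "'w measure \<Rightarrow> 'b measure \<Rightarrow> ('b set \<Rightarrow> 'w \<Rightarrow> real) \<Rightarrow> ('b \<Rightarrow> real) \<Rightarrow> ('w \<Rightarrow> real) \<Rightarrow> bool" where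
  "stochastic_integral_limit M m \<Lambda> f Y \<longleftrightarrow> f \<in> borel_measurable m \<and> Y \<in> borel_measurable M \<and>
     (\<exists>g :: nat \<Rightarrow> 'b \<Rightarrow> real.
        (\<forall>n. simple_function m (g n) \<and> {x \<in> space m. g n x \<noteq> 0} \<in> finite_measure_sets m) \<and>
        (AE x in m. (\<lambda>n. g n x) \<longlonglongrightarrow> f x) \<and>
        converges_in_probability M (\<lambda>n. simple_stochastic_integral m \<Lambda> (space m) (g n)) Y)"

lemma stochastic_integral_limitI:
  "has_stochastic_integral M m \<Lambda> f Y \<Longrightarrow> stochastic_integral_limit M m \<Lambda> f Y"
  unfolding has_stochastic_integral_def stochastic_integral_limit_def by blast

section \<open>Integrals of simple functions against a Levy basis\<close>

locale levy_basis_space = prob_space M for M :: "'w measure" +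
  fixes m :: "'b measure" and \<kappa> :: "real \<Rightarrow> complex" and \<Lambda> :: "'b set \<Rightarrow> 'w \<Rightarrow> real"
  assumes basis: "levy_basis M m \<kappa> \<Lambda>"
begin

abbreviation "fms \<equiv> finite_measure_sets m"

lemma \<Lambda>_measurable: "A \<in> fms \<Longrightarrow> \<Lambda> A \<in> borel_measurable M"
  using basis by (simp add: levy_basis_def)

lemma \<Lambda>_char: "A \<in> fms \<Longrightarrow> char (distr M borel (\<Lambda> A)) \<zeta> = exp (of_real (measure m A) * \<kappa> \<zeta>)"
  using basis by (simp add: levy_basis_def)

lemma \<Lambda>_indep:
  "range A \<subseteq> fms \<Longrightarrow> disjoint_family A \<Longrightarrow> indep_vars (\<lambda>_. borel) (\<lambda>n::nat. \<Lambda> (A n)) UNIV"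
  using basis by (simp add: levy_basis_def)

lemma \<Lambda>_sums:
  "range A \<subseteq> fms \<Longrightarrow> disjoint_family A \<Longrightarrow> (\<Union>n. A n) \<in> fms \<Longrightarrow>
    AE \<omega> in M. (\<lambda>n::nat. \<Lambda> (A n) \<omega>) sums \<Lambda> (\<Union>n. A n) \<omega>"
  using basis by (simp add: levy_basis_def)

lemma empty_fms [simp]: "{} \<in> fms"
  by (simp add: finite_measure_sets_def)

lemma fms_subset: "A \<in> fms \<Longrightarrow> B \<in> sets m \<Longrightarrow> B \<subseteq> A \<Longrightarrow> B \<in> fms"
  unfolding finite_measure_sets_def by (auto intro: le_less_trans[OF emeasure_mono])

lemma fms_UN:
  assumes "finite I" "\<And>i. i \<in> I \<Longrightarrow> A i \<in> fms"
  shows "(\<Union>i\<in>I. A i) \<in> fms"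
proof -
  have "emeasure m (\<Union>i\<in>I. A i) \<le> (\<Sum>i\<in>I. emeasure m (A i))"
    using assms by (intro emeasure_subadditive_finite) (auto simp: finite_measure_sets_def)
  also have "\<dots> < \<infinity>" using assms by (auto simp: finite_measure_sets_def)
  finally show ?thesis using assms by (auto simp: finite_measure_sets_def)
qed

text \<open>The constant sequence of empty sets is disjoint with empty union, so countable
  additivity makes a constant series converge.\<close>

lemma \<Lambda>_empty: "AE \<omega> in M. \<Lambda> {} \<omega> = 0"
proof -
  have "AE \<omega> in M. (\<lambda>n::nat. \<Lambda> {} \<omega>) sums \<Lambda> {} \<omega>"
    using \<Lambda>_sums[of "\<lambda>_. {}"] by (auto simp: disjoint_family_on_def)
  then show ?thesis by eventually_elim (auto simp: sums_iff summable_const_iff)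
qed

text \<open>Independence and additivity of a Levy basis are stated for sequences; a finite disjoint
  family becomes one by padding with empty sets.\<close>

lemma enumerate_disjoint:
  assumes "finite I" "disjoint_family_on A I" "\<And>i. i \<in> I \<Longrightarrow> A i \<in> fms"
  obtains e :: "nat \<Rightarrow> 'i" and B :: "nat \<Rightarrow> 'b set"
  where "bij_betw e {..<card I} I" "\<And>k. k < card I \<Longrightarrow> B k = A (e k)" "\<And>k. k \<ge> card I \<Longrightarrow> B k = {}"
    "range B \<subseteq> fms" "disjoint_family B"
proof -
  obtain e where e: "bij_betw e {..<card I} I"
    using ex_bij_betw_nat_finite[OF assms(1)] by (auto simp: atLeast0LessThan)
  define B where "B k = (if k < card I then A (e k) else {})" for k
  have eI: "k < card I \<Longrightarrow> e k \<in> I" for k using e by (auto simp: bij_betw_def)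
  have "range B \<subseteq> fms" using assms(3) eI by (auto simp: B_def)
  moreover have "disjoint_family B"
    unfolding disjoint_family_on_def
  proof (intro ballI impI)
    fix k l :: nat assume "k \<noteq> l"
    then show "B k \<inter> B l = {}"
      using assms(2) e eI[of k] eI[of l] unfolding B_def disjoint_family_on_def bij_betw_def inj_on_def
      by auto
  qed
  ultimately show ?thesis using that[of e B] e by (auto simp: B_def)
qed

lemma \<Lambda>_finite_additive:
  assumes "finite I" "disjoint_family_on A I" "\<And>i. i \<in> I \<Longrightarrow> A i \<in> fms"
  shows "AE \<omega> in M. \<Lambda> (\<Union>i\<in>I. A i) \<omega> = (\<Sum>i\<in>I. \<Lambda> (A i) \<omega>)"
proof -
  obtain e B where e: "bij_betw e {..<card I} I" "\<And>k. k < card I \<Longrightarrow> B k = A (e k)"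
    "\<And>k. k \<ge> card I \<Longrightarrow> B k = {}" and B: "range B \<subseteq> fms" "disjoint_family B"
    using enumerate_disjoint[OF assms] by blast
  have "(\<Union>k. B k) = (\<Union>k<card I. A (e k))"
  proof (intro equalityI subsetI)
    fix x assume "x \<in> (\<Union>k. B k)"
    then obtain k where "x \<in> B k" by auto
    then show "x \<in> (\<Union>k<card I. A (e k))" using e(2,3)[of k] by (cases "k < card I") auto
  next
    fix x assume "x \<in> (\<Union>k<card I. A (e k))"
    then show "x \<in> (\<Union>k. B k)" using e(2) by auto
  qed
  also have "\<dots> = (\<Union>i\<in>e ` {..<card I}. A i)" by auto
  also have "e ` {..<card I} = I" using e(1) by (rule bij_betw_imp_surj_on)
  finally have U: "(\<Union>k. B k) = (\<Union>i\<in>I. A i)" .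
  have "AE \<omega> in M. (\<lambda>k. \<Lambda> (B k) \<omega>) sums \<Lambda> (\<Union>i\<in>I. A i) \<omega>"
    using \<Lambda>_sums[OF B] fms_UN[OF assms(1,3)] by (simp add: U)
  then show ?thesis using \<Lambda>_empty
  proof eventually_elim
    case (elim \<omega>)
    have "(\<lambda>k. \<Lambda> (B k) \<omega>) sums (\<Sum>k<card I. \<Lambda> (B k) \<omega>)"
      by (rule sums_finite) (use elim(2) e(3) in auto)
    then have "\<Lambda> (\<Union>i\<in>I. A i) \<omega> = (\<Sum>k<card I. \<Lambda> (B k) \<omega>)" using elim(1) sums_unique2 by blast
    also have "\<dots> = (\<Sum>k<card I. \<Lambda> (A (e k)) \<omega>)" using e(2) by auto
    also have "\<dots> = (\<Sum>i\<in>I. \<Lambda> (A i) \<omega>)" by (rule sum.reindex_bij_betw[OF e(1)])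
    finally show ?case .
  qed
qed

lemma char_sum_\<Lambda>:
  assumes "finite I" "disjoint_family_on A I" "\<And>i. i \<in> I \<Longrightarrow> A i \<in> fms"
  shows "char (distr M borel (\<lambda>\<omega>. \<Sum>i\<in>I. c i * \<Lambda> (A i) \<omega>)) \<zeta>
    = exp (\<Sum>i\<in>I. of_real (measure m (A i)) * \<kappa> (\<zeta> * c i))"
proof -
  obtain e B where e: "bij_betw e {..<card I} I" "\<And>k. k < card I \<Longrightarrow> B k = A (e k)"
    and B: "range B \<subseteq> fms" "disjoint_family B"
    using enumerate_disjoint[OF assms] by metis
  have Bf: "B k \<in> fms" for k using B by auto
  have "indep_vars (\<lambda>_. borel) (\<lambda>k. \<Lambda> (B k)) {..<card I}"
    using \<Lambda>_indep[OF B] by (rule indep_vars_subset) auto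
  then have ind: "indep_vars (\<lambda>_. borel) (\<lambda>k \<omega>. c (e k) * \<Lambda> (B k) \<omega>) {..<card I}"
    by (rule indep_vars_compose2[where Y = "\<lambda>k x. c (e k) * x"]) auto
  have "(\<Sum>i\<in>I. c i * \<Lambda> (A i) \<omega>) = (\<Sum>k<card I. c (e k) * \<Lambda> (B k) \<omega>)" for \<omega>
    using e(2) by (subst sum.reindex_bij_betw[OF e(1), symmetric]) auto
  then have "char (distr M borel (\<lambda>\<omega>. \<Sum>i\<in>I. c i * \<Lambda> (A i) \<omega>)) \<zeta>
    = (\<Prod>k<card I. char (distr M borel (\<lambda>\<omega>. c (e k) * \<Lambda> (B k) \<omega>)) \<zeta>)"
    using char_distr_sum[OF ind] by simp
  also have "\<dots> = (\<Prod>k<card I. exp (of_real (measure m (A (e k))) * \<kappa> (\<zeta> * c (e k))))"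
    by (intro prod.cong refl) (simp add: e(2)[symmetric] Bf char_distr_cmult \<Lambda>_measurable \<Lambda>_char)
  also have "\<dots> = (\<Prod>i\<in>I. exp (of_real (measure m (A i)) * \<kappa> (\<zeta> * c i)))"
    by (rule prod.reindex_bij_betw[OF e(1)])
  also have "\<dots> = exp (\<Sum>i\<in>I. of_real (measure m (A i)) * \<kappa> (\<zeta> * c i))"
    by (rule exp_sum[OF assms(1), symmetric])
  finally show ?thesis .
qed

abbreviation "I \<equiv> simple_stochastic_integral m \<Lambda> (space m)"

lemma simple_level_fms:
  fixes g :: "'b \<Rightarrow> real"
  assumes "simple_function m g" "{x \<in> space m. g x \<noteq> 0} \<in> fms" "y \<noteq> (0::real)"
  shows "{x \<in> space m. g x = y} \<in> fms"
  using assms(2)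
proof (rule fms_subset)
  show "{x \<in> space m. g x = y} \<in> sets m"
    using simple_functionD(2)[OF assms(1), of "{y}"] by (simp add: vimage_def Int_def conj_commute)
qed (use assms(3) in auto)

text \<open>The integral of \<open>v (k x)\<close> is defined through the level sets of the
  composition; here it is computed on the finer partition by the values of \<open>k\<close>.
  Additivity holds almost surely, and only finitely many null sets have to be collected. The value 0
  is a separate case because its level set may have infinite measure, where \<Lambda> is
  unconstrained.\<close>

lemma simple_integral_refine:
  fixes k :: "'b \<Rightarrow> 'c" and v :: "'c \<Rightarrow> real"
  assumes fin: "finite (k ` space m)"
    and fms: "\<And>w. v w \<noteq> 0 \<Longrightarrow> {x \<in> space m. k x = w} \<in> fms"
  shows "AE \<omega> in M. I (\<lambda>x. v (k x)) \<omega> = (\<Sum>w\<in>k ` space m. v w * \<Lambda> {x \<in> space m. k x = w} \<omega>)"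
proof -
  let ?W = "k ` space m" and ?L = "\<lambda>w. {x \<in> space m. k x = w}"
  have "AE \<omega> in M. \<forall>y\<in>v ` ?W. y \<noteq> 0 \<longrightarrow> \<Lambda> {x \<in> space m. v (k x) = y} \<omega> = (\<Sum>w\<in>{w \<in> ?W. v w = y}. \<Lambda> (?L w) \<omega>)"
  proof (intro AE_finite_allI)
    fix y assume "y \<in> v ` ?W"
    show "AE \<omega> in M. y \<noteq> 0 \<longrightarrow> \<Lambda> {x \<in> space m. v (k x) = y} \<omega> = (\<Sum>w\<in>{w \<in> ?W. v w = y}. \<Lambda> (?L w) \<omega>)"
    proof (cases "y = 0")
      case False
      have "AE \<omega> in M. \<Lambda> (\<Union>w\<in>{w \<in> ?W. v w = y}. ?L w) \<omega> = (\<Sum>w\<in>{w \<in> ?W. v w = y}. \<Lambda> (?L w) \<omega>)"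
        using False fin fms by (intro \<Lambda>_finite_additive) (auto simp: disjoint_family_on_def)
      moreover have "(\<Union>w\<in>{w \<in> ?W. v w = y}. ?L w) = {x \<in> space m. v (k x) = y}" by auto
      ultimately show ?thesis by simp
    qed simp
  qed (use fin in auto)
  then show ?thesis
  proof eventually_elim
    case (elim \<omega>)
    have "I (\<lambda>x. v (k x)) \<omega> = (\<Sum>y\<in>v ` ?W. y * \<Lambda> {x \<in> space m. v (k x) = y} \<omega>)"
      by (simp add: simple_stochastic_integral_def image_image)
    also have "\<dots> = (\<Sum>y\<in>v ` ?W. \<Sum>w\<in>{w \<in> ?W. v w = y}. v w * \<Lambda> (?L w) \<omega>)"
    proof (intro sum.cong refl)
      fix y assume y: "y \<in> v ` ?W"
      show "y * \<Lambda> {x \<in> space m. v (k x) = y} \<omega> = (\<Sum>w\<in>{w \<in> ?W. v w = y}. v w * \<Lambda> (?L w) \<omega>)"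
      proof (cases "y = 0")
        case False
        then show ?thesis using elim y by (auto simp: sum_distrib_left intro!: sum.cong)
      qed (auto intro!: sum.neutral[symmetric])
    qed
    also have "\<dots> = (\<Sum>w\<in>?W. v w * \<Lambda> (?L w) \<omega>)"
      using fin by (rule sum.image_gen[symmetric])
    finally show ?case .
  qed
qed

text \<open>Both functions and their combination are constant on the level sets of the pair
  \<open>(g x, h x)\<close>, so all three integrals become sums over the same partition.\<close>

lemma simple_integral_linear:
  fixes g h :: "'b \<Rightarrow> real" and c d :: real
  assumes g: "simple_function m g" "{x \<in> space m. g x \<noteq> 0} \<in> fms"
    and h: "simple_function m h" "{x \<in> space m. h x \<noteq> 0} \<in> fms"
  shows "AE \<omega> in M. I (\<lambda>x. c * g x + d * h x) \<omega> = c * I g \<omega> + d * I h \<omega>"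
proof -
  let ?k = "\<lambda>x. (g x, h x)"
  have fin: "finite (?k ` space m)"
    using finite_subset[of "?k ` space m" "g ` space m \<times> h ` space m"] g(1) h(1)
    by (auto simp: simple_function_def)
  have lev: "{x \<in> space m. ?k x = w} \<in> fms" if "w \<noteq> (0, 0)" for w
  proof -
    have eq: "{x \<in> space m. ?k x = w} = {x \<in> space m. g x = fst w} \<inter> {x \<in> space m. h x = snd w}"
      by auto
    have "{x \<in> space m. g x = y} \<in> sets m" "{x \<in> space m. h x = y} \<in> sets m" for y
      using simple_functionD(2)[OF g(1), of "{y}"] simple_functionD(2)[OF h(1), of "{y}"]
      by (simp_all add: vimage_def Int_def conj_commute)
    then have s: "{x \<in> space m. ?k x = w} \<in> sets m" unfolding eq by auto
    show ?thesis
    proof (cases "fst w = 0")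
      case False
      show ?thesis by (rule fms_subset[OF simple_level_fms[OF g False] s]) auto
    next
      case True
      then have "snd w \<noteq> 0" using that by (cases w) auto
      show ?thesis by (rule fms_subset[OF simple_level_fms[OF h \<open>snd w \<noteq> 0\<close>] s]) auto
    qed
  qed
  have "AE \<omega> in M. I (\<lambda>x. (\<lambda>w. c * fst w + d * snd w) (?k x)) \<omega> =
      (\<Sum>w\<in>?k ` space m. (c * fst w + d * snd w) * \<Lambda> {x \<in> space m. ?k x = w} \<omega>)"
    by (rule simple_integral_refine[OF fin], rule lev) auto
  moreover have "AE \<omega> in M. I (\<lambda>x. fst (?k x)) \<omega> = (\<Sum>w\<in>?k ` space m. fst w * \<Lambda> {x \<in> space m. ?k x = w} \<omega>)"
    by (rule simple_integral_refine[OF fin], rule lev) auto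
  moreover have "AE \<omega> in M. I (\<lambda>x. snd (?k x)) \<omega> = (\<Sum>w\<in>?k ` space m. snd w * \<Lambda> {x \<in> space m. ?k x = w} \<omega>)"
    by (rule simple_integral_refine[OF fin], rule lev) auto
  ultimately show ?thesis
    by eventually_elim (simp add: sum_distrib_left sum.distrib[symmetric] algebra_simps)
qed

lemma simple_integral_eq:
  assumes "simple_function m g"
  shows "I g \<omega> = (\<Sum>y\<in>g ` space m - {0}. y * \<Lambda> {x \<in> space m. g x = y} \<omega>)"
  unfolding simple_stochastic_integral_def
  using assms by (intro sum.mono_neutral_cong_right) (auto simp: simple_function_def)

lemma simple_integral_measurable:
  assumes g: "simple_function m g" "{x \<in> space m. g x \<noteq> 0} \<in> fms"
  shows "I g \<in> borel_measurable M"
proof -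
  have "I g = (\<lambda>\<omega>. \<Sum>y\<in>g ` space m - {0}. y * \<Lambda> {x \<in> space m. g x = y} \<omega>)"
    using simple_integral_eq[OF g(1)] by auto
  then show ?thesis
    using simple_level_fms[OF g] by (auto intro!: borel_measurable_sum borel_measurable_times \<Lambda>_measurable)
qed

lemma char_simple_integral:
  assumes g: "simple_function m g" "{x \<in> space m. g x \<noteq> 0} \<in> fms"
  shows "char (distr M borel (I g)) \<zeta>
    = exp (\<Sum>y\<in>g ` space m - {0}. of_real (measure m {x \<in> space m. g x = y}) * \<kappa> (\<zeta> * y))"
proof -
  have "I g = (\<lambda>\<omega>. \<Sum>y\<in>g ` space m - {0}. y * \<Lambda> {x \<in> space m. g x = y} \<omega>)"
    using simple_integral_eq[OF g(1)] by auto
  then show ?thesis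
    using simple_level_fms[OF g] g(1) by (simp only:) (intro char_sum_\<Lambda>[where I = "g ` space m - {0}" and A = "\<lambda>y. {x \<in> space m. g x = y}" and c = "\<lambda>y. y"],
      auto simp: disjoint_family_on_def simple_function_def)
qed

lemma simple_sum_integral:
  fixes g \<phi> :: "_ \<Rightarrow> real"
  assumes g: "simple_function m g" "{x \<in> space m. g x \<noteq> 0} \<in> fms" and "\<phi> 0 = (0::real)"
  shows "integrable m (\<lambda>x. \<phi> (g x))"
    and "(\<integral>x. \<phi> (g x) \<partial>m) = (\<Sum>y\<in>g ` space m - {0}. measure m {x \<in> space m. g x = y} * \<phi> y)"
proof -
  have fin: "finite (g ` space m - {0})" using g(1) by (simp add: simple_function_def)
  have eq: "\<phi> (g x) = (\<Sum>y\<in>g ` space m - {0}. \<phi> y * indicator {x \<in> space m. g x = y} x)" if "x \<in> space m" for x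
  proof -
    have "(\<Sum>y\<in>g ` space m - {0}. \<phi> y * indicator {x \<in> space m. g x = y} x)
      = (\<Sum>y\<in>g ` space m - {0}. if y = g x then \<phi> y else 0)"
      using that by (intro sum.cong) (auto simp: indicator_def)
    also have "\<dots> = \<phi> (g x)" using fin that assms(3) by auto
    finally show ?thesis by simp
  qed
  have lev: "{x \<in> space m. g x = y} \<in> sets m" "emeasure m {x \<in> space m. g x = y} < \<infinity>" if "y \<noteq> 0" for y
    using simple_level_fms[OF g that] by (auto simp: finite_measure_sets_def)
  have int: "integrable m (\<lambda>x. \<phi> y * indicator {x \<in> space m. g x = y} x)" if "y \<in> g ` space m - {0}" for y
    using lev[of y] that by (intro integrable_mult_right integrable_real_indicator) auto
  show "integrable m (\<lambda>x. \<phi> (g x))"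
    using int by (subst Bochner_Integration.integrable_cong[OF refl eq]) (auto intro!: Bochner_Integration.integrable_sum)
  have "(\<integral>x. \<phi> (g x) \<partial>m) = (\<integral>x. (\<Sum>y\<in>g ` space m - {0}. \<phi> y * indicator {x \<in> space m. g x = y} x) \<partial>m)"
    by (intro Bochner_Integration.integral_cong refl eq)
  also have "\<dots> = (\<Sum>y\<in>g ` space m - {0}. \<integral>x. \<phi> y * indicator {x \<in> space m. g x = y} x \<partial>m)"
    by (intro Bochner_Integration.integral_sum int)
  also have "\<dots> = (\<Sum>y\<in>g ` space m - {0}. measure m {x \<in> space m. g x = y} * \<phi> y)"
  proof (intro sum.cong refl)
    fix y assume "y \<in> g ` space m - {0}"
    then have "(\<integral>x. indicator {x \<in> space m. g x = y} x \<partial>m) = measure m {x \<in> space m. g x = y}"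
      using lev[of y] by (subst Bochner_Integration.integral_indicator) (auto simp: Int_def conj_commute)
    then show "(\<integral>x. \<phi> y * indicator {x \<in> space m. g x = y} x \<partial>m) = measure m {x \<in> space m. g x = y} * \<phi> y"
      by simp
  qed
  finally show "(\<integral>x. \<phi> (g x) \<partial>m) = (\<Sum>y\<in>g ` space m - {0}. measure m {x \<in> space m. g x = y} * \<phi> y)" .
qed

lemma simple_linear_fms:
  fixes g h :: "'b \<Rightarrow> real" and c d :: real
  assumes g: "simple_function m g" "{x \<in> space m. g x \<noteq> 0} \<in> fms"
    and h: "simple_function m h" "{x \<in> space m. h x \<noteq> 0} \<in> fms"
  shows "simple_function m (\<lambda>x. c * g x + d * h x) \<and> {x \<in> space m. c * g x + d * h x \<noteq> 0} \<in> fms"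
proof
  show s: "simple_function m (\<lambda>x. c * g x + d * h x)"
    using g(1) h(1) by (intro simple_function_add simple_function_mult simple_function_const)
  have "{x \<in> space m. g x \<noteq> 0} \<union> {x \<in> space m. h x \<noteq> 0} \<in> fms"
    using fms_UN[of "{False, True}" "\<lambda>b. if b then {x \<in> space m. g x \<noteq> 0} else {x \<in> space m. h x \<noteq> 0}"] g h
    by (auto simp: Un_commute)
  moreover have "{x \<in> space m. c * g x + d * h x \<noteq> 0} \<in> sets m"
    using borel_measurable_simple_function[OF s] by measurable
  ultimately show "{x \<in> space m. c * g x + d * h x \<noteq> 0} \<in> fms"
    by (rule fms_subset) auto
qed

lemma stochastic_integral_limit_linear:
  assumes f: "stochastic_integral_limit M m \<Lambda> f U" and h: "stochastic_integral_limit M m \<Lambda> h V"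
  shows "stochastic_integral_limit M m \<Lambda> (\<lambda>x. c * f x + d * h x) (\<lambda>\<omega>. c * U \<omega> + d * V \<omega>)"
proof -
  obtain gf where gf: "\<And>n. simple_function m (gf n)" "\<And>n. {x \<in> space m. gf n x \<noteq> 0} \<in> fms"
    "AE x in m. (\<lambda>n. gf n x) \<longlonglongrightarrow> f x" "converges_in_probability M (\<lambda>n. I (gf n)) U"
    using f by (auto simp: stochastic_integral_limit_def)
  obtain gh where gh: "\<And>n. simple_function m (gh n)" "\<And>n. {x \<in> space m. gh n x \<noteq> 0} \<in> fms"
    "AE x in m. (\<lambda>n. gh n x) \<longlonglongrightarrow> h x" "converges_in_probability M (\<lambda>n. I (gh n)) V"
    using h by (auto simp: stochastic_integral_limit_def)
  have [measurable]: "f \<in> borel_measurable m" "h \<in> borel_measurable m" "U \<in> borel_measurable M" "V \<in> borel_measurable M"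
    using f h by (auto simp: stochastic_integral_limit_def)
  note lin = simple_linear_fms[OF gf(1,2) gh(1,2), where c = c and d = d]
  have "AE x in m. (\<lambda>n. c * gf n x + d * gh n x) \<longlonglongrightarrow> c * f x + d * h x"
    using gf(3) gh(3) by eventually_elim (intro tendsto_intros)
  moreover have "converges_in_probability M (\<lambda>n. I (\<lambda>x. c * gf n x + d * gh n x)) (\<lambda>\<omega>. c * U \<omega> + d * V \<omega>)"
  proof (rule converges_in_probability_linear[OF _ _ _ _ _ gf(4) gh(4)])
    show "AE \<omega> in M. I (\<lambda>x. c * gf n x + d * gh n x) \<omega> = c * I (gf n) \<omega> + d * I (gh n) \<omega>" for n
      by (rule simple_integral_linear[OF gf(1,2) gh(1,2)])
  qed (use gf gh lin in \<open>auto intro!: simple_integral_measurable\<close>)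
  ultimately show ?thesis unfolding stochastic_integral_limit_def
    using lin by (intro conjI exI[of _ "\<lambda>n x. c * gf n x + d * gh n x"]) auto
qed

lemma stochastic_integral_limit_sum:
  assumes "finite J" "\<And>j. j \<in> J \<Longrightarrow> stochastic_integral_limit M m \<Lambda> (f j) (Y j)"
  shows "stochastic_integral_limit M m \<Lambda> (\<lambda>x. \<Sum>j\<in>J. c j * f j x) (\<lambda>\<omega>. \<Sum>j\<in>J. c j * Y j \<omega>)"
  using assms
proof (induction J rule: finite_induct)
  case empty
  have "I (\<lambda>_. 0) = (\<lambda>_. 0)" by (rule ext) (auto simp: simple_stochastic_integral_def intro!: sum.neutral)
  then show ?case
    unfolding stochastic_integral_limit_def
    by (intro conjI exI[of _ "\<lambda>_ _. 0"]) (auto simp: converges_in_probability_def)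
next
  case (insert j J)
  then have "stochastic_integral_limit M m \<Lambda> (\<lambda>x. c j * f j x + 1 * (\<Sum>j\<in>J. c j * f j x))
      (\<lambda>\<omega>. c j * Y j \<omega> + 1 * (\<Sum>j\<in>J. c j * Y j \<omega>))"
    by (intro stochastic_integral_limit_linear) auto
  then show ?case using insert by simp
qed

end

section \<open>The modulus formula for stochastic integrals\<close>

locale levy_khintchine_space = levy_basis_space M m "levy_khintchine a b \<mu>" \<Lambda>
  for M :: "'w measure" and m :: "'b measure" and a b :: real and \<mu> :: "real measure" and \<Lambda> +
  assumes b_nonneg: "b \<ge> 0" and levy: "levy_measure \<mu>"
begin

lemma decays_like_simple:
  assumes g: "simple_function m g" "{x \<in> space m. g x \<noteq> 0} \<in> fms"
  shows "decays_like b \<mu> m M g (I g)"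
proof -
  have "norm (char (distr M borel (I g)) \<zeta>) = exp (- (\<integral>x. lk_decay b \<mu> (\<zeta> * g x) \<partial>m))" for \<zeta>
  proof -
    have "norm (char (distr M borel (I g)) \<zeta>)
      = exp (\<Sum>y\<in>g ` space m - {0}. measure m {x \<in> space m. g x = y} * - lk_decay b \<mu> (\<zeta> * y))"
      unfolding char_simple_integral[OF g] norm_exp_eq_Re by (simp add: Re_levy_khintchine[OF levy])
    then show ?thesis
      using simple_sum_integral(2)[OF g, of "\<lambda>y. lk_decay b \<mu> (\<zeta> * y)"] by (simp add: sum_negf)
  qed
  then show ?thesis unfolding decays_like_def
    using simple_sum_integral(1)[OF g, of "\<lambda>y. lk_decay b \<mu> (\<zeta> * y)" for \<zeta>] simple_integral_measurable[OF g]
      borel_measurable_simple_function[OF g(1)] by auto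
qed

lemma decays_like_AE_cong:
  assumes "decays_like b \<mu> m M f U" "V \<in> borel_measurable M" "AE \<omega> in M. U \<omega> = V \<omega>"
  shows "decays_like b \<mu> m M f V"
proof -
  have "distr M borel U = distr M borel V"
    using assms by (intro distr_cong_AE) (auto simp: decays_like_def)
  then show ?thesis using assms by (simp add: decays_like_def)
qed

text \<open>The formula is exact for simple functions, and differences of approximants are again
  simple, so closure under limits applies. The difference of two integrals agrees with the integral
  of the difference only almost surely, which leaves its law unchanged.\<close>

lemma decays_like_stochastic_integral:
  assumes "stochastic_integral_limit M m \<Lambda> f Y"
  shows "decays_like b \<mu> m M f Y"
proof -
  obtain g where g: "\<And>n. simple_function m (g n)" "\<And>n. {x \<in> space m. g n x \<noteq> 0} \<in> fms"
    "AE x in m. (\<lambda>n. g n x) \<longlonglongrightarrow> f x" "converges_in_probability M (\<lambda>n. I (g n)) Y"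
    using assms by (auto simp: stochastic_integral_limit_def)
  show ?thesis
  proof (rule decays_like_limit[OF levy b_nonneg _ _ _ _ g(3,4)])
    fix n k
    have G: "1 * u + (-1) * v = u - v" for u v :: real by simp
    have "decays_like b \<mu> m M (\<lambda>x. g n x - g k x) (I (\<lambda>x. g n x - g k x))"
      using simple_linear_fms[OF g(1)[of n] g(2)[of n] g(1)[of k] g(2)[of k], where c = 1 and d = "-1", unfolded G]
      by (intro decays_like_simple) blast+
    moreover have "(\<lambda>\<omega>. I (g n) \<omega> - I (g k) \<omega>) \<in> borel_measurable M"
      by (intro borel_measurable_diff simple_integral_measurable g)
    moreover have "AE \<omega> in M. I (\<lambda>x. g n x - g k x) \<omega> = I (g n) \<omega> - I (g k) \<omega>"
      using simple_integral_linear[OF g(1)[of n] g(2)[of n] g(1)[of k] g(2)[of k], where c = 1 and d = "-1", unfolded G] by simp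
    ultimately show "decays_like b \<mu> m M (\<lambda>x. g n x - g k x) (\<lambda>\<omega>. I (g n) \<omega> - I (g k) \<omega>)"
      by (rule decays_like_AE_cong)
  qed (use assms g in \<open>auto simp: stochastic_integral_limit_def intro: decays_like_simple\<close>)
qed

end

text \<open>Sets bounded away from the origin have finite measure because \<open>min 1 (x^2)\<close>
  is bounded below on them; the origin itself is a null set.\<close>

lemma levy_measure_sigma_finite:
  assumes "levy_measure \<mu>"
  shows "sigma_finite_measure \<mu>"
proof
  have s[measurable_cong]: "sets \<mu> = sets borel" and z: "emeasure \<mu> {0} = 0"
    and fin: "(\<integral>\<^sup>+x. ennreal (min 1 (x\<^sup>2)) \<partial>\<mu>) < \<infinity>"
    using assms by (simp_all add: levy_measure_def)
  let ?B = "\<lambda>n::nat. {x::real. \<bar>x\<bar> \<ge> 1 / real (Suc n)}"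
  have Bs: "?B n \<in> sets \<mu>" for n unfolding s by measurable
  have Bf: "emeasure \<mu> (?B n) < \<infinity>" for n
  proof -
    have "emeasure \<mu> (?B n) = (\<integral>\<^sup>+x. indicator (?B n) x \<partial>\<mu>)" using Bs by simp
    also have "\<dots> \<le> (\<integral>\<^sup>+x. ennreal ((real (Suc n))\<^sup>2) * ennreal (min 1 (x\<^sup>2)) \<partial>\<mu>)"
    proof (intro nn_integral_mono)
      fix x
      have "1 \<le> (real (Suc n))\<^sup>2 * min 1 (x\<^sup>2)" if "\<bar>x\<bar> \<ge> 1 / real (Suc n)"
      proof -
        have "1 \<le> real (Suc n) * \<bar>x\<bar>" using that by (simp add: field_simps)
        then have "1 \<le> (real (Suc n) * \<bar>x\<bar>)\<^sup>2" by (simp add: one_le_power)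
        moreover have "1 \<le> (real (Suc n))\<^sup>2" by (simp add: one_le_power)
        ultimately show ?thesis by (simp add: min_def power_mult_distrib)
      qed
      then show "indicator (?B n) x \<le> ennreal ((real (Suc n))\<^sup>2) * ennreal (min 1 (x\<^sup>2))"
        by (auto simp: indicator_def ennreal_mult[symmetric])
    qed
    also have "\<dots> = ennreal ((real (Suc n))\<^sup>2) * (\<integral>\<^sup>+x. ennreal (min 1 (x\<^sup>2)) \<partial>\<mu>)"
      by (intro nn_integral_cmult) measurable
    also have "\<dots> < \<infinity>" using fin by (simp add: ennreal_mult_less_top)
    finally show ?thesis .
  qed
  have "x \<in> {0} \<union> (\<Union>n. ?B n)" for x :: real
  proof (cases "x = 0")
    case False
    then obtain n where "1 / real (Suc n) < \<bar>x\<bar>" using nat_approx_posE[of "\<bar>x\<bar>"] by auto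
    then show ?thesis by (auto intro: less_imp_le)
  qed simp
  then have "\<Union> (insert {0} (range ?B)) = UNIV" by blast
  moreover have "space \<mu> = UNIV" using sets_eq_imp_space_eq[OF s] by simp
  moreover have "{0} \<in> sets \<mu>" by (simp add: s)
  ultimately show "\<exists>A. countable A \<and> A \<subseteq> sets \<mu> \<and> \<Union> A = space \<mu> \<and> (\<forall>a\<in>A. emeasure \<mu> a \<noteq> \<infinity>)"
    using Bs Bf z by (intro exI[of _ "insert {0} (range ?B)"]) (auto simp: less_top[symmetric])
qed

section \<open>Moments and characteristic functions\<close>

text \<open>For \<open>\<bar>u\<bar> \<le> 1\<close> the quadratic term of cosh dominates, which is
  where \<open>q \<ge> 2\<close> enters; for larger arguments a term of even degree at least
  \<open>q\<close> does.\<close>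

lemma abs_powr_le_cosh:
  fixes q :: real
  assumes "q \<ge> 2"
  obtains C where "C > 0" "\<And>u. \<bar>u\<bar> powr q \<le> C * (cosh u - 1)"
proof -
  define k where "k = nat \<lceil>q\<rceil>"
  have k: "q \<le> real (2 * k + 2)" unfolding k_def by linarith
  have cosh_term: "u ^ (2 * j + 2) \<le> fact (2 * j + 2) * (cosh u - 1)" for u :: real and j
  proof -
    have "u ^ (2 * j + 2) / fact (2 * j + 2) \<le> cosh u - 1"
      using cosh_partial_sum_le[of "{j}" u] by (simp only: sum.insert_if finite.intros sum.empty) simp
    then show ?thesis by (simp only: pos_divide_le_eq[OF fact_gt_zero] mult.commute)
  qed
  have "\<bar>u\<bar> powr q \<le> (2 + fact (2 * k + 2)) * (cosh u - 1)" for u :: real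
  proof (cases "\<bar>u\<bar> \<le> 1")
    case True
    have "\<bar>u\<bar> powr q \<le> \<bar>u\<bar> powr 2" using True assms by (intro powr_mono') auto
    also have "\<dots> = u\<^sup>2" by (cases "u = 0") (simp_all add: powr_numeral)
    also have "\<dots> \<le> 2 * (cosh u - 1)" using cosh_term[of u 0] by (simp add: numeral_2_eq_2)
    also have "\<dots> \<le> (2 + fact (2 * k + 2)) * (cosh u - 1)"
      by (intro mult_right_mono) (auto simp: cosh_real_ge_1)
    finally show ?thesis .
  next
    case False
    have "\<bar>u\<bar> powr q \<le> \<bar>u\<bar> powr real (2 * k + 2)" using False k by (intro powr_mono) auto
    also have "\<dots> = \<bar>u\<bar> ^ (2 * k + 2)" using False by (intro powr_realpow) auto
    also have "\<dots> = u ^ (2 * k + 2)" by (rule power_even_abs) simp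
    also have "\<dots> \<le> fact (2 * k + 2) * (cosh u - 1)" by (rule cosh_term)
    also have "\<dots> \<le> (2 + fact (2 * k + 2)) * (cosh u - 1)"
      by (intro mult_right_mono) (auto simp: cosh_real_ge_1)
    finally show ?thesis .
  qed
  then show ?thesis using that[of "2 + fact (2 * k + 2)"] by (simp add: add_pos_pos)
qed

section \<open>Symmetrization and lower bounds for moments\<close>

context prob_space
begin

text \<open>The difference of two independent copies of \<open>Y\<close>, realized on
  \<open>M \<Otimes>\<^sub>M M\<close>. Its characteristic function is the squared modulus of that
  of \<open>Y\<close>, so its law is determined by what \<open>decays_like\<close> records.\<close>

abbreviation (input) sym :: "('a \<Rightarrow> real) \<Rightarrow> 'a \<times> 'a \<Rightarrow> real" where
  "sym Y \<equiv> \<lambda>z. Y (fst z) - Y (snd z)"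

lemma integral_cos_sym:
  assumes [measurable]: "Y \<in> borel_measurable M"
  shows "(\<integral>z. cos (\<zeta> * sym Y z) \<partial>(M \<Otimes>\<^sub>M M)) = (norm (char (distr M borel Y) \<zeta>))\<^sup>2"
proof -
  interpret P: pair_prob_space M M by unfold_locales
  let ?\<phi> = "char (distr M borel Y) \<zeta>"
  have [measurable]: "cnj \<in> borel_measurable borel"
    by (intro borel_measurable_continuous_onI continuous_intros)
  have int: "integrable (M \<Otimes>\<^sub>M M) (\<lambda>(x, y). iexp (\<zeta> * Y x) * cnj (iexp (\<zeta> * Y y)))"
    by (rule P.integrable_const_bound[of _ 1]) (auto simp: norm_mult)
  have "(\<integral>z. cos (\<zeta> * sym Y z) \<partial>(M \<Otimes>\<^sub>M M)) = (\<integral>z. Re (case z of (x, y) \<Rightarrow> iexp (\<zeta> * Y x) * cnj (iexp (\<zeta> * Y y))) \<partial>(M \<Otimes>\<^sub>M M))"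
    by (intro Bochner_Integration.integral_cong) (auto simp: Re_exp Im_exp right_diff_distrib cos_diff)
  also have "\<dots> = Re (\<integral>z. (case z of (x, y) \<Rightarrow> iexp (\<zeta> * Y x) * cnj (iexp (\<zeta> * Y y))) \<partial>(M \<Otimes>\<^sub>M M))"
    by (rule integral_Re[OF int])
  also have "(\<integral>z. (case z of (x, y) \<Rightarrow> iexp (\<zeta> * Y x) * cnj (iexp (\<zeta> * Y y))) \<partial>(M \<Otimes>\<^sub>M M))
    = (\<integral>x. (\<integral>y. iexp (\<zeta> * Y x) * cnj (iexp (\<zeta> * Y y)) \<partial>M) \<partial>M)"
    using P.integral_fst[OF int] by simp
  also have "\<dots> = ?\<phi> * cnj ?\<phi>"
    by (simp add: char_distr)
  also have "\<dots> = of_real ((norm ?\<phi>)\<^sup>2)" by (rule complex_norm_square[symmetric])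
  finally show ?thesis by simp
qed

lemma integrable_cos_sym:
  assumes [measurable]: "Y \<in> borel_measurable M"
  shows "integrable (M \<Otimes>\<^sub>M M) (\<lambda>z. cos (\<zeta> * sym Y z))"
proof -
  interpret P: pair_prob_space M M by unfold_locales
  show ?thesis by (rule P.integrable_const_bound[of _ 1]) auto
qed

lemma integral_one_minus_cos_sym:
  assumes [measurable]: "Y \<in> borel_measurable M"
  shows "(\<integral>z. 1 - cos (\<zeta> * sym Y z) \<partial>(M \<Otimes>\<^sub>M M)) = 1 - (norm (char (distr M borel Y) \<zeta>))\<^sup>2"
    and "integrable (M \<Otimes>\<^sub>M M) (\<lambda>z. 1 - cos (\<zeta> * sym Y z))"
proof -
  interpret P: pair_prob_space M M by unfold_locales
  note i = integrable_cos_sym[OF assms]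
  show "integrable (M \<Otimes>\<^sub>M M) (\<lambda>z. 1 - cos (\<zeta> * sym Y z))"
    using i by (intro Bochner_Integration.integrable_diff) auto
  show "(\<integral>z. 1 - cos (\<zeta> * sym Y z) \<partial>(M \<Otimes>\<^sub>M M)) = 1 - (norm (char (distr M borel Y) \<zeta>))\<^sup>2"
    using i by (subst Bochner_Integration.integral_diff) (auto simp: integral_cos_sym P.prob_space)
qed

text \<open>The cross term vanishes for centred \<open>Y\<close>, which leaves twice the
  variance.\<close>

lemma nn_integral_sym_square:
  assumes [measurable]: "Y \<in> borel_measurable M" and int: "integrable M (\<lambda>\<omega>. (Y \<omega>)\<^sup>2)"
    and mean: "expectation Y = 0"
  shows "(\<integral>\<^sup>+z. ennreal ((sym Y z)\<^sup>2) \<partial>(M \<Otimes>\<^sub>M M)) = ennreal (2 * expectation (\<lambda>\<omega>. (Y \<omega>)\<^sup>2))"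
proof -
  let ?v = "expectation (\<lambda>\<omega>. (Y \<omega>)\<^sup>2)"
  have v: "?v \<ge> 0" by (intro Bochner_Integration.integral_nonneg) auto
  have intY: "integrable M Y" by (rule square_integrable_imp_integrable[OF _ int]) simp
  have inner: "(\<integral>\<^sup>+y. ennreal ((c - Y y)\<^sup>2) \<partial>M) = ennreal (c\<^sup>2 + ?v)" for c
  proof -
    have eq: "(c - Y y)\<^sup>2 = c\<^sup>2 + (Y y)\<^sup>2 - 2 * c * Y y" for y by (simp add: power2_diff)
    have i: "integrable M (\<lambda>y. (c - Y y)\<^sup>2)" unfolding eq using int intY by auto
    have "(\<integral>y. (c - Y y)\<^sup>2 \<partial>M) = c\<^sup>2 + ?v" unfolding eq using int intY by (simp add: mean prob_space)
    then show ?thesis using i by (subst nn_integral_eq_integral) auto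
  qed
  have "(\<integral>\<^sup>+z. ennreal ((sym Y z)\<^sup>2) \<partial>(M \<Otimes>\<^sub>M M)) = (\<integral>\<^sup>+x. \<integral>\<^sup>+y. ennreal ((Y x - Y y)\<^sup>2) \<partial>M \<partial>M)"
    by (subst nn_integral_fst[symmetric]) auto
  also have "\<dots> = (\<integral>\<^sup>+x. ennreal ((Y x)\<^sup>2 + ?v) \<partial>M)" by (simp only: inner)
  also have "\<dots> = ennreal (\<integral>x. (Y x)\<^sup>2 + ?v \<partial>M)"
    using int v by (intro nn_integral_eq_integral) auto
  also have "(\<integral>x. (Y x)\<^sup>2 + ?v \<partial>M) = 2 * ?v" using int by (simp add: prob_space)
  finally show ?thesis .
qed

lemma nn_integral_sym_powr_le:
  assumes [measurable]: "Y \<in> borel_measurable M" and "q > 0"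
  shows "(\<integral>\<^sup>+z. ennreal (\<bar>sym Y z\<bar> powr q) \<partial>(M \<Otimes>\<^sub>M M)) \<le> ennreal (2 * 2 powr q) * (\<integral>\<^sup>+\<omega>. ennreal (\<bar>Y \<omega>\<bar> powr q) \<partial>M)"
proof -
  let ?n = "\<integral>\<^sup>+\<omega>. ennreal (\<bar>Y \<omega>\<bar> powr q) \<partial>M"
  have pt: "\<bar>u - v\<bar> powr q \<le> 2 powr q * (\<bar>u\<bar> powr q + \<bar>v\<bar> powr q)" for u v :: real
  proof -
    have "\<bar>u - v\<bar> powr q \<le> (2 * max \<bar>u\<bar> \<bar>v\<bar>) powr q"
      using \<open>q > 0\<close> by (intro powr_mono2) auto
    also have "\<dots> = 2 powr q * max \<bar>u\<bar> \<bar>v\<bar> powr q" by (simp add: powr_mult)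
    also have "max \<bar>u\<bar> \<bar>v\<bar> powr q \<le> \<bar>u\<bar> powr q + \<bar>v\<bar> powr q" by (auto simp: max_def)
    finally show ?thesis by simp
  qed
  have "(\<integral>\<^sup>+z. ennreal (\<bar>sym Y z\<bar> powr q) \<partial>(M \<Otimes>\<^sub>M M))
     = (\<integral>\<^sup>+x. \<integral>\<^sup>+y. ennreal (\<bar>Y x - Y y\<bar> powr q) \<partial>M \<partial>M)"
    by (subst nn_integral_fst[symmetric]) auto
  also have "\<dots> \<le> (\<integral>\<^sup>+x. \<integral>\<^sup>+y. ennreal (2 powr q) * (ennreal (\<bar>Y x\<bar> powr q) + ennreal (\<bar>Y y\<bar> powr q)) \<partial>M \<partial>M)"
    using pt by (intro nn_integral_mono) (simp add: ennreal_mult[symmetric] ennreal_plus[symmetric] ennreal_leI del: ennreal_plus)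
  also have "\<dots> = ennreal (2 powr q) * (?n + ?n)"
    by (simp add: nn_integral_cmult nn_integral_add emeasure_space_1)
  also have "\<dots> = ennreal (2 * 2 powr q) * ?n"
  proof -
    have "ennreal (2 * 2 powr q) = 2 * ennreal (2 powr q)" by (simp add: ennreal_mult)
    then show ?thesis by (simp only: mult_2 distrib_left distrib_right)
  qed
  finally show ?thesis .
qed

text \<open>Jensen's inequality in the form of the tangent
  \<open>1 + c * y \<le> exp (c * y)\<close>.\<close>

lemma nn_integral_exp_ge_1:
  assumes [measurable]: "integrable M Y" and "expectation Y = 0"
  shows "(\<integral>\<^sup>+\<omega>. ennreal (exp (c * Y \<omega>)) \<partial>M) \<ge> 1"
proof (cases "(\<integral>\<^sup>+\<omega>. ennreal (exp (c * Y \<omega>)) \<partial>M) < \<infinity>")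
  case True
  then have i: "integrable M (\<lambda>\<omega>. exp (c * Y \<omega>))" by (intro integrableI_nonneg) auto
  have "1 = (\<integral>\<omega>. 1 + c * Y \<omega> \<partial>M)" using assms by (simp add: prob_space)
  also have "\<dots> \<le> (\<integral>\<omega>. exp (c * Y \<omega>) \<partial>M)"
    using i assms by (intro integral_mono) auto
  finally have "ennreal 1 \<le> ennreal (\<integral>\<omega>. exp (c * Y \<omega>) \<partial>M)" by (rule ennreal_leI)
  then show ?thesis using i by (subst nn_integral_eq_integral) auto
qed (simp add: not_less top_unique)

text \<open>For centred \<open>Y\<close> the two factors of \<open>E exp (c (Y - Y'))\<close> are at least \<open>1\<close>.\<close>
lemma nn_integral_cosh_le_sym:
  assumes i[measurable]: "integrable M Y" and m: "expectation Y = 0"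
  shows "(\<integral>\<^sup>+\<omega>. ennreal (cosh (c * Y \<omega>)) \<partial>M) \<le> (\<integral>\<^sup>+z. ennreal (cosh (c * sym Y z)) \<partial>(M \<Otimes>\<^sub>M M))"
proof -
  let ?A = "\<integral>\<^sup>+\<omega>. ennreal (exp (c * Y \<omega>)) \<partial>M" and ?B = "\<integral>\<^sup>+\<omega>. ennreal (exp (- c * Y \<omega>)) \<partial>M"
  have cosh_e: "ennreal (cosh u) = ennreal (1/2) * (ennreal (exp u) + ennreal (exp (- u)))" for u :: real
    by (simp add: cosh_field_def ennreal_plus[symmetric] ennreal_mult[symmetric] del: ennreal_plus ennreal_half)
  have "(\<integral>\<^sup>+z. ennreal (exp (d * sym Y z)) \<partial>(M \<Otimes>\<^sub>M M))
      = (\<integral>\<^sup>+\<omega>. ennreal (exp (d * Y \<omega>)) \<partial>M) * (\<integral>\<^sup>+\<omega>. ennreal (exp (- d * Y \<omega>)) \<partial>M)" for d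
  proof -
    have "(\<integral>\<^sup>+z. ennreal (exp (d * sym Y z)) \<partial>(M \<Otimes>\<^sub>M M))
       = (\<integral>\<^sup>+x. \<integral>\<^sup>+y. ennreal (exp (d * Y x)) * ennreal (exp (- d * Y y)) \<partial>M \<partial>M)"
      by (subst nn_integral_fst[symmetric]) (auto simp: ennreal_mult[symmetric] exp_add[symmetric] algebra_simps)
    then show ?thesis by (simp add: nn_integral_cmult nn_integral_multc)
  qed
  note e = this[of c] this[of "- c"]
  have "(\<integral>\<^sup>+z. ennreal (cosh (c * sym Y z)) \<partial>(M \<Otimes>\<^sub>M M))
     = ennreal (1/2) * ((\<integral>\<^sup>+z. ennreal (exp (c * sym Y z)) \<partial>(M \<Otimes>\<^sub>M M)) + (\<integral>\<^sup>+z. ennreal (exp (- c * sym Y z)) \<partial>(M \<Otimes>\<^sub>M M)))"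
    unfolding cosh_e by (simp add: nn_integral_cmult nn_integral_add del: ennreal_half)
  also have "\<dots> = ennreal (1/2) * (?A * ?B + ?A * ?B)" unfolding e by (simp add: mult.commute)
  finally have r: "(\<integral>\<^sup>+z. ennreal (cosh (c * sym Y z)) \<partial>(M \<Otimes>\<^sub>M M)) = ennreal (1/2) * (?A * ?B + ?A * ?B)" .
  have "(\<integral>\<^sup>+\<omega>. ennreal (cosh (c * Y \<omega>)) \<partial>M) = ennreal (1/2) * (?A + ?B)"
    unfolding cosh_e by (simp add: nn_integral_cmult nn_integral_add del: ennreal_half)
  also have "\<dots> \<le> ennreal (1/2) * (?A * ?B + ?A * ?B)"
  proof (intro mult_left_mono add_mono)
    show "?A \<le> ?A * ?B" using mult_left_mono[OF nn_integral_exp_ge_1[OF i m, of "- c"], of ?A] by simp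
    show "?B \<le> ?A * ?B" using mult_right_mono[OF nn_integral_exp_ge_1[OF i m, of c], of ?B] by simp
  qed auto
  finally show ?thesis unfolding r .
qed

text \<open>Averaging the characteristic function over a normal variable gives the mean of
  \<open>exp (- ((c * Y)^2 / 2))\<close>. The Gaussian majorant bounds this by
  \<open>1 / sqrt (1 + (s * c)^2)\<close>, while the mean is at least \<open>exp (- (1/2))\<close>
  times the probability that \<open>\<bar>Y\<bar> \<le> 1 / c\<close>.\<close>

lemma prob_small_le_half:
  assumes [measurable]: "Y \<in> borel_measurable M" and s: "s > 0"
    and char: "\<And>\<zeta>. norm (char (distr M borel Y) \<zeta>) \<le> exp (- (s\<^sup>2 * \<zeta>\<^sup>2 / 2))"
  shows "prob {\<omega> \<in> space M. \<bar>Y \<omega>\<bar> \<le> s / 4} \<le> 1 / 2"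
proof -
  \<comment> \<open>This choice yields \<open>1 / sqrt 17\<close>, and
    \<open>exp (1/2) / sqrt 17 \<le> 2 / 4\<close>.\<close>
  define c where "c = 4 / s"
  have c: "c > 0" using s by (simp add: c_def)
  interpret S: prob_space std_normal_distribution by (rule prob_space_normal_density) simp
  interpret P: pair_prob_space M std_normal_distribution by unfold_locales
  have [measurable_cong]: "sets std_normal_distribution = sets borel" by simp
  have e1: "exp (- ((c * Y \<omega>)\<^sup>2 / 2)) = (\<integral>z. cos (c * Y \<omega> * z) \<partial>std_normal_distribution)" for \<omega>
  proof -
    have "of_real (exp (- ((c * Y \<omega>)\<^sup>2) / 2)) = char std_normal_distribution (c * Y \<omega>)"
      by (simp add: char_std_normal_distribution)
    then have "exp (- ((c * Y \<omega>)\<^sup>2) / 2) = Re (char std_normal_distribution (c * Y \<omega>))"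
      by (metis Re_complex_of_real)
    also have "\<dots> = (\<integral>z. Re (iexp (c * Y \<omega> * z)) \<partial>std_normal_distribution)"
      unfolding char_def by (rule integral_Re[symmetric], rule S.integrable_const_bound[of _ 1]) auto
    finally show ?thesis by (simp add: Re_exp)
  qed
  have int: "integrable (M \<Otimes>\<^sub>M std_normal_distribution) (\<lambda>(\<omega>, z). cos (c * Y \<omega> * z))"
    by (rule P.integrable_const_bound[of _ 1]) auto
  have "(\<integral>\<omega>. exp (- ((c * Y \<omega>)\<^sup>2 / 2)) \<partial>M) = (\<integral>\<omega>. \<integral>z. cos (c * Y \<omega> * z) \<partial>std_normal_distribution \<partial>M)"
    by (simp only: e1)
  also have "\<dots> = (\<integral>z. \<integral>\<omega>. cos (c * Y \<omega> * z) \<partial>M \<partial>std_normal_distribution)"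
    by (rule P.Fubini_integral[OF int, symmetric])
  also have "\<dots> \<le> (\<integral>z. exp (- (s\<^sup>2 * (c * z)\<^sup>2 / 2)) \<partial>std_normal_distribution)"
  proof (rule integral_mono)
    show "integrable std_normal_distribution (\<lambda>z. \<integral>\<omega>. cos (c * Y \<omega> * z) \<partial>M)"
      using P.integrable_snd[OF int] by simp
    show "integrable std_normal_distribution (\<lambda>z. exp (- (s\<^sup>2 * (c * z)\<^sup>2 / 2)))"
      by (rule S.integrable_const_bound[of _ 1]) auto
    fix z
    have "(\<integral>\<omega>. cos (c * Y \<omega> * z) \<partial>M) = Re (char (distr M borel Y) (c * z))"
    proof -
      have "Re (\<integral>\<omega>. iexp (c * z * Y \<omega>) \<partial>M) = (\<integral>\<omega>. Re (iexp (c * z * Y \<omega>)) \<partial>M)"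
        by (rule integral_Re[symmetric], rule integrable_iexp_rv) simp
      then show ?thesis by (subst char_distr) (simp_all add: Re_exp ac_simps)
    qed
    also have "\<dots> \<le> norm (char (distr M borel Y) (c * z))" by (rule complex_Re_le_cmod)
    also have "\<dots> \<le> exp (- (s\<^sup>2 * (c * z)\<^sup>2 / 2))" by (rule char)
    finally show "(\<integral>\<omega>. cos (c * Y \<omega> * z) \<partial>M) \<le> exp (- (s\<^sup>2 * (c * z)\<^sup>2 / 2))" .
  qed
  also have "(\<integral>z. exp (- (s\<^sup>2 * (c * z)\<^sup>2 / 2)) \<partial>std_normal_distribution) = 1 / sqrt 17"
  proof -
    let ?d = "1 / sqrt 17 :: real"
    have "(\<integral>z. exp (- (s\<^sup>2 * (c * z)\<^sup>2 / 2)) \<partial>std_normal_distribution)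
      = (\<integral>z. std_normal_density z * exp (- (s\<^sup>2 * (c * z)\<^sup>2 / 2)) \<partial>lborel)"
      by (subst integral_density) (auto simp: normal_density_nonneg)
    also have "\<dots> = (\<integral>z. ?d * normal_density 0 ?d z \<partial>lborel)"
    proof (rule Bochner_Integration.integral_cong[OF refl])
      fix z
      have "s\<^sup>2 * (c * z)\<^sup>2 = 16 * z\<^sup>2" using s by (simp add: c_def power_mult_distrib power_divide)
      then have "std_normal_density z * exp (- (s\<^sup>2 * (c * z)\<^sup>2 / 2)) = 1 / sqrt (2 * pi) * exp (- (17 * z\<^sup>2 / 2))"
        by (simp add: std_normal_density_def exp_add[symmetric])
      also have "\<dots> = ?d * normal_density 0 ?d z"
        by (simp add: normal_density_def power_divide real_sqrt_divide)
      finally show "std_normal_density z * exp (- (s\<^sup>2 * (c * z)\<^sup>2 / 2)) = ?d * normal_density 0 ?d z" .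
    qed
    also have "\<dots> = ?d" using integral_normal_density[of ?d 0] by simp
    finally show ?thesis .
  qed
  finally have upper: "(\<integral>\<omega>. exp (- ((c * Y \<omega>)\<^sup>2 / 2)) \<partial>M) \<le> 1 / sqrt 17" .
  let ?A = "{\<omega> \<in> space M. \<bar>Y \<omega>\<bar> \<le> s / 4}"
  have "exp (- (1/2)) * prob ?A = (\<integral>\<omega>. exp (- (1/2)) * indicator ?A \<omega> \<partial>M)" by simp
  also have "\<dots> \<le> (\<integral>\<omega>. exp (- ((c * Y \<omega>)\<^sup>2 / 2)) \<partial>M)"
  proof (rule integral_mono)
    show "integrable M (\<lambda>\<omega>. exp (- ((c * Y \<omega>)\<^sup>2 / 2)))"
      by (rule integrable_const_bound[of _ 1]) auto
    fix \<omega>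
    show "exp (- (1/2)) * indicator ?A \<omega> \<le> exp (- ((c * Y \<omega>)\<^sup>2 / 2))"
    proof (cases "\<omega> \<in> ?A")
      case True
      then have "\<bar>c * Y \<omega>\<bar> \<le> 1" using s by (simp add: c_def abs_mult field_simps)
      then have "(c * Y \<omega>)\<^sup>2 \<le> 1" by (simp add: abs_square_le_1)
      then show ?thesis using True by simp
    qed simp
  qed (auto simp: emeasure_eq_measure)
  also note upper
  finally have "exp (- (1/2)) * prob ?A \<le> 1 / sqrt 17" .
  then have "prob ?A \<le> exp (1/2) / sqrt 17" by (simp add: exp_minus field_simps)
  also have "\<dots> \<le> 2 / 4"
  proof (intro frac_le)
    have "(exp (1/2 :: real))\<^sup>2 \<le> 2\<^sup>2" using exp_le by (simp add: power2_eq_square exp_add[symmetric])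
    then show "exp (1/2) \<le> (2::real)" by (rule power2_le_imp_le) simp
    show "4 \<le> sqrt 17" by (rule real_le_rsqrt) simp
  qed auto
  finally show ?thesis by simp
qed

lemma moment_lower_of_char:
  assumes Y[measurable]: "Y \<in> borel_measurable M" and s: "s > 0" and "q > 0"
    and char: "\<And>\<zeta>. norm (char (distr M borel Y) \<zeta>) \<le> exp (- (s\<^sup>2 * \<zeta>\<^sup>2 / 2))"
    and int: "integrable M (\<lambda>\<omega>. \<bar>Y \<omega>\<bar> powr q)"
  shows "(s / 4) powr q / 2 \<le> expectation (\<lambda>\<omega>. \<bar>Y \<omega>\<bar> powr q)"
proof -
  let ?A = "{\<omega> \<in> space M. \<bar>Y \<omega>\<bar> \<le> s / 4}"
  have "prob (space M - ?A) = 1 - prob ?A" by (rule prob_compl) measurable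
  then have "1 / 2 \<le> prob (space M - ?A)" using prob_small_le_half[OF Y s char] by simp
  then have "(s / 4) powr q / 2 \<le> (s / 4) powr q * prob (space M - ?A)"
    using mult_left_mono[of "1/2" "prob (space M - ?A)" "(s / 4) powr q"] by simp
  also have "\<dots> = (\<integral>\<omega>. (s / 4) powr q * indicator (space M - ?A) \<omega> \<partial>M)" by simp
  also have "\<dots> \<le> expectation (\<lambda>\<omega>. \<bar>Y \<omega>\<bar> powr q)"
  proof (rule integral_mono)
    show "integrable M (\<lambda>\<omega>. (s / 4) powr q * indicator (space M - ?A) \<omega>)"
      by (intro integrable_mult_right integrable_real_indicator) (auto simp: emeasure_eq_measure)
    show "(s / 4) powr q * indicator (space M - ?A) \<omega> \<le> \<bar>Y \<omega>\<bar> powr q" for \<omega>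
      using s \<open>q > 0\<close> by (auto simp: indicator_def intro!: powr_mono2)
  qed (rule int)
  finally show ?thesis .
qed

end

section \<open>Moment bounds from the modulus of the characteristic function\<close>

locale decay_setup = prob_space M + m: sigma_finite_measure m
  for M :: "'a measure" and m :: "'b measure" +
  fixes b :: real and \<mu> :: "real measure"
  assumes b: "b > 0" and levy: "levy_measure \<mu>"
begin

sublocale \<mu>: sigma_finite_measure \<mu> by (rule levy_measure_sigma_finite[OF levy])
sublocale mp: pair_sigma_finite m \<mu> ..

lemma sets_\<mu> [measurable_cong]: "sets \<mu> = sets borel"
  using levy by (simp add: levy_measure_def)

abbreviation "decay \<equiv> decays_like b \<mu> m M"

lemma decayD:
  assumes "decay f Y"
  shows "f \<in> borel_measurable m" "Y \<in> borel_measurable M"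
    "integrable m (\<lambda>x. lk_decay b \<mu> (\<zeta> * f x))"
    "norm (char (distr M borel Y) \<zeta>) = exp (- (\<integral>x. lk_decay b \<mu> (\<zeta> * f x) \<partial>m))"
  using assms by (auto simp: decays_like_def)

text \<open>The Gaussian component alone bounds the decay below by \<open>b / 2\<close> times the
  square, and \<open>b > 0\<close>.\<close>

lemma decay_square_integrable:
  assumes "decay f Y"
  shows "integrable m (\<lambda>x. (f x)\<^sup>2)"
proof -
  note [measurable] = decayD(1)[OF assms]
  have "integrable m (\<lambda>x. b / 2 * (f x)\<^sup>2)"
  proof (rule Bochner_Integration.integrable_bound[OF decayD(3)[OF assms, of 1]])
    show "AE x in m. norm (b / 2 * (f x)\<^sup>2) \<le> norm (lk_decay b \<mu> (1 * f x))"
      using lk_decay_ge[of b _ \<mu>] lk_decay_nonneg[of b \<mu>] b by (auto intro!: AE_I2)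
  qed measurable
  then have "integrable m (\<lambda>x. 2 / b * (b / 2 * (f x)\<^sup>2))" by (rule integrable_mult_right)
  then show ?thesis using b by simp
qed

lemma decay_char_le:
  assumes "decay f Y"
  shows "norm (char (distr M borel Y) \<zeta>) \<le> exp (- (b * (\<integral>x. (f x)\<^sup>2 \<partial>m) * \<zeta>\<^sup>2 / 2))"
proof -
  have "b * (\<integral>x. (f x)\<^sup>2 \<partial>m) * \<zeta>\<^sup>2 / 2 = (\<integral>x. b * (\<zeta> * f x)\<^sup>2 / 2 \<partial>m)"
    by (simp add: power_mult_distrib)
  also have "\<dots> \<le> (\<integral>x. lk_decay b \<mu> (\<zeta> * f x) \<partial>m)"
    using decay_square_integrable[OF assms] decayD(3)[OF assms]
    by (intro integral_mono lk_decay_ge) (auto simp: power_mult_distrib)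
  finally show ?thesis by (simp add: decayD(4)[OF assms])
qed

text \<open>Removing the Gaussian term from the exponent leaves a cosine transform of
  \<open>x * f z\<close> under \<open>m \<Otimes>\<^sub>M \<mu>\<close>, so that the results on
  analytic cosine transforms apply to the jumps.\<close>

lemma decay_cos_product:
  assumes f: "decay f Y"
  shows "integrable (m \<Otimes>\<^sub>M \<mu>) (\<lambda>z. 1 - cos (\<zeta> * (snd z * f (fst z))))"
    and "(\<integral>z. 1 - cos (\<zeta> * (snd z * f (fst z))) \<partial>(m \<Otimes>\<^sub>M \<mu>))
      = (\<integral>x. lk_decay b \<mu> (\<zeta> * f x) \<partial>m) - b * \<zeta>\<^sup>2 / 2 * (\<integral>x. (f x)\<^sup>2 \<partial>m)"
proof -
  note [measurable] = decayD(1)[OF f]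
  let ?g = "\<lambda>z. 1 - cos (\<zeta> * (snd z * f (fst z)))"
  have inner: "(\<integral>x. ?g (z, x) \<partial>\<mu>) = lk_decay b \<mu> (\<zeta> * f z) - b * \<zeta>\<^sup>2 / 2 * (f z)\<^sup>2" for z
    by (simp add: lk_decay_def power_mult_distrib ac_simps)
  have ii: "integrable \<mu> (\<lambda>x. ?g (z, x))" for z
    using levy_measure_integrable_cos[OF levy, of "\<zeta> * f z"] by (simp add: ac_simps)
  have io: "integrable m (\<lambda>z. \<integral>x. ?g (z, x) \<partial>\<mu>)"
    unfolding inner using decayD(3)[OF f] decay_square_integrable[OF f] by auto
  show i: "integrable (m \<Otimes>\<^sub>M \<mu>) ?g"
  proof (rule mp.Fubini_integrable)
    show "integrable m (\<lambda>x. \<integral>y. norm (?g (x, y)) \<partial>\<mu>)" using io by simp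
  qed (use ii in auto)
  have "(\<integral>z. ?g z \<partial>(m \<Otimes>\<^sub>M \<mu>)) = (\<integral>z. \<integral>x. ?g (z, x) \<partial>\<mu> \<partial>m)"
    by (rule mp.integral_fst'[OF i, symmetric])
  also have "\<dots> = (\<integral>z. lk_decay b \<mu> (\<zeta> * f z) - b * \<zeta>\<^sup>2 / 2 * (f z)\<^sup>2 \<partial>m)"
    by (simp only: inner)
  also have "\<dots> = (\<integral>x. lk_decay b \<mu> (\<zeta> * f x) \<partial>m) - b * \<zeta>\<^sup>2 / 2 * (\<integral>x. (f x)\<^sup>2 \<partial>m)"
    using decayD(3)[OF f] decay_square_integrable[OF f] by (subst Bochner_Integration.integral_diff) auto
  finally show "(\<integral>z. ?g z \<partial>(m \<Otimes>\<^sub>M \<mu>))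
      = (\<integral>x. lk_decay b \<mu> (\<zeta> * f x) \<partial>m) - b * \<zeta>\<^sup>2 / 2 * (\<integral>x. (f x)\<^sup>2 \<partial>m)" .
qed

text \<open>The cosh moment of the jumps extends their exponent to a holomorphic \<open>H\<close>,
  and with it the squared modulus to an exponential. Its values at imaginary points give the cosh
  moment of the symmetrized variable exactly, and centring bounds that of \<open>Y\<close> by it.
  The gap between \<theta> and \<open>R\<close> keeps the imaginary points inside the disc.\<close>

lemma decay_cosh_upper:
  assumes f: "decay f Y" and i: "integrable M Y" and mean: "expectation Y = 0"
    and \<theta>: "0 < \<theta>" "\<theta> < R"
    and fin: "(\<integral>\<^sup>+z. ennreal (cosh (R * (snd z * f (fst z))) - 1) \<partial>(m \<Otimes>\<^sub>M \<mu>)) < \<infinity>"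
  shows "(\<integral>\<^sup>+\<omega>. ennreal (cosh (\<theta> * Y \<omega>)) \<partial>M)
    \<le> ennreal (exp (b * \<theta>\<^sup>2 * (\<integral>x. (f x)\<^sup>2 \<partial>m) + 2 * (\<integral>z. cosh (\<theta> * (snd z * f (fst z))) - 1 \<partial>(m \<Otimes>\<^sub>M \<mu>))))"
proof -
  note [measurable] = decayD(1,2)[OF f]
  interpret P: pair_prob_space M M by unfold_locales
  have "R > 0" using \<theta> by simp
  have meas: "(\<lambda>z. snd z * f (fst z)) \<in> borel_measurable (m \<Otimes>\<^sub>M \<mu>)" by measurable
  show ?thesis
  proof (rule holomorphic_of_cosh_moment[OF meas \<open>R > 0\<close> fin])
  fix H assume H: "H holomorphic_on ball 0 R"
    "\<And>\<zeta>. \<bar>\<zeta>\<bar> < R \<Longrightarrow> integrable (m \<Otimes>\<^sub>M \<mu>) (\<lambda>z. 1 - cos (\<zeta> * (snd z * f (fst z))))"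
    "\<And>\<zeta>. \<bar>\<zeta>\<bar> < R \<Longrightarrow> H (of_real \<zeta>) = of_real (\<integral>z. 1 - cos (\<zeta> * (snd z * f (fst z))) \<partial>(m \<Otimes>\<^sub>M \<mu>))"
    "\<And>\<theta>. \<bar>\<theta>\<bar> < R \<Longrightarrow> integrable (m \<Otimes>\<^sub>M \<mu>) (\<lambda>z. cosh (\<theta> * (snd z * f (fst z))) - 1)"
    "\<And>\<theta>. \<bar>\<theta>\<bar> < R \<Longrightarrow> H (\<i> * of_real \<theta>) = - of_real (\<integral>z. cosh (\<theta> * (snd z * f (fst z))) - 1 \<partial>(m \<Otimes>\<^sub>M \<mu>))"
  define s where "s = (\<integral>x. (f x)\<^sup>2 \<partial>m)"
  define C where "C = (\<integral>z. cosh (\<theta> * (snd z * f (fst z))) - 1 \<partial>(m \<Otimes>\<^sub>M \<mu>))"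
  \<comment> \<open>Squaring the modulus doubles the exponent: \<open>2 * H\<close> for the jumps
    and \<open>b * s * z^2\<close> for the Gaussian part.\<close>
  define G where "G z = 1 - exp (- (2 * H z) - of_real (b * s) * z\<^sup>2)" for z
  have Gh: "G holomorphic_on ball 0 R"
    unfolding G_def by (intro holomorphic_intros H(1))
  have Geq: "(\<integral>z. 1 - cos (\<zeta> * sym Y z) \<partial>(M \<Otimes>\<^sub>M M)) = Re (G (of_real \<zeta>))" if "\<bar>\<zeta>\<bar> < R" for \<zeta>
  proof -
    let ?Q = "\<integral>x. lk_decay b \<mu> (\<zeta> * f x) \<partial>m"
    have "- (2 * H (of_real \<zeta>)) - of_real (b * s) * (of_real \<zeta>)\<^sup>2 = of_real (- 2 * ?Q)"
      unfolding H(3)[OF that] decay_cos_product(2)[OF f] s_def[symmetric] by (simp add: algebra_simps)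
    then have "G (of_real \<zeta>) = of_real (1 - exp (- 2 * ?Q))"
      unfolding G_def by (simp only: exp_of_real of_real_diff of_real_1)
    moreover have "(norm (char (distr M borel Y) \<zeta>))\<^sup>2 = exp (- 2 * ?Q)"
      unfolding decayD(4)[OF f] by (simp add: power2_eq_square exp_add[symmetric])
    ultimately show ?thesis by (simp add: integral_one_minus_cos_sym)
  qed
  have "(\<integral>\<^sup>+z. ennreal (cosh (\<theta> * sym Y z) - 1) \<partial>(M \<Otimes>\<^sub>M M))
    = ennreal (- Re (G (\<i> * of_real \<theta>) + G (- (\<i> * of_real \<theta>))) / 2)"
    by (rule cosh_moment_of_holomorphic[OF _ Gh \<theta> integral_one_minus_cos_sym(2) Geq]) auto
  also have "- Re (G (\<i> * of_real \<theta>) + G (- (\<i> * of_real \<theta>))) / 2 = exp (2 * C + b * s * \<theta>\<^sup>2) - 1"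
  proof -
    have "H (\<i> * of_real \<theta>) = - of_real C" using H(5)[of \<theta>] \<theta> by (simp add: C_def)
    moreover have "H (- (\<i> * of_real \<theta>)) = - of_real C"
      using H(5)[of "- \<theta>"] \<theta> by (simp add: C_def)
    ultimately have "G (\<i> * of_real \<theta>) = of_real (1 - exp (2 * C + b * s * \<theta>\<^sup>2))"
      "G (- (\<i> * of_real \<theta>)) = of_real (1 - exp (2 * C + b * s * \<theta>\<^sup>2))"
      unfolding G_def by (simp_all add: power_mult_distrib exp_of_real flip: exp_of_real)
    then show ?thesis by simp
  qed
  finally have e: "(\<integral>\<^sup>+z. ennreal (cosh (\<theta> * sym Y z) - 1) \<partial>(M \<Otimes>\<^sub>M M)) = ennreal (exp (2 * C + b * s * \<theta>\<^sup>2) - 1)" .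
  have C0: "C \<ge> 0" unfolding C_def by (intro Bochner_Integration.integral_nonneg) (simp add: cosh_real_ge_1)
  have s0: "s \<ge> 0" unfolding s_def by (intro Bochner_Integration.integral_nonneg) simp
  have "(\<integral>\<^sup>+z. ennreal (cosh (\<theta> * sym Y z)) \<partial>(M \<Otimes>\<^sub>M M)) = (\<integral>\<^sup>+z. 1 + ennreal (cosh (\<theta> * sym Y z) - 1) \<partial>(M \<Otimes>\<^sub>M M))"
    by (intro nn_integral_cong) (simp add: cosh_real_ge_1 flip: ennreal_1 ennreal_plus)
  also have "\<dots> = 1 + ennreal (exp (2 * C + b * s * \<theta>\<^sup>2) - 1)"
    by (subst nn_integral_add) (auto simp: e P.emeasure_space_1)
  also have "\<dots> = ennreal (exp (2 * C + b * s * \<theta>\<^sup>2))"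
    using C0 s0 b by (simp flip: ennreal_1 ennreal_plus)
  finally have "(\<integral>\<^sup>+\<omega>. ennreal (cosh (\<theta> * Y \<omega>)) \<partial>M) \<le> ennreal (exp (2 * C + b * s * \<theta>\<^sup>2))"
    using nn_integral_cosh_le_sym[OF i mean, of \<theta>] by simp
  then show ?thesis by (simp add: C_def s_def ac_simps)
  qed
qed

lemma lk_decay_le_square:
  assumes v: "integrable \<mu> (\<lambda>x. x\<^sup>2)"
  shows "lk_decay b \<mu> u \<le> (b + (\<integral>x. x\<^sup>2 \<partial>\<mu>)) * u\<^sup>2 / 2"
proof -
  have "(\<integral>x. 1 - cos (u * x) \<partial>\<mu>) \<le> (\<integral>x. u\<^sup>2 / 2 * x\<^sup>2 \<partial>\<mu>)"
  proof (rule integral_mono)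
    show "1 - cos (u * x) \<le> u\<^sup>2 / 2 * x\<^sup>2" for x
      using one_minus_cos_le[of "u * x"] by (simp add: power_mult_distrib)
  qed (use v levy_measure_integrable_cos[OF levy] in auto)
  then show ?thesis by (simp add: lk_decay_def algebra_simps add_divide_distrib)
qed

lemma decay_integral_le:
  assumes f: "decay f Y" and v: "integrable \<mu> (\<lambda>x. x\<^sup>2)"
  shows "(\<integral>x. lk_decay b \<mu> (\<zeta> * f x) \<partial>m) \<le> (b + (\<integral>x. x\<^sup>2 \<partial>\<mu>)) * \<zeta>\<^sup>2 / 2 * (\<integral>x. (f x)\<^sup>2 \<partial>m)"
proof -
  have "(\<integral>x. lk_decay b \<mu> (\<zeta> * f x) \<partial>m) \<le> (\<integral>x. (b + (\<integral>x. x\<^sup>2 \<partial>\<mu>)) * \<zeta>\<^sup>2 / 2 * (f x)\<^sup>2 \<partial>m)"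
  proof (rule integral_mono)
    show "lk_decay b \<mu> (\<zeta> * f x) \<le> (b + (\<integral>x. x\<^sup>2 \<partial>\<mu>)) * \<zeta>\<^sup>2 / 2 * (f x)\<^sup>2" for x
      using lk_decay_le_square[OF v, of "\<zeta> * f x"] by (simp add: power_mult_distrib)
  qed (use decayD(3)[OF f] decay_square_integrable[OF f] in auto)
  then show ?thesis by simp
qed

text \<open>Fatou's lemma is applied to the second difference quotients of the squared modulus at 0.
  Symmetrization puts the same factor 2 on both sides.\<close>

lemma decay_second_moment_le:
  assumes f: "decay f Y" and v: "integrable \<mu> (\<lambda>x. x\<^sup>2)"
    and int: "integrable M (\<lambda>\<omega>. (Y \<omega>)\<^sup>2)" and mean: "expectation Y = 0"
  shows "expectation (\<lambda>\<omega>. (Y \<omega>)\<^sup>2) \<le> (b + (\<integral>x. x\<^sup>2 \<partial>\<mu>)) * (\<integral>x. (f x)\<^sup>2 \<partial>m)"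
proof -
  note [measurable] = decayD(1,2)[OF f]
  let ?K = "(b + (\<integral>x. x\<^sup>2 \<partial>\<mu>)) * (\<integral>x. (f x)\<^sup>2 \<partial>m)"
  have "?K \<ge> 0" using b by (intro mult_nonneg_nonneg add_nonneg_nonneg Bochner_Integration.integral_nonneg) auto
  define h where "h n = 1 / real (Suc n)" for n
  have h: "h \<longlonglongrightarrow> 0" "\<And>n. h n \<noteq> 0" "\<And>n. h n > 0"
    unfolding h_def by (rule LIMSEQ_Suc[OF lim_const_over_n]) auto
  have le: "(\<integral>\<^sup>+z. ennreal (2 * (1 - cos (h n * sym Y z)) / (h n)\<^sup>2) \<partial>(M \<Otimes>\<^sub>M M)) \<le> ennreal (2 * ?K)" for n
  proof -
    let ?Q = "\<integral>x. lk_decay b \<mu> (h n * f x) \<partial>m"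
    have "(\<integral>\<^sup>+z. ennreal (2 * (1 - cos (h n * sym Y z)) / (h n)\<^sup>2) \<partial>(M \<Otimes>\<^sub>M M))
      = ennreal (\<integral>z. 2 / (h n)\<^sup>2 * (1 - cos (h n * sym Y z)) \<partial>(M \<Otimes>\<^sub>M M))"
    proof -
      have e: "2 * u / (h n)\<^sup>2 = 2 / (h n)\<^sup>2 * u" for u by simp
      show ?thesis unfolding e
        by (intro nn_integral_eq_integral integrable_mult_right integral_one_minus_cos_sym(2)) auto
    qed
    also have "(\<integral>z. 2 / (h n)\<^sup>2 * (1 - cos (h n * sym Y z)) \<partial>(M \<Otimes>\<^sub>M M)) = 2 / (h n)\<^sup>2 * (1 - (norm (char (distr M borel Y) (h n)))\<^sup>2)"
      by (subst integral_mult_right_zero) (simp add: integral_one_minus_cos_sym(1))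
    also have "(norm (char (distr M borel Y) (h n)))\<^sup>2 = exp (- 2 * ?Q)"
      unfolding decayD(4)[OF f] by (simp add: power2_eq_square exp_add[symmetric])
    also have "2 / (h n)\<^sup>2 * (1 - exp (- 2 * ?Q)) \<le> 2 / (h n)\<^sup>2 * (2 * ?Q)"
      using exp_ge_add_one_self[of "- 2 * ?Q"] by (intro mult_left_mono) auto
    also have "\<dots> \<le> 2 / (h n)\<^sup>2 * (2 * ((b + (\<integral>x. x\<^sup>2 \<partial>\<mu>)) * (h n)\<^sup>2 / 2 * (\<integral>x. (f x)\<^sup>2 \<partial>m)))"
      by (intro mult_left_mono decay_integral_le[OF f v]) auto
    also have "\<dots> = 2 * ?K" using h(2)[of n] by simp
    finally show ?thesis by (simp add: ennreal_leI)
  qed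
  have "ennreal (2 * expectation (\<lambda>\<omega>. (Y \<omega>)\<^sup>2)) = (\<integral>\<^sup>+z. ennreal ((sym Y z)\<^sup>2) \<partial>(M \<Otimes>\<^sub>M M))"
    by (rule nn_integral_sym_square[OF _ int mean, symmetric]) simp
  also have "\<dots> = (\<integral>\<^sup>+z. liminf (\<lambda>n. ennreal (2 * (1 - cos (h n * sym Y z)) / (h n)\<^sup>2)) \<partial>(M \<Otimes>\<^sub>M M))"
    by (intro nn_integral_cong lim_imp_Liminf[symmetric] tendsto_ennrealI tendsto_second_difference_cos h) auto
  also have "\<dots> \<le> liminf (\<lambda>n. \<integral>\<^sup>+z. ennreal (2 * (1 - cos (h n * sym Y z)) / (h n)\<^sup>2) \<partial>(M \<Otimes>\<^sub>M M))"
    by (rule nn_integral_liminf) measurable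
  also have "\<dots> \<le> ennreal (2 * ?K)" using le by (intro Liminf_le) auto
  finally show ?thesis using \<open>?K \<ge> 0\<close> by (simp add: ennreal_le_iff)
qed

text \<open>The test function is a combination of cosines at \<zeta> and \<open>2 * \<zeta>\<close>,
  so its symmetrized mean is \<open>3 / 2 - 2 * exp (- x) + exp (- y) / 2\<close>. To first order
  this is \<open>2 * x - y / 2\<close>, the integral of four times the decay at
  \<open>\<zeta> * f\<close> minus the decay at \<open>2 * \<zeta> * f\<close>; there the Gaussian
  parts cancel and each jump leaves \<open>2 * (1 - cos)^2\<close>. The lower bounds for the
  exponentials lose at most \<open>x^2\<close>.\<close>

lemma decay_fourth_lower:
  assumes f: "decay f Y" and v: "integrable \<mu> (\<lambda>x. x\<^sup>2)"
    and A: "A \<in> sets m" and \<kappa>: "\<kappa> \<ge> 0"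
    and low: "\<And>x. x \<in> A \<Longrightarrow> \<kappa> \<le> 4 * lk_decay b \<mu> (\<zeta> * f x) - lk_decay b \<mu> (2 * (\<zeta> * f x))"
  shows "\<kappa> * measure m A - ((b + (\<integral>x. x\<^sup>2 \<partial>\<mu>)) * \<zeta>\<^sup>2 * (\<integral>x. (f x)\<^sup>2 \<partial>m))\<^sup>2
    \<le> (\<integral>z. (1 - cos (\<zeta> * sym Y z))\<^sup>2 \<partial>(M \<Otimes>\<^sub>M M))"
proof -
  interpret P: pair_prob_space M M by unfold_locales
  note [measurable] = decayD(1,2)[OF f]
  let ?\<psi> = "lk_decay b \<mu>"
  define x where "x = 2 * (\<integral>x. ?\<psi> (\<zeta> * f x) \<partial>m)"
  define y where "y = 2 * (\<integral>x. ?\<psi> (2 * \<zeta> * f x) \<partial>m)"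
  have x0: "x \<ge> 0" unfolding x_def using b by (intro mult_nonneg_nonneg Bochner_Integration.integral_nonneg lk_decay_nonneg) auto
  have eq: "(1 - cos (\<zeta> * sym Y z))\<^sup>2 = 3 / 2 - 2 * cos (\<zeta> * sym Y z) + 1 / 2 * cos (2 * \<zeta> * sym Y z)" for z
  proof -
    have "cos (2 * \<zeta> * sym Y z) = 2 * (cos (\<zeta> * sym Y z))\<^sup>2 - 1"
      using cos_double_cos[of "\<zeta> * sym Y z"] by (simp add: mult.assoc)
    then show ?thesis by (simp add: power2_diff field_simps)
  qed
  have "(\<integral>z. (1 - cos (\<zeta> * sym Y z))\<^sup>2 \<partial>(M \<Otimes>\<^sub>M M)) = 3 / 2 - 2 * exp (- x) + 1 / 2 * exp (- y)"
    unfolding eq x_def y_def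
    using integrable_cos_sym[of Y \<zeta>] integrable_cos_sym[of Y "2 * \<zeta>"]
    by (simp add: integral_cos_sym P.prob_space decayD(4)[OF f] power2_eq_square exp_add[symmetric])
  moreover have "exp (- x) \<le> 1 - x + x\<^sup>2 / 2"
  proof -
    \<comment> \<open>A product identity replaces a Taylor remainder: the polynomial times
      \<open>1 + x + x^2 / 2\<close> is \<open>1 + x^4 / 4\<close>, and for \<open>x \<ge> 0\<close>
      the second factor is at most \<open>exp x\<close>.\<close>
    have "1 \<le> 1 + x ^ 4 / 4" by simp
    also have "\<dots> = (1 - x + x\<^sup>2 / 2) * (1 + x + x\<^sup>2 / 2)"
      by (simp add: algebra_simps power2_eq_square power4_eq_xxxx)
    also have "\<dots> \<le> (1 - x + x\<^sup>2 / 2) * exp x"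
    proof (intro mult_left_mono exp_lower_Taylor_quadratic x0)
      have "1 - x + x\<^sup>2 / 2 = ((1 - x)\<^sup>2 + 1) / 2" by (simp add: power2_diff)
      moreover have "0 \<le> ((1 - x)\<^sup>2 + 1) / 2" by simp
      ultimately show "0 \<le> 1 - x + x\<^sup>2 / 2" by (simp only:)
    qed
    finally show ?thesis by (simp add: exp_minus field_simps)
  qed
  moreover have "exp (- y) \<ge> 1 - y" using exp_ge_add_one_self[of "- y"] by simp
  ultimately have 1: "2 * x - y / 2 - x\<^sup>2 \<le> (\<integral>z. (1 - cos (\<zeta> * sym Y z))\<^sup>2 \<partial>(M \<Otimes>\<^sub>M M))" by argo
  \<comment> \<open>On \<open>A\<close> four times the integrable decay is at least \<kappa>, so a
    positive \<kappa> forces \<open>A\<close> to have finite measure.\<close>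
  have fin: "emeasure m A < \<infinity>" if "\<kappa> > 0"
  proof -
    have "(\<integral>\<^sup>+x. ennreal \<kappa> * indicator A x \<partial>m) \<le> (\<integral>\<^sup>+x. ennreal (4 * ?\<psi> (\<zeta> * f x)) \<partial>m)"
    proof (intro nn_integral_mono)
      fix x
      show "ennreal \<kappa> * indicator A x \<le> ennreal (4 * ?\<psi> (\<zeta> * f x))"
        using low[of x] lk_decay_nonneg[of b \<mu> "2 * (\<zeta> * f x)"] b by (auto simp: indicator_def intro!: ennreal_leI)
    qed
    also have "\<dots> < \<infinity>" using decayD(3)[OF f, of \<zeta>] lk_decay_nonneg[of b \<mu>] b
      by (subst nn_integral_eq_integral) auto
    finally show ?thesis using that A by (auto simp: nn_integral_cmult_indicator ennreal_mult_less_top)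
  qed
  have sq: "4 * ?\<psi> u - ?\<psi> (2 * u) \<ge> 0" for u
  proof -
    have "4 * ?\<psi> u - ?\<psi> (2 * u) = (\<integral>x. 4 * (1 - cos (u * x)) - (1 - cos (2 * u * x)) \<partial>\<mu>)"
    proof -
      note i = levy_measure_integrable_cos[OF levy]
      have "(\<integral>x. 4 * (1 - cos (u * x)) - (1 - cos (2 * u * x)) \<partial>\<mu>)
          = 4 * (\<integral>x. 1 - cos (u * x) \<partial>\<mu>) - (\<integral>x. 1 - cos (2 * u * x) \<partial>\<mu>)"
        by (subst Bochner_Integration.integral_diff[OF integrable_mult_right[OF i] i]) (simp only: integral_mult_right_zero)
      then show ?thesis by (simp only: lk_decay_def) (simp add: power_mult_distrib)
    qed
    also have "\<dots> \<ge> 0"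
    proof (intro Bochner_Integration.integral_nonneg)
      fix x
      have "4 * (1 - cos (u * x)) - (1 - cos (2 * u * x)) = 2 * (1 - cos (u * x))\<^sup>2"
        using cos_double_cos[of "u * x"] by (simp add: power2_diff mult.assoc)
      then show "4 * (1 - cos (u * x)) - (1 - cos (2 * u * x)) \<ge> 0" by simp
    qed
    finally show ?thesis .
  qed
  have "\<kappa> * measure m A \<le> (\<integral>x. 4 * ?\<psi> (\<zeta> * f x) - ?\<psi> (2 * \<zeta> * f x) \<partial>m)"
  proof (cases "\<kappa> = 0")
    case True
    then show ?thesis using sq by (auto intro!: Bochner_Integration.integral_nonneg simp: mult.assoc)
  next
    case False
    have "\<kappa> * measure m A = (\<integral>x. \<kappa> * indicator A x \<partial>m)" using A by simp
    also have "\<dots> \<le> (\<integral>x. 4 * ?\<psi> (\<zeta> * f x) - ?\<psi> (2 * \<zeta> * f x) \<partial>m)"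
    proof (rule integral_mono)
      show "integrable m (\<lambda>x. \<kappa> * indicator A x)" using fin False \<kappa> A by auto
      show "integrable m (\<lambda>x. 4 * ?\<psi> (\<zeta> * f x) - ?\<psi> (2 * \<zeta> * f x))"
        using decayD(3)[OF f, of \<zeta>] decayD(3)[OF f, of "2 * \<zeta>"] by auto
      show "\<kappa> * indicator A x \<le> 4 * ?\<psi> (\<zeta> * f x) - ?\<psi> (2 * \<zeta> * f x)" for x
        using low[of x] sq[of "\<zeta> * f x"] by (auto simp: indicator_def mult.assoc)
    qed
    finally show ?thesis .
  qed
  also have "\<dots> = 2 * x - y / 2"
    unfolding x_def y_def using decayD(3)[OF f, of \<zeta>] decayD(3)[OF f, of "2 * \<zeta>"] by simp
  finally have 2: "\<kappa> * measure m A \<le> 2 * x - y / 2" .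
  have "x \<le> (b + (\<integral>x. x\<^sup>2 \<partial>\<mu>)) * \<zeta>\<^sup>2 * (\<integral>x. (f x)\<^sup>2 \<partial>m)"
    unfolding x_def using decay_integral_le[OF f v, of \<zeta>] by simp
  then have "x\<^sup>2 \<le> ((b + (\<integral>x. x\<^sup>2 \<partial>\<mu>)) * \<zeta>\<^sup>2 * (\<integral>x. (f x)\<^sup>2 \<partial>m))\<^sup>2"
    using x0 by (intro power_mono) auto
  then show ?thesis using 1 2 by linarith
qed

text \<open>
  Analyticity of \<open>\<kappa>\<close> makes the decay exponent of \<open>Y\<close>, a cosine transform of the jumps, the real part
  of a holomorphic function near the origin.
\<close>
lemma decay_analytic_cosh_moment:
  assumes f: "decay f Y" and \<kappa>: "is_cumulant_function M Y \<kappa>" "analytic_near_origin \<kappa>"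
    and A: "A \<in> sets m" "emeasure m A \<noteq> 0" and \<delta>: "\<delta> > 0" "\<And>x. x \<in> A \<Longrightarrow> \<delta> \<le> f x"
  obtains c where "c > 0" "(\<integral>\<^sup>+x. ennreal (cosh (c * x) - 1) \<partial>\<mu>) < \<infinity>"
proof -
  note [measurable] = decayD(1,2)[OF f] A(1)
  obtain K where K: "K analytic_on {0}" "\<forall>\<^sub>F \<zeta> in nhds 0. K (of_real \<zeta>) = \<kappa> \<zeta>"
    using \<kappa>(2) by (auto simp: analytic_near_origin_def)
  obtain e1 where e1: "e1 > 0" "K holomorphic_on ball 0 e1" using K(1) by (auto simp: analytic_on_def)
  obtain e2 where e2: "e2 > 0" "\<And>\<zeta>. \<bar>\<zeta>\<bar> < e2 \<Longrightarrow> K (of_real \<zeta>) = \<kappa> \<zeta>"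
    using K(2) by (auto simp: eventually_nhds_metric dist_real_def)
  define R where "R = min e1 e2"
  have R: "R > 0" "R \<le> e1" "R \<le> e2" using e1 e2 by (auto simp: R_def)
  define s where "s = (\<integral>x. (f x)\<^sup>2 \<partial>m)"
  \<comment> \<open>On the real axis \<open>- K\<close> has the decay exponent of \<open>Y\<close>
    as its real part; subtracting the Gaussian quadratic leaves the jumps.\<close>
  define G where "G z = - K z - of_real (b / 2 * s) * z\<^sup>2" for z
  have G: "G holomorphic_on ball 0 R"
    unfolding G_def using R by (intro holomorphic_intros holomorphic_on_subset[OF e1(2)]) auto
  have Geq: "(\<integral>z. 1 - cos (\<zeta> * (snd z * f (fst z))) \<partial>(m \<Otimes>\<^sub>M \<mu>)) = Re (G (of_real \<zeta>))" if "\<bar>\<zeta>\<bar> < R" for \<zeta>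
  proof -
    have "exp (\<kappa> \<zeta>) = char (distr M borel Y) \<zeta>" using \<kappa>(1) by (simp add: is_cumulant_function_def)
    then have "exp (Re (\<kappa> \<zeta>)) = norm (char (distr M borel Y) \<zeta>)" by (metis norm_exp_eq_Re)
    then have "Re (\<kappa> \<zeta>) = - (\<integral>x. lk_decay b \<mu> (\<zeta> * f x) \<partial>m)" by (simp add: decayD(4)[OF f])
    moreover have "Re (of_real (b / 2 * s) * (complex_of_real \<zeta>)\<^sup>2) = b / 2 * s * \<zeta>\<^sup>2"
      by (simp flip: of_real_power of_real_mult)
    ultimately show ?thesis
      using e2(2)[of \<zeta>] that R unfolding G_def decay_cos_product(2)[OF f] s_def by simp
  qed
  have meas: "(\<lambda>z. snd z * f (fst z)) \<in> borel_measurable (m \<Otimes>\<^sub>M \<mu>)" by measurable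
  have "(\<integral>\<^sup>+z. ennreal (cosh (R / 2 * (snd z * f (fst z))) - 1) \<partial>(m \<Otimes>\<^sub>M \<mu>))
     = ennreal (- Re (G (\<i> * of_real (R / 2)) + G (- (\<i> * of_real (R / 2)))) / 2)"
    by (rule cosh_moment_of_holomorphic[OF meas G _ _ decay_cos_product(1)[OF f] Geq]) (use R in auto)
  also have "\<dots> < \<infinity>" by simp
  finally have fin: "(\<integral>\<^sup>+z. ennreal (cosh (R / 2 * (snd z * f (fst z))) - 1) \<partial>(m \<Otimes>\<^sub>M \<mu>)) < \<infinity>" .
  \<comment> \<open>On \<open>A\<close> the function \<open>f\<close> is at least \<delta>, so every
    slice over \<open>A\<close> already dominates the cosh moment of \<mu> with this
    \<open>c\<close>; since \<open>A\<close> has positive measure, that moment is finite.\<close>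
  define c where "c = R / 2 * \<delta>"
  let ?J = "\<integral>\<^sup>+x. ennreal (cosh (c * x) - 1) \<partial>\<mu>"
  have "emeasure m A * ?J = (\<integral>\<^sup>+z. ?J * indicator A z \<partial>m)"
    by (subst nn_integral_cmult_indicator) (simp_all add: mult.commute)
  also have "\<dots> \<le> (\<integral>\<^sup>+z. \<integral>\<^sup>+x. ennreal (cosh (R / 2 * (x * f z)) - 1) \<partial>\<mu> \<partial>m)"
  proof (intro nn_integral_mono)
    fix z
    have "?J \<le> (\<integral>\<^sup>+x. ennreal (cosh (R / 2 * (x * f z)) - 1) \<partial>\<mu>)" if "z \<in> A"
    proof (intro nn_integral_mono ennreal_leI diff_mono order_refl)
      fix x
      have "\<bar>c * x\<bar> \<le> \<bar>R / 2 * (x * f z)\<bar>"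
      proof -
        have "R / 2 * \<bar>x\<bar> * \<delta> \<le> R / 2 * \<bar>x\<bar> * f z"
          using \<delta>(2)[OF that] R by (intro mult_left_mono) auto
        then show ?thesis using \<delta>(2)[OF that] \<delta>(1) R by (simp add: c_def abs_mult ac_simps)
      qed
      then have "cosh \<bar>c * x\<bar> \<le> cosh \<bar>R / 2 * (x * f z)\<bar>" by (intro iffD2[OF cosh_real_nonneg_le_iff]) auto
      then show "cosh (c * x) \<le> cosh (R / 2 * (x * f z))" by (simp only: cosh_real_abs)
    qed
    then show "?J * indicator A z \<le> (\<integral>\<^sup>+x. ennreal (cosh (R / 2 * (x * f z)) - 1) \<partial>\<mu>)"
      by (auto simp: indicator_def)
  qed
  also have "\<dots> = (\<integral>\<^sup>+z. ennreal (cosh (R / 2 * (snd z * f (fst z))) - 1) \<partial>(m \<Otimes>\<^sub>M \<mu>))"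
    by (subst \<mu>.nn_integral_fst[symmetric]) auto
  also note fin
  finally have "?J < \<infinity>" using A(2) by (auto simp: ennreal_mult_less_top)
  then show ?thesis using that[of c] \<delta>(1) R by (simp add: c_def)
qed

end

section \<open>The supOU kernel and its time integral\<close>

lemma supOU_kernel_eq: "supOU_kernel t (\<xi>, s) = (if s \<le> \<xi> * t then exp (s - \<xi> * t) else 0)"
  by (simp add: supOU_kernel_def)

lemma supOU_kernel_bounds: "0 \<le> supOU_kernel t z" "supOU_kernel t z \<le> 1"
  by (cases z; simp add: supOU_kernel_eq)+

lemma integrable_indicator_Icc: "integrable lborel (indicator {a..b} :: real \<Rightarrow> real)"
  by (rule integrable_real_indicator) (auto simp: emeasure_lborel_Icc_eq)

lemma nn_integral_exp_half_line:
  "(\<integral>\<^sup>+x. ennreal (if 0 \<le> x then exp (- x) else 0) \<partial>lborel) = 1"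
proof -
  have "prob_space (density lborel (exponential_density 1))" by (rule prob_space_exponential_density) simp
  then have "emeasure (density lborel (exponential_density 1)) UNIV = 1"
    using prob_space.emeasure_space_1 by fastforce
  then have "(\<integral>\<^sup>+x. ennreal (exponential_density 1 x) \<partial>lborel) = 1"
    by (simp add: emeasure_density)
  moreover have "exponential_density 1 x = (if 0 \<le> x then exp (- x) else 0)" for x :: real
    by (simp add: exponential_density_def)
  ultimately show ?thesis by simp
qed

text \<open>Substituting \<open>x = \<xi> * t - s\<close> turns the kernel into the exponential
  density.\<close>

lemma supOU_kernel_integral_space: "(\<integral>\<^sup>+s. ennreal (supOU_kernel t (\<xi>, s)) \<partial>lborel) = 1"
proof -
  have "(\<integral>\<^sup>+s. ennreal (supOU_kernel t (\<xi>, s)) \<partial>lborel)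
      = ennreal \<bar>-1\<bar> * (\<integral>\<^sup>+x. ennreal (supOU_kernel t (\<xi>, \<xi> * t + (-1) * x)) \<partial>lborel)"
    by (rule nn_integral_real_affine) (auto simp: supOU_kernel_eq)
  also have "\<dots> = (\<integral>\<^sup>+x. ennreal (if 0 \<le> x then exp (- x) else 0) \<partial>lborel)"
    by (auto simp: supOU_kernel_eq intro!: nn_integral_cong)
  finally show ?thesis by (simp add: nn_integral_exp_half_line)
qed

lemma supOU_kernel_integral_time:
  assumes "\<xi> > 0"
  shows "(\<integral>\<^sup>+u. ennreal (supOU_kernel u (\<xi>, s)) \<partial>lborel) = ennreal (1 / \<xi>)"
proof -
  have "(\<integral>\<^sup>+u. ennreal (supOU_kernel u (\<xi>, s)) \<partial>lborel)
      = ennreal \<bar>1 / \<xi>\<bar> * (\<integral>\<^sup>+x. ennreal (supOU_kernel (s / \<xi> + 1 / \<xi> * x) (\<xi>, s)) \<partial>lborel)"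
    using assms by (intro nn_integral_real_affine) (auto simp: supOU_kernel_eq)
  also have "\<dots> = ennreal (1 / \<xi>) * (\<integral>\<^sup>+x. ennreal (if 0 \<le> x then exp (- x) else 0) \<partial>lborel)"
    using assms by (auto simp: supOU_kernel_eq distrib_left intro!: arg_cong2[where f = "(*)"] nn_integral_cong)
  finally show ?thesis using assms by (simp add: nn_integral_exp_half_line)
qed

text \<open>An instance of \<open>\<bar>x - y\<bar> + 2 * min x y = x + y\<close>: the minimum of
  the two kernels is the earlier one damped by \<open>exp (- (\<xi> * (v - u)))\<close>. The
  additive form avoids subtracting extended reals after integration.\<close>

lemma supOU_kernel_diff:
  assumes "u \<le> v" "\<xi> > 0"
  shows "\<bar>supOU_kernel u (\<xi>, s) - supOU_kernel v (\<xi>, s)\<bar> + 2 * exp (- (\<xi> * (v - u))) * supOU_kernel u (\<xi>, s)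
    = supOU_kernel u (\<xi>, s) + supOU_kernel v (\<xi>, s)"
proof (cases "s \<le> \<xi> * u")
  case True
  have "\<xi> * u \<le> \<xi> * v" using assms by (intro mult_left_mono) auto
  then have v: "s \<le> \<xi> * v" using True by linarith
  have e: "exp (s - \<xi> * v) = exp (- (\<xi> * (v - u))) * exp (s - \<xi> * u)"
    by (simp add: exp_add[symmetric] algebra_simps)
  have "exp (s - \<xi> * v) \<le> exp (s - \<xi> * u)" using \<open>\<xi> * u \<le> \<xi> * v\<close> by simp
  then show ?thesis using True v unfolding supOU_kernel_eq by (simp add: e[symmetric] mult.assoc)
next
  case False
  then show ?thesis by (simp add: supOU_kernel_eq)
qed

lemma supOU_kernel_diff_integral:
  assumes "u \<le> v" "\<xi> > 0"
  shows "(\<integral>\<^sup>+s. ennreal \<bar>supOU_kernel u (\<xi>, s) - supOU_kernel v (\<xi>, s)\<bar> \<partial>lborel)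
    = ennreal (2 * (1 - exp (- (\<xi> * (v - u)))))"
proof -
  let ?e = "exp (- (\<xi> * (v - u)))"
  have [measurable]: "(\<lambda>s. supOU_kernel t (\<xi>, s)) \<in> borel_measurable lborel" for t
    by (simp add: supOU_kernel_eq)
  let ?I = "\<integral>\<^sup>+s. ennreal \<bar>supOU_kernel u (\<xi>, s) - supOU_kernel v (\<xi>, s)\<bar> \<partial>lborel"
  have "?I + ennreal (2 * ?e) * 1 = (\<integral>\<^sup>+s. ennreal \<bar>supOU_kernel u (\<xi>, s) - supOU_kernel v (\<xi>, s)\<bar>
      + ennreal (2 * ?e) * ennreal (supOU_kernel u (\<xi>, s)) \<partial>lborel)"
    by (subst nn_integral_add) (auto simp: nn_integral_cmult supOU_kernel_integral_space)
  also have "\<dots> = (\<integral>\<^sup>+s. ennreal (supOU_kernel u (\<xi>, s)) + ennreal (supOU_kernel v (\<xi>, s)) \<partial>lborel)"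
    using supOU_kernel_diff[OF assms]
    by (intro nn_integral_cong) (simp add: ennreal_mult[symmetric] supOU_kernel_bounds flip: ennreal_plus)
  also have "\<dots> = 2" by (subst nn_integral_add) (auto simp: supOU_kernel_integral_space)
  finally have s: "?I + ennreal (2 * ?e) = ennreal 2" by simp
  then have "?I < \<infinity>" by (metis ennreal_add_eq_top ennreal_less_top infinity_ennreal_def less_top)
  then obtain r where r: "?I = ennreal r" "r \<ge> 0" by (cases ?I) auto
  have "ennreal (r + 2 * ?e) = ennreal 2" using s r by (subst ennreal_plus) auto
  then have "r + 2 * ?e = 2" using r by (subst (asm) ennreal_inj) auto
  then have "(r + 2 * ?e) - 2 * ?e = 2 - 2 * ?e" by (simp only:)
  then have "r = 2 * (1 - ?e)" by (simp only: add_diff_cancel_right' right_diff_distrib mult_1_right)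
  then show ?thesis using r by (simp only:)
qed

text \<open>Cauchy-Schwarz, read off from the nonnegative variance of
  \<open>\<bar>W\<bar>\<close>.\<close>

lemma (in prob_space) expectation_abs_le_sqrt:
  assumes [measurable]: "W \<in> borel_measurable M" and int: "integrable M (\<lambda>\<omega>. (W \<omega>)\<^sup>2)"
    and le: "expectation (\<lambda>\<omega>. (W \<omega>)\<^sup>2) \<le> c"
  shows "(\<integral>\<^sup>+\<omega>. ennreal \<bar>W \<omega>\<bar> \<partial>M) \<le> ennreal (sqrt c)"
proof -
  have i: "integrable M (\<lambda>\<omega>. \<bar>W \<omega>\<bar>)"
    using square_integrable_imp_integrable[OF _ int] by auto
  let ?e = "expectation (\<lambda>\<omega>. \<bar>W \<omega>\<bar>)"
  have "0 \<le> expectation (\<lambda>\<omega>. (\<bar>W \<omega>\<bar> - ?e)\<^sup>2)" by (intro Bochner_Integration.integral_nonneg) auto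
  also have "(\<lambda>\<omega>. (\<bar>W \<omega>\<bar> - ?e)\<^sup>2) = (\<lambda>\<omega>. (W \<omega>)\<^sup>2 - 2 * ?e * \<bar>W \<omega>\<bar> + ?e\<^sup>2)"
    by (auto simp: power2_diff)
  also have "expectation \<dots> = expectation (\<lambda>\<omega>. (W \<omega>)\<^sup>2) - 2 * ?e * ?e + ?e\<^sup>2"
    using i int by (simp add: prob_space)
  finally have "?e\<^sup>2 \<le> c" using le by (simp add: power2_eq_square)
  then have "?e \<le> sqrt c" by (rule real_le_rsqrt)
  then show ?thesis using i by (subst nn_integral_eq_integral) (auto intro: ennreal_leI)
qed

section \<open>Step functions on a uniform grid and the time integral of the kernel\<close>

definition step_node :: "real \<Rightarrow> nat \<Rightarrow> nat \<Rightarrow> real" where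
  "step_node t n i = real (Suc i) * t / real n"

definition step_fun :: "real \<Rightarrow> nat \<Rightarrow> (real \<Rightarrow> real) \<Rightarrow> real \<Rightarrow> real" where
  "step_fun t n h u = (\<Sum>i<n. h (step_node t n i) * indicator {real i * t / real n..<step_node t n i} u)"

text \<open>The witness is the right endpoint of the cell containing \<open>u\<close>. It is the
  same for all \<open>h\<close>, so it serves the paths of all \<omega> simultaneously.\<close>

lemma step_fun_eq:
  assumes "t > 0" "n > 0" "0 \<le> u" "u < t"
  obtains v where "u \<le> v" "v \<le> u + t / real n" "u < v" "\<And>h. step_fun t n h u = h v"
proof -
  define k where "k = nat \<lfloor>real n * u / t\<rfloor>"
  have nonneg: "0 \<le> real n * u / t" using assms by simp
  have k: "real k \<le> real n * u / t" "real n * u / t < real k + 1"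
    using nonneg unfolding k_def by linarith+
  have "real n * u / t < real n" using assms by (simp add: field_simps)
  then have kn: "k < n" using k(1) by linarith
  have iff: "u \<in> {real i * t / real n..<step_node t n i} \<longleftrightarrow> i = k" for i
  proof -
    have "u \<in> {real i * t / real n..<step_node t n i} \<longleftrightarrow> real i \<le> real n * u / t \<and> real n * u / t < real i + 1"
      using assms by (auto simp: step_node_def field_simps)
    also have "\<dots> \<longleftrightarrow> i = k"
    proof
      assume "real i \<le> real n * u / t \<and> real n * u / t < real i + 1"
      then have "real i < real k + 1" "real k < real i + 1" using k by linarith+
      then show "i = k" by linarith
    qed (use k in auto)
    finally show ?thesis .
  qed
  have e: "step_fun t n h u = h (step_node t n k)" for h
  proof -
    have "step_fun t n h u = (\<Sum>i<n. if i = k then h (step_node t n i) else 0)"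
      unfolding step_fun_def using iff by (intro sum.cong) (auto simp: indicator_def)
    then show ?thesis using kn by simp
  qed
  have u: "real k * t / real n \<le> u" "u < step_node t n k" using iff[of k] by auto
  have "step_node t n k = real k * t / real n + t / real n"
    by (simp add: step_node_def add_divide_distrib distrib_right)
  then show ?thesis using that[of "step_node t n k"] u e by auto
qed

lemma step_fun_integral:
  assumes "t > 0" "n > 0"
  shows "integrable lborel (step_fun t n h)"
    and "(\<integral>u. indicator {0..t} u * step_fun t n h u \<partial>lborel) = (\<Sum>i<n. t / real n * h (step_node t n i))"
    and "integrable lborel (\<lambda>u. indicator {0..t} u * step_fun t n h u)"
proof -
  let ?J = "\<lambda>i. {real i * t / real n..<step_node t n i}"
  have J: "?J i \<subseteq> {0..t}" if "i < n" for i
  proof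
    fix u assume u: "u \<in> ?J i"
    have "0 \<le> real i * t / real n" using assms by simp
    moreover have "step_node t n i \<le> t"
    proof -
      have "real (Suc i) * t \<le> real n * t" using that assms by (intro mult_right_mono) auto
      then show ?thesis using assms by (simp add: step_node_def divide_le_eq mult.commute)
    qed
    ultimately show "u \<in> {0..t}" using u by auto
  qed
  have len: "measure lborel (?J i) = t / real n" for i
  proof -
    have "step_node t n i = real i * t / real n + t / real n"
      by (simp add: step_node_def add_divide_distrib distrib_right)
    then show ?thesis using assms by simp
  qed
  have int: "integrable lborel (\<lambda>u. h (step_node t n i) * indicator (?J i) u)" for i
  proof (intro integrable_mult_right integrable_real_indicator)
    have "emeasure lborel (?J i) \<le> emeasure lborel {real i * t / real n..step_node t n i}"
      by (intro emeasure_mono) auto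
    also have "\<dots> < \<infinity>" by (simp add: emeasure_lborel_Icc_eq)
    finally show "emeasure lborel (?J i) < \<infinity>" .
  qed simp
  show i1: "integrable lborel (step_fun t n h)"
    unfolding step_fun_def[abs_def] by (intro Bochner_Integration.integrable_sum int)
  have e: "indicator {0..t} u * step_fun t n h u = step_fun t n h u" for u
    unfolding step_fun_def sum_distrib_left
  proof (intro sum.cong refl)
    fix i assume i: "i \<in> {..<n}"
    show "indicator {0..t} u * (h (step_node t n i) * indicator (?J i) u) = h (step_node t n i) * indicator (?J i) u"
    proof (cases "u \<in> ?J i")
      case True
      then have "u \<in> {0..t}" using J[of i] i by blast
      then have "indicator {0..t} u = (1::real)" by (rule indicator_simps)
      then show ?thesis by (simp only: mult_1)
    next
      case False
      then have "indicator (?J i) u = (0::real)" by (rule indicator_simps)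
      then show ?thesis by (simp only: mult_zero_right)
    qed
  qed
  show "integrable lborel (\<lambda>u. indicator {0..t} u * step_fun t n h u)" unfolding e by (rule i1)
  have "(\<integral>u. step_fun t n h u \<partial>lborel) = (\<Sum>i<n. \<integral>u. h (step_node t n i) * indicator (?J i) u \<partial>lborel)"
    unfolding step_fun_def by (rule Bochner_Integration.integral_sum[OF int])
  also have "\<dots> = (\<Sum>i<n. t / real n * h (step_node t n i))"
    using len by (intro sum.cong refl) (simp add: mult.commute)
  finally show "(\<integral>u. indicator {0..t} u * step_fun t n h u \<partial>lborel) = (\<Sum>i<n. t / real n * h (step_node t n i))"
    unfolding e .
qed

definition kernel_integral :: "real \<Rightarrow> real \<times> real \<Rightarrow> real" where
  "kernel_integral t z = (\<integral>u. indicator {0..t} u * supOU_kernel u z \<partial>lborel)"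

lemma kernel_time_measurable [measurable]: "(\<lambda>u. supOU_kernel u z) \<in> borel_measurable borel"
  by (cases z) (simp add: supOU_kernel_eq)

lemma kernel_time_integrable: "integrable lborel (\<lambda>u. indicator {0..t} u * supOU_kernel u z)"
proof (rule Bochner_Integration.integrable_bound)
  show "integrable lborel (indicator {0..t} :: real \<Rightarrow> real)" by (rule integrable_indicator_Icc)
  show "AE u in lborel. norm (indicator {0..t} u * supOU_kernel u z) \<le> norm (indicator {0..t} u :: real)"
    using supOU_kernel_bounds by (auto simp: indicator_def abs_le_iff intro!: AE_I2)
qed measurable

lemma kernel_integral_nn: "ennreal (kernel_integral t z) = (\<integral>\<^sup>+u. ennreal (indicator {0..t} u * supOU_kernel u z) \<partial>lborel)"
  unfolding kernel_integral_def
  by (rule nn_integral_eq_integral[OF kernel_time_integrable, symmetric]) (auto simp: supOU_kernel_bounds)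

lemma kernel_integral_bounds:
  assumes "t \<ge> 0"
  shows "0 \<le> kernel_integral t z" "kernel_integral t z \<le> t" "\<xi> > 0 \<Longrightarrow> kernel_integral t (\<xi>, s) \<le> 1 / \<xi>"
proof -
  show "0 \<le> kernel_integral t z"
    unfolding kernel_integral_def by (intro Bochner_Integration.integral_nonneg) (auto simp: supOU_kernel_bounds)
  have "kernel_integral t z \<le> (\<integral>u. indicator {0..t} u \<partial>lborel)"
    unfolding kernel_integral_def
  proof (rule integral_mono[OF kernel_time_integrable integrable_indicator_Icc])
    show "indicator {0..t} u * supOU_kernel u z \<le> indicator {0..t} u" for u
      using supOU_kernel_bounds by (auto simp: indicator_def)
  qed
  also have "\<dots> = t" using assms by simp
  finally show "kernel_integral t z \<le> t" .
  assume \<xi>: "\<xi> > 0"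
  have "ennreal (kernel_integral t (\<xi>, s)) \<le> (\<integral>\<^sup>+u. ennreal (supOU_kernel u (\<xi>, s)) \<partial>lborel)"
    unfolding kernel_integral_nn by (intro nn_integral_mono) (auto simp: indicator_def)
  then show "kernel_integral t (\<xi>, s) \<le> 1 / \<xi>"
    using \<xi> by (simp add: supOU_kernel_integral_time)
qed

text \<open>Geometric interpolation between the bounds \<open>t\<close> and
  \<open>1 / \<xi>\<close>.\<close>

lemma kernel_integral_le_powr:
  assumes "t > 0" "\<xi> > 0" "0 \<le> \<gamma>" "\<gamma> \<le> 1"
  shows "kernel_integral t (\<xi>, s) \<le> t powr (1 - \<gamma>) * \<xi> powr - \<gamma>"
proof (cases "kernel_integral t (\<xi>, s) = 0")
  case False
  let ?F = "kernel_integral t (\<xi>, s)"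
  have F: "?F > 0" "?F \<le> t" "?F \<le> 1 / \<xi>" using False kernel_integral_bounds[of t] assms by (auto simp: less_le)
  have "?F = ?F powr (1 - \<gamma>) * ?F powr \<gamma>" using F by (simp add: powr_add[symmetric])
  also have "\<dots> \<le> t powr (1 - \<gamma>) * (1 / \<xi>) powr \<gamma>"
    using F assms by (intro mult_mono powr_mono2) auto
  also have "(1 / \<xi>) powr \<gamma> = \<xi> powr - \<gamma>" using assms by (simp add: powr_divide powr_minus_divide)
  finally show ?thesis .
qed auto

text \<open>For \<open>\<xi> \<le> 1 / t\<close> and \<open>s \<ge> -1\<close> the exponent
  \<open>s - \<xi> * u\<close> stays at least -2 over the whole interval, and
  \<open>s \<le> 0\<close> keeps the indicator equal to 1. Such a jump occurs no later than time 0
  and decays by a bounded factor only.\<close>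

lemma kernel_integral_lower:
  assumes t: "t > 0" and \<xi>: "0 < \<xi>" "\<xi> \<le> 1 / t" and s: "-1 \<le> s" "s \<le> 0"
  shows "exp (- 2) * t \<le> kernel_integral t (\<xi>, s)"
proof -
  have "exp (- 2) * t = (\<integral>u. exp (- 2) * indicator {0..t} u \<partial>lborel)" using t by simp
  also have "\<dots> \<le> kernel_integral t (\<xi>, s)"
    unfolding kernel_integral_def
  proof (rule integral_mono[OF _ kernel_time_integrable])
    show "integrable lborel (\<lambda>u. exp (- 2) * indicator {0..t} u :: real)"
      by (intro integrable_mult_right integrable_indicator_Icc)
    fix u
    show "exp (- 2) * indicator {0..t} u \<le> indicator {0..t} u * supOU_kernel u (\<xi>, s)"
    proof (cases "u \<in> {0..t}")
      case True
      have "\<xi> * u \<le> 1 / t * t" using True \<xi> t by (intro mult_mono) auto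
      moreover have "0 \<le> \<xi> * u" using True \<xi> by simp
      ultimately show ?thesis using True s t by (simp add: supOU_kernel_eq)
    qed simp
  qed
  finally show ?thesis .
qed

text \<open>The nodes lie to the right of the points they approximate, and the kernel is right-continuous.\<close>
lemma kernel_riemann_sum_tendsto:
  assumes t: "t > 0" and pos: "fst z > 0"
  shows "(\<lambda>n. \<Sum>i<Suc n. t / real (Suc n) * supOU_kernel (step_node t (Suc n) i) z) \<longlonglongrightarrow> kernel_integral t z"
proof -
  obtain \<xi> s where z: "z = (\<xi>, s)" by (cases z)
  have \<xi>: "\<xi> > 0" using pos z by simp
  let ?h = "\<lambda>u. supOU_kernel u z"
  have "(\<lambda>n. \<integral>u. indicator {0..t} u * step_fun t (Suc n) ?h u \<partial>lborel) \<longlonglongrightarrow> (\<integral>u. indicator {0..t} u * ?h u \<partial>lborel)"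
  proof (rule integral_dominated_convergence[where w = "indicator {0..t}"])
    show "integrable lborel (indicator {0..t} :: real \<Rightarrow> real)" by (rule integrable_indicator_Icc)
    \<comment> \<open>The half-open cells miss the endpoint \<open>t\<close>.\<close>
    have ne: "AE u in lborel. u \<noteq> t" by (rule AE_lborel_singleton)
    show "AE u in lborel. norm (indicator {0..t} u * step_fun t (Suc n) ?h u) \<le> indicator {0..t} u" for n
      using ne
    proof eventually_elim
      case (elim u)
      show ?case
      proof (cases "u \<in> {0..t}")
        case True
        then obtain v where "step_fun t (Suc n) ?h u = ?h v"
          using step_fun_eq[of t "Suc n" u] t elim by auto
        then show ?thesis using True supOU_kernel_bounds[of v z] by simp
      qed simp
    qed
    show "AE u in lborel. (\<lambda>n. indicator {0..t} u * step_fun t (Suc n) ?h u) \<longlonglongrightarrow> indicator {0..t} u * ?h u"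
      using ne
    proof eventually_elim
      case (elim u)
      show ?case
      proof (cases "u \<in> {0..t}")
        case True
        have "\<exists>v. u < v \<and> v \<le> u + t / real (Suc n) \<and> step_fun t (Suc n) ?h u = ?h v" for n
          using step_fun_eq[of t "Suc n" u] t elim True by (metis atLeastAtMost_iff less_le zero_less_Suc)
        then obtain v where v: "\<And>n. u < v n" "\<And>n. v n \<le> u + t / real (Suc n)"
          "\<And>n. step_fun t (Suc n) ?h u = ?h (v n)" by metis
        have "(\<lambda>n. u + t / real (Suc n)) \<longlonglongrightarrow> u + 0"
          by (intro tendsto_intros LIMSEQ_Suc[OF lim_const_over_n])
        then have vl: "v \<longlonglongrightarrow> u"
          by (intro tendsto_sandwich[OF _ _ tendsto_const, of u v sequentially "\<lambda>n. u + t / real (Suc n)"])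
            (use v in \<open>auto intro!: always_eventually less_imp_le\<close>)
        have "(\<lambda>n. ?h (v n)) \<longlonglongrightarrow> ?h u"
          proof (cases "s \<le> \<xi> * u")
            case True
            have "s \<le> \<xi> * v n" for n
            proof -
              have "\<xi> * u \<le> \<xi> * v n" using \<xi> v(1)[of n] by (intro mult_left_mono) auto
              then show ?thesis using True by linarith
            qed
            then have "(\<lambda>n. ?h (v n)) = (\<lambda>n. exp (s - \<xi> * v n))" by (simp add: z supOU_kernel_eq)
            moreover have "?h u = exp (s - \<xi> * u)" using True by (simp add: z supOU_kernel_eq)
            moreover have "(\<lambda>n. exp (s - \<xi> * v n)) \<longlonglongrightarrow> exp (s - \<xi> * u)" by (intro tendsto_intros vl)
            ultimately show ?thesis by simp
          next
            case False
            have "(\<lambda>n. \<xi> * v n) \<longlonglongrightarrow> \<xi> * u" by (intro tendsto_intros vl)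
            then have "\<forall>\<^sub>F n in sequentially. \<xi> * v n < s" by (rule order_tendstoD(2)) (use False in simp)
            then have "\<forall>\<^sub>F n in sequentially. ?h u = ?h (v n)"
              by eventually_elim (use False in \<open>simp add: z supOU_kernel_eq\<close>)
            then show ?thesis by (rule Lim_transform_eventually[OF tendsto_const])
          qed
        then show ?thesis using True v(3) by simp
      qed simp
    qed
    show "(\<lambda>u. indicator {0..t} u * step_fun t (Suc n) ?h u) \<in> borel_measurable lborel" for n
      using step_fun_integral(3)[of t "Suc n" ?h] t by auto
  qed measurable
  then show ?thesis
    using step_fun_integral(2)[of t "Suc _" ?h] t by (simp only: kernel_integral_def)
qed


section \<open>The integrated process as a stochastic integral\<close>

locale supou = prob_space M for M :: "'w measure" +
  fixes a b :: real and \<mu> \<pi> :: "real measure" and \<Lambda> :: "(real \<times> real) set \<Rightarrow> 'w \<Rightarrow> real" and X :: "real \<Rightarrow> 'w \<Rightarrow> real"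
  assumes b_pos: "b > 0" and levy_\<mu>: "levy_measure \<mu>" and prob_\<pi>: "prob_space \<pi>"
    and sets_\<pi>: "sets \<pi> = sets (restrict_space borel {0<..})"
    and basis_\<Lambda>: "levy_basis M (\<pi> \<Otimes>\<^sub>M lborel) (levy_khintchine a b \<mu>) \<Lambda>"
    and X_int: "\<And>t. has_stochastic_integral M (\<pi> \<Otimes>\<^sub>M lborel) \<Lambda> (supOU_kernel t) (X t)"
    and X_joint: "(\<lambda>(t, \<omega>). X t \<omega>) \<in> borel_measurable (borel \<Otimes>\<^sub>M M)"
    and X_sq: "\<And>t. integrable M (\<lambda>\<omega>. (X t \<omega>)\<^sup>2)"
    and X_mean: "\<And>t. (LINT \<omega>|M. X t \<omega>) = 0"
begin

sublocale \<pi>: prob_space \<pi> by (rule prob_\<pi>)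
sublocale \<pi>l: pair_sigma_finite \<pi> lborel ..

abbreviation "m \<equiv> \<pi> \<Otimes>\<^sub>M (lborel :: real measure)"

sublocale decay_setup M m b \<mu>
  by unfold_locales (use b_pos levy_\<mu> in auto)

sublocale levy_khintchine_space M m a b \<mu> \<Lambda>
  by unfold_locales (use b_pos levy_\<mu> basis_\<Lambda> in auto)

lemma space_\<pi>: "space \<pi> = {0<..}"
  using sets_eq_imp_space_eq[OF sets_\<pi>] by (simp add: space_restrict_space)

lemma measurable_id_\<pi> [measurable]: "(\<lambda>\<xi>. \<xi>) \<in> borel_measurable \<pi>"
proof -
  have "(\<lambda>\<xi>::real. \<xi>) \<in> borel_measurable (restrict_space borel {0<..})"
    by (intro measurable_restrict_space1) simp
  then show ?thesis using measurable_cong_sets[OF sets_\<pi> refl] by blast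
qed

lemma measurable_kernel_joint [measurable]: "(\<lambda>p. supOU_kernel (fst p) (snd p)) \<in> borel_measurable (borel \<Otimes>\<^sub>M m)"
proof -
  have [measurable]: "(\<lambda>p. fst (snd p)) \<in> borel_measurable (borel \<Otimes>\<^sub>M m)"
    using measurable_compose[OF measurable_compose[OF measurable_snd measurable_fst] measurable_id_\<pi>] by simp
  have "supOU_kernel (fst p) (snd p) = (if snd (snd p) \<le> fst (snd p) * fst p then exp (snd (snd p) - fst (snd p) * fst p) else 0)" for p
    by (cases p) (simp add: supOU_kernel_eq split: prod.splits)
  then show ?thesis by simp
qed

lemma measurable_kernel [measurable]: "supOU_kernel t \<in> borel_measurable m"
  using measurable_compose[OF measurable_Pair1'[of t borel m] measurable_kernel_joint] by simp

lemma X_measurable [measurable]: "X t \<in> borel_measurable M"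
  using X_int[of t] by (simp add: has_stochastic_integral_def)

lemma X_stochastic_integral: "stochastic_integral_limit M m \<Lambda> (supOU_kernel t) (X t)"
  by (rule stochastic_integral_limitI[OF X_int])

lemma X_integrable: "integrable M (X t)"
  by (rule square_integrable_imp_integrable[OF _ X_sq]) simp

lemma decay_X: "decay (supOU_kernel t) (X t)"
  by (intro decays_like_stochastic_integral X_stochastic_integral)

lemma decay_X_diff: "decay (\<lambda>z. supOU_kernel u z - supOU_kernel v z) (\<lambda>\<omega>. X u \<omega> - X v \<omega>)"
  using decays_like_stochastic_integral[OF stochastic_integral_limit_linear[OF X_stochastic_integral[of u] X_stochastic_integral[of v], of 1 "-1"]]
  by simp

text \<open>The value at \<open>v - u\<close> is the integral of the absolute difference of the
  kernels at \<open>u\<close> and \<open>v\<close>; it controls the mean square increments of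
  \<open>X\<close>.\<close>

definition modulus :: "real \<Rightarrow> real" where
  "modulus \<delta> = (\<integral>\<xi>. 2 * (1 - exp (- (\<xi> * \<delta>))) \<partial>\<pi>)"

lemma modulus_integrable: "\<delta> \<ge> 0 \<Longrightarrow> integrable \<pi> (\<lambda>\<xi>. 2 * (1 - exp (- (\<xi> * \<delta>))))"
  by (rule \<pi>.integrable_const_bound[of _ 2]) (auto intro!: AE_I2 simp: space_\<pi>)

lemma modulus_mono: "0 \<le> \<delta> \<Longrightarrow> \<delta> \<le> \<epsilon> \<Longrightarrow> modulus \<delta> \<le> modulus \<epsilon>"
  unfolding modulus_def by (intro integral_mono modulus_integrable) (auto simp: space_\<pi> intro!: mult_left_mono)

lemma modulus_tendsto: "(\<lambda>n. modulus (t / real (Suc n))) \<longlonglongrightarrow> 0" if "t \<ge> 0"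
proof -
  have "(\<lambda>n. modulus (t / real (Suc n))) \<longlonglongrightarrow> (\<integral>\<xi>. 0 \<partial>\<pi>)"
    unfolding modulus_def
  proof (rule integral_dominated_convergence[where w = "\<lambda>_. 2"])
    show "AE \<xi> in \<pi>. (\<lambda>n. 2 * (1 - exp (- (\<xi> * (t / real (Suc n)))))) \<longlonglongrightarrow> 0"
    proof (intro AE_I2)
      fix \<xi>
      have "(\<lambda>n. 2 * (1 - exp (- (\<xi> * (t / real (Suc n)))))) \<longlonglongrightarrow> 2 * (1 - exp (- (\<xi> * 0)))"
        by (intro tendsto_intros LIMSEQ_Suc[OF lim_const_over_n])
      then show "(\<lambda>n. 2 * (1 - exp (- (\<xi> * (t / real (Suc n)))))) \<longlonglongrightarrow> 0" by simp
    qed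
    show "AE \<xi> in \<pi>. norm (2 * (1 - exp (- (\<xi> * (t / real (Suc n)))))) \<le> 2" for n
      using that by (intro AE_I2) (simp add: space_\<pi>)
  qed auto
  then show ?thesis by simp
qed

text \<open>Both kernels lie between 0 and 1, so the square of their difference is at most its
  absolute value, whose integral is explicit.\<close>

lemma kernel_diff_square:
  assumes "u \<le> v"
  shows "(\<integral>z. (supOU_kernel u z - supOU_kernel v z)\<^sup>2 \<partial>m) \<le> modulus (v - u)"
proof -
  have "ennreal (\<integral>z. (supOU_kernel u z - supOU_kernel v z)\<^sup>2 \<partial>m) = (\<integral>\<^sup>+z. ennreal ((supOU_kernel u z - supOU_kernel v z)\<^sup>2) \<partial>m)"
    by (rule nn_integral_eq_integral[OF decay_square_integrable[OF decay_X_diff], symmetric]) auto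
  also have "\<dots> \<le> (\<integral>\<^sup>+z. ennreal \<bar>supOU_kernel u z - supOU_kernel v z\<bar> \<partial>m)"
  proof (intro nn_integral_mono ennreal_leI)
    fix z
    have "\<bar>supOU_kernel u z - supOU_kernel v z\<bar> \<le> 1"
      using supOU_kernel_bounds[of u z] supOU_kernel_bounds[of v z] by linarith
    then have "\<bar>supOU_kernel u z - supOU_kernel v z\<bar> * \<bar>supOU_kernel u z - supOU_kernel v z\<bar> \<le> \<bar>supOU_kernel u z - supOU_kernel v z\<bar>"
      by (intro mult_left_le) auto
    then show "(supOU_kernel u z - supOU_kernel v z)\<^sup>2 \<le> \<bar>supOU_kernel u z - supOU_kernel v z\<bar>"
      by (simp add: power2_eq_square abs_mult_self_eq)
  qed
  also have "\<dots> = (\<integral>\<^sup>+\<xi>. \<integral>\<^sup>+s. ennreal \<bar>supOU_kernel u (\<xi>, s) - supOU_kernel v (\<xi>, s)\<bar> \<partial>lborel \<partial>\<pi>)"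
    by (rule lborel.nn_integral_fst[symmetric]) measurable
  also have "\<dots> = (\<integral>\<^sup>+\<xi>. ennreal (2 * (1 - exp (- (\<xi> * (v - u))))) \<partial>\<pi>)"
    using assms by (intro nn_integral_cong supOU_kernel_diff_integral) (auto simp: space_\<pi>)
  also have "\<dots> = ennreal (modulus (v - u))"
    unfolding modulus_def using assms
    by (intro nn_integral_eq_integral modulus_integrable AE_I2) (auto simp: space_\<pi>)
  finally show ?thesis
    unfolding modulus_def using assms
    by (subst (asm) ennreal_le_iff) (auto intro!: Bochner_Integration.integral_nonneg simp: space_\<pi>)
qed

lemma kernel_square_le_1: "(\<integral>z. (supOU_kernel u z)\<^sup>2 \<partial>m) \<le> 1"
proof -
  have "ennreal (\<integral>z. (supOU_kernel u z)\<^sup>2 \<partial>m) = (\<integral>\<^sup>+z. ennreal ((supOU_kernel u z)\<^sup>2) \<partial>m)"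
    by (rule nn_integral_eq_integral[OF decay_square_integrable[OF decay_X], symmetric]) auto
  also have "\<dots> \<le> (\<integral>\<^sup>+z. ennreal (supOU_kernel u z) \<partial>m)"
  proof (intro nn_integral_mono ennreal_leI)
    show "(supOU_kernel u z)\<^sup>2 \<le> supOU_kernel u z" for z
      using supOU_kernel_bounds[of u z] by (simp add: power2_eq_square mult_left_le)
  qed
  also have "\<dots> = (\<integral>\<^sup>+\<xi>. \<integral>\<^sup>+s. ennreal (supOU_kernel u (\<xi>, s)) \<partial>lborel \<partial>\<pi>)"
    by (rule lborel.nn_integral_fst[symmetric]) measurable
  also have "\<dots> = 1" by (simp add: supOU_kernel_integral_space \<pi>.emeasure_space_1)
  finally show ?thesis by simp
qed

lemma kernel_integral_measurable [measurable]: "kernel_integral t \<in> borel_measurable m"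
proof -
  have "(\<lambda>p. indicator {0..t} (snd p) * supOU_kernel (snd p) (fst p)) \<in> borel_measurable (m \<Otimes>\<^sub>M lborel)"
  proof -
    have "(\<lambda>p. supOU_kernel (snd p) (fst p)) \<in> borel_measurable (m \<Otimes>\<^sub>M lborel)"
    proof -
      have "(\<lambda>p. (snd p, fst p)) \<in> measurable (m \<Otimes>\<^sub>M (lborel :: real measure)) (borel \<Otimes>\<^sub>M m)" by measurable
      from measurable_compose[OF this measurable_kernel_joint] show ?thesis by simp
    qed
    then show ?thesis by measurable
  qed
  then show ?thesis
    unfolding kernel_integral_def[abs_def] by (intro lborel.borel_measurable_lebesgue_integral) (simp add: case_prod_beta')
qed

text \<open>By Tonelli, each time in \<open>{0..t}\<close> contributes a kernel of total mass
  1.\<close>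

lemma kernel_integral_total:
  assumes "t \<ge> 0"
  shows "(\<integral>\<^sup>+s. ennreal (kernel_integral t (\<xi>, s)) \<partial>lborel) = ennreal t"
proof -
  have meas: "(\<lambda>(s, u). ennreal (indicator {0..t} u * supOU_kernel u (\<xi>, s))) \<in> borel_measurable (lborel \<Otimes>\<^sub>M lborel)"
    unfolding supOU_kernel_eq by measurable
  have "(\<integral>\<^sup>+s. ennreal (kernel_integral t (\<xi>, s)) \<partial>lborel)
    = (\<integral>\<^sup>+s. \<integral>\<^sup>+u. ennreal (indicator {0..t} u * supOU_kernel u (\<xi>, s)) \<partial>lborel \<partial>lborel)"
    by (simp add: kernel_integral_nn)
  also have "\<dots> = (\<integral>\<^sup>+u. \<integral>\<^sup>+s. ennreal (indicator {0..t} u * supOU_kernel u (\<xi>, s)) \<partial>lborel \<partial>lborel)"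
    by (rule lborel_pair.Fubini'[OF meas, symmetric])
  also have "\<dots> = (\<integral>\<^sup>+u. ennreal (indicator {0..t} u) * 1 \<partial>lborel)"
  proof (intro nn_integral_cong)
    fix u
    have "(\<integral>\<^sup>+s. ennreal (indicator {0..t} u * supOU_kernel u (\<xi>, s)) \<partial>lborel)
      = (\<integral>\<^sup>+s. ennreal (indicator {0..t} u) * ennreal (supOU_kernel u (\<xi>, s)) \<partial>lborel)"
      by (simp add: ennreal_mult supOU_kernel_bounds)
    also have "\<dots> = ennreal (indicator {0..t} u) * (\<integral>\<^sup>+s. ennreal (supOU_kernel u (\<xi>, s)) \<partial>lborel)"
      by (rule nn_integral_cmult) (simp add: supOU_kernel_eq)
    finally show "(\<integral>\<^sup>+s. ennreal (indicator {0..t} u * supOU_kernel u (\<xi>, s)) \<partial>lborel) = ennreal (indicator {0..t} u) * 1"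
      by (simp add: supOU_kernel_integral_space)
  qed
  also have "\<dots> = ennreal t" using assms by (simp add: ennreal_indicator)
  finally show ?thesis .
qed

text \<open>One factor of the square is replaced by the interpolated bound, which is free of
  \<open>s\<close>; the other integrates to \<open>t\<close> over \<open>s\<close>.\<close>

lemma kernel_integral_square_upper:
  assumes t: "t > 0" and \<gamma>: "0 \<le> \<gamma>" "\<gamma> \<le> 1" and fin: "(\<integral>\<^sup>+\<xi>. ennreal (\<xi> powr - \<gamma>) \<partial>\<pi>) < \<infinity>"
  shows "(\<integral>\<^sup>+z. ennreal ((kernel_integral t z)\<^sup>2) \<partial>m) \<le> ennreal (t powr (2 - \<gamma>)) * (\<integral>\<^sup>+\<xi>. ennreal (\<xi> powr - \<gamma>) \<partial>\<pi>)"
proof -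
  note Fm [measurable] = kernel_integral_measurable[of t]
  have "(\<integral>\<^sup>+z. ennreal ((kernel_integral t z)\<^sup>2) \<partial>m) = (\<integral>\<^sup>+\<xi>. \<integral>\<^sup>+s. ennreal ((kernel_integral t (\<xi>, s))\<^sup>2) \<partial>lborel \<partial>\<pi>)"
    by (rule lborel.nn_integral_fst[symmetric]) measurable
  also have "\<dots> \<le> (\<integral>\<^sup>+\<xi>. ennreal (t powr (2 - \<gamma>)) * ennreal (\<xi> powr - \<gamma>) \<partial>\<pi>)"
  proof (intro nn_integral_mono)
    fix \<xi> assume "\<xi> \<in> space \<pi>"
    then have \<xi>: "\<xi> > 0" by (simp add: space_\<pi>)
    have [measurable]: "(\<lambda>s. kernel_integral t (\<xi>, s)) \<in> borel_measurable lborel"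
      using measurable_compose[OF measurable_Pair1'[OF \<open>\<xi> \<in> space \<pi>\<close>] Fm] by simp
    have "(\<integral>\<^sup>+s. ennreal ((kernel_integral t (\<xi>, s))\<^sup>2) \<partial>lborel)
      \<le> (\<integral>\<^sup>+s. ennreal (t powr (1 - \<gamma>) * \<xi> powr - \<gamma>) * ennreal (kernel_integral t (\<xi>, s)) \<partial>lborel)"
    proof (intro nn_integral_mono)
      fix s
      have "kernel_integral t (\<xi>, s) * kernel_integral t (\<xi>, s) \<le> t powr (1 - \<gamma>) * \<xi> powr - \<gamma> * kernel_integral t (\<xi>, s)"
        using kernel_integral_le_powr[OF t \<xi> \<gamma>, of s] kernel_integral_bounds(1)[of t] t by (intro mult_right_mono) auto
      then show "ennreal ((kernel_integral t (\<xi>, s))\<^sup>2) \<le> ennreal (t powr (1 - \<gamma>) * \<xi> powr - \<gamma>) * ennreal (kernel_integral t (\<xi>, s))"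
        using kernel_integral_bounds(1)[of t] t by (simp add: power2_eq_square ennreal_mult[symmetric] ennreal_leI)
    qed
    also have "\<dots> = ennreal (t powr (1 - \<gamma>) * \<xi> powr - \<gamma>) * ennreal t"
      using t by (subst nn_integral_cmult) (auto simp: kernel_integral_total)
    also have "\<dots> = ennreal (t powr (2 - \<gamma>)) * ennreal (\<xi> powr - \<gamma>)"
    proof -
      have "t powr (2 - \<gamma>) = t powr (1 - \<gamma>) * t"
        using t powr_add[of t "1 - \<gamma>" 1] by simp
      then show ?thesis using t by (simp add: ennreal_mult[symmetric] ac_simps)
    qed
    finally show "(\<integral>\<^sup>+s. ennreal ((kernel_integral t (\<xi>, s))\<^sup>2) \<partial>lborel) \<le> ennreal (t powr (2 - \<gamma>)) * ennreal (\<xi> powr - \<gamma>)" .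
  qed
  also have "\<dots> = ennreal (t powr (2 - \<gamma>)) * (\<integral>\<^sup>+\<xi>. ennreal (\<xi> powr - \<gamma>) \<partial>\<pi>)"
    by (rule nn_integral_cmult) measurable
  finally show ?thesis .
qed

end

lemma (in prob_space) converges_in_probability_L1:
  assumes [measurable]: "\<And>n. Z n \<in> borel_measurable M" "Y \<in> borel_measurable M"
    and le: "\<And>n. (\<integral>\<^sup>+\<omega>. ennreal \<bar>Z n \<omega> - Y \<omega>\<bar> \<partial>M) \<le> ennreal (r n)" and r: "r \<longlonglongrightarrow> 0" "\<And>n. r n \<ge> 0"
  shows "converges_in_probability M Z Y"
  unfolding converges_in_probability_def
proof (intro allI impI)
  fix e :: real assume "e > 0"
  have bound: "prob {\<omega> \<in> space M. \<bar>Z n \<omega> - Y \<omega>\<bar> > e} \<le> r n / e" for n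
  proof -
    let ?A = "{\<omega> \<in> space M. \<bar>Z n \<omega> - Y \<omega>\<bar> > e}"
    have "ennreal (e * prob ?A) = (\<integral>\<^sup>+\<omega>. ennreal e * indicator ?A \<omega> \<partial>M)"
      using \<open>e > 0\<close> by (subst nn_integral_cmult_indicator) (auto simp: emeasure_eq_measure ennreal_mult)
    also have "\<dots> \<le> (\<integral>\<^sup>+\<omega>. ennreal \<bar>Z n \<omega> - Y \<omega>\<bar> \<partial>M)"
      by (intro nn_integral_mono) (auto simp: indicator_def ennreal_leI)
    also have "\<dots> \<le> ennreal (r n)" by (rule le)
    finally have "e * prob ?A \<le> r n" using r(2)[of n] by (simp add: ennreal_le_iff)
    then show ?thesis using \<open>e > 0\<close> by (simp add: field_simps)
  qed
  have lim: "(\<lambda>n. r n / e) \<longlonglongrightarrow> 0"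
    using tendsto_divide[OF r(1) tendsto_const, of e] \<open>e > 0\<close> by simp
  show "(\<lambda>n. prob {\<omega> \<in> space M. e < \<bar>Z n \<omega> - Y \<omega>\<bar>}) \<longlonglongrightarrow> 0"
    by (rule tendsto_sandwich[OF _ _ tendsto_const lim]) (auto intro!: always_eventually bound)
qed

section \<open>Second moments and convergence of Riemann sums of the paths\<close>

locale supou_square = supou +
  assumes \<mu>_sq: "integrable \<mu> (\<lambda>x. x\<^sup>2)"
begin

text \<open>The variance of the driving variable \<open>L(1)\<close>.\<close>

definition "K = b + (\<integral>x. x\<^sup>2 \<partial>\<mu>)"

lemma K_pos: "K > 0"
  unfolding K_def using b_pos by (intro add_pos_nonneg Bochner_Integration.integral_nonneg) auto

lemma X_second_moment: "expectation (\<lambda>\<omega>. (X t \<omega>)\<^sup>2) \<le> K"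
proof -
  have "expectation (\<lambda>\<omega>. (X t \<omega>)\<^sup>2) \<le> K * (\<integral>z. (supOU_kernel t z)\<^sup>2 \<partial>m)"
    unfolding K_def by (rule decay_second_moment_le[OF decay_X \<mu>_sq X_sq X_mean])
  also have "\<dots> \<le> K * 1" using K_pos by (intro mult_left_mono kernel_square_le_1) auto
  finally show ?thesis by simp
qed

lemma X_diff_L1:
  assumes "u \<le> v"
  shows "(\<integral>\<^sup>+\<omega>. ennreal \<bar>X u \<omega> - X v \<omega>\<bar> \<partial>M) \<le> ennreal (sqrt (K * modulus (v - u)))"
proof (rule expectation_abs_le_sqrt)
  have "(X u \<omega> - X v \<omega>)\<^sup>2 \<le> 2 * (X u \<omega>)\<^sup>2 + 2 * (X v \<omega>)\<^sup>2" for \<omega>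
    using square_le_of_abs_le_add[of "X u \<omega> - X v \<omega>" "X u \<omega>" "X v \<omega>" 1] by (simp add: abs_triangle_ineq4)
  then show sq: "integrable M (\<lambda>\<omega>. (X u \<omega> - X v \<omega>)\<^sup>2)"
    by (intro Bochner_Integration.integrable_bound[OF Bochner_Integration.integrable_add[OF
          integrable_mult_right[OF X_sq[of u], of 2] integrable_mult_right[OF X_sq[of v], of 2]]] AE_I2) auto
  have "expectation (\<lambda>\<omega>. (X u \<omega> - X v \<omega>)\<^sup>2) \<le> K * (\<integral>z. (supOU_kernel u z - supOU_kernel v z)\<^sup>2 \<partial>m)"
    unfolding K_def by (rule decay_second_moment_le[OF decay_X_diff \<mu>_sq sq]) (simp add: X_integrable X_mean)
  also have "\<dots> \<le> K * modulus (v - u)" using K_pos assms by (intro mult_left_mono kernel_diff_square) auto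
  finally show "expectation (\<lambda>\<omega>. (X u \<omega> - X v \<omega>)\<^sup>2) \<le> K * modulus (v - u)" .
qed measurable

sublocale lM: pair_sigma_finite lborel M ..

lemma X_joint' [measurable]: "(\<lambda>p. X (fst p) (snd p)) \<in> borel_measurable (lborel \<Otimes>\<^sub>M M)"
proof -
  have "sets (lborel \<Otimes>\<^sub>M M) = sets (borel \<Otimes>\<^sub>M M)" by (intro sets_pair_measure_cong) auto
  then show ?thesis using X_joint measurable_cong_sets[of "lborel \<Otimes>\<^sub>M M" "borel \<Otimes>\<^sub>M M" borel borel]
    by (simp add: case_prod_beta')
qed

text \<open>First absolute moments are bounded uniformly in time, so Fubini applies: almost every
  path is integrable on \<open>{0..t}\<close>, and the integrated process inherits mean
  zero.\<close>

lemma X_product_integrable: "integrable (lborel \<Otimes>\<^sub>M M) (\<lambda>p. indicator {0..t} (fst p) * X (fst p) (snd p))"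
proof (rule lM.Fubini_integrable)
  have le: "expectation (\<lambda>\<omega>. \<bar>X u \<omega>\<bar>) \<le> 1 + K" for u
  proof -
    have "\<bar>x\<bar> \<le> 1 + x\<^sup>2" for x :: real
      using zero_le_power2[of "\<bar>x\<bar> - 1"] by (simp add: power2_diff)
    then have "expectation (\<lambda>\<omega>. \<bar>X u \<omega>\<bar>) \<le> expectation (\<lambda>\<omega>. 1 + (X u \<omega>)\<^sup>2)"
      using X_integrable[of u] X_sq[of u] by (intro integral_mono) auto
    also have "\<dots> = 1 + expectation (\<lambda>\<omega>. (X u \<omega>)\<^sup>2)" using X_sq[of u] by (simp add: prob_space)
    finally show ?thesis using X_second_moment[of u] by linarith
  qed
  show "integrable lborel (\<lambda>x. \<integral>y. norm (indicator {0..t} (fst (x, y)) * X (fst (x, y)) (snd (x, y))) \<partial>M)"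
  proof (rule Bochner_Integration.integrable_bound[OF integrable_mult_right[OF integrable_indicator_Icc]])
    show "AE u in lborel. norm (\<integral>y. norm (indicator {0..t} (fst (u, y)) * X (fst (u, y)) (snd (u, y))) \<partial>M)
      \<le> norm ((1 + K) * indicator {0..t} u)"
      using le K_pos by (intro AE_I2) (auto simp: indicator_def abs_of_nonneg Bochner_Integration.integral_nonneg)
    have "(\<lambda>(x, y). norm (indicator {0..t} (fst (x, y)) * X (fst (x, y)) (snd (x, y)))) \<in> borel_measurable (lborel \<Otimes>\<^sub>M M)"
      by (simp add: case_prod_beta')
    then show "(\<lambda>x. \<integral>y. norm (indicator {0..t} (fst (x, y)) * X (fst (x, y)) (snd (x, y))) \<partial>M) \<in> borel_measurable lborel"
      by (rule borel_measurable_lebesgue_integral)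
  qed
  show "AE x in lborel. integrable M (\<lambda>y. indicator {0..t} (fst (x, y)) * X (fst (x, y)) (snd (x, y)))"
    using X_integrable by auto
qed measurable

lemma integrated_eq: "integrated_process X t \<omega> = (\<integral>u. indicator {0..t} u * X u \<omega> \<partial>lborel)"
  by (simp add: integrated_process_def set_lebesgue_integral_def)

lemma path_integrable: "AE \<omega> in M. integrable lborel (\<lambda>u. indicator {0..t} u * X u \<omega>)"
  using lM.AE_integrable_snd[of "\<lambda>u \<omega>. indicator {0..t} u * X u \<omega>"] X_product_integrable[of t] by (simp add: case_prod_beta')

lemma integrated_integrable: "integrable M (integrated_process X t)"
  using lM.integrable_snd[of "\<lambda>u \<omega>. indicator {0..t} u * X u \<omega>"] X_product_integrable[of t]
  by (simp add: case_prod_beta' integrated_eq[abs_def])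

lemma integrated_measurable [measurable]: "integrated_process X t \<in> borel_measurable M"
  using integrated_integrable by auto

lemma integrated_mean: "expectation (integrated_process X t) = 0"
proof -
  have "expectation (integrated_process X t) = (\<integral>\<omega>. \<integral>u. indicator {0..t} u * X u \<omega> \<partial>lborel \<partial>M)"
    by (simp add: integrated_eq[abs_def])
  also have "\<dots> = (\<integral>u. \<integral>\<omega>. indicator {0..t} u * X u \<omega> \<partial>M \<partial>lborel)"
    using lM.Fubini_integral[of "\<lambda>u \<omega>. indicator {0..t} u * X u \<omega>"] X_product_integrable[of t] by (simp add: case_prod_beta')
  also have "\<dots> = 0" by (simp add: X_mean)
  finally show ?thesis .
qed

definition riemann :: "real \<Rightarrow> nat \<Rightarrow> 'a \<Rightarrow> real" where
  "riemann t n \<omega> = (\<Sum>i<Suc n. t / real (Suc n) * X (step_node t (Suc n) i) \<omega>)"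

definition kernel_riemann :: "real \<Rightarrow> nat \<Rightarrow> real \<times> real \<Rightarrow> real" where
  "kernel_riemann t n z = (\<Sum>i<Suc n. t / real (Suc n) * supOU_kernel (step_node t (Suc n) i) z)"

lemma riemann_measurable [measurable]: "riemann t n \<in> borel_measurable M"
  unfolding riemann_def[abs_def] by measurable

lemma riemann_stochastic_integral: "stochastic_integral_limit M m \<Lambda> (kernel_riemann t n) (riemann t n)"
  unfolding riemann_def[abs_def] kernel_riemann_def[abs_def]
  by (intro stochastic_integral_limit_sum X_stochastic_integral) auto

text \<open>The error is the time integral of increments of \<open>X\<close> between a point and the
  node to its right, at distance at most \<open>t / real (Suc n)\<close>. The mean of such an
  increment is bounded uniformly in the position.\<close>

lemma riemann_L1:
  assumes t: "t > 0"
  shows "(\<integral>\<^sup>+\<omega>. ennreal \<bar>riemann t n \<omega> - integrated_process X t \<omega>\<bar> \<partial>M) \<le> ennreal (t * sqrt (K * modulus (t / real (Suc n))))"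
proof -
  let ?D = "\<lambda>u \<omega>. indicator {0..t} u * step_fun t (Suc n) (\<lambda>v. X v \<omega>) u - indicator {0..t} u * X u \<omega>"
  have D[measurable]: "(\<lambda>p. ?D (fst p) (snd p)) \<in> borel_measurable (lborel \<Otimes>\<^sub>M M)"
    unfolding step_fun_def by measurable
  have "(\<integral>\<^sup>+\<omega>. ennreal \<bar>riemann t n \<omega> - integrated_process X t \<omega>\<bar> \<partial>M) \<le> (\<integral>\<^sup>+\<omega>. \<integral>\<^sup>+u. ennreal \<bar>?D u \<omega>\<bar> \<partial>lborel \<partial>M)"
  proof (rule nn_integral_mono_AE, use path_integrable[of t] in eventually_elim)
    case (elim \<omega>)
    note st = step_fun_integral[of t "Suc n" "\<lambda>v. X v \<omega>"]
    have "riemann t n \<omega> - integrated_process X t \<omega> = (\<integral>u. ?D u \<omega> \<partial>lborel)"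
      unfolding integrated_eq riemann_def using st t elim by (subst Bochner_Integration.integral_diff) auto
    then show ?case
      using integral_norm_bound_ennreal[of lborel "\<lambda>u. ?D u \<omega>"] st t elim by auto
  qed
  also have "\<dots> = (\<integral>\<^sup>+u. \<integral>\<^sup>+\<omega>. ennreal \<bar>?D u \<omega>\<bar> \<partial>M \<partial>lborel)"
  proof (rule lM.Fubini')
    show "(\<lambda>(u, \<omega>). ennreal \<bar>?D u \<omega>\<bar>) \<in> borel_measurable (lborel \<Otimes>\<^sub>M M)"
      unfolding case_prod_beta' by (rule measurable_compose[OF D, where g = "\<lambda>x. ennreal \<bar>x\<bar>"]) measurable
  qed
  also have "\<dots> \<le> (\<integral>\<^sup>+u. ennreal (sqrt (K * modulus (t / real (Suc n)))) * indicator {0..t} u \<partial>lborel)"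
  proof (rule nn_integral_mono_AE, use AE_lborel_singleton[of t] in eventually_elim)
    case (elim u)
    show ?case
    proof (cases "u \<in> {0..t}")
      case True
      then obtain v where v: "u \<le> v" "v \<le> u + t / real (Suc n)" "\<And>h. step_fun t (Suc n) h u = h v"
        using step_fun_eq[of t "Suc n" u] t elim by (metis atLeastAtMost_iff less_le zero_less_Suc)
      have "(\<integral>\<^sup>+\<omega>. ennreal \<bar>?D u \<omega>\<bar> \<partial>M) = (\<integral>\<^sup>+\<omega>. ennreal \<bar>X u \<omega> - X v \<omega>\<bar> \<partial>M)"
        using True by (simp add: v(3) abs_minus_commute)
      also have "\<dots> \<le> ennreal (sqrt (K * modulus (v - u)))" by (rule X_diff_L1[OF v(1)])
      also have "\<dots> \<le> ennreal (sqrt (K * modulus (t / real (Suc n))))"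
        using v(1,2) K_pos by (intro ennreal_leI real_sqrt_le_mono mult_left_mono modulus_mono) auto
      finally have "(\<integral>\<^sup>+\<omega>. ennreal \<bar>?D u \<omega>\<bar> \<partial>M) \<le> ennreal (sqrt (K * modulus (t / real (Suc n))))" .
      moreover have "indicator {0..t} u = (1::ennreal)" using True by (rule indicator_simps)
      ultimately show ?thesis by (simp only: mult_1_right)
    next
      case False
      then have "indicator {0..t} u = (0::real)" by (rule indicator_simps)
      then show ?thesis by (simp only: mult_zero_left) simp
    qed
  qed
  also have "\<dots> = ennreal (t * sqrt (K * modulus (t / real (Suc n))))"
    using t by (subst nn_integral_cmult_indicator) (auto simp: ennreal_mult' mult.commute)
  finally show ?thesis .
qed

lemma riemann_converges:
  assumes "t \<ge> 0"
  shows "converges_in_probability M (riemann t) (integrated_process X t)"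
proof (cases "t = 0")
  case True
  have "riemann 0 n = (\<lambda>_. 0)" for n by (simp add: riemann_def[abs_def])
  moreover have "integrated_process X 0 = (\<lambda>_. 0)"
  proof
    fix \<omega>
    have e0: "indicator {0..0} u * X u \<omega> = X 0 \<omega> * indicator {0} u" for u :: real
      by (auto simp: indicator_def)
    show "integrated_process X 0 \<omega> = 0" unfolding integrated_eq e0 by simp
  qed
  ultimately show ?thesis using True by (simp add: converges_in_probability_def)
next
  case False
  then have t: "t > 0" using assms by simp
  have mod0: "modulus \<delta> \<ge> 0" if "\<delta> \<ge> 0" for \<delta>
    unfolding modulus_def using that by (intro integral_nonneg_AE AE_I2) (simp add: space_\<pi>)
  have "(\<lambda>n. t * sqrt (K * modulus (t / real (Suc n)))) \<longlonglongrightarrow> t * sqrt (K * 0)"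
    using t by (intro tendsto_intros modulus_tendsto) auto
  then show ?thesis
    using t K_pos by (intro converges_in_probability_L1[OF _ _ riemann_L1[OF t]]) (auto intro!: mult_nonneg_nonneg mod0)
qed

lemma decay_integrated:
  assumes t: "t > 0"
  shows "decay (kernel_integral t) (integrated_process X t)"
proof (rule decays_like_limit[OF levy b_nonneg _ _ _ _ _ riemann_converges])
  fix n k
  show "decay (kernel_riemann t n) (riemann t n)"
    by (intro decays_like_stochastic_integral riemann_stochastic_integral)
  show "decay (\<lambda>z. kernel_riemann t n z - kernel_riemann t k z) (\<lambda>\<omega>. riemann t n \<omega> - riemann t k \<omega>)"
    using decays_like_stochastic_integral[OF stochastic_integral_limit_linear[OF riemann_stochastic_integral[of t n] riemann_stochastic_integral[of t k], of 1 "-1"]]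
    by simp
next
  show "AE z in m. (\<lambda>n. kernel_riemann t n z) \<longlonglongrightarrow> kernel_integral t z"
    unfolding kernel_riemann_def
    by (intro AE_I2 kernel_riemann_sum_tendsto t) (auto simp: space_pair_measure space_\<pi>)
qed (use t in auto)

end

section \<open>The Gaussian case\<close>

context prob_space
begin

text \<open>\<open>s = 0\<close> is allowed because linear combinations and limits may degenerate to
  constants.\<close>

definition gaussian_char :: "('a \<Rightarrow> real) \<Rightarrow> bool" where
  "gaussian_char Y \<longleftrightarrow> Y \<in> borel_measurable M \<and>
     (\<exists>c s. s \<ge> 0 \<and> (\<forall>\<zeta>. char (distr M borel Y) \<zeta> = iexp (\<zeta> * c) * of_real (exp (- (\<zeta>\<^sup>2 * s / 2)))))"

lemma real_distribution_rv: "Y \<in> borel_measurable M \<Longrightarrow> real_distribution (distr M borel Y)"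
  by (auto simp: real_distribution_def real_distribution_axioms_def prob_space_distr)

text \<open>Averaging over a normal variable turns unimodular factors into a bound on the drift.\<close>
lemma bounded_of_tendsto_iexp:
  fixes c :: "nat \<Rightarrow> real" and h :: "real \<Rightarrow> complex"
  assumes lim: "\<And>\<zeta>. (\<lambda>n. iexp (\<zeta> * c n)) \<longlonglongrightarrow> h \<zeta>" and cont: "isCont h 0" and h: "h \<in> borel_measurable borel"
  shows "bounded (range c)"
proof -
  interpret S: prob_space std_normal_distribution by (rule prob_space_normal_density) simp
  have [measurable_cong]: "sets std_normal_distribution = sets borel" by simp
  note [measurable] = h
  have "h 0 = 1" using lim[of 0] LIMSEQ_unique[OF _ tendsto_const] by fastforce
  have h1: "norm (h \<zeta>) = 1" for \<zeta>
    using tendsto_norm[OF lim[of \<zeta>]] LIMSEQ_unique[OF _ tendsto_const] by fastforce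
  have e: "(\<integral>z. iexp (\<eta> * z * c n) \<partial>std_normal_distribution) = of_real (exp (- ((\<eta> * c n)\<^sup>2) / 2))" for \<eta> n
    using fun_cong[OF char_std_normal_distribution, of "\<eta> * c n"] by (simp add: char_def ac_simps)
  have L1: "(\<lambda>n. complex_of_real (exp (- ((\<eta> * c n)\<^sup>2) / 2))) \<longlonglongrightarrow> (\<integral>z. h (\<eta> * z) \<partial>std_normal_distribution)" for \<eta>
    unfolding e[symmetric]
  proof (rule integral_dominated_convergence[where w = "\<lambda>_. 1"])
    show "AE z in std_normal_distribution. (\<lambda>n. iexp (\<eta> * z * c n)) \<longlonglongrightarrow> h (\<eta> * z)"
      by (intro AE_I2 lim)
  qed auto
  have "(\<lambda>k. \<integral>z. h (1 / real (Suc k) * z) \<partial>std_normal_distribution) \<longlonglongrightarrow> (\<integral>z. 1 \<partial>std_normal_distribution)"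
  proof (rule integral_dominated_convergence[where w = "\<lambda>_. 1"])
    show "AE z in std_normal_distribution. (\<lambda>k. h (1 / real (Suc k) * z)) \<longlonglongrightarrow> 1"
    proof (intro AE_I2)
      fix z
      have "(\<lambda>k. 1 / real (Suc k) * z) \<longlonglongrightarrow> 0 * z" by (intro tendsto_intros LIMSEQ_Suc[OF lim_const_over_n])
      then show "(\<lambda>k. h (1 / real (Suc k) * z)) \<longlonglongrightarrow> 1"
        using isCont_tendsto_compose[OF cont] \<open>h 0 = 1\<close> by simp
    qed
  qed (auto simp: h1)
  then have "(\<lambda>k. Re (\<integral>z. h (1 / real (Suc k) * z) \<partial>std_normal_distribution)) \<longlonglongrightarrow> 1"
    using tendsto_Re S.prob_space by (force dest: tendsto_Re)
  then have "\<forall>\<^sub>F k in sequentially. Re (\<integral>z. h (1 / real (Suc k) * z) \<partial>std_normal_distribution) > 1 / 2"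
    by (rule order_tendstoD(1)) simp
  then obtain k where k: "Re (\<integral>z. h (1 / real (Suc k) * z) \<partial>std_normal_distribution) > 1 / 2"
    by (auto simp: eventually_sequentially)
  \<comment> \<open>At this scale the normal average of the limit \<open>h\<close> exceeds 1/2. The
    averages for large \<open>n\<close> then exceed 1/2 as well, and they are
    \<open>exp (- ((\<eta> * c n)^2) / 2)\<close>, which confines \<open>c n\<close>.\<close>
  define \<eta> where "\<eta> = 1 / real (Suc k)"
  have "\<eta> > 0" by (simp add: \<eta>_def)
  have "(\<lambda>n. exp (- ((\<eta> * c n)\<^sup>2) / 2)) \<longlonglongrightarrow> Re (\<integral>z. h (\<eta> * z) \<partial>std_normal_distribution)"
    using tendsto_Re[OF L1[of \<eta>]] by simp
  then have "\<forall>\<^sub>F n in sequentially. exp (- ((\<eta> * c n)\<^sup>2) / 2) > 1 / 2"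
    by (rule order_tendstoD(1)) (use k in \<open>simp add: \<eta>_def\<close>)
  then obtain N where N: "\<And>n. n \<ge> N \<Longrightarrow> exp (- ((\<eta> * c n)\<^sup>2) / 2) > 1 / 2" by (auto simp: eventually_sequentially)
  have le: "\<bar>c n\<bar> \<le> 2 / \<eta>" if "n \<ge> N" for n
  proof -
    let ?w = "(\<eta> * c n)\<^sup>2 / 2"
    have "1 / 2 < exp (- ?w)" using N[OF that] by simp
    then have "exp ?w < 2" by (simp add: exp_minus field_simps)
    then have "?w < 1" using exp_ge_add_one_self[of ?w] by linarith
    then have "(\<eta> * c n)\<^sup>2 \<le> 2\<^sup>2" by simp
    then have "\<bar>\<eta> * c n\<bar> \<le> 2" by (simp add: abs_le_square_iff[of "\<eta> * c n" 2, simplified])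
    then show ?thesis using \<open>\<eta> > 0\<close> by (simp add: abs_mult field_simps)
  qed
  have "range c \<subseteq> c ` {..<N} \<union> cball 0 (2 / \<eta>)"
  proof
    fix x assume "x \<in> range c"
    then obtain n where "x = c n" by auto
    then show "x \<in> c ` {..<N} \<union> cball 0 (2 / \<eta>)"
      using le[of n] by (cases "n < N") auto
  qed
  moreover have "bounded (c ` {..<N} \<union> cball 0 (2 / \<eta>))" by (simp add: finite_imp_bounded)
  ultimately show ?thesis using bounded_subset by blast
qed

text \<open>The modulus at a single nonzero point where the limit does not vanish determines the
  limit of the variances. Dividing the Gaussian factor out leaves
  \<open>iexp (\<zeta> * c n)\<close>, whose convergence bounds the drifts; a convergent subsequence
  identifies the limit.\<close>

lemma gaussian_char_limit:
  assumes g: "\<And>n. gaussian_char (Z n)" and [measurable]: "Y \<in> borel_measurable M"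
    and conv: "converges_in_probability M Z Y"
  shows "gaussian_char Y"
proof -
  have [measurable]: "Z n \<in> borel_measurable M" for n using g by (simp add: gaussian_char_def)
  obtain c s where cs: "\<And>n. s n \<ge> 0"
    "\<And>n \<zeta>. char (distr M borel (Z n)) \<zeta> = iexp (\<zeta> * c n) * of_real (exp (- (\<zeta>\<^sup>2 * s n / 2)))"
    using g unfolding gaussian_char_def by metis
  let ?\<phi> = "char (distr M borel Y)"
  interpret D: real_distribution "distr M borel Y" by (rule real_distribution_rv) simp
  have lim: "(\<lambda>n. iexp (\<zeta> * c n) * of_real (exp (- (\<zeta>\<^sup>2 * s n / 2)))) \<longlonglongrightarrow> ?\<phi> \<zeta>" for \<zeta>
    using converges_in_probability_char[OF _ _ conv, of \<zeta>] unfolding cs by simp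
  have "(?\<phi> \<longlongrightarrow> ?\<phi> 0) (at 0)" using D.isCont_char[of 0] by (simp add: isCont_def)
  then have "((\<lambda>\<zeta>. norm (?\<phi> \<zeta>)) \<longlongrightarrow> norm (?\<phi> 0)) (at 0)" by (rule tendsto_norm)
  then have "((\<lambda>\<zeta>. norm (?\<phi> \<zeta>)) \<longlongrightarrow> 1) (at 0)" by (simp add: D.char_zero)
  then have "\<forall>\<^sub>F \<zeta> in at 0. norm (?\<phi> \<zeta>) > 0" by (rule order_tendstoD(1)) simp
  then obtain \<delta> where \<delta>: "\<delta> \<noteq> 0" "norm (?\<phi> \<delta>) > 0"
    using eventually_at_filter[of "\<lambda>\<zeta>. norm (?\<phi> \<zeta>) > 0" "0::real" UNIV]
      eventually_happens[of _ "at (0::real)"] by (metis (mono_tags, lifting) at_neq_bot eventually_conj eventually_neq_at_within)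
  have "(\<lambda>n. norm (iexp (\<delta> * c n) * of_real (exp (- (\<delta>\<^sup>2 * s n / 2))))) \<longlonglongrightarrow> norm (?\<phi> \<delta>)"
    by (rule tendsto_norm[OF lim])
  then have "(\<lambda>n. exp (- (\<delta>\<^sup>2 * s n / 2))) \<longlonglongrightarrow> norm (?\<phi> \<delta>)" by (simp add: norm_mult)
  then have "(\<lambda>n. ln (exp (- (\<delta>\<^sup>2 * s n / 2)))) \<longlonglongrightarrow> ln (norm (?\<phi> \<delta>))" using \<delta> by (intro tendsto_ln) auto
  then have "(\<lambda>n. -2 / \<delta>\<^sup>2 * ln (exp (- (\<delta>\<^sup>2 * s n / 2)))) \<longlonglongrightarrow> -2 / \<delta>\<^sup>2 * ln (norm (?\<phi> \<delta>))"
    by (rule tendsto_mult_left)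
  then obtain s' where s': "s \<longlonglongrightarrow> s'" using \<delta> by (auto simp: power2_eq_square)
  have "s' \<ge> 0" by (rule LIMSEQ_le_const[OF s']) (use cs in auto)
  define h where "h \<zeta> = ?\<phi> \<zeta> * of_real (exp (\<zeta>\<^sup>2 * s' / 2))" for \<zeta>
  have hl: "(\<lambda>n. iexp (\<zeta> * c n)) \<longlonglongrightarrow> h \<zeta>" for \<zeta>
  proof -
    have "(\<lambda>n. iexp (\<zeta> * c n) * of_real (exp (- (\<zeta>\<^sup>2 * s n / 2))) * of_real (exp (\<zeta>\<^sup>2 * s n / 2))) \<longlonglongrightarrow> h \<zeta>"
      unfolding h_def by (intro tendsto_mult[OF lim] tendsto_intros s') auto
    moreover have "iexp (\<zeta> * c n) * of_real (exp (- (\<zeta>\<^sup>2 * s n / 2))) * of_real (exp (\<zeta>\<^sup>2 * s n / 2)) = iexp (\<zeta> * c n)" for n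
      by (simp add: mult.assoc exp_minus flip: of_real_mult)
    ultimately show ?thesis by (simp only:)
  qed
  have hc: "isCont h \<zeta>" for \<zeta> unfolding h_def by (intro continuous_intros D.isCont_char) auto
  have "bounded (range c)"
    by (rule bounded_of_tendsto_iexp[OF hl hc])
      (intro borel_measurable_continuous_onI continuous_at_imp_continuous_on ballI hc)
  then obtain l r where r: "strict_mono r" "(c \<circ> r) \<longlonglongrightarrow> l"
    using bounded_imp_convergent_subsequence by blast
  have "h \<zeta> = iexp (\<zeta> * l)" for \<zeta>
  proof (rule LIMSEQ_unique)
    show "(\<lambda>n. iexp (\<zeta> * (c \<circ> r) n)) \<longlonglongrightarrow> h \<zeta>"
      using LIMSEQ_subseq_LIMSEQ[OF hl r(1)] by (simp add: o_def)
    show "(\<lambda>n. iexp (\<zeta> * (c \<circ> r) n)) \<longlonglongrightarrow> iexp (\<zeta> * l)" by (intro tendsto_intros r)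
  qed
  moreover have "?\<phi> \<zeta> = h \<zeta> * of_real (exp (- (\<zeta>\<^sup>2 * s' / 2)))" for \<zeta>
    unfolding h_def by (simp add: mult.assoc exp_minus flip: of_real_mult)
  ultimately have "?\<phi> \<zeta> = iexp (\<zeta> * l) * of_real (exp (- (\<zeta>\<^sup>2 * s' / 2)))" for \<zeta>
    by (simp only:)
  then show ?thesis unfolding gaussian_char_def using \<open>s' \<ge> 0\<close> by auto
qed

text \<open>An affine image of a standard normal variable has the same characteristic function, so
  uniqueness transfers its law; for \<open>s = 0\<close> the image is a point mass.\<close>

lemma gaussian_char_imp_gaussian:
  assumes "gaussian_char Y"
  shows "gaussian_variable M Y"
proof -
  have [measurable]: "Y \<in> borel_measurable M" using assms by (simp add: gaussian_char_def)
  obtain c s where s: "s \<ge> 0" and \<phi>: "\<And>\<zeta>. char (distr M borel Y) \<zeta> = iexp (\<zeta> * c) * of_real (exp (- (\<zeta>\<^sup>2 * s / 2)))"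
    using assms by (auto simp: gaussian_char_def)
  interpret S: prob_space std_normal_distribution by (rule prob_space_normal_density) simp
  have [measurable_cong]: "sets std_normal_distribution = sets borel" by simp
  let ?Z = "\<lambda>z. c + sqrt s * z"
  have "char (distr std_normal_distribution borel ?Z) \<zeta> = char (distr M borel Y) \<zeta>" for \<zeta>
  proof -
    have "char (distr std_normal_distribution borel ?Z) \<zeta> = (\<integral>z. iexp (\<zeta> * c) * iexp (\<zeta> * sqrt s * z) \<partial>std_normal_distribution)"
      by (subst S.char_distr) (auto simp: algebra_simps exp_add[symmetric])
    also have "\<dots> = iexp (\<zeta> * c) * char std_normal_distribution (\<zeta> * sqrt s)"
      by (simp add: char_def)
    also have "\<dots> = char (distr M borel Y) \<zeta>"
      using s by (simp add: char_std_normal_distribution \<phi> power_mult_distrib)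
    finally show ?thesis .
  qed
  then have eq: "distr M borel Y = distr std_normal_distribution borel ?Z"
    by (intro Levy_uniqueness real_distribution_rv S.real_distribution_rv) auto
  show ?thesis
  proof (cases "s = 0")
    case True
    have "AE x in distr std_normal_distribution borel ?Z. x = c"
      using True by (subst AE_distr_iff) auto
    then have "AE \<omega> in M. Y \<omega> = c" unfolding eq[symmetric] by (subst (asm) AE_distr_iff) auto
    then show ?thesis by (auto simp: gaussian_variable_def)
  next
    case False
    then have sp: "sqrt s > 0" using s by simp
    have "distributed std_normal_distribution lborel (\<lambda>z. z) std_normal_density"
      by (auto simp: distributed_def distr_id2)
    then have "distributed std_normal_distribution lborel (\<lambda>z. c + sqrt s * z) (normal_density (c + sqrt s * 0) (\<bar>sqrt s\<bar> * 1))"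
      using sp by (intro S.normal_density_affine) auto
    then have "distr std_normal_distribution lborel ?Z = density lborel (normal_density c (sqrt s))"
      using sp by (simp add: distributed_def)
    moreover have "distr M lborel Y = distr M borel Y" "distr std_normal_distribution lborel ?Z = distr std_normal_distribution borel ?Z"
      by (auto intro!: distr_cong)
    ultimately have "distributed M lborel Y (normal_density c (sqrt s))"
      using eq by (auto simp: distributed_def)
    then show ?thesis using sp by (auto simp: gaussian_variable_def)
  qed
qed

end

lemma levy_khintchine_null: "levy_khintchine a b (null_measure borel) \<zeta> = \<i> * of_real (\<zeta> * a) - of_real (\<zeta>\<^sup>2 / 2 * b)"
  by (simp add: levy_khintchine_def integral_null_measure)

text \<open>Without jumps the cumulant is a quadratic polynomial, so integrals of simple functions
  have Gaussian characteristic functions, and this class is closed under limits in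
  probability.\<close>

lemma (in levy_khintchine_space) gaussian_char_stochastic_integral:
  assumes null: "\<mu> = null_measure borel" and f: "stochastic_integral_limit M m \<Lambda> f Y"
  shows "gaussian_char Y"
proof -
  obtain g where g: "\<And>n. simple_function m (g n)" "\<And>n. {x \<in> space m. g n x \<noteq> 0} \<in> fms"
    "converges_in_probability M (\<lambda>n. I (g n)) Y"
    using f by (auto simp: stochastic_integral_limit_def)
  have "gaussian_char (I (g n))" for n
  proof -
    let ?W = "g n ` space m - {0}" and ?m = "\<lambda>y. measure m {x \<in> space m. g n x = y}"
    have "char (distr M borel (I (g n))) \<zeta> = iexp (\<zeta> * (a * (\<Sum>y\<in>?W. ?m y * y))) * of_real (exp (- (\<zeta>\<^sup>2 * (b * (\<Sum>y\<in>?W. ?m y * y\<^sup>2)) / 2)))" for \<zeta>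
    proof -
      have "(\<Sum>y\<in>?W. of_real (?m y) * levy_khintchine a b \<mu> (\<zeta> * y))
        = \<i> * of_real (\<zeta> * (a * (\<Sum>y\<in>?W. ?m y * y))) + of_real (- (\<zeta>\<^sup>2 * (b * (\<Sum>y\<in>?W. ?m y * y\<^sup>2)) / 2))"
        unfolding null levy_khintchine_null
        by (simp add: sum_distrib_left sum_subtractf sum_negf[symmetric] sum_divide_distrib right_diff_distrib power_mult_distrib ac_simps)
      then show ?thesis unfolding char_simple_integral[OF g(1,2)] by (simp only: exp_add exp_of_real)
    qed
    moreover have "b * (\<Sum>y\<in>?W. ?m y * y\<^sup>2) \<ge> 0" using b_nonneg by (intro mult_nonneg_nonneg sum_nonneg) auto
    ultimately show ?thesis unfolding gaussian_char_def using simple_integral_measurable[OF g(1,2)] by blast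
  qed
  moreover have "Y \<in> borel_measurable M" using f by (simp add: stochastic_integral_limit_def)
  ultimately show ?thesis using g(3) by (rule gaussian_char_limit)
qed

context supou_square
begin

text \<open>A linear combination over several times is approximated by Riemann sums with a common
  \<open>n\<close>, and their combination is again a single stochastic integral.\<close>

lemma integrated_gaussian:
  assumes null: "\<mu> = null_measure borel"
  shows "gaussian_process_on M {0..} (integrated_process X)"
  unfolding gaussian_process_on_def
proof (intro allI impI)
  fix F :: "real set" and c :: "real \<Rightarrow> real" assume F: "finite F \<and> F \<subseteq> {0..}"
  have conv: "converges_in_probability M (\<lambda>n \<omega>. \<Sum>t\<in>F. c t * riemann t n \<omega>) (\<lambda>\<omega>. \<Sum>t\<in>F. c t * integrated_process X t \<omega>)"
    using conjunct1[OF F] conjunct2[OF F]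
  proof (induction F rule: finite_induct)
    case empty
    then show ?case by (simp add: converges_in_probability_def)
  next
    case (insert t F)
    have "converges_in_probability M (\<lambda>n \<omega>. \<Sum>t\<in>insert t F. c t * riemann t n \<omega>)
      (\<lambda>\<omega>. c t * integrated_process X t \<omega> + 1 * (\<Sum>t\<in>F. c t * integrated_process X t \<omega>))"
      using insert by (intro converges_in_probability_linear[where U = "riemann t" and V = "\<lambda>n \<omega>. \<Sum>t\<in>F. c t * riemann t n \<omega>"])
        (auto intro!: riemann_converges)
    then show ?case using insert by simp
  qed
  have "gaussian_char (\<lambda>\<omega>. \<Sum>t\<in>F. c t * riemann t n \<omega>)" for n
  proof (rule gaussian_char_stochastic_integral[OF null])
    show "stochastic_integral_limit M m \<Lambda> (\<lambda>z. \<Sum>t\<in>F. c t * kernel_riemann t n z) (\<lambda>\<omega>. \<Sum>t\<in>F. c t * riemann t n \<omega>)"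
      using F by (intro stochastic_integral_limit_sum riemann_stochastic_integral) auto
  qed
  then have "gaussian_char (\<lambda>\<omega>. \<Sum>t\<in>F. c t * integrated_process X t \<omega>)"
    by (rule gaussian_char_limit[OF _ _ conv]) measurable
  then show "gaussian_variable M (\<lambda>\<omega>. \<Sum>t\<in>F. c t * integrated_process X t \<omega>)"
    by (rule gaussian_char_imp_gaussian)
qed

end

section \<open>Scaling exponents\<close>

lemma powr_two_minus: "t > 0 \<Longrightarrow> t powr (2 - x) = t\<^sup>2 * t powr - x" for t x :: real
  by (simp add: powr_diff powr_minus powr_numeral field_simps)

text \<open>Every term of the series of cosh - 1 carries the factor \<open>s^2\<close>, up to powers
  of \<open>s^2 \<le> 1\<close>.\<close>

lemma cosh_scale_le:
  assumes "\<bar>s\<bar> \<le> (1::real)"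
  shows "cosh (s * y) - 1 \<le> s\<^sup>2 * (cosh y - 1)"
proof (rule sums_le)
  show "(\<lambda>k. (s * y) ^ (2 * k + 2) / fact (2 * k + 2)) sums (cosh (s * y) - 1)" by (rule cosh_even_sums)
  show "(\<lambda>k. s\<^sup>2 * (y ^ (2 * k + 2) / fact (2 * k + 2))) sums (s\<^sup>2 * (cosh y - 1))"
    by (intro sums_mult cosh_even_sums)
  fix k
  have "(s\<^sup>2) ^ k \<le> 1" using assms by (intro power_le_one[of "s\<^sup>2"]) (auto simp: abs_square_le_1)
  then have "s\<^sup>2 * (s\<^sup>2) ^ k \<le> s\<^sup>2 * 1" by (intro mult_left_mono) auto
  moreover have "s ^ (2 * k + 2) = s\<^sup>2 * (s\<^sup>2) ^ k" by (simp only: power_mult[symmetric] power_add mult.commute)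
  ultimately have "s ^ (2 * k + 2) \<le> s\<^sup>2" by simp
  moreover have "y ^ (2 * k + 2) / fact (2 * k + 2) \<ge> 0" by (intro divide_nonneg_nonneg zero_le_even_power) auto
  ultimately have "s ^ (2 * k + 2) * (y ^ (2 * k + 2) / fact (2 * k + 2)) \<le> s\<^sup>2 * (y ^ (2 * k + 2) / fact (2 * k + 2))"
    by (intro mult_right_mono)
  then show "(s * y) ^ (2 * k + 2) / fact (2 * k + 2) \<le> s\<^sup>2 * (y ^ (2 * k + 2) / fact (2 * k + 2))"
    by (simp only: power_mult_distrib times_divide_eq_right)
qed

text \<open>Constants contribute \<open>ln C / ln t\<close>, which vanishes, so bounds with an
  arbitrarily small loss in the exponent determine the limit. The lower bound also makes the moment
  positive, as its logarithm requires.\<close>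

lemma has_scaling_exponentI:
  fixes Y :: "real \<Rightarrow> 'w \<Rightarrow> real"
  assumes upper: "\<And>\<delta>. \<delta> > 0 \<Longrightarrow> \<exists>C>0. \<forall>\<^sub>F t in at_top. integrable M (\<lambda>\<omega>. \<bar>Y t \<omega>\<bar> powr q) \<and>
      (LINT \<omega>|M. \<bar>Y t \<omega>\<bar> powr q) \<le> C * t powr (\<tau> + \<delta>)"
    and lower: "\<And>\<delta>. \<delta> > 0 \<Longrightarrow> \<exists>C>0. \<forall>\<^sub>F t in at_top. C * t powr (\<tau> - \<delta>) \<le> (LINT \<omega>|M. \<bar>Y t \<omega>\<bar> powr q)"
  shows "has_scaling_exponent M Y q \<tau>"
  unfolding has_scaling_exponent_def
proof
  show "\<forall>\<^sub>F t in at_top. integrable M (\<lambda>\<omega>. \<bar>Y t \<omega>\<bar> powr q)"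
    using upper[of 1] by (auto elim: eventually_mono)
  let ?E = "\<lambda>t. LINT \<omega>|M. \<bar>Y t \<omega>\<bar> powr q"
  show "((\<lambda>t. ln (?E t) / ln t) \<longlongrightarrow> \<tau>) at_top"
  proof (rule tendstoI)
    fix e :: real assume "e > 0"
    obtain C1 where "C1 > 0" "\<forall>\<^sub>F t in at_top. integrable M (\<lambda>\<omega>. \<bar>Y t \<omega>\<bar> powr q) \<and> ?E t \<le> C1 * t powr (\<tau> + e / 2)"
      using upper[of "e / 2"] \<open>e > 0\<close> by auto
    then have C1: "C1 > 0" "\<forall>\<^sub>F t in at_top. ?E t \<le> C1 * t powr (\<tau> + e / 2)"
      by (auto elim: eventually_mono)
    obtain C2 where C2: "C2 > 0" "\<forall>\<^sub>F t in at_top. C2 * t powr (\<tau> - e / 2) \<le> ?E t"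
      using lower[of "e / 2"] \<open>e > 0\<close> by auto
    have small: "\<forall>\<^sub>F t in at_top. \<bar>ln C / ln t\<bar> < e / 2" for C :: real
    proof -
      have "((\<lambda>t. ln C / ln t) \<longlongrightarrow> 0) at_top"
        by (intro tendsto_divide_0[OF tendsto_const] filterlim_at_top_imp_at_infinity ln_at_top)
      from tendstoD[OF this, of "e / 2"] show ?thesis using \<open>e > 0\<close> by (simp only: dist_real_def diff_zero)
    qed
    show "\<forall>\<^sub>F t in at_top. dist (ln (?E t) / ln t) \<tau> < e"
      using C1(2) C2(2) small[of C1] small[of C2] eventually_gt_at_top[of 1]
    proof eventually_elim
      case (elim t)
      have lt: "ln t > 0" using elim by simp
      have pos: "0 < C2 * t powr (\<tau> - e / 2)" using C2(1) elim by simp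
      have "ln (C2 * t powr (\<tau> - e / 2)) \<le> ln (?E t)"
        using pos elim by (subst ln_le_cancel_iff) auto
      then have "ln C2 + (\<tau> - e / 2) * ln t \<le> ln (?E t)" using C2(1) elim by (simp add: ln_mult ln_powr)
      then have l: "ln C2 / ln t + (\<tau> - e / 2) \<le> ln (?E t) / ln t"
        using divide_right_mono[of _ _ "ln t"] lt by (fastforce simp: add_divide_distrib)
      have "ln (?E t) \<le> ln (C1 * t powr (\<tau> + e / 2))"
        using pos elim by (subst ln_le_cancel_iff) auto
      then have "ln (?E t) \<le> ln C1 + (\<tau> + e / 2) * ln t" using C1(1) elim by (simp add: ln_mult ln_powr)
      then have u: "ln (?E t) / ln t \<le> ln C1 / ln t + (\<tau> + e / 2)"
        using divide_right_mono[of _ _ "ln t"] lt by (fastforce simp: add_divide_distrib)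
      show ?case using l u elim unfolding dist_real_def abs_less_iff by linarith
    qed
  qed
qed

text \<open>A nonzero Levy measure does not charge the origin, so it charges one of the bands
  exhausting the punctured line; bands are bounded away from 0 and hence of finite mass.\<close>

lemma levy_measure_band:
  assumes levy: "levy_measure \<mu>" and "\<mu> \<noteq> null_measure borel"
  obtains r where "r > 0" "measure \<mu> {x. 1 / r \<le> \<bar>x\<bar> \<and> \<bar>x\<bar> \<le> r} > 0"
    "{x. 1 / r \<le> \<bar>x\<bar> \<and> \<bar>x\<bar> \<le> r} \<in> sets \<mu>" "emeasure \<mu> {x. 1 / r \<le> \<bar>x\<bar> \<and> \<bar>x\<bar> \<le> r} < \<infinity>"
proof -
  have s[measurable_cong]: "sets \<mu> = sets borel" and z: "emeasure \<mu> {0} = 0"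
    using levy by (simp_all add: levy_measure_def)
  let ?B = "\<lambda>n::nat. {x::real. 1 / real (Suc n) \<le> \<bar>x\<bar> \<and> \<bar>x\<bar> \<le> real (Suc n)}"
  have Bs: "?B n \<in> sets \<mu>" for n unfolding s by measurable
  have "\<exists>n. emeasure \<mu> (?B n) \<noteq> 0"
  proof (rule ccontr)
    assume "\<not> ?thesis"
    then have "emeasure \<mu> (\<Union>n. ?B n) = 0" using Bs by (intro emeasure_UN_eq_0) auto
    then have "emeasure \<mu> ({0} \<union> (\<Union>n. ?B n)) = 0" using z Bs by (subst emeasure_Un_null_set) (auto simp: null_sets_def s)
    moreover have "x \<in> {0} \<union> (\<Union>n. ?B n)" for x
    proof (cases "x = 0")
      case False
      obtain n1 where n1: "1 / real (Suc n1) < \<bar>x\<bar>" using False nat_approx_posE[of "\<bar>x\<bar>"] by auto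
      obtain n2 :: nat where n2: "\<bar>x\<bar> \<le> real n2" using real_arch_simple by blast
      have "1 / real (Suc (max n1 n2)) \<le> 1 / real (Suc n1)" by (intro divide_left_mono) auto
      then have "x \<in> ?B (max n1 n2)" using n1 n2 by auto
      then show ?thesis by blast
    qed simp
    then have "{0} \<union> (\<Union>n. ?B n) = UNIV" by blast
    ultimately have "emeasure \<mu> UNIV = 0" by simp
    then have "emeasure \<mu> A = 0" for A
      using emeasure_mono[of A UNIV \<mu>] s by (metis le_zero_eq sets.top sets_eq_imp_space_eq space_borel top_greatest)
    then have "\<mu> = null_measure borel" using s by (intro measure_eqI) auto
    then show False using assms(2) by simp
  qed
  then obtain n where n: "emeasure \<mu> (?B n) \<noteq> 0" by blast
  define r where "r = real (Suc n)"
  let ?C = "{x. 1 / r \<le> \<bar>x\<bar> \<and> \<bar>x\<bar> \<le> r}"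
  have r: "r > 0" "r \<ge> 1" by (auto simp: r_def)
  have "emeasure \<mu> ?C < \<infinity>"
  proof -
    have "emeasure \<mu> ?C = (\<integral>\<^sup>+x. indicator ?C x \<partial>\<mu>)" using Bs[of n] by (simp add: r_def)
    also have "\<dots> \<le> (\<integral>\<^sup>+x. ennreal (r\<^sup>2) * ennreal (min 1 (x\<^sup>2)) \<partial>\<mu>)"
    proof (intro nn_integral_mono)
      fix x
      have "1 \<le> r\<^sup>2 * min 1 (x\<^sup>2)" if "1 / r \<le> \<bar>x\<bar>"
      proof -
        have "1 \<le> r * \<bar>x\<bar>" using that r by (simp add: field_simps)
        then have "1 \<le> (r * \<bar>x\<bar>)\<^sup>2" by (simp add: one_le_power)
        moreover have "1 \<le> r\<^sup>2" using r by (simp add: one_le_power)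
        ultimately show ?thesis by (simp add: min_def power_mult_distrib)
      qed
      then show "indicator ?C x \<le> ennreal (r\<^sup>2) * ennreal (min 1 (x\<^sup>2))"
        by (auto simp: indicator_def ennreal_mult[symmetric])
    qed
    also have "\<dots> = ennreal (r\<^sup>2) * (\<integral>\<^sup>+x. ennreal (min 1 (x\<^sup>2)) \<partial>\<mu>)"
      by (intro nn_integral_cmult) measurable
    also have "\<dots> < \<infinity>" using levy by (simp add: levy_measure_def ennreal_mult_less_top)
    finally show ?thesis .
  qed
  moreover have "measure \<mu> ?C > 0"
    using n \<open>emeasure \<mu> ?C < \<infinity>\<close> by (simp add: r_def measure_def enn2real_positive_iff zero_less_iff_neq_zero)
  ultimately show ?thesis using that[of r] r Bs[of n] by (simp add: r_def)
qed

text \<open>For small arguments the quadratic parts cancel and only jumps contribute.\<close>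
lemma lk_decay_fourth_difference:
  assumes levy: "levy_measure \<mu>" and ne: "\<mu> \<noteq> null_measure borel" and "0 < d" "d \<le> 1"
  obtains z \<kappa> where "z > 0" "\<kappa> > 0"
    "\<And>u. d * z \<le> u \<Longrightarrow> u \<le> z \<Longrightarrow> \<kappa> \<le> 4 * lk_decay b \<mu> u - lk_decay b \<mu> (2 * u)"
proof -
  obtain r where r: "r > 0" "measure \<mu> {x. 1 / r \<le> \<bar>x\<bar> \<and> \<bar>x\<bar> \<le> r} > 0"
    "{x. 1 / r \<le> \<bar>x\<bar> \<and> \<bar>x\<bar> \<le> r} \<in> sets \<mu>" "emeasure \<mu> {x. 1 / r \<le> \<bar>x\<bar> \<and> \<bar>x\<bar> \<le> r} < \<infinity>"
    by (rule levy_measure_band[OF levy ne]) (rule that)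
  let ?C = "{x. 1 / r \<le> \<bar>x\<bar> \<and> \<bar>x\<bar> \<le> r}"
  \<comment> \<open>For \<open>u\<close> between \<open>d * z\<close> and \<open>z\<close> and
    \<open>x\<close> in the band, \<open>u * \<bar>x\<bar>\<close> lies between \<open>w\<close> and
    1. This range is within \<open>[0, pi]\<close>, where the cosine decreases, so
    \<open>1 - cos (u * x) \<ge> 1 - cos w\<close>.\<close>
  define z where "z = 1 / r"
  define w where "w = d * z / r"
  have "r \<ge> 1"
  proof (rule ccontr)
    assume "\<not> r \<ge> 1"
    then have "1 / r > r" using r(1) by (simp add: field_simps) (smt (verit) mult_less_cancel_right2)
    then have C0: "?C = {}" by auto
    show False using r(2) unfolding C0 by simp
  qed
  have w: "0 < w" "w \<le> 1"
  proof -
    show "0 < w" using r(1) assms by (simp add: w_def z_def)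
    have "d / (r * r) \<le> 1 / 1" using \<open>r \<ge> 1\<close> assms by (intro frac_le mult_ge1_I) auto
    then show "w \<le> 1" by (simp add: w_def z_def)
  qed
  define \<kappa> where "\<kappa> = 2 * (1 - cos w)\<^sup>2 * measure \<mu> ?C"
  have "cos w < cos 0" using w pi_gt3 by (intro cos_monotone_0_pi) auto
  then have \<kappa>: "\<kappa> > 0" using r(2) by (simp add: \<kappa>_def)
  have "\<kappa> \<le> 4 * lk_decay b \<mu> u - lk_decay b \<mu> (2 * u)" if u: "d * z \<le> u" "u \<le> z" for u
  proof -
    note i = levy_measure_integrable_cos[OF levy]
    have u0: "u > 0" using u(1) r(1) assms by (smt (verit) divide_pos_pos mult_pos_pos z_def)
    have sq: "4 * (1 - cos (u * x)) - (1 - cos (2 * u * x)) = 2 * (1 - cos (u * x))\<^sup>2" for x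
      using cos_double_cos[of "u * x"] by (simp add: power2_diff mult.assoc)
    have "\<kappa> = (\<integral>x. 2 * (1 - cos w)\<^sup>2 * indicator ?C x \<partial>\<mu>)" using r(3) by (simp add: \<kappa>_def)
    also have "\<dots> \<le> (\<integral>x. 4 * (1 - cos (u * x)) - (1 - cos (2 * u * x)) \<partial>\<mu>)"
    proof (rule integral_mono)
      show "integrable \<mu> (\<lambda>x. 2 * (1 - cos w)\<^sup>2 * indicator ?C x)"
        by (intro integrable_mult_right integrable_real_indicator r(3,4))
      show "integrable \<mu> (\<lambda>x. 4 * (1 - cos (u * x)) - (1 - cos (2 * u * x)))"
        by (intro Bochner_Integration.integrable_diff integrable_mult_right i)
      fix x
      show "2 * (1 - cos w)\<^sup>2 * indicator ?C x \<le> 4 * (1 - cos (u * x)) - (1 - cos (2 * u * x))"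
      proof (cases "x \<in> ?C")
        case True
        have "w \<le> u * \<bar>x\<bar>"
        proof -
          have "d * z * (1 / r) \<le> u * \<bar>x\<bar>" using True u u0 r(1) by (intro mult_mono) auto
          then show ?thesis by (simp add: w_def)
        qed
        moreover have "u * \<bar>x\<bar> \<le> 1"
        proof -
          have "u * \<bar>x\<bar> \<le> z * r" using True u u0 r(1) by (intro mult_mono) (auto simp: z_def)
          then show ?thesis using r(1) by (simp add: z_def)
        qed
        ultimately have "cos (u * \<bar>x\<bar>) \<le> cos w" using w pi_gt3 by (intro cos_monotone_0_pi_le) auto
        moreover have "cos (u * \<bar>x\<bar>) = cos (u * x)" using u0 by (metis abs_mult abs_of_pos cos_abs_real)
        ultimately have "(1 - cos w)\<^sup>2 \<le> (1 - cos (u * x))\<^sup>2" by (intro power_mono) auto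
        then show ?thesis using True unfolding sq by simp
      next
        case False
        then have "indicator ?C x = (0::real)" by (rule indicator_simps)
        then show ?thesis unfolding sq by (simp only: mult_zero_right) simp
      qed
    qed
    also have "\<dots> = 4 * (\<integral>x. 1 - cos (u * x) \<partial>\<mu>) - (\<integral>x. 1 - cos (2 * u * x) \<partial>\<mu>)"
      by (subst Bochner_Integration.integral_diff[OF integrable_mult_right[OF i] i]) (simp only: integral_mult_right_zero)
    also have "\<dots> = 4 * lk_decay b \<mu> u - lk_decay b \<mu> (2 * u)"
      by (simp only: lk_decay_def) (simp add: power_mult_distrib)
    finally show ?thesis .
  qed
  then show ?thesis using that[of z \<kappa>] \<kappa> r(1) by (simp add: z_def)
qed

text \<open>For each \<xi> the kernel at time 1 is at least 1/2 on an interval of \<open>s\<close>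
  of length \<open>ln 2\<close>. This gives a set of positive measure on which the kernel is bounded
  below, through which the jumps inherit an exponential moment from \<open>X 1\<close>.\<close>

lemma (in supou) cosh_moment_of_analytic:
  assumes "is_cumulant_function M (X 1) \<kappa>" "analytic_near_origin \<kappa>"
  obtains c where "c > 0" "(\<integral>\<^sup>+x. ennreal (cosh (c * x) - 1) \<partial>\<mu>) < \<infinity>"
proof -
  let ?A = "{z \<in> space m. 1 / 2 \<le> supOU_kernel 1 z}"
  have A[measurable]: "?A \<in> sets m" by measurable
  have "ennreal (ln 2) = (\<integral>\<^sup>+\<xi>. ennreal (ln 2) \<partial>\<pi>)" by (simp add: \<pi>.emeasure_space_1)
  also have "\<dots> = (\<integral>\<^sup>+\<xi>. \<integral>\<^sup>+s. indicator {\<xi> - ln 2..\<xi>} s \<partial>lborel \<partial>\<pi>)"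
    by (intro nn_integral_cong) simp
  also have "\<dots> \<le> (\<integral>\<^sup>+\<xi>. \<integral>\<^sup>+s. indicator ?A (\<xi>, s) \<partial>lborel \<partial>\<pi>)"
  proof (intro nn_integral_mono)
    fix \<xi> s assume "\<xi> \<in> space \<pi>"
    have "1 / 2 \<le> exp (s - \<xi>)" if "\<xi> - ln 2 \<le> s"
    proof -
      have "exp (- ln 2) \<le> exp (s - \<xi>)" using that by simp
      then show ?thesis by (simp add: exp_minus)
    qed
    then show "indicator {\<xi> - ln 2..\<xi>} s \<le> (indicator ?A (\<xi>, s) :: ennreal)"
      using \<open>\<xi> \<in> space \<pi>\<close> by (auto simp: indicator_def supOU_kernel_eq space_pair_measure)
  qed
  also have "\<dots> = (\<integral>\<^sup>+z. indicator ?A z \<partial>m)" by (rule lborel.nn_integral_fst) measurable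
  also have "\<dots> = emeasure m ?A" by (rule nn_integral_indicator[OF A])
  finally have "emeasure m ?A \<noteq> 0" by (auto simp: ln_gt_zero)
  then show ?thesis
    using decay_analytic_cosh_moment[OF decay_X assms A, of "1 / 2"] that by auto
qed

lemma powr_eventually_le:
  fixes x y D d :: real
  assumes "x < y" "d > 0"
  shows "\<forall>\<^sub>F t in at_top. D * t powr x \<le> d * t powr y"
proof -
  have "((\<lambda>t::real. D * t powr (x - y)) \<longlongrightarrow> D * 0) at_top"
    using assms by (intro tendsto_mult tendsto_const tendsto_neg_powr filterlim_ident) auto
  then have "\<forall>\<^sub>F t::real in at_top. D * t powr (x - y) < d"
    using assms by (intro order_tendstoD(2)) auto
  then show ?thesis
    using eventually_gt_at_top[of 0]
  proof eventually_elim
    case (elim t)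
    have "D * t powr x = D * t powr (x - y) * t powr y" by (simp add: mult.assoc powr_add[symmetric])
    also have "\<dots> \<le> d * t powr y" using elim by (intro mult_right_mono) auto
    finally show ?case .
  qed
qed

text \<open>Beyond the threshold \<open>r\<close> the bound 4 is paid by the \<open>q\<close>-th
  power; below it, vanishing to fourth order leaves the factor \<open>r^2\<close> in front of the
  square. A small \<open>r\<close> makes the variance term negligible at the price
  \<open>r powr - q\<close>.\<close>

lemma one_minus_cos_square_le:
  fixes v r q :: real
  assumes "0 < r" "q > 0"
  shows "(1 - cos v)\<^sup>2 \<le> 4 * r powr - q * \<bar>v\<bar> powr q + r\<^sup>2 * v\<^sup>2"
proof (cases "\<bar>v\<bar> \<ge> r")
  case True
  have "1 - cos v \<le> 2" using cos_ge_minus_one[of v] by linarith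
  then have "(1 - cos v)\<^sup>2 \<le> 2\<^sup>2" by (intro power_mono) auto
  also have "2\<^sup>2 * 1 \<le> 4 * (r powr - q * \<bar>v\<bar> powr q)"
  proof -
    have "r powr q \<le> \<bar>v\<bar> powr q" using True assms by (intro powr_mono2) auto
    then have "r powr - q * r powr q \<le> r powr - q * \<bar>v\<bar> powr q" by (intro mult_left_mono) auto
    then show ?thesis using assms by (simp add: powr_add[symmetric])
  qed
  finally have "(1 - cos v)\<^sup>2 \<le> 4 * (r powr - q * \<bar>v\<bar> powr q)" by simp
  moreover have "0 \<le> r\<^sup>2 * v\<^sup>2" by simp
  ultimately show ?thesis by (simp only: mult.assoc)
next
  case False
  have "(1 - cos v)\<^sup>2 \<le> (v\<^sup>2 / 2)\<^sup>2" using one_minus_cos_le[of v] by (intro power_mono) auto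
  also have "\<dots> \<le> (v\<^sup>2)\<^sup>2" by (intro power_mono) auto
  also have "(v\<^sup>2)\<^sup>2 = v\<^sup>2 * v\<^sup>2" by (rule power2_eq_square)
  also have "\<dots> \<le> r\<^sup>2 * v\<^sup>2"
  proof (intro mult_right_mono)
    have "\<bar>v\<bar>\<^sup>2 \<le> r\<^sup>2" using False by (intro power_mono) auto
    then show "v\<^sup>2 \<le> r\<^sup>2" by simp
  qed simp
  finally have "(1 - cos v)\<^sup>2 \<le> r\<^sup>2 * v\<^sup>2" .
  moreover have "0 \<le> 4 * r powr - q * \<bar>v\<bar> powr q" by simp
  ultimately show ?thesis by linarith
qed

section \<open>Growth of the moments of the integrated process\<close>

locale supou_scaling = supou_square +
  fixes \<alpha> c0 :: real
  assumes \<alpha>: "0 < \<alpha>" "\<alpha> < 1"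
    and neg_moment: "\<And>\<gamma>. 0 \<le> \<gamma> \<Longrightarrow> \<gamma> < \<alpha> \<Longrightarrow> (\<integral>\<^sup>+\<xi>. ennreal (\<xi> powr - \<gamma>) \<partial>\<pi>) < \<infinity>"
    and mass_lower: "\<And>\<epsilon>. \<epsilon> > 0 \<Longrightarrow> \<exists>c>0. \<exists>t0>0. \<forall>t\<ge>t0. ennreal (c * t powr - (\<alpha> + \<epsilon>)) \<le> emeasure \<pi> {0<..<1 / t}"
    and c0: "c0 > 0" "(\<integral>\<^sup>+x. ennreal (cosh (c0 * x) - 1) \<partial>\<mu>) < \<infinity>"
begin

abbreviation "F \<equiv> kernel_integral"

definition S :: "real \<Rightarrow> real" where "S t = (\<integral>z. (F t z)\<^sup>2 \<partial>m)"

lemma S_nn: "t > 0 \<Longrightarrow> ennreal (S t) = (\<integral>\<^sup>+z. ennreal ((F t z)\<^sup>2) \<partial>m)"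
  unfolding S_def by (rule nn_integral_eq_integral[OF decay_square_integrable[OF decay_integrated], symmetric]) auto

lemma S_nonneg: "S t \<ge> 0"
  unfolding S_def by (intro Bochner_Integration.integral_nonneg) auto

lemma S_upper:
  assumes "0 \<le> \<gamma>" "\<gamma> < \<alpha>"
  obtains C where "C > 0" "\<And>t. t > 0 \<Longrightarrow> S t \<le> C * t powr (2 - \<gamma>)"
proof -
  obtain I where I: "(\<integral>\<^sup>+\<xi>. ennreal (\<xi> powr - \<gamma>) \<partial>\<pi>) = ennreal I" "I \<ge> 0"
    using neg_moment[OF assms] by (cases "\<integral>\<^sup>+\<xi>. ennreal (\<xi> powr - \<gamma>) \<partial>\<pi>") auto
  have "S t \<le> (I + 1) * t powr (2 - \<gamma>)" if "t > 0" for t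
  proof -
    have "ennreal (S t) \<le> ennreal (t powr (2 - \<gamma>)) * ennreal I"
      unfolding S_nn[OF that] I(1)[symmetric]
      by (rule kernel_integral_square_upper[OF that assms(1) _ neg_moment[OF assms]]) (use \<alpha> assms in auto)
    then have "S t \<le> t powr (2 - \<gamma>) * I" using I(2) by (simp add: ennreal_mult[symmetric])
    also have "\<dots> \<le> (I + 1) * t powr (2 - \<gamma>)" by (simp add: algebra_simps)
    finally show ?thesis .
  qed
  then show ?thesis using that[of "I + 1"] I(2) by simp
qed

text \<open>Parameters of slowly forgotten jumps: mean reversion slower than \<open>1 / t\<close>
  and arrival no later than time 0. On this set the kernel integral attains its maximal order
  \<open>t\<close>.\<close>

definition near_set :: "real \<Rightarrow> (real \<times> real) set" where
  "near_set t = {0<..<1 / t} \<times> {-1..0}"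

lemma near_set: "near_set t \<in> sets m" "emeasure m (near_set t) = emeasure \<pi> {0<..<1 / t}"
proof -
  have "{0<..<1 / t} \<in> sets \<pi>" unfolding sets_\<pi> by (auto simp: sets_restrict_space_iff)
  then show "near_set t \<in> sets m" "emeasure m (near_set t) = emeasure \<pi> {0<..<1 / t}"
    unfolding near_set_def by (auto simp: lborel.emeasure_pair_measure_Times)
qed

lemma near_set_measure: "measure m (near_set t) = measure \<pi> {0<..<1 / t}"
  by (simp add: measure_def near_set)

lemma F_near: "t > 0 \<Longrightarrow> z \<in> near_set t \<Longrightarrow> exp (- 2) * t \<le> F t z"
  using kernel_integral_lower[of t "fst z" "snd z"] by (auto simp: near_set_def)

lemma mass_lower_real:
  assumes "\<epsilon> > 0"
  obtains c where "c > 0" "\<forall>\<^sub>F t in at_top. c * t powr - (\<alpha> + \<epsilon>) \<le> measure m (near_set t)"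
proof -
  obtain c t0 where c: "c > 0" "\<And>t. t \<ge> t0 \<Longrightarrow> ennreal (c * t powr - (\<alpha> + \<epsilon>)) \<le> emeasure \<pi> {0<..<1 / t}"
    using mass_lower[OF assms] by blast
  have "\<forall>\<^sub>F t in at_top. c * t powr - (\<alpha> + \<epsilon>) \<le> measure m (near_set t)"
    using eventually_ge_at_top[of t0]
  proof eventually_elim
    case (elim t)
    then show ?case using c(2)[of t] by (simp add: near_set_measure \<pi>.emeasure_eq_measure)
  qed
  then show ?thesis using that c(1) by blast
qed

text \<open>Only \<open>near_set t\<close> is kept: its mass times the square of
  \<open>exp (- 2) * t\<close>.\<close>

lemma S_lower:
  assumes "\<epsilon> > 0"
  obtains c where "c > 0" "\<forall>\<^sub>F t in at_top. c * t powr (2 - (\<alpha> + \<epsilon>)) \<le> S t"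
proof -
  obtain c where c: "c > 0" "\<forall>\<^sub>F t in at_top. c * t powr - (\<alpha> + \<epsilon>) \<le> measure m (near_set t)"
    using mass_lower_real[OF assms] by blast
  have "\<forall>\<^sub>F t in at_top. (exp (- 4) * c) * t powr (2 - (\<alpha> + \<epsilon>)) \<le> S t"
    using c(2) eventually_gt_at_top[of 0]
  proof eventually_elim
    case (elim t)
    have t: "t > 0" by fact
    have e: "(exp (- 2) * t)\<^sup>2 = exp (- 4) * t\<^sup>2" by (simp add: power_mult_distrib power2_eq_square exp_add[symmetric])
    have "(exp (- 4) * c) * t powr (2 - (\<alpha> + \<epsilon>)) = exp (- 4) * t\<^sup>2 * (c * t powr - (\<alpha> + \<epsilon>))"
      using powr_two_minus[OF t, of "\<alpha> + \<epsilon>"] by simp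
    also have "\<dots> \<le> exp (- 4) * t\<^sup>2 * measure m (near_set t)" using elim by (intro mult_left_mono) auto
    also have "\<dots> = (\<integral>z. exp (- 4) * t\<^sup>2 * indicator (near_set t) z \<partial>m)" using near_set(1)[of t] by simp
    also have "\<dots> \<le> S t"
      unfolding S_def
    proof (rule integral_mono)
      show "integrable m (\<lambda>z. exp (- 4) * t\<^sup>2 * indicator (near_set t) z)"
        using near_set[of t] \<pi>.emeasure_finite[of "{0<..<1 / t}"]
        by (intro integrable_mult_right integrable_real_indicator) (auto simp: less_top[symmetric])
      show "integrable m (\<lambda>z. (F t z)\<^sup>2)" by (rule decay_square_integrable[OF decay_integrated[OF t]])
      fix z
      show "exp (- 4) * t\<^sup>2 * indicator (near_set t) z \<le> (F t z)\<^sup>2"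
      proof (cases "z \<in> near_set t")
        case True
        then have "(exp (- 2) * t)\<^sup>2 \<le> (F t z)\<^sup>2" using F_near[OF t True] t by (intro power_mono) auto
        then show ?thesis using True e by simp
      qed simp
    qed
    finally show ?case .
  qed
  then show ?thesis using that[of "exp (- 4) * c"] c(1) by simp
qed

abbreviation "Y \<equiv> integrated_process X"

text \<open>Working with cosh - 1 rather than cosh brings in
  \<open>exp B - 1 \<le> B * exp B\<close>. When the exponential parameter is of order
  \<open>1 / t\<close>, the factor \<open>B\<close> is small and carries the decay in
  \<open>t\<close>.\<close>

lemma moment_of_cosh:
  assumes t: "t > 0" and q: "q \<ge> 2" and \<theta>: "\<theta> > 0" "\<theta> < R" and C: "C > 0" "\<And>u. \<bar>u\<bar> powr q \<le> C * (cosh u - 1)"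
    and fin: "(\<integral>\<^sup>+z. ennreal (cosh (R * (snd z * F t (fst z))) - 1) \<partial>(m \<Otimes>\<^sub>M \<mu>)) < \<infinity>"
    and B: "b * \<theta>\<^sup>2 * S t + 2 * (\<integral>z. cosh (\<theta> * (snd z * F t (fst z))) - 1 \<partial>(m \<Otimes>\<^sub>M \<mu>)) \<le> B"
  shows "integrable M (\<lambda>\<omega>. \<bar>Y t \<omega>\<bar> powr q)" "expectation (\<lambda>\<omega>. \<bar>Y t \<omega>\<bar> powr q) \<le> C / \<theta> powr q * (B * exp B)"
proof -
  let ?P = "\<lambda>\<omega>. cosh (\<theta> * Y t \<omega>)"
  have nn: "(\<integral>\<^sup>+\<omega>. ennreal (?P \<omega>) \<partial>M) \<le> ennreal (exp B)"
    using decay_cosh_upper[OF decay_integrated[OF t] integrated_integrable integrated_mean \<theta> fin] B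
    unfolding S_def by (meson ennreal_leI exp_le_cancel_iff order_trans)
  then have iP: "integrable M ?P" by (intro integrableI_nonneg) (auto intro: le_less_trans)
  have eP: "expectation ?P \<le> exp B"
    using nn iP by (subst (asm) nn_integral_eq_integral) auto
  have le: "\<bar>Y t \<omega>\<bar> powr q \<le> C / \<theta> powr q * (?P \<omega> - 1)" for \<omega>
    using C(2)[of "\<theta> * Y t \<omega>"] \<theta> by (simp add: abs_mult powr_mult field_simps)
  show i: "integrable M (\<lambda>\<omega>. \<bar>Y t \<omega>\<bar> powr q)"
  proof (rule Bochner_Integration.integrable_bound)
    show "integrable M (\<lambda>\<omega>. C / \<theta> powr q * (?P \<omega> - 1))" using iP by auto
    show "AE \<omega> in M. norm (\<bar>Y t \<omega>\<bar> powr q) \<le> norm (C / \<theta> powr q * (?P \<omega> - 1))"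
      using le by (intro AE_I2) (smt (verit) powr_ge_zero real_norm_def)
  qed measurable
  have "expectation (\<lambda>\<omega>. \<bar>Y t \<omega>\<bar> powr q) \<le> expectation (\<lambda>\<omega>. C / \<theta> powr q * (?P \<omega> - 1))"
    using iP le by (intro integral_mono i) auto
  also have "\<dots> = C / \<theta> powr q * (expectation ?P - 1)" using iP by (simp add: prob_space)
  also have "\<dots> \<le> C / \<theta> powr q * (B * exp B)"
  proof (intro mult_left_mono)
    have "exp (- B) \<ge> 1 - B" using exp_ge_add_one_self[of "- B"] by simp
    then have "exp B * exp (- B) \<ge> exp B * (1 - B)" by (intro mult_left_mono) auto
    then have "exp B - 1 \<le> B * exp B" by (simp add: exp_minus algebra_simps)
    then show "expectation ?P - 1 \<le> B * exp B" using eP by linarith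
  qed (use C \<theta> in auto)
  finally show "expectation (\<lambda>\<omega>. \<bar>Y t \<omega>\<bar> powr q) \<le> C / \<theta> powr q * (B * exp B)" .
qed

text \<open>The exponential parameter is of order \<open>1 / t\<close>, matched to
  \<open>F t z \<le> t\<close>: the jumps then see at most the parameter \<open>c0\<close>, and
  scaling cosh - 1 extracts \<open>(F t z / t)^2\<close>, whose integral is of order at most
  \<open>t powr - \<gamma>\<close>.\<close>

lemma upper_general:
  assumes q: "q \<ge> 2" and \<gamma>: "0 \<le> \<gamma>" "\<gamma> < \<alpha>"
  obtains C where "C > 0" "\<And>t. t \<ge> 1 \<Longrightarrow> integrable M (\<lambda>\<omega>. \<bar>Y t \<omega>\<bar> powr q)"
    "\<And>t. t \<ge> 1 \<Longrightarrow> expectation (\<lambda>\<omega>. \<bar>Y t \<omega>\<bar> powr q) \<le> C * t powr (q - \<gamma>)"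
proof -
  obtain Cq where Cq: "Cq > 0" "\<And>u. \<bar>u\<bar> powr q \<le> Cq * (cosh u - 1)" using abs_powr_le_cosh[OF q] by blast
  obtain CS where CS: "CS > 0" "\<And>t. t > 0 \<Longrightarrow> S t \<le> CS * t powr (2 - \<gamma>)" using S_upper[OF \<gamma>] by blast
  obtain J where J: "(\<integral>\<^sup>+x. ennreal (cosh (c0 * x) - 1) \<partial>\<mu>) = ennreal J" "J \<ge> 0"
    using c0(2) by (cases "\<integral>\<^sup>+x. ennreal (cosh (c0 * x) - 1) \<partial>\<mu>") auto
  \<comment> \<open>The summands are the Gaussian term at the parameter \<open>c0 / (2 * t)\<close>
    and twice the jump integral, both relative to \<open>S t / t^2\<close>.\<close>
  define D where "D = CS * (b * c0\<^sup>2 / 4 + 2 * J)"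
  have D: "D > 0" unfolding D_def using CS(1) b_pos c0(1) J(2) by (intro mult_pos_pos add_pos_nonneg) auto
  define C where "C = Cq * (2 / c0) powr q * (D * exp D)"
  have "integrable M (\<lambda>\<omega>. \<bar>Y t \<omega>\<bar> powr q) \<and> expectation (\<lambda>\<omega>. \<bar>Y t \<omega>\<bar> powr q) \<le> C * t powr (q - \<gamma>)" if "t \<ge> 1" for t
  proof -
    have t: "t > 0" using that by simp
    have "(\<lambda>x. ennreal (cosh (c0 * x) - 1)) \<in> borel_measurable borel" by measurable
    then have Jm: "(\<lambda>x. ennreal (cosh (c0 * x) - 1)) \<in> borel_measurable \<mu>"
      by (simp only: measurable_cong_sets[OF sets_\<mu> refl])
    let ?h = "\<lambda>z. cosh (c0 / t * (snd z * F t (fst z))) - 1"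
    let ?g = "\<lambda>z. cosh (c0 / (2 * t) * (snd z * F t (fst z))) - 1"
    have pt: "cosh (c0 / t * (x * F t z)) - 1 \<le> (F t z)\<^sup>2 / t\<^sup>2 * (cosh (c0 * x) - 1)" for x z
    proof -
      have "\<bar>F t z / t\<bar> \<le> 1" using kernel_integral_bounds(1)[of t z] kernel_integral_bounds(2)[of t z] t by simp
      from cosh_scale_le[OF this, of "c0 * x"] show ?thesis by (simp add: power_divide ac_simps)
    qed
    have nn: "(\<integral>\<^sup>+z. ennreal (?h z) \<partial>(m \<Otimes>\<^sub>M \<mu>)) \<le> ennreal (S t / t\<^sup>2 * J)"
    proof -
      have "(\<integral>\<^sup>+z. ennreal (?h z) \<partial>(m \<Otimes>\<^sub>M \<mu>)) = (\<integral>\<^sup>+z. \<integral>\<^sup>+x. ennreal (cosh (c0 / t * (x * F t z)) - 1) \<partial>\<mu> \<partial>m)"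
        by (subst \<mu>.nn_integral_fst[symmetric]) auto
      also have "\<dots> \<le> (\<integral>\<^sup>+z. \<integral>\<^sup>+x. ennreal ((F t z)\<^sup>2 / t\<^sup>2) * ennreal (cosh (c0 * x) - 1) \<partial>\<mu> \<partial>m)"
        using pt by (intro nn_integral_mono) (simp add: ennreal_mult[symmetric] cosh_real_ge_1 ennreal_leI)
      also have "\<dots> = (\<integral>\<^sup>+z. ennreal ((F t z)\<^sup>2 / t\<^sup>2) * ennreal J \<partial>m)"
      proof (intro nn_integral_cong)
        fix z
        show "(\<integral>\<^sup>+x. ennreal ((F t z)\<^sup>2 / t\<^sup>2) * ennreal (cosh (c0 * x) - 1) \<partial>\<mu>) = ennreal ((F t z)\<^sup>2 / t\<^sup>2) * ennreal J"
          unfolding J(1)[symmetric] by (rule nn_integral_cmult[OF Jm])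
      qed
      also have "\<dots> = (\<integral>\<^sup>+z. ennreal (J / t\<^sup>2) * ennreal ((F t z)\<^sup>2) \<partial>m)"
      proof (intro nn_integral_cong)
        fix z
        have "(F t z)\<^sup>2 / t\<^sup>2 * J = J / t\<^sup>2 * (F t z)\<^sup>2" by simp
        then show "ennreal ((F t z)\<^sup>2 / t\<^sup>2) * ennreal J = ennreal (J / t\<^sup>2) * ennreal ((F t z)\<^sup>2)"
          using J(2) by (simp only: ennreal_mult[symmetric] zero_le_power2 divide_nonneg_nonneg)
      qed
      also have "\<dots> = ennreal (J / t\<^sup>2) * ennreal (S t)"
        by (subst nn_integral_cmult) (auto simp: S_nn[OF t])
      also have "\<dots> = ennreal (S t / t\<^sup>2 * J)" using J(2) S_nonneg by (simp add: ennreal_mult[symmetric])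
      finally show ?thesis .
    qed
    then have fin: "(\<integral>\<^sup>+z. ennreal (?h z) \<partial>(m \<Otimes>\<^sub>M \<mu>)) < \<infinity>" by (rule le_less_trans) simp
    have gle: "?g z \<le> ?h z" for z
    proof -
      have "cosh (1/2 * (c0 / t * (snd z * F t (fst z)))) - 1 \<le> (1/2)\<^sup>2 * ?h z" by (rule cosh_scale_le) simp
      moreover have "?h z \<ge> 0" by (simp add: cosh_real_ge_1)
      ultimately have "cosh (1/2 * (c0 / t * (snd z * F t (fst z)))) - 1 \<le> ?h z"
        by (simp add: power2_eq_square)
      then show ?thesis by (simp add: ac_simps)
    qed
    have ih: "integrable (m \<Otimes>\<^sub>M \<mu>) ?h" using fin by (intro integrableI_nonneg) (auto simp: cosh_real_ge_1)
    have "(\<integral>z. ?g z \<partial>(m \<Otimes>\<^sub>M \<mu>)) \<le> (\<integral>z. ?h z \<partial>(m \<Otimes>\<^sub>M \<mu>))"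
      using ih gle by (intro integral_mono') (auto simp: cosh_real_ge_1)
    also have "\<dots> \<le> S t / t\<^sup>2 * J"
      using nn ih J(2) S_nonneg by (subst (asm) nn_integral_eq_integral) (auto simp: cosh_real_ge_1)
    finally have G: "(\<integral>z. ?g z \<partial>(m \<Otimes>\<^sub>M \<mu>)) \<le> S t / t\<^sup>2 * J" .
    have St: "S t / t\<^sup>2 \<le> CS * t powr - \<gamma>"
    proof -
      have "t powr (2 - \<gamma>) = t\<^sup>2 * t powr - \<gamma>" by (rule powr_two_minus[OF t])
      then have "S t \<le> CS * t powr - \<gamma> * t\<^sup>2" using CS(2)[OF t] by (simp add: ac_simps)
      then show ?thesis using t by (simp add: divide_le_eq)
    qed
    have "b * (c0 / (2 * t))\<^sup>2 * S t + 2 * (\<integral>z. ?g z \<partial>(m \<Otimes>\<^sub>M \<mu>)) \<le> b * (c0 / (2 * t))\<^sup>2 * S t + 2 * (S t / t\<^sup>2 * J)"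
      using G by simp
    also have "\<dots> = S t / t\<^sup>2 * (b * c0\<^sup>2 / 4 + 2 * J)"
      using t by (simp add: power_divide power_mult_distrib field_simps)
    also have "\<dots> \<le> CS * t powr - \<gamma> * (b * c0\<^sup>2 / 4 + 2 * J)"
      using St J(2) b_pos by (intro mult_right_mono) auto
    also have "\<dots> = D * t powr - \<gamma>" by (simp add: D_def ac_simps)
    finally have B: "b * (c0 / (2 * t))\<^sup>2 * S t + 2 * (\<integral>z. ?g z \<partial>(m \<Otimes>\<^sub>M \<mu>)) \<le> D * t powr - \<gamma>" .
    have th: "c0 / (2 * t) > 0" "c0 / (2 * t) < c0 / t" using c0 t by (auto simp: field_simps)
    note mom = moment_of_cosh[OF t q th Cq fin B]
    have "expectation (\<lambda>\<omega>. \<bar>Y t \<omega>\<bar> powr q) \<le> Cq / (c0 / (2 * t)) powr q * (D * t powr - \<gamma> * exp (D * t powr - \<gamma>))"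
      by (rule mom(2))
    also have "\<dots> \<le> Cq / (c0 / (2 * t)) powr q * (D * t powr - \<gamma> * exp D)"
    proof -
      have "t powr - \<gamma> \<le> t powr 0" using that \<gamma> by (intro powr_mono) auto
      then have "D * t powr - \<gamma> \<le> D" using D t by (simp add: mult_left_le)
      then show ?thesis using D Cq by (intro mult_left_mono) auto
    qed
    also have "\<dots> = C * t powr (q - \<gamma>)"
    proof -
      have "Cq / (c0 / (2 * t)) powr q = Cq * (2 / c0 * t) powr q"
      proof -
        have "(c0 / (2 * t)) powr q * (2 / c0 * t) powr q = (c0 / (2 * t) * (2 / c0 * t)) powr q"
          using c0 t by (simp only: powr_mult)
        also have "c0 / (2 * t) * (2 / c0 * t) = 1" using c0 t by simp
        finally have "(c0 / (2 * t)) powr q * (2 / c0 * t) powr q = 1" by simp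
        moreover have "(c0 / (2 * t)) powr q > 0" using c0 t by simp
        ultimately show ?thesis by (simp only: divide_eq_eq) (simp add: mult.commute)
      qed
      also have "\<dots> = Cq * ((2 / c0) powr q * t powr q)" by (simp only: powr_mult)
      finally have "Cq / (c0 / (2 * t)) powr q * (D * t powr - \<gamma> * exp D) = C * (t powr q * t powr - \<gamma>)"
        by (simp add: C_def)
      also have "t powr q * t powr - \<gamma> = t powr (q - \<gamma>)" by (simp add: powr_add[symmetric])
      finally show ?thesis .
    qed
    finally show ?thesis using mom(1) by blast
  qed
  moreover have "C > 0" unfolding C_def using Cq D c0 by simp
  ultimately show ?thesis using that by blast
qed

lemma Y_square: "t \<ge> 1 \<Longrightarrow> integrable M (\<lambda>\<omega>. (Y t \<omega>)\<^sup>2)"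
proof -
  have e: "\<bar>y\<bar> powr 2 = y\<^sup>2" for y :: real by (cases "y = 0") (simp_all add: powr_numeral)
  assume "t \<ge> 1"
  then show ?thesis using upper_general[of 2 0] \<alpha> unfolding e by auto
qed

lemma Y_second_moment: "t \<ge> 1 \<Longrightarrow> expectation (\<lambda>\<omega>. (Y t \<omega>)\<^sup>2) \<le> K * S t"
  unfolding K_def S_def
  by (rule decay_second_moment_le[OF decay_integrated \<mu>_sq Y_square integrated_mean]) auto

text \<open>Truncation at \<open>s = t powr (1 - \<gamma> / 2)\<close>, whose square is the growth
  bound for the variance, reduces the moment to the variance.\<close>

lemma upper_small:
  assumes q: "0 < q" "q \<le> 2" and \<gamma>: "0 \<le> \<gamma>" "\<gamma> < \<alpha>"
  obtains C where "C > 0" "\<And>t. t \<ge> 1 \<Longrightarrow> integrable M (\<lambda>\<omega>. \<bar>Y t \<omega>\<bar> powr q)"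
    "\<And>t. t \<ge> 1 \<Longrightarrow> expectation (\<lambda>\<omega>. \<bar>Y t \<omega>\<bar> powr q) \<le> C * t powr ((1 - \<gamma> / 2) * q)"
proof -
  obtain CS where CS: "CS > 0" "\<And>t. t > 0 \<Longrightarrow> S t \<le> CS * t powr (2 - \<gamma>)" using S_upper[OF \<gamma>] by blast
  have pt: "\<bar>y\<bar> powr q \<le> s powr q + s powr (q - 2) * y\<^sup>2" if "s > 0" for s y :: real
  proof (cases "\<bar>y\<bar> \<le> s")
    case True
    then have "\<bar>y\<bar> powr q \<le> s powr q" using q by (intro powr_mono2) auto
    moreover have "0 \<le> s powr (q - 2) * y\<^sup>2" by simp
    ultimately show ?thesis by linarith
  next
    case False
    then have y: "\<bar>y\<bar> > 0" using that by linarith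
    have "\<bar>y\<bar> powr q = \<bar>y\<bar> powr (q - 2) * \<bar>y\<bar> powr 2" by (simp only: powr_add[symmetric]) simp
    also have "\<bar>y\<bar> powr 2 = y\<^sup>2" using y by (simp add: powr_numeral)
    also have "\<bar>y\<bar> powr (q - 2) * y\<^sup>2 \<le> s powr (q - 2) * y\<^sup>2"
      using False that q by (intro mult_right_mono powr_mono2') auto
    finally show ?thesis by (smt (verit) powr_ge_zero)
  qed
  have "integrable M (\<lambda>\<omega>. \<bar>Y t \<omega>\<bar> powr q) \<and> expectation (\<lambda>\<omega>. \<bar>Y t \<omega>\<bar> powr q) \<le> (1 + K * CS) * t powr ((1 - \<gamma> / 2) * q)" if "t \<ge> 1" for t
  proof -
    have t: "t > 0" using that by simp
    define s where "s = t powr (1 - \<gamma> / 2)"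
    have s: "s > 0" using t by (simp add: s_def)
    have i2: "integrable M (\<lambda>\<omega>. s powr q + s powr (q - 2) * (Y t \<omega>)\<^sup>2)" using Y_square[OF that] by auto
    have i: "integrable M (\<lambda>\<omega>. \<bar>Y t \<omega>\<bar> powr q)"
    proof (rule Bochner_Integration.integrable_bound[OF i2])
      show "AE \<omega> in M. norm (\<bar>Y t \<omega>\<bar> powr q) \<le> norm (s powr q + s powr (q - 2) * (Y t \<omega>)\<^sup>2)"
        using pt[OF s] by (intro AE_I2) (smt (verit) powr_ge_zero real_norm_def)
    qed measurable
    have "expectation (\<lambda>\<omega>. \<bar>Y t \<omega>\<bar> powr q) \<le> expectation (\<lambda>\<omega>. s powr q + s powr (q - 2) * (Y t \<omega>)\<^sup>2)"
      using pt[OF s] by (intro integral_mono i i2) auto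
    also have "\<dots> = s powr q + s powr (q - 2) * expectation (\<lambda>\<omega>. (Y t \<omega>)\<^sup>2)"
      using Y_square[OF that] by (simp add: prob_space)
    also have "\<dots> \<le> s powr q + s powr (q - 2) * (K * CS * s powr 2)"
    proof -
      have "s powr 2 = t powr (2 - \<gamma>)" unfolding s_def powr_powr by (simp add: algebra_simps)
      then have "K * S t \<le> K * CS * s powr 2" using CS(2)[OF t] K_pos by simp
      then show ?thesis using Y_second_moment[OF that] by (intro add_left_mono mult_left_mono) auto
    qed
    also have "\<dots> = (1 + K * CS) * s powr q"
    proof -
      have "s powr (q - 2) * s powr 2 = s powr q" by (simp only: powr_add[symmetric]) simp
      then show ?thesis by (simp add: algebra_simps)
    qed
    also have "s powr q = t powr ((1 - \<gamma> / 2) * q)" by (simp add: s_def powr_powr)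
    finally show ?thesis using i by blast
  qed
  moreover have "1 + K * CS > 0" using K_pos CS by (simp add: add_pos_pos)
  ultimately show ?thesis using that by blast
qed

text \<open>Without jumps the exponential parameter is not limited by \<open>c0 / t\<close> and can
  be the inverse of the diffusive scale \<open>t powr (1 - \<gamma> / 2)\<close>; \<open>B\<close>
  is then bounded instead of decaying. Any radius above \<theta> would serve in place of
  \<open>2 * \<theta>\<close>, the jump integral being 0.\<close>

lemma upper_gaussian:
  assumes null: "\<mu> = null_measure borel" and q: "q \<ge> 2" and \<gamma>: "0 \<le> \<gamma>" "\<gamma> < \<alpha>"
  obtains C where "C > 0" "\<And>t. t \<ge> 1 \<Longrightarrow> integrable M (\<lambda>\<omega>. \<bar>Y t \<omega>\<bar> powr q)"
    "\<And>t. t \<ge> 1 \<Longrightarrow> expectation (\<lambda>\<omega>. \<bar>Y t \<omega>\<bar> powr q) \<le> C * t powr ((1 - \<gamma> / 2) * q)"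
proof -
  obtain Cq where Cq: "Cq > 0" "\<And>u. \<bar>u\<bar> powr q \<le> Cq * (cosh u - 1)" using abs_powr_le_cosh[OF q] by blast
  obtain CS where CS: "CS > 0" "\<And>t. t > 0 \<Longrightarrow> S t \<le> CS * t powr (2 - \<gamma>)" using S_upper[OF \<gamma>] by blast
  define B where "B = b * CS"
  have "B > 0" using b_pos CS by (simp add: B_def)
  have "integrable M (\<lambda>\<omega>. \<bar>Y t \<omega>\<bar> powr q) \<and> expectation (\<lambda>\<omega>. \<bar>Y t \<omega>\<bar> powr q) \<le> (Cq * (B * exp B)) * t powr ((1 - \<gamma> / 2) * q)" if "t \<ge> 1" for t
  proof -
    have t: "t > 0" using that by simp
    define \<theta> where "\<theta> = t powr - (1 - \<gamma> / 2)"
    have \<theta>: "\<theta> > 0" "\<theta> < 2 * \<theta>" using t by (auto simp: \<theta>_def)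
    have z: "(\<integral>\<^sup>+z. ennreal (cosh (r * (snd z * F t (fst z))) - 1) \<partial>(m \<Otimes>\<^sub>M \<mu>)) = 0" for r
      by (subst \<mu>.nn_integral_fst[symmetric]) (auto simp: null)
    have z': "(\<integral>z. cosh (r * (snd z * F t (fst z))) - 1 \<partial>(m \<Otimes>\<^sub>M \<mu>)) = 0" for r
      using z[of r] by (subst integral_eq_nn_integral) (auto simp: cosh_real_ge_1)
    have "\<theta>\<^sup>2 * t powr (2 - \<gamma>) = 1"
    proof -
      have "\<theta>\<^sup>2 = t powr (- (2 - \<gamma>))" unfolding \<theta>_def using t
        by (simp add: power2_eq_square powr_add[symmetric])
      then show ?thesis using t by (simp add: powr_add[symmetric])
    qed
    then have "\<theta>\<^sup>2 * S t \<le> CS" using mult_left_mono[OF CS(2)[OF t], of "\<theta>\<^sup>2"] by (simp add: ac_simps)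
    then have Bt: "b * \<theta>\<^sup>2 * S t + 2 * (\<integral>z. cosh (\<theta> * (snd z * F t (fst z))) - 1 \<partial>(m \<Otimes>\<^sub>M \<mu>)) \<le> B"
      unfolding z' B_def using b_pos by (simp add: mult.assoc)
    have fin: "(\<integral>\<^sup>+z. ennreal (cosh (2 * \<theta> * (snd z * F t (fst z))) - 1) \<partial>(m \<Otimes>\<^sub>M \<mu>)) < \<infinity>"
      unfolding z by simp
    note mom = moment_of_cosh[OF t q \<theta> Cq fin Bt]
    have "Cq / \<theta> powr q * (B * exp B) = (Cq * (B * exp B)) * t powr ((1 - \<gamma> / 2) * q)"
      unfolding \<theta>_def powr_powr using t by (simp add: powr_minus field_simps)
    then show ?thesis using mom by simp
  qed
  moreover have "Cq * (B * exp B) > 0" using Cq \<open>B > 0\<close> by simp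
  ultimately show ?thesis using that by blast
qed

lemma lower_all:
  assumes q: "q > 0" and \<epsilon>: "\<epsilon> > 0" and int: "\<forall>\<^sub>F t in at_top. integrable M (\<lambda>\<omega>. \<bar>Y t \<omega>\<bar> powr q)"
  obtains C where "C > 0" "\<forall>\<^sub>F t in at_top. C * t powr ((1 - (\<alpha> + \<epsilon>) / 2) * q) \<le> expectation (\<lambda>\<omega>. \<bar>Y t \<omega>\<bar> powr q)"
proof -
  obtain c where c: "c > 0" "\<forall>\<^sub>F t in at_top. c * t powr (2 - (\<alpha> + \<epsilon>)) \<le> S t" using S_lower[OF \<epsilon>] by blast
  define C where "C = (sqrt (b * c) / 4) powr q / 2"
  have bc: "b * c > 0" using b_pos c by simp
  have "\<forall>\<^sub>F t in at_top. C * t powr ((1 - (\<alpha> + \<epsilon>) / 2) * q) \<le> expectation (\<lambda>\<omega>. \<bar>Y t \<omega>\<bar> powr q)"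
    using c(2) int eventually_gt_at_top[of 0]
  proof eventually_elim
    case (elim t)
    have t: "t > 0" by fact
    \<comment> \<open>\<open>s\<close> is at most \<open>sqrt (b * S t)\<close>, the standard
      deviation of the Gaussian component, so the Gaussian majorant of the modulus holds with
      \<open>s\<close>.\<close>
    define s where "s = sqrt (b * c) * t powr (1 - (\<alpha> + \<epsilon>) / 2)"
    have s: "s > 0" using t bc by (simp add: s_def)
    have s2: "s\<^sup>2 \<le> b * S t"
    proof -
      have "s\<^sup>2 = b * c * (t powr (1 - (\<alpha> + \<epsilon>) / 2))\<^sup>2" using bc by (simp add: s_def power_mult_distrib)
      also have "(t powr (1 - (\<alpha> + \<epsilon>) / 2))\<^sup>2 = t powr (2 - (\<alpha> + \<epsilon>))"
        by (simp add: power2_eq_square powr_add[symmetric] algebra_simps)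
      finally show ?thesis using elim(1) b_pos by (simp add: mult.assoc)
    qed
    have ch: "norm (char (distr M borel (Y t)) \<zeta>) \<le> exp (- (s\<^sup>2 * \<zeta>\<^sup>2 / 2))" for \<zeta>
    proof -
      have "s\<^sup>2 * \<zeta>\<^sup>2 \<le> b * S t * \<zeta>\<^sup>2" using s2 by (intro mult_right_mono) auto
      then show ?thesis using decay_char_le[OF decay_integrated[OF t], of \<zeta>] unfolding S_def by (smt (verit) divide_right_mono exp_le_cancel_iff)
    qed
    have "(s / 4) powr q / 2 \<le> expectation (\<lambda>\<omega>. \<bar>Y t \<omega>\<bar> powr q)"
      by (rule moment_lower_of_char[OF integrated_measurable s q ch elim(2)])
    moreover have "(s / 4) powr q = (sqrt (b * c) / 4) powr q * t powr ((1 - (\<alpha> + \<epsilon>) / 2) * q)"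
    proof -
      have "s / 4 = (sqrt (b * c) / 4) * t powr (1 - (\<alpha> + \<epsilon>) / 2)" by (simp add: s_def)
      then show ?thesis using bc t by (simp only: powr_mult powr_powr)
    qed
    ultimately show ?case by (simp add: C_def)
  qed
  moreover have "C > 0" using b_pos c(1) by (simp add: C_def)
  ultimately show ?thesis using that by blast
qed

text \<open>
  A single jump whose factor \<open>\<xi>\<close> is below \<open>1/t\<close> moves the integrated process by a multiple of \<open>t\<close>,
  and this has probability of order \<open>t powr - \<alpha>\<close>.  The Gaussian part is cancelled by the
  fourth-order difference \<open>(1 - cos)\<^sup>2\<close>.
\<close>
lemma lower_jump:
  assumes ne: "\<mu> \<noteq> null_measure borel" and q: "q > 0" and \<epsilon>: "\<epsilon> > 0" "3 * \<epsilon> < \<alpha>"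
    and int: "\<And>t. t \<ge> 1 \<Longrightarrow> integrable M (\<lambda>\<omega>. \<bar>Y t \<omega>\<bar> powr q)"
  obtains C where "C > 0" "\<forall>\<^sub>F t in at_top. C * t powr (q - \<alpha> - \<epsilon> * (2 * q + 1)) \<le> expectation (\<lambda>\<omega>. \<bar>Y t \<omega>\<bar> powr q)"
proof -
  interpret P: pair_prob_space M M by unfold_locales
  obtain z \<kappa> where z: "z > 0" and \<kappa>: "\<kappa> > 0"
    "\<And>u. exp (- 2) * z \<le> u \<Longrightarrow> u \<le> z \<Longrightarrow> \<kappa> \<le> 4 * lk_decay b \<mu> u - lk_decay b \<mu> (2 * u)"
    by (rule lk_decay_fourth_difference[OF levy ne, of "exp (- 2)" b]) (auto intro: that)
  \<comment> \<open>The two error terms get the exponents \<open>- 2 * \<gamma>\<close> and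
    \<open>- 4 * \<epsilon> - \<gamma> = - \<alpha> - 3 * \<epsilon>\<close>. The first lies below
    \<open>- (\<alpha> + \<epsilon>)\<close> exactly because
    \<open>3 * \<epsilon> < \<alpha>\<close>.\<close>
  define \<gamma> where "\<gamma> = \<alpha> - \<epsilon>"
  have \<gamma>: "0 \<le> \<gamma>" "\<gamma> < \<alpha>" using \<epsilon> by (auto simp: \<gamma>_def)
  obtain CS where CS: "CS > 0" "\<And>t. t > 0 \<Longrightarrow> S t \<le> CS * t powr (2 - \<gamma>)" using S_upper[OF \<gamma>] by blast
  obtain c where c: "c > 0" "\<forall>\<^sub>F t in at_top. c * t powr - (\<alpha> + \<epsilon>) \<le> measure m (near_set t)"
    using mass_lower_real[OF \<epsilon>(1)] by blast
  define D1 where "D1 = (K * z\<^sup>2 * CS)\<^sup>2"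
  define D2 where "D2 = 2 * z\<^sup>2 * K * CS"
  define D3 where "D3 = 8 * (2 * z) powr q"
  have D3: "D3 > 0" using z by (simp add: D3_def)
  have main: "\<kappa> * measure m (near_set t) \<le> D1 * t powr (- 2 * \<gamma>) + D2 * t powr (- 4 * \<epsilon> - \<gamma>)
      + D3 * t powr (2 * \<epsilon> * q - q) * expectation (\<lambda>\<omega>. \<bar>Y t \<omega>\<bar> powr q)" if "t \<ge> 1" for t
  proof -
    have t: "t > 0" using that by simp
    let ?E = "expectation (\<lambda>\<omega>. \<bar>Y t \<omega>\<bar> powr q)"
    \<comment> \<open>On \<open>near_set t\<close> this puts \<open>\<zeta> * F t p\<close> into the
      window from \<open>exp (- 2) * z\<close> to \<open>z\<close>, where the fourth-order
      difference of the decay is at least \<kappa>.\<close>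
    define \<zeta> where "\<zeta> = z / t"
    have \<zeta>: "\<zeta> > 0" using z t by (simp add: \<zeta>_def)
    \<comment> \<open>The threshold tends to 0 slowly: \<open>r^2\<close> gains
      \<open>t powr (- 4 * \<epsilon>)\<close> on the variance term, while \<open>r powr - q\<close>
      costs only \<open>t powr (2 * \<epsilon> * q)\<close>.\<close>
    define r where "r = t powr (- 2 * \<epsilon>)"
    have r: "r > 0" using t by (simp add: r_def)
    let ?E4 = "\<integral>p. (1 - cos (\<zeta> * sym (Y t) p))\<^sup>2 \<partial>(M \<Otimes>\<^sub>M M)"
    have \<zeta>2: "\<zeta>\<^sup>2 * t powr (2 - \<gamma>) = z\<^sup>2 * t powr - \<gamma>"
      using t unfolding powr_two_minus[OF t] by (simp add: \<zeta>_def power_divide)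
    have "\<kappa> * measure m (near_set t) - (K * \<zeta>\<^sup>2 * S t)\<^sup>2 \<le> ?E4"
      unfolding K_def S_def
    proof (rule decay_fourth_lower[OF decay_integrated[OF t] \<mu>_sq near_set(1)])
      fix p assume p: "p \<in> near_set t"
      have "exp (- 2) * z \<le> \<zeta> * F t p"
        using mult_left_mono[OF F_near[OF t p], of \<zeta>] \<zeta> t by (simp add: \<zeta>_def ac_simps)
      moreover have "\<zeta> * F t p \<le> z"
        using mult_left_mono[OF kernel_integral_bounds(2)[of t p], of \<zeta>] \<zeta> t by (simp add: \<zeta>_def)
      ultimately show "\<kappa> \<le> 4 * lk_decay b \<mu> (\<zeta> * F t p) - lk_decay b \<mu> (2 * (\<zeta> * F t p))" by (rule \<kappa>(2))
    qed (use \<kappa> in auto)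
    moreover have "(K * \<zeta>\<^sup>2 * S t)\<^sup>2 \<le> D1 * t powr (- 2 * \<gamma>)"
    proof -
      have "K * \<zeta>\<^sup>2 * S t \<le> K * \<zeta>\<^sup>2 * (CS * t powr (2 - \<gamma>))"
        using K_pos CS(2)[OF t] by (intro mult_left_mono) auto
      also have "\<dots> = K * CS * (\<zeta>\<^sup>2 * t powr (2 - \<gamma>))" by (simp add: ac_simps)
      also have "\<dots> = K * z\<^sup>2 * CS * t powr - \<gamma>" unfolding \<zeta>2 by (simp add: ac_simps)
      finally have "(K * \<zeta>\<^sup>2 * S t)\<^sup>2 \<le> (K * z\<^sup>2 * CS * t powr - \<gamma>)\<^sup>2"
        using K_pos S_nonneg by (intro power_mono) auto
      also have "\<dots> = D1 * (t powr - \<gamma>)\<^sup>2" by (simp add: D1_def power_mult_distrib)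
      also have "(t powr - \<gamma>)\<^sup>2 = t powr (- 2 * \<gamma>)" by (simp add: power2_eq_square powr_add[symmetric])
      finally show ?thesis .
    qed
    moreover have "?E4 \<le> D2 * t powr (- 4 * \<epsilon> - \<gamma>) + D3 * t powr (2 * \<epsilon> * q - q) * ?E"
    proof -
      let ?u = "4 * r powr - q * \<zeta> powr q" and ?v = "r\<^sup>2 * \<zeta>\<^sup>2"
      have "?E4 \<le> ?v * (2 * (K * S t)) + ?u * (2 * 2 powr q * ?E)"
      proof -
        have E0: "?E \<ge> 0" by (intro Bochner_Integration.integral_nonneg) auto
        have i4: "integrable (M \<Otimes>\<^sub>M M) (\<lambda>p. (1 - cos (\<zeta> * sym (Y t) p))\<^sup>2)"
        proof (rule P.integrable_const_bound[of _ 4])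
          show "AE p in M \<Otimes>\<^sub>M M. norm ((1 - cos (\<zeta> * sym (Y t) p))\<^sup>2) \<le> 4"
          proof (intro AE_I2)
            fix p
            have "1 - cos (\<zeta> * sym (Y t) p) \<le> 2" using cos_ge_minus_one[of "\<zeta> * sym (Y t) p"] by linarith
            then have "(1 - cos (\<zeta> * sym (Y t) p))\<^sup>2 \<le> 2\<^sup>2" by (intro power_mono) auto
            then show "norm ((1 - cos (\<zeta> * sym (Y t) p))\<^sup>2) \<le> 4" by simp
          qed
        qed measurable
        have "ennreal ?E4 = (\<integral>\<^sup>+p. ennreal ((1 - cos (\<zeta> * sym (Y t) p))\<^sup>2) \<partial>(M \<Otimes>\<^sub>M M))"
          by (rule nn_integral_eq_integral[OF i4, symmetric]) auto
        also have "\<dots> \<le> (\<integral>\<^sup>+p. ennreal ?v * ennreal ((sym (Y t) p)\<^sup>2) + ennreal ?u * ennreal (\<bar>sym (Y t) p\<bar> powr q) \<partial>(M \<Otimes>\<^sub>M M))"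
        proof (intro nn_integral_mono)
          fix p
          have "(1 - cos (\<zeta> * sym (Y t) p))\<^sup>2 \<le> 4 * r powr - q * \<bar>\<zeta> * sym (Y t) p\<bar> powr q + r\<^sup>2 * (\<zeta> * sym (Y t) p)\<^sup>2"
            by (rule one_minus_cos_square_le[OF r q])
          also have "\<dots> = ?v * (sym (Y t) p)\<^sup>2 + ?u * \<bar>sym (Y t) p\<bar> powr q"
            using \<zeta> by (simp add: abs_mult powr_mult power_mult_distrib)
          finally show "ennreal ((1 - cos (\<zeta> * sym (Y t) p))\<^sup>2) \<le> ennreal ?v * ennreal ((sym (Y t) p)\<^sup>2) + ennreal ?u * ennreal (\<bar>sym (Y t) p\<bar> powr q)"
            by (simp add: ennreal_mult[symmetric] ennreal_plus[symmetric] ennreal_leI del: ennreal_plus)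
        qed
        also have "\<dots> = ennreal ?v * (\<integral>\<^sup>+p. ennreal ((sym (Y t) p)\<^sup>2) \<partial>(M \<Otimes>\<^sub>M M)) + ennreal ?u * (\<integral>\<^sup>+p. ennreal (\<bar>sym (Y t) p\<bar> powr q) \<partial>(M \<Otimes>\<^sub>M M))"
          by (subst nn_integral_add) (auto simp: nn_integral_cmult)
        also have "\<dots> \<le> ennreal ?v * ennreal (2 * (K * S t)) + ennreal ?u * (ennreal (2 * 2 powr q) * ennreal ?E)"
        proof (intro add_mono mult_left_mono)
          show "(\<integral>\<^sup>+p. ennreal ((sym (Y t) p)\<^sup>2) \<partial>(M \<Otimes>\<^sub>M M)) \<le> ennreal (2 * (K * S t))"
            using Y_second_moment[OF that]
            by (subst nn_integral_sym_square[OF _ Y_square[OF that] integrated_mean]) (auto intro: ennreal_leI)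
          have "(\<integral>\<^sup>+\<omega>. ennreal (\<bar>Y t \<omega>\<bar> powr q) \<partial>M) = ennreal ?E"
            by (rule nn_integral_eq_integral[OF int[OF that]]) auto
          then show "(\<integral>\<^sup>+p. ennreal (\<bar>sym (Y t) p\<bar> powr q) \<partial>(M \<Otimes>\<^sub>M M)) \<le> ennreal (2 * 2 powr q) * ennreal ?E"
            using nn_integral_sym_powr_le[OF integrated_measurable q, of t] by simp
        qed auto
        also have "\<dots> = ennreal (?v * (2 * (K * S t)) + ?u * (2 * 2 powr q * ?E))"
          using E0 K_pos S_nonneg[of t] by (simp add: ennreal_mult[symmetric] ennreal_plus[symmetric] del: ennreal_plus)
        finally show ?thesis
          using E0 K_pos S_nonneg[of t] by (subst (asm) ennreal_le_iff) auto
      qed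
      also have "?v * (2 * (K * S t)) \<le> D2 * t powr (- 4 * \<epsilon> - \<gamma>)"
      proof -
        have "?v * (2 * (K * S t)) \<le> ?v * (2 * (K * (CS * t powr (2 - \<gamma>))))"
          using K_pos CS(2)[OF t] by (intro mult_left_mono) auto
        also have "\<dots> = r\<^sup>2 * 2 * K * CS * (\<zeta>\<^sup>2 * t powr (2 - \<gamma>))" by (simp add: ac_simps)
        also have "\<dots> = D2 * (r\<^sup>2 * t powr - \<gamma>)" unfolding \<zeta>2 by (simp add: D2_def ac_simps)
        also have "r\<^sup>2 * t powr - \<gamma> = t powr (- 4 * \<epsilon> - \<gamma>)"
          by (simp add: r_def power2_eq_square powr_add[symmetric])
        finally show ?thesis .
      qed
      also have "?u * (2 * 2 powr q * ?E) = D3 * t powr (2 * \<epsilon> * q - q) * ?E"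
      proof -
        have "\<zeta> powr q = z powr q * t powr - q" using z t by (simp add: \<zeta>_def powr_divide powr_minus field_simps)
        moreover have "r powr - q = t powr (2 * \<epsilon> * q)" by (simp add: r_def powr_powr)
        ultimately have "?u * (2 * 2 powr q * ?E) = 8 * (2 powr q * z powr q) * (t powr (2 * \<epsilon> * q) * t powr - q) * ?E" by simp
        also have "2 powr q * z powr q = (2 * z) powr q" using z by (simp add: powr_mult)
        also have "t powr (2 * \<epsilon> * q) * t powr - q = t powr (2 * \<epsilon> * q - q)" by (simp add: powr_add[symmetric])
        finally show ?thesis by (simp add: D3_def)
      qed
      finally show ?thesis by simp
    qed
    ultimately show ?thesis by linarith
  qed
  \<comment> \<open>Each error term takes at most a quarter of the main term, leaving half of it for
    the moment.\<close>
  have e1: "\<forall>\<^sub>F t in at_top. D1 * t powr (- 2 * \<gamma>) \<le> \<kappa> * c / 4 * t powr - (\<alpha> + \<epsilon>)"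
    by (rule powr_eventually_le) (use \<epsilon> \<kappa> c in \<open>auto simp: \<gamma>_def\<close>)
  have e2: "\<forall>\<^sub>F t in at_top. D2 * t powr (- 4 * \<epsilon> - \<gamma>) \<le> \<kappa> * c / 4 * t powr - (\<alpha> + \<epsilon>)"
    by (rule powr_eventually_le) (use \<epsilon> \<kappa> c in \<open>auto simp: \<gamma>_def\<close>)
  have "\<forall>\<^sub>F t in at_top. (\<kappa> * c / (2 * D3)) * t powr (q - \<alpha> - \<epsilon> * (2 * q + 1)) \<le> expectation (\<lambda>\<omega>. \<bar>Y t \<omega>\<bar> powr q)"
    using e1 e2 c(2) eventually_ge_at_top[of 1]
  proof eventually_elim
    case (elim t)
    let ?E = "expectation (\<lambda>\<omega>. \<bar>Y t \<omega>\<bar> powr q)"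
    have t: "t > 0" using elim by simp
    have "\<kappa> * (c * t powr - (\<alpha> + \<epsilon>)) \<le> \<kappa> * measure m (near_set t)"
      using elim(3) \<kappa>(1) by (intro mult_left_mono) auto
    then have "\<kappa> * c * t powr - (\<alpha> + \<epsilon>) \<le> 2 * (\<kappa> * c / 4 * t powr - (\<alpha> + \<epsilon>)) + D3 * t powr (2 * \<epsilon> * q - q) * ?E"
      using main[OF elim(4)] elim(1,2) by (simp only: mult.assoc)
    then have "\<kappa> * c / 2 * t powr - (\<alpha> + \<epsilon>) \<le> D3 * t powr (2 * \<epsilon> * q - q) * ?E" by simp
    \<comment> \<open>Solving for the moment multiplies by
      \<open>t powr (q - 2 * \<epsilon> * q)\<close>; combined with
      \<open>- (\<alpha> + \<epsilon>)\<close> this produces the loss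
      \<open>\<epsilon> * (2 * q + 1)\<close>.\<close>
    then have "\<kappa> * c / 2 * t powr - (\<alpha> + \<epsilon>) * (t powr (q - 2 * \<epsilon> * q) / D3) \<le> D3 * t powr (2 * \<epsilon> * q - q) * ?E * (t powr (q - 2 * \<epsilon> * q) / D3)"
      using D3 by (intro mult_right_mono) auto
    also have "\<dots> = (t powr (2 * \<epsilon> * q - q) * t powr (q - 2 * \<epsilon> * q)) * ?E" using D3 by simp
    also have "t powr (2 * \<epsilon> * q - q) * t powr (q - 2 * \<epsilon> * q) = 1" using t by (simp add: powr_add[symmetric])
    finally have "\<kappa> * c / (2 * D3) * (t powr - (\<alpha> + \<epsilon>) * t powr (q - 2 * \<epsilon> * q)) \<le> ?E" by (simp add: ac_simps)
    moreover have "t powr - (\<alpha> + \<epsilon>) * t powr (q - 2 * \<epsilon> * q) = t powr (q - \<alpha> - \<epsilon> * (2 * q + 1))"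
      by (simp add: powr_add[symmetric] algebra_simps)
    ultimately show ?case by (simp only:)
  qed
  moreover have "\<kappa> * c / (2 * D3) > 0" using \<kappa> c D3 by simp
  ultimately show ?thesis using that by blast
qed

text \<open>Shared by the range \<open>q \<le> 2\<close> and the Gaussian case: the Gaussian
  component supplies the lower bound for every \<open>q > 0\<close>, so only the upper bound depends
  on the case.\<close>

lemma scaling_diffusive:
  assumes q: "q > 0"
    and upper: "\<And>\<gamma>. 0 \<le> \<gamma> \<Longrightarrow> \<gamma> < \<alpha> \<Longrightarrow> \<exists>C>0. \<forall>t\<ge>1. integrable M (\<lambda>\<omega>. \<bar>Y t \<omega>\<bar> powr q) \<and>
      expectation (\<lambda>\<omega>. \<bar>Y t \<omega>\<bar> powr q) \<le> C * t powr ((1 - \<gamma> / 2) * q)"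
  shows "has_scaling_exponent M Y q ((1 - \<alpha> / 2) * q)"
proof (rule has_scaling_exponentI)
  fix \<delta> :: real assume \<delta>: "\<delta> > 0"
  \<comment> \<open>\<gamma> enters the exponent with the factor \<open>q / 2\<close>, hence the
    loss \<open>2 * \<delta> / q\<close>; the maximum keeps it nonnegative when \<delta> is
    large.\<close>
  define \<gamma> where "\<gamma> = max 0 (\<alpha> - 2 * \<delta> / q)"
  have \<gamma>: "0 \<le> \<gamma>" "\<gamma> < \<alpha>" using \<alpha> \<delta> q by (auto simp: \<gamma>_def)
  have "\<gamma> \<ge> \<alpha> - 2 * \<delta> / q" by (simp add: \<gamma>_def)
  then have "\<gamma> * q \<ge> (\<alpha> - 2 * \<delta> / q) * q" using q by (intro mult_right_mono) auto
  then have ex: "(1 - \<gamma> / 2) * q \<le> (1 - \<alpha> / 2) * q + \<delta>" using q by (simp add: algebra_simps)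
  obtain C where C: "C > 0" "\<And>t. t \<ge> 1 \<Longrightarrow> integrable M (\<lambda>\<omega>. \<bar>Y t \<omega>\<bar> powr q)"
    "\<And>t. t \<ge> 1 \<Longrightarrow> expectation (\<lambda>\<omega>. \<bar>Y t \<omega>\<bar> powr q) \<le> C * t powr ((1 - \<gamma> / 2) * q)"
    using upper[OF \<gamma>] by blast
  have "\<forall>\<^sub>F t in at_top. integrable M (\<lambda>\<omega>. \<bar>Y t \<omega>\<bar> powr q) \<and>
      expectation (\<lambda>\<omega>. \<bar>Y t \<omega>\<bar> powr q) \<le> C * t powr ((1 - \<alpha> / 2) * q + \<delta>)"
    using eventually_ge_at_top[of 1]
  proof eventually_elim
    case (elim t)
    have "C * t powr ((1 - \<gamma> / 2) * q) \<le> C * t powr ((1 - \<alpha> / 2) * q + \<delta>)"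
      using C(1) elim ex by (intro mult_left_mono powr_mono) auto
    then show ?case using C(2,3)[OF elim] by linarith
  qed
  then show "\<exists>C>0. \<forall>\<^sub>F t in at_top. integrable M (\<lambda>\<omega>. \<bar>Y t \<omega>\<bar> powr q) \<and>
      expectation (\<lambda>\<omega>. \<bar>Y t \<omega>\<bar> powr q) \<le> C * t powr ((1 - \<alpha> / 2) * q + \<delta>)"
    using C(1) by blast
  have "\<forall>\<^sub>F t in at_top. integrable M (\<lambda>\<omega>. \<bar>Y t \<omega>\<bar> powr q)"
    using eventually_ge_at_top[of 1] by eventually_elim (rule C(2))
  moreover have "2 * \<delta> / q > 0" using \<delta> q by simp
  ultimately obtain C' where C': "C' > 0"
    "\<forall>\<^sub>F t in at_top. C' * t powr ((1 - (\<alpha> + 2 * \<delta> / q) / 2) * q) \<le> expectation (\<lambda>\<omega>. \<bar>Y t \<omega>\<bar> powr q)"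
    using lower_all[OF q, of "2 * \<delta> / q"] by blast
  moreover have "(1 - (\<alpha> + 2 * \<delta> / q) / 2) * q = (1 - \<alpha> / 2) * q - \<delta>" using q by (simp add: field_simps)
  ultimately show "\<exists>C>0. \<forall>\<^sub>F t in at_top. C * t powr ((1 - \<alpha> / 2) * q - \<delta>) \<le> expectation (\<lambda>\<omega>. \<bar>Y t \<omega>\<bar> powr q)"
    by auto
qed

lemma scaling_small: "0 < q \<Longrightarrow> q \<le> 2 \<Longrightarrow> has_scaling_exponent M Y q ((1 - \<alpha> / 2) * q)"
proof (rule scaling_diffusive)
  fix \<gamma> assume "0 < q" "q \<le> 2" and \<gamma>: "0 \<le> \<gamma>" "\<gamma> < \<alpha>"
  then obtain C where "C > 0" "\<And>t. t \<ge> 1 \<Longrightarrow> integrable M (\<lambda>\<omega>. \<bar>Y t \<omega>\<bar> powr q)"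
    "\<And>t. t \<ge> 1 \<Longrightarrow> expectation (\<lambda>\<omega>. \<bar>Y t \<omega>\<bar> powr q) \<le> C * t powr ((1 - \<gamma> / 2) * q)"
    using upper_small[of q \<gamma>] by blast
  then show "\<exists>C>0. \<forall>t\<ge>1. integrable M (\<lambda>\<omega>. \<bar>Y t \<omega>\<bar> powr q) \<and>
      expectation (\<lambda>\<omega>. \<bar>Y t \<omega>\<bar> powr q) \<le> C * t powr ((1 - \<gamma> / 2) * q)"
    by blast
qed

lemma scaling_gaussian:
  "\<mu> = null_measure borel \<Longrightarrow> 0 < q \<Longrightarrow> has_scaling_exponent M Y q ((1 - \<alpha> / 2) * q)"
proof (cases "q \<le> 2")
  case False
  assume null: "\<mu> = null_measure borel"
  from False have q: "q \<ge> 2" by simp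
  show ?thesis
  proof (rule scaling_diffusive)
    fix \<gamma> assume \<gamma>: "0 \<le> \<gamma>" "\<gamma> < \<alpha>"
    obtain C where "C > 0" "\<And>t. t \<ge> 1 \<Longrightarrow> integrable M (\<lambda>\<omega>. \<bar>Y t \<omega>\<bar> powr q)"
      "\<And>t. t \<ge> 1 \<Longrightarrow> expectation (\<lambda>\<omega>. \<bar>Y t \<omega>\<bar> powr q) \<le> C * t powr ((1 - \<gamma> / 2) * q)"
      using upper_gaussian[OF null q \<gamma>] by blast
    then show "\<exists>C>0. \<forall>t\<ge>1. integrable M (\<lambda>\<omega>. \<bar>Y t \<omega>\<bar> powr q) \<and>
      expectation (\<lambda>\<omega>. \<bar>Y t \<omega>\<bar> powr q) \<le> C * t powr ((1 - \<gamma> / 2) * q)"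
      by blast
  qed (use q in simp)
qed (rule scaling_small)

lemma scaling_jump:
  assumes ne: "\<mu> \<noteq> null_measure borel" and q: "q \<ge> 2"
  shows "has_scaling_exponent M Y q (q - \<alpha>)"
proof (rule has_scaling_exponentI)
  fix \<delta> :: real assume \<delta>: "\<delta> > 0"
  define \<gamma> where "\<gamma> = max 0 (\<alpha> - \<delta>)"
  have \<gamma>: "0 \<le> \<gamma>" "\<gamma> < \<alpha>" using \<alpha> \<delta> by (auto simp: \<gamma>_def)
  obtain C where C: "C > 0" "\<And>t. t \<ge> 1 \<Longrightarrow> integrable M (\<lambda>\<omega>. \<bar>Y t \<omega>\<bar> powr q)"
    "\<And>t. t \<ge> 1 \<Longrightarrow> expectation (\<lambda>\<omega>. \<bar>Y t \<omega>\<bar> powr q) \<le> C * t powr (q - \<gamma>)"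
    using upper_general[OF q \<gamma>] by blast
  have "\<forall>\<^sub>F t in at_top. integrable M (\<lambda>\<omega>. \<bar>Y t \<omega>\<bar> powr q) \<and>
      expectation (\<lambda>\<omega>. \<bar>Y t \<omega>\<bar> powr q) \<le> C * t powr (q - \<alpha> + \<delta>)"
    using eventually_ge_at_top[of 1]
  proof eventually_elim
    case (elim t)
    have "C * t powr (q - \<gamma>) \<le> C * t powr (q - \<alpha> + \<delta>)"
      using C(1) elim by (intro mult_left_mono powr_mono) (auto simp: \<gamma>_def)
    then show ?case using C(2,3)[OF elim] by linarith
  qed
  then show "\<exists>C>0. \<forall>\<^sub>F t in at_top. integrable M (\<lambda>\<omega>. \<bar>Y t \<omega>\<bar> powr q) \<and>
      expectation (\<lambda>\<omega>. \<bar>Y t \<omega>\<bar> powr q) \<le> C * t powr (q - \<alpha> + \<delta>)"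
    using C(1) by blast
  \<comment> \<open>\<open>\<delta> / (2 * q + 1)\<close> absorbs the loss in
    \<open>lower_jump\<close>, and \<open>\<alpha> / 4\<close> secures
    \<open>3 * \<epsilon> < \<alpha>\<close>.\<close>
  define \<epsilon> where "\<epsilon> = min (\<alpha> / 4) (\<delta> / (2 * q + 1))"
  have \<epsilon>: "\<epsilon> > 0" "3 * \<epsilon> < \<alpha>" using \<alpha> \<delta> q by (auto simp: \<epsilon>_def min_def)
  have "\<epsilon> \<le> \<delta> / (2 * q + 1)" by (simp add: \<epsilon>_def)
  then have ex: "\<epsilon> * (2 * q + 1) \<le> \<delta>" using q by (simp add: pos_le_divide_eq)
  have "q > 0" using q by simp
  obtain C' where C': "C' > 0"
    "\<forall>\<^sub>F t in at_top. C' * t powr (q - \<alpha> - \<epsilon> * (2 * q + 1)) \<le> expectation (\<lambda>\<omega>. \<bar>Y t \<omega>\<bar> powr q)"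
    using lower_jump[OF ne \<open>q > 0\<close> \<epsilon> C(2)] by blast
  have "\<forall>\<^sub>F t in at_top. C' * t powr (q - \<alpha> - \<delta>) \<le> expectation (\<lambda>\<omega>. \<bar>Y t \<omega>\<bar> powr q)"
    using C'(2) eventually_ge_at_top[of 1]
  proof eventually_elim
    case (elim t)
    have "C' * t powr (q - \<alpha> - \<delta>) \<le> C' * t powr (q - \<alpha> - \<epsilon> * (2 * q + 1))"
      using C'(1) elim ex by (intro mult_left_mono powr_mono) auto
    then show ?case using elim by linarith
  qed
  then show "\<exists>C>0. \<forall>\<^sub>F t in at_top. C * t powr (q - \<alpha> - \<delta>) \<le> expectation (\<lambda>\<omega>. \<bar>Y t \<omega>\<bar> powr q)"
    using C'(1) by blast
qed

end

theorem theorem4p1: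
  fixes M :: "'w measure"
    and X :: "real \<Rightarrow> 'w \<Rightarrow> real"
    and a b \<alpha> :: real
    and \<mu>\<^sub>L \<pi> :: "real measure"
    and p l :: "real \<Rightarrow> real"
    and \<kappa>\<^sub>X :: "real \<Rightarrow> complex"
  assumes "prob_space M"
    and "supOU_process M a b \<mu>\<^sub>L \<pi> X"
    and "(\<lambda>(t, \<omega>). X t \<omega>) \<in> borel_measurable (borel \<Otimes>\<^sub>M M)"
    and "\<And>t. integrable M (\<lambda>\<omega>. (X t \<omega>)\<^sup>2)"
    and "\<And>t. (LINT \<omega>|M. X t \<omega>) = 0"
    and "is_cumulant_function M (X 1) \<kappa>\<^sub>X"
    and "analytic_near_origin \<kappa>\<^sub>X"
    and "p \<in> borel_measurable (restrict_space lborel {0<..})"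
    and "\<And>x. x > 0 \<Longrightarrow> p x \<ge> 0"
    and "\<pi> = density (restrict_space lborel {0<..}) (\<lambda>x. ennreal (p x))"
    and "0 < \<alpha>" and "\<alpha> < 1"
    and "slowly_varying l"
    and "p \<sim>[at_right 0] (\<lambda>x. \<alpha> * l (inverse x) * x powr (\<alpha> - 1))"
    and "b > 0"
  shows "(\<mu>\<^sub>L \<noteq> null_measure borel \<longrightarrow>
            (\<forall>q. 0 < q \<and> q \<le> 2 \<longrightarrow>
               has_scaling_exponent M (integrated_process X) q ((1 - \<alpha> / 2) * q)) \<and>
            (\<forall>q\<ge>2. has_scaling_exponent M (integrated_process X) q (q - \<alpha>))) \<and>
         (\<mu>\<^sub>L = null_measure borel \<longrightarrow>
            gaussian_process_on M {0..} (integrated_process X) \<and>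
            (\<forall>q>0. has_scaling_exponent M (integrated_process X) q ((1 - \<alpha> / 2) * q)))"
proof -
  obtain \<Lambda> where cq: "characteristic_quadruple a b \<mu>\<^sub>L \<pi>"
    and \<Lambda>: "levy_basis M (\<pi> \<Otimes>\<^sub>M lborel) (levy_khintchine a b \<mu>\<^sub>L) \<Lambda>"
      "\<And>t. has_stochastic_integral M (\<pi> \<Otimes>\<^sub>M lborel) \<Lambda> (supOU_kernel t) (X t)"
    using assms(2) by (auto simp: supOU_process_def)
  have levy: "levy_measure \<mu>\<^sub>L" and \<pi>: "prob_space \<pi>" "sets \<pi> = sets (restrict_space borel {0<..})"
    using cq by (auto simp: characteristic_quadruple_def)
  interpret prob_space M by fact
  interpret supou M a b \<mu>\<^sub>L \<pi> \<Lambda> X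
    by (rule supou.intro[OF assms(1)], rule supou_axioms.intro) (fact assms(3,4,5,15) levy \<pi> \<Lambda>)+
  obtain c0 where c0: "c0 > 0" "(\<integral>\<^sup>+x. ennreal (cosh (c0 * x) - 1) \<partial>\<mu>\<^sub>L) < \<infinity>"
    using cosh_moment_of_analytic[OF assms(6,7)] by blast
  have cosh_meas: "(\<lambda>x. cosh (c0 * x) - 1) \<in> borel_measurable \<mu>\<^sub>L"
    unfolding measurable_cong_sets[OF sets_\<mu> refl] by measurable
  \<comment> \<open>The second moment of the jumps is derived from their exponential moment through
    \<open>u^2 / 2 \<le> cosh u - 1\<close>.\<close>
  have int2: "integrable \<mu>\<^sub>L (\<lambda>x. x\<^sup>2)"
  proof (rule Bochner_Integration.integrable_bound)
    show "integrable \<mu>\<^sub>L (\<lambda>x. 2 / c0\<^sup>2 * (cosh (c0 * x) - 1))"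
      using c0 cosh_meas by (intro integrable_mult_right integrableI_nonneg) (auto simp: cosh_real_ge_1)
    show "AE x in \<mu>\<^sub>L. norm (x\<^sup>2) \<le> norm (2 / c0\<^sup>2 * (cosh (c0 * x) - 1))"
    proof (intro AE_I2)
      fix x
      have "(c0 * x)\<^sup>2 / 2 \<le> cosh (c0 * x) - 1"
        using cosh_partial_sum_le[of "{0}" "c0 * x"] by (simp add: power2_eq_square)
      then have "x\<^sup>2 \<le> 2 / c0\<^sup>2 * (cosh (c0 * x) - 1)" using c0 by (simp add: field_simps)
      then show "norm (x\<^sup>2) \<le> norm (2 / c0\<^sup>2 * (cosh (c0 * x) - 1))"
        unfolding real_norm_def abs_power2 by (rule order_trans[OF _ abs_ge_self])
    qed
    show "(\<lambda>x. x\<^sup>2) \<in> borel_measurable \<mu>\<^sub>L"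
      unfolding measurable_cong_sets[OF sets_\<mu> refl] by measurable
  qed
  interpret supou_scaling M a b \<mu>\<^sub>L \<pi> \<Lambda> X \<alpha> c0
  proof unfold_locales
    show "(\<integral>\<^sup>+\<xi>. ennreal (\<xi> powr - \<gamma>) \<partial>\<pi>) < \<infinity>" if "0 \<le> \<gamma>" "\<gamma> < \<alpha>" for \<gamma>
      by (rule regvar_negative_moment[OF \<pi>(1) assms(8,9,10,11,13,14) that])
    show "\<exists>c>0. \<exists>t0>0. \<forall>t\<ge>t0. ennreal (c * t powr - (\<alpha> + \<epsilon>)) \<le> emeasure \<pi> {0<..<1 / t}" if "\<epsilon> > 0" for \<epsilon>
      using regvar_mass_lower[OF \<pi>(1) assms(8,9,10,11,13,14) that] by metis
  qed (rule int2 assms(11,12) c0)+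
  show ?thesis
    using scaling_small scaling_jump scaling_gaussian integrated_gaussian by blast
qed

end
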